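(* Let $\alpha\in\mathbb{R}$. The set of all spreadable states on $\mathbb{A}_\alpha^{\mathbb{Z}}$ is a Bauer simplex whose extreme points are exactly the product states $\times\omega$, where $\omega$ is a $\Delta_\alpha^\perp$-invariant state on $C(\mathbb{T})$. In particular: (i) if $\frac{\alpha}{2\pi}$ is irrational, the canonical trace $\mathrm{tr}$ is the only spreadable state on $\mathbb{A}_\alpha^{\mathbb{Z}}$; (ii) if $\frac{\alpha}{2\pi}=\frac{q_1^{n_1}\cdots q_s^{n_s}}{p_1^{m_1}\cdots p_r^{m_r}}$ is rational, with $q_1,\ldots,q_s,p_1,\ldots,p_r$ pairwise distinct primes and $n_1,\ldots,n_s,m_1,\ldots,m_r\in\mathbb{N}$, then the extreme points of the set of spreadable states are the product states $\times\omega$, where $\omega$ is any state on $C(\mathbb{T})$ invariant under all rotations by $n_0$-th roots of unity, with $n_0=p_1^{\{m_1/2\}}\cdots p_r^{\{m_r/2\}}$.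
   Context: $\mathbb{A}_\alpha^{\mathbb{Z}}$ is the universal (unital) $C^*$-algebra generated by unitaries $\{u_l: l\in\mathbb{Z}\}$ satisfying $u_lu_k=e^{i\alpha}u_ku_l$ for all $l,k\in\mathbb{Z}$ with $l<k$. For every strictly increasing map $h:\mathbb{Z}\to\mathbb{Z}$, let $\alpha_h$ be the $*$-endomorphism of $\mathbb{A}_\alpha^{\mathbb{Z}}$ determined by $\alpha_h(u_l)=u_{h(l)}$, $l\in\mathbb{Z}$. A state $\varphi$ on $\mathbb{A}_\alpha^{\mathbb{Z}}$ is spreadable if $\varphi\circ\alpha_h=\varphi$ for every strictly increasing $h:\mathbb{Z}\to\mathbb{Z}$; the set of spreadable states carries the weak-$*$ topology. The canonical trace $\mathrm{tr}$ is the state with $\mathrm{tr}(u_{l_1}^{k_1}\cdots u_{l_n}^{k_n})=\delta_{k_1,0}\cdots\delta_{k_n,0}$ for pairwise distinct $l_1,\ldots,l_n\in\mathbb{Z}$ and $k_1,\ldots,k_n\in\mathbb{Z}$. $\Delta_\alpha:=\{k\in\mathbb{Z}: e^{i\alpha k^2}=1\}$ and $\Delta_\alpha^\perp:=\{z\in\mathbb{T}: z^l=1 \text{ for all } l\in\Delta_\alpha\}$. A state $\omega$ on $C(\mathbb{T})$ is $\Delta_\alpha^\perp$-invariant if it is invariant under all rotations of $\mathbb{T}$ by elements of $\Delta_\alpha^\perp$, i.e. $\omega(f(z\,\cdot))=\omega(f)$ for all $f\in C(\mathbb{T})$, $z\in\Delta_\alpha^\perp$. For a $\Delta_\alpha^\perp$-invariant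 state $\omega$ on $C(\mathbb{T})$, $\times\omega$ denotes the (unique) state on $\mathbb{A}_\alpha^{\mathbb{Z}}$ such that $\times\omega(u_{j_1}^{k_1}\cdots u_{j_l}^{k_l})=\omega(z^{k_1})\cdots\omega(z^{k_l})$ for all pairwise distinct $j_1,\ldots,j_l\in\mathbb{Z}$ and all $k_1,\ldots,k_l\in\mathbb{Z}$, where $z$ is the coordinate function on $\mathbb{T}$. For an integer $n$, $\{n/2\}$ denotes $n/2$ if $n$ is even and $(n+1)/2$ if $n$ is odd. A Bauer simplex is a Choquet simplex whose set of extreme points is closed. *)

theory Defs
  imports
    "HOL-Analysis.Analysis"
    "HOL-Library.Function_Algebras"
    "HOL-Library.Poly_Mapping"
    "HOL-Algebra.Module"
    "HOL-Algebra.Lattice"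
    "HOL-Computational_Algebra.Primes"
begin

section \<open>Choquet and Bauer simplices\<close>

text \<open>
  Pointwise real vector space structure on functions. Together with the product topology from
  \<^theory>\<open>HOL-Analysis.Function_Topology\<close>, \<^typ>\<open>'a \<Rightarrow> complex\<close> is a Hausdorff locally convex
  space carrying the topology of pointwise convergence.
\<close>

instantiation "fun" :: (type, real_vector) real_vector
begin

definition scaleR_fun :: "real \<Rightarrow> ('a \<Rightarrow> 'b) \<Rightarrow> 'a \<Rightarrow> 'b"
  where "scaleR_fun r f = (\<lambda>x. r *\<^sub>R f x)"

instance
  by standard (simp_all add: scaleR_fun_def fun_eq_iff algebra_simps)

end

text \<open>
  Choquet's definition: a compact convex set, viewed at height 1, is the base of a cone, and it is
  a simplex if this cone is a lattice for the order that the cone itself induces.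
  The ambient space is meant to be Hausdorff and locally convex.
\<close>

definition choquet_simplex :: "'a::{real_vector, topological_space} set \<Rightarrow> bool" where
  "choquet_simplex K \<longleftrightarrow> compact K \<and> convex K \<and>
     Lattice.lattice
       \<lparr>carrier = cone hull (K \<times> {1::real}), eq = (=),
        le = (\<lambda>x y. y - x \<in> cone hull (K \<times> {1::real}))\<rparr>"

definition bauer_simplex :: "'a::{real_vector, topological_space} set \<Rightarrow> bool" where
  "bauer_simplex K \<longleftrightarrow> choquet_simplex K \<and> closed {x. x extreme_point_of K}"


section \<open>Unital *-algebras, their morphisms and states\<close>

text \<open>
  The \<open>C\<^sup>*\<close>-norm is not recorded: it is determined by the *-algebra structure, and *-homomorphisms
  and states of a unital \<open>C\<^sup>*\<close>-algebra are automatically bounded.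
\<close>

record 'a star_algebra = "(complex, 'a) module" +
  star :: "'a \<Rightarrow> 'a"

definition star_hom :: "'a star_algebra \<Rightarrow> 'b star_algebra \<Rightarrow> ('a \<Rightarrow> 'b) set" where
  "star_hom A B =
     {f \<in> ring_hom A B. \<forall>x\<in>carrier A.
        (\<forall>c. f (c \<odot>\<^bsub>A\<^esub> x) = c \<odot>\<^bsub>B\<^esub> f x) \<and> f (star A x) = star B (f x)}"

text \<open>
  Functionals are normalised to vanish off the carrier, so that they correspond bijectively to
  functions on the carrier and the weak-* topology is the topology of the function space.
\<close>

definition states :: "'a star_algebra \<Rightarrow> ('a \<Rightarrow> complex) set" where
  "states A = {\<phi>.
     (\<forall>x. x \<notin> carrier A \<longrightarrow> \<phi> x = 0) \<and>
     (\<forall>x\<in>carrier A. \<forall>y\<in>carrier A. \<phi> (x \<oplus>\<^bsub>A\<^esub> y) = \<phi> x + \<phi> y) \<and>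
     (\<forall>c. \<forall>x\<in>carrier A. \<phi> (c \<odot>\<^bsub>A\<^esub> x) = c * \<phi> x) \<and>
     (\<forall>x\<in>carrier A. \<phi> (star A x \<otimes>\<^bsub>A\<^esub> x) \<in> \<real>\<^sub>\<ge>\<^sub>0) \<and>
     \<phi> \<one>\<^bsub>A\<^esub> = 1}"


section \<open>Free unital *-algebras\<close>

text \<open>
  The free unital complex *-algebra on a set of generators is the monoid algebra of the free
  monoid on the letters \<open>g\<close> (encoded as \<open>(g, False)\<close>) and \<open>g\<^sup>*\<close> (encoded as \<open>(g, True)\<close>).
  The monoid is written additively since the convolution product of \<^typ>\<open>'k \<Rightarrow>\<^sub>0 complex\<close>
  requires \<^typ>\<open>'k\<close> to be of class \<^class>\<open>monoid_add\<close>.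
\<close>

datatype 'g star_word = Word (letters: "('g \<times> bool) list")

instantiation star_word :: (type) monoid_add
begin

definition "0 = Word []"

definition "v + w = Word (letters v @ letters w)"

instance
  by standard (simp_all add: zero_star_word_def plus_star_word_def)

end

type_synonym 'g free_star_algebra = "'g star_word \<Rightarrow>\<^sub>0 complex"

definition free_gen :: "'g \<Rightarrow> 'g free_star_algebra" where
  "free_gen g = Poly_Mapping.single (Word [(g, False)]) 1"

definition free_scale :: "complex \<Rightarrow> 'g free_star_algebra \<Rightarrow> 'g free_star_algebra" where
  "free_scale c x = Poly_Mapping.single 0 c * x"

definition star_word :: "'g star_word \<Rightarrow> 'g star_word" where
  "star_word w = Word (rev (map (\<lambda>(g, b). (g, \<not> b)) (letters w)))"

definition free_star :: "'g free_star_algebra \<Rightarrow> 'g free_star_algebra" where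
  "free_star x =
     (\<Sum>w\<in>Poly_Mapping.keys x. Poly_Mapping.single (star_word w) (cnj (Poly_Mapping.lookup x w)))"


section \<open>Universal \<open>C\<^sup>*\<close>-algebras\<close>

definition cstar_seminorm :: "('g free_star_algebra \<Rightarrow> real) \<Rightarrow> bool" where
  "cstar_seminorm p \<longleftrightarrow>
     (\<forall>x y. p (x + y) \<le> p x + p y) \<and>
     (\<forall>c x. p (free_scale c x) = cmod c * p x) \<and>
     (\<forall>x y. p (x * y) \<le> p x * p y) \<and>
     (\<forall>x. p (free_star x * x) = (p x)\<^sup>2)"

text \<open>
  The universal \<open>C\<^sup>*\<close>-algebra on generators subject to the relations \<open>r = 0\<close> for \<open>r \<in> R\<close> is the
  Hausdorff completion of the free *-algebra for the largest \<open>C\<^sup>*\<close>-seminorm that vanishes on \<open>R\<close>.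
  This presupposes that the supremum below is finite, which is the case if \<open>R\<close> forces all
  generators to be unitary. Elements of the completion are classes of Cauchy sequences.
\<close>

definition univ_seminorm :: "'g free_star_algebra set \<Rightarrow> 'g free_star_algebra \<Rightarrow> real" where
  "univ_seminorm R x = (SUP p \<in> {p. cstar_seminorm p \<and> (\<forall>r\<in>R. p r = 0)}. p x)"

definition cauchy_seqs :: "'g free_star_algebra set \<Rightarrow> (nat \<Rightarrow> 'g free_star_algebra) set" where
  "cauchy_seqs R = {X. \<forall>e>0. \<exists>N. \<forall>m\<ge>N. \<forall>n\<ge>N. univ_seminorm R (X m - X n) < e}"

definition null_rel :: "'g free_star_algebra set \<Rightarrow>
    ((nat \<Rightarrow> 'g free_star_algebra) \<times> (nat \<Rightarrow> 'g free_star_algebra)) set" where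
  "null_rel R = {(X, Y). X \<in> cauchy_seqs R \<and> Y \<in> cauchy_seqs R \<and>
     (\<lambda>n. univ_seminorm R (X n - Y n)) \<longlonglongrightarrow> 0}"

definition seq_class :: "'g free_star_algebra set \<Rightarrow> (nat \<Rightarrow> 'g free_star_algebra) \<Rightarrow>
    (nat \<Rightarrow> 'g free_star_algebra) set" where
  "seq_class R X = null_rel R `` {X}"

definition universal_cstar ::
    "'g free_star_algebra set \<Rightarrow> (nat \<Rightarrow> 'g free_star_algebra) set star_algebra" where
  "universal_cstar R = \<lparr>
     carrier = cauchy_seqs R // null_rel R,
     mult = (\<lambda>S T. \<Union>X\<in>S. \<Union>Y\<in>T. seq_class R (\<lambda>n. X n * Y n)),
     one = seq_class R (\<lambda>n. 1),
     zero = seq_class R (\<lambda>n. 0),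
     add = (\<lambda>S T. \<Union>X\<in>S. \<Union>Y\<in>T. seq_class R (\<lambda>n. X n + Y n)),
     smult = (\<lambda>c S. \<Union>X\<in>S. seq_class R (\<lambda>n. free_scale c (X n))),
     star = (\<lambda>S. \<Union>X\<in>S. seq_class R (\<lambda>n. free_star (X n)))\<rparr>"


section \<open>The infinite noncommutative torus and its spreadable states\<close>

definition torus_rels :: "real \<Rightarrow> int free_star_algebra set" where
  "torus_rels \<alpha> =
     {free_star (free_gen l) * free_gen l - 1 | l. True} \<union>
     {free_gen l * free_star (free_gen l) - 1 | l. True} \<union>
     {free_gen l * free_gen k - free_scale (exp (\<i> * of_real \<alpha>)) (free_gen k * free_gen l)
        | l k. l < k}"

type_synonym torus_elem = "(nat \<Rightarrow> int free_star_algebra) set"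

definition torus :: "real \<Rightarrow> torus_elem star_algebra" where
  "torus \<alpha> = universal_cstar (torus_rels \<alpha>)"

definition torus_gen :: "real \<Rightarrow> int \<Rightarrow> torus_elem" where
  "torus_gen \<alpha> l = seq_class (torus_rels \<alpha>) (\<lambda>n. free_gen l)"

definition torus_endo :: "real \<Rightarrow> (int \<Rightarrow> int) \<Rightarrow> torus_elem \<Rightarrow> torus_elem" where
  "torus_endo \<alpha> h = (THE f. f \<in> star_hom (torus \<alpha>) (torus \<alpha>) \<inter> extensional (carrier (torus \<alpha>)) \<and>
     (\<forall>l. f (torus_gen \<alpha> l) = torus_gen \<alpha> (h l)))"

definition spreadable_states :: "real \<Rightarrow> (torus_elem \<Rightarrow> complex) set" where
  "spreadable_states \<alpha> = {\<phi> \<in> states (torus \<alpha>).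
     \<forall>h. strict_mono h \<longrightarrow> (\<forall>x\<in>carrier (torus \<alpha>). \<phi> (torus_endo \<alpha> h x) = \<phi> x)}"

text \<open>The ordered product \<open>u\<^bsub>j\<^sub>1\<^esub>\<^bsup>k\<^sub>1\<^esup> \<dots> u\<^bsub>j\<^sub>n\<^esub>\<^bsup>k\<^sub>n\<^esup>\<close> for the list of pairs \<open>(j\<^sub>i, k\<^sub>i)\<close>.\<close>

definition torus_monomial :: "real \<Rightarrow> (int \<times> int) list \<Rightarrow> torus_elem" where
  "torus_monomial \<alpha> jks =
     foldr (\<otimes>\<^bsub>torus \<alpha>\<^esub>) (map (\<lambda>(j, k). torus_gen \<alpha> j [^]\<^bsub>torus \<alpha>\<^esub> k) jks) \<one>\<^bsub>torus \<alpha>\<^esub>"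

definition canonical_trace :: "real \<Rightarrow> torus_elem \<Rightarrow> complex" where
  "canonical_trace \<alpha> = (THE \<phi>. \<phi> \<in> states (torus \<alpha>) \<and>
     (\<forall>lks. distinct (map fst lks) \<longrightarrow>
        \<phi> (torus_monomial \<alpha> lks) = prod_list (map (\<lambda>(l, k). if k = 0 then 1 else 0) lks)))"


section \<open>States on \<open>C(\<T>)\<close> and product states\<close>

text \<open>Continuous functions on the unit circle, extended by 0 to the complex plane.\<close>

definition circle_algebra :: "(complex \<Rightarrow> complex) star_algebra" where
  "circle_algebra = \<lparr>
     carrier = {f. continuous_on (sphere 0 1) f \<and> (\<forall>w. w \<notin> sphere 0 1 \<longrightarrow> f w = 0)},
     mult = (\<lambda>f g w. f w * g w),
     one = indicator (sphere 0 1),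
     zero = (\<lambda>w. 0),
     add = (\<lambda>f g w. f w + g w),
     smult = (\<lambda>c f w. c * f w),
     star = (\<lambda>f w. cnj (f w))\<rparr>"

definition circle_coord :: "complex \<Rightarrow> complex" where
  "circle_coord = (\<lambda>w. if w \<in> sphere 0 1 then w else 0)"

definition rotation_invariant_states ::
    "complex set \<Rightarrow> ((complex \<Rightarrow> complex) \<Rightarrow> complex) set" where
  "rotation_invariant_states G = {\<omega> \<in> states circle_algebra.
     \<forall>f\<in>carrier circle_algebra. \<forall>z\<in>G. \<omega> (\<lambda>w. f (z * w)) = \<omega> f}"

definition Delta :: "real \<Rightarrow> int set" where
  "Delta \<alpha> = {k. exp (\<i> * of_real \<alpha> * of_int (k\<^sup>2)) = 1}"

definition Delta_perp :: "real \<Rightarrow> complex set" where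
  "Delta_perp \<alpha> = {z \<in> sphere 0 1. \<forall>l\<in>Delta \<alpha>. z powi l = 1}"

definition product_state :: "real \<Rightarrow> ((complex \<Rightarrow> complex) \<Rightarrow> complex) \<Rightarrow> torus_elem \<Rightarrow> complex" where
  "product_state \<alpha> \<omega> = (THE \<phi>. \<phi> \<in> states (torus \<alpha>) \<and>
     (\<forall>jks. distinct (map fst jks) \<longrightarrow>
        \<phi> (torus_monomial \<alpha> jks) =
          prod_list (map (\<lambda>(j, k). \<omega> (circle_coord [^]\<^bsub>circle_algebra\<^esub> k)) jks)))"


definition half_up :: "nat \<Rightarrow> nat" where
  "half_up n = (if even n then n div 2 else (n + 1) div 2)"

end

theory Submission
  imports Defs
begin

text \<open>
  A spreadable state does not notice when a factor \<open>u\<^sub>j\<^sup>k\<close> of a word is replaced by the average of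
  the \<open>k\<close>-th powers of many consecutive generators, provided that the other letters are moved out
  of the way. For two disjoint blocks of generators this shows that \<open>\<phi> (u\<^bsub>0\<^esub>\<^bsup>-k\<^esup> u\<^bsub>1\<^esub>\<^bsup>k\<^esup>)\<close> is a
  nonnegative number, and since exchanging the two factors costs the phase \<open>exp (\<i> \<alpha> k\<^sup>2)\<close> or its
  inverse, it vanishes for \<open>k\<close> outside \<open>\<Delta>\<^sub>\<alpha>\<close> (\<open>cor_zero\<close>). By Cauchy--Schwarz every word in which
  some generator has a total exponent outside \<open>\<Delta>\<^sub>\<alpha>\<close> has value zero (\<open>f_word_zero\<close>). For \<open>a, b\<close> in
  \<open>\<Delta>\<^sub>\<alpha>\<close> the powers \<open>u\<^sub>i\<^sup>a\<close> and \<open>u\<^sub>j\<^sup>b\<close> commute (\<open>Del_mult\<close>), so that on the remaining words \<open>\<phi>\<close>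
  behaves like an exchangeable state on a commutative algebra.

  The extreme points are then found as in de Finetti's theorem. Perturbing an extreme \<open>\<phi>\<close> by
  \<open>1 + \<lambda> u\<^sup>k\<close> at a fresh site gives spreadable states again, two of which have \<open>\<phi>\<close> as a convex
  combination; hence they all equal \<open>\<phi>\<close>, which says that \<open>\<phi>\<close> is multiplicative over sites
  (\<open>extreme_product_moments\<close>). Conversely the averages of \<open>u\<^sub>j\<^sup>k\<close> have zero limiting variance in a
  product state; the mean square deviation from a fixed number is nonnegative and affine in the
  state, so both parts of a decomposition have zero deviation from the same moments
  (\<open>product_moments_extreme\<close>).

  Product states exist for all normalized positive definite moments \<open>m\<close>
  (\<open>product_functional_exists\<close>): on a word take the phase of its normal ordering times the product
  of the one-site moments, and zero if an exponent lies outside \<open>\<Delta>\<^sub>\<alpha>\<close>. By Fejer's theorem \<open>m\<close> is a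
  limit of moments of finitely supported measures, so positivity reduces to one character at each
  site. There the Gram matrix is block diagonal over the classes of exponents modulo \<open>\<Delta>\<^sub>\<alpha>\<close>, and
  within a class the ordering phase is a coboundary, so that each block has rank one
  (\<open>twisted_char_nonneg\<close>). The GNS operator norm of such a functional is one of the seminorms that
  define the universal norm, which makes the functional continuous (\<open>pos_functional_le_N\<close>).
  Conversely every state is automatically continuous, because a selfadjoint contraction is the
  real part of a unitary (\<open>selfadjoint_real_part_unitary\<close>).

  The spreadable states form a compact convex set, and its extreme points are cut out by the
  equations of a product state, hence form a closed set. An extreme point is determined by its
  moments, so that the extreme points become a compact space \<open>M\<close>. An element \<open>x\<close> of the algebra
  defines the function \<open>e \<mapsto> Re (e x)\<close> on \<open>M\<close>, and the product of two such functions comes from the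
  element that has one factor on the even and the other on the odd sites (\<open>E_shift_mult\<close>). By
  Stone--Weierstrass these functions are dense in \<open>C(M)\<close>, and by Bauer's maximum principle a
  spreadable state is monotone in them. The cone over the spreadable states is therefore the cone
  of positive functionals on \<open>C(M)\<close>, which is a lattice by the Riesz--Kantorovich formula
  (\<open>riesz_positive_part\<close>, \<open>cone_lattice\<close>).

  If \<open>\<alpha> / 2\<pi>\<close> is irrational then \<open>\<Delta>\<^sub>\<alpha> = {0}\<close> and only the moments of the trace remain. If it is a
  reduced fraction with denominator \<open>b\<close> then \<open>k\<close> lies in \<open>\<Delta>\<^sub>\<alpha>\<close> iff \<open>b\<close> divides \<open>k\<^sup>2\<close>, that is, iff
  \<open>n\<^sub>0\<close> divides \<open>k\<close>.
\<close>

section \<open>Calculations in free *-algebras\<close>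

lemma free_induct [case_names single add]:
  fixes x :: "'g free_star_algebra"
  assumes "\<And>w c. P (Poly_Mapping.single w c)" "\<And>x y. P x \<Longrightarrow> P y \<Longrightarrow> P (x + y)"
  shows "P x"
proof (induction x rule: update_induct)
  case const
  show ?case using assms(1)[of 0 0] by simp
next
  case (update p a b)
  have "Poly_Mapping.update a b p = p + Poly_Mapping.single a b"
    by (rule poly_mapping_eqI)
      (use update in \<open>auto simp: lookup_update lookup_add lookup_single when_def in_keys_iff\<close>)
  then show ?case using assms update by metis
qed

lemma scale_single: "free_scale c (Poly_Mapping.single w d) = Poly_Mapping.single w (c * d)"
  by (simp add: free_scale_def mult_single)

lemma scale_add: "free_scale c (x + y) = free_scale c x + free_scale c y"
  and scale_diff: "free_scale c (x - y) = free_scale c x - free_scale c y"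
  and scale_zero [simp]: "free_scale c 0 = 0" "free_scale 0 x = 0"
  and scale_one [simp]: "free_scale 1 x = x"
  and scale_add_left: "free_scale (c + d) x = free_scale c x + free_scale d x"
  by (simp_all add: free_scale_def single_add distrib_left distrib_right right_diff_distrib)

lemma scale_scale [simp]: "free_scale c (free_scale d x) = free_scale (c * d) x"
  unfolding free_scale_def mult.assoc[symmetric] by (simp add: mult_single)

lemma scale_mult_left [simp]: "free_scale c x * y = free_scale c (x * y)"
  unfolding free_scale_def mult.assoc ..

lemma scale_neg_one: "free_scale (- 1) x = - x"
  by (simp add: free_scale_def single_uminus)

lemma scale_mult_right [simp]: "x * free_scale c y = free_scale c (x * y)"
proof -
  have "x * Poly_Mapping.single 0 c = Poly_Mapping.single 0 c * x"
    by (induction x rule: free_induct) (simp_all add: mult_single distrib_left distrib_right mult.commute[of c])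
  then show ?thesis
    by (metis free_scale_def mult.assoc)
qed

lemma star_word_invol [simp]: "star_word (star_word w) = w"
  by (simp add: star_word_def rev_map[symmetric] o_def case_prod_unfold)

lemma star_word_eq_iff: "star_word v = w \<longleftrightarrow> v = star_word w"
  by (metis star_word_invol)

lemma star_word_add: "star_word (v + w) = star_word w + star_word v"
  by (simp add: star_word_def plus_star_word_def)

lemma star_word_zero [simp]: "star_word 0 = 0"
  by (simp add: star_word_def zero_star_word_def)

lemma lookup_star: "Poly_Mapping.lookup (free_star x) w = cnj (Poly_Mapping.lookup x (star_word w))"
proof -
  have "Poly_Mapping.lookup (free_star x) w =
      (\<Sum>v\<in>Poly_Mapping.keys x. if v = star_word w then cnj (Poly_Mapping.lookup x v) else 0)"
    unfolding free_star_def lookup_sum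
    by (rule sum.cong) (auto simp: lookup_single when_def star_word_eq_iff)
  then show ?thesis
    by (auto simp: in_keys_iff)
qed

lemma star_add: "free_star (x + y) = free_star x + free_star y"
  and star_diff: "free_star (x - y) = free_star x - free_star y"
  and star_zero [simp]: "free_star 0 = 0"
  and star_star [simp]: "free_star (free_star x) = x"
  by (auto intro!: poly_mapping_eqI simp: lookup_star lookup_add lookup_minus)

lemma star_single: "free_star (Poly_Mapping.single w c) = Poly_Mapping.single (star_word w) (cnj c)"
  by (rule poly_mapping_eqI) (auto simp: lookup_star lookup_single when_def star_word_eq_iff[symmetric])

lemma star_one [simp]: "free_star 1 = 1"
  using star_single[of 0 1] by simp

lemma star_mult: "free_star (x * y) = free_star y * free_star x"
proof (induction x rule: free_induct)
  case (single w c)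
  show ?case
    by (induction y rule: free_induct)
      (simp_all add: mult_single star_single star_word_add star_add distrib_left distrib_right mult.commute)
qed (simp add: star_add distrib_left distrib_right)

lemma star_scale: "free_star (free_scale c x) = free_scale (cnj c) (free_star x)"
  by (simp add: free_scale_def star_mult star_single) (metis free_scale_def mult.right_neutral scale_mult_right)

lemma star_sum: "free_star (sum g I) = (\<Sum>i\<in>I. free_star (g i))"
  by (induction I rule: infinite_finite_induct) (auto simp: star_add)

text \<open>The three sums may all be taken over the union of the two supports, where the added terms
  vanish; this spares every linear extension from words the case of cancelling coefficients.\<close>

lemma lin_ext_add:
  fixes F :: "'g star_word \<Rightarrow> complex \<Rightarrow> 'b::comm_monoid_add"
  assumes "\<And>w. F w 0 = 0" "\<And>w a b. F w (a + b) = F w a + F w b"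
  shows "(\<Sum>w\<in>Poly_Mapping.keys (x + y). F w (Poly_Mapping.lookup (x + y) w)) =
    (\<Sum>w\<in>Poly_Mapping.keys x. F w (Poly_Mapping.lookup x w)) +
    (\<Sum>w\<in>Poly_Mapping.keys y. F w (Poly_Mapping.lookup y w))"
proof -
  let ?K = "Poly_Mapping.keys x \<union> Poly_Mapping.keys y"
  have e: "(\<Sum>w\<in>Poly_Mapping.keys z. F w (Poly_Mapping.lookup z w)) = (\<Sum>w\<in>?K. F w (Poly_Mapping.lookup z w))"
    if "Poly_Mapping.keys z \<subseteq> ?K" for z
    using that by (intro sum.mono_neutral_left) (auto simp: in_keys_iff assms)
  show ?thesis
    using e[of "x + y"] e[of x] e[of y] keys_add[of x y]
    by (auto simp: assms lookup_add sum.distrib)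
qed

section \<open>\<open>C\<^sup>*\<close>-seminorms\<close>

context
  fixes p :: "'g free_star_algebra \<Rightarrow> real"
  assumes p: "cstar_seminorm p"
begin

lemma csn_triangle: "p (x + y) \<le> p x + p y"
  and csn_scale: "p (free_scale c x) = cmod c * p x"
  and csn_mult: "p (x * y) \<le> p x * p y"
  and csn_cstar: "p (free_star x * x) = (p x)\<^sup>2"
  using p by (auto simp: cstar_seminorm_def)

lemma csn_zero [simp]: "p 0 = 0"
  using csn_scale[of 0 0] by simp

lemma csn_minus [simp]: "p (- x) = p x"
  using csn_scale[of "-1" x] by (simp add: scale_neg_one)

lemma csn_nonneg [simp]: "p x \<ge> 0"
  using csn_triangle[of x "- x"] by simp

lemma csn_diff_commute: "p (x - y) = p (y - x)"
  using csn_minus[of "x - y"] by simp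

lemma csn_diff_triangle: "p (x - z) \<le> p (x - y) + p (y - z)"
  using csn_triangle[of "x - y" "y - z"] by simp

lemma csn_abs_diff: "\<bar>p x - p y\<bar> \<le> p (x - y)"
  using csn_triangle[of "x - y" y] csn_triangle[of "y - x" x] csn_diff_commute[of x y] by simp

text \<open>The \<open>C\<^sup>*\<close>-identity and submultiplicativity give \<open>(p y)\<^sup>2 \<le> p (free_star y) * p y\<close>.\<close>

lemma csn_star [simp]: "p (free_star x) = p x"
proof -
  have *: "p y \<le> p (free_star y)" for y
  proof (cases "p y = 0")
    case False
    have "p y * p y \<le> p (free_star y) * p y"
      using csn_cstar[of y] csn_mult[of "free_star y" y] by (simp add: power2_eq_square)
    then show ?thesis using False csn_nonneg[of y] mult_right_le_imp_le[of "p y" "p y"] by (metis less_le)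
  qed simp
  show ?thesis using *[of x] *[of "free_star x"] by (intro antisym) simp_all
qed

lemma csn_cong: "p (x - y) = 0 \<Longrightarrow> p x = p y"
  using csn_abs_diff[of x y] by simp

lemma csn_one_le: "p 1 \<le> 1"
proof -
  have "p 1 * p 1 = p 1" using csn_cstar[of 1] by (simp add: power2_eq_square)
  then show ?thesis by (metis mult_cancel_left1 mult_zero_left order.refl zero_le_one)
qed

text \<open>This is what makes the universal seminorm finite: a generator that is an isometry modulo the
  relations has norm at most one in every admissible seminorm.\<close>

lemma csn_isometry_le: assumes "p (free_star u * u - 1) = 0" shows "p u \<le> 1"
proof -
  have "(p u)\<^sup>2 \<le> 1"
    using csn_cong[OF assms] csn_cstar[of u] csn_one_le by simp
  then show ?thesis by (metis abs_le_square_iff abs_of_nonneg abs_one csn_nonneg one_power2)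
qed

end

text \<open>Without this bound the supremum in the definition of the universal seminorm would be an
  unspecified number.\<close>

locale finite_univ_seminorm =
  fixes R :: "'g free_star_algebra set"
  assumes bdd: "bdd_above ((\<lambda>p. p x) ` {p. cstar_seminorm p \<and> (\<forall>r\<in>R. p r = 0)})"
begin

abbreviation N where "N \<equiv> univ_seminorm R"

lemma seminorm_le_N: "cstar_seminorm p \<Longrightarrow> (\<And>r. r \<in> R \<Longrightarrow> p r = 0) \<Longrightarrow> p x \<le> N x"
  unfolding univ_seminorm_def by (rule cSUP_upper2[where x = p]) (auto intro: bdd)

lemma N_le: "(\<And>p. cstar_seminorm p \<Longrightarrow> (\<And>r. r \<in> R \<Longrightarrow> p r = 0) \<Longrightarrow> p x \<le> c) \<Longrightarrow> N x \<le> c"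
proof -
  assume a: "\<And>p. cstar_seminorm p \<Longrightarrow> (\<And>r. r \<in> R \<Longrightarrow> p r = 0) \<Longrightarrow> p x \<le> c"
  have "cstar_seminorm (\<lambda>_. 0)" by (simp add: cstar_seminorm_def)
  then show "N x \<le> c"
    unfolding univ_seminorm_def by (intro cSUP_least) (auto intro: a)
qed

lemma N_nonneg0: "N x \<ge> 0"
  using seminorm_le_N[of "\<lambda>_. 0" x] by (simp add: cstar_seminorm_def)

lemma N_scale_le: "N (free_scale c x) \<le> cmod c * N x"
  by (rule N_le) (simp add: csn_scale mult_left_mono seminorm_le_N)

lemma cstar_N: "cstar_seminorm N"
  unfolding cstar_seminorm_def
proof (intro conjI allI)
  fix x y :: "'g free_star_algebra" and c :: complex
  show "N (x + y) \<le> N x + N y"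
    by (rule N_le) (meson add_mono csn_triangle order_trans seminorm_le_N)
  show "N (x * y) \<le> N x * N y"
  proof (rule N_le)
    fix p :: "'g free_star_algebra \<Rightarrow> real" assume p: "cstar_seminorm p" "\<And>r. r \<in> R \<Longrightarrow> p r = 0"
    have "p (x * y) \<le> p x * p y" using p by (simp add: csn_mult)
    also have "\<dots> \<le> N x * N y" using p by (intro mult_mono) (auto intro: seminorm_le_N csn_nonneg N_nonneg0)
    finally show "p (x * y) \<le> N x * N y" .
  qed
  show "N (free_scale c x) = cmod c * N x"
  proof (cases "c = 0")
    case True
    have "N 0 \<le> 0" by (rule N_le) simp
    then show ?thesis using True N_nonneg0[of 0] by simp
  next
    case False
    have "cmod c * N x = cmod c * N (free_scale (inverse c) (free_scale c x))" using False by simp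
    also have "\<dots> \<le> cmod c * (cmod (inverse c) * N (free_scale c x))"
      by (intro mult_left_mono N_scale_le) auto
    also have "\<dots> = N (free_scale c x)" using False by (simp add: norm_inverse)
    finally show ?thesis using N_scale_le[of c x] by simp
  qed
  show "N (free_star x * x) = (N x)\<^sup>2"
  proof (rule antisym)
    show "N (free_star x * x) \<le> (N x)\<^sup>2"
    proof (rule N_le)
      fix p :: "'g free_star_algebra \<Rightarrow> real" assume p: "cstar_seminorm p" "\<And>r. r \<in> R \<Longrightarrow> p r = 0"
      show "p (free_star x * x) \<le> (N x)\<^sup>2"
        using p by (simp add: csn_cstar power_mono seminorm_le_N)
    qed
    have "N x \<le> sqrt (N (free_star x * x))"
    proof (rule N_le)
      fix p :: "'g free_star_algebra \<Rightarrow> real" assume p: "cstar_seminorm p" "\<And>r. r \<in> R \<Longrightarrow> p r = 0"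
      show "p x \<le> sqrt (N (free_star x * x))"
        using seminorm_le_N[OF p, of "free_star x * x"] p by (simp add: csn_cstar real_le_rsqrt)
    qed
    then show "(N x)\<^sup>2 \<le> N (free_star x * x)"
      using N_nonneg0 by (metis power_mono real_sqrt_pow2)
  qed
qed

lemmas N_triangle = csn_triangle[OF cstar_N]
lemmas N_scale = csn_scale[OF cstar_N]
lemmas N_mult = csn_mult[OF cstar_N]
lemmas N_cstar = csn_cstar[OF cstar_N]
lemmas N_zero [simp] = csn_zero[OF cstar_N]
lemmas N_minus [simp] = csn_minus[OF cstar_N]
lemmas N_nonneg [simp] = csn_nonneg[OF cstar_N]
lemmas N_diff_commute = csn_diff_commute[OF cstar_N]
lemmas N_diff_triangle = csn_diff_triangle[OF cstar_N]
lemmas N_abs_diff = csn_abs_diff[OF cstar_N]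
lemmas N_star [simp] = csn_star[OF cstar_N]
lemmas N_one_le = csn_one_le[OF cstar_N]

lemma N_rel: "r \<in> R \<Longrightarrow> N r = 0"
  using N_le[of r 0] N_nonneg[of r] by (simp add: order_antisym)

subsection \<open>Cauchy sequences\<close>

abbreviation CS where "CS \<equiv> cauchy_seqs R"

lemma CS_iff_Cauchy: "X \<in> CS \<longleftrightarrow> (\<forall>e>0. \<exists>M. \<forall>m\<ge>M. \<forall>n\<ge>M. N (X m - X n) < e)"
  by (simp add: cauchy_seqs_def)

lemma CS_const [simp]: "(\<lambda>n. x) \<in> CS"
  by (simp add: CS_iff_Cauchy)

text \<open>Every operation of the algebra is Lipschitz along Cauchy sequences, which are bounded; this
  one criterion therefore gives closure of the Cauchy sequences under all of them.\<close>

lemma CS_dom: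
  assumes "X \<in> CS" "Y \<in> CS" "\<And>m n. N (Z m - Z n) \<le> a * N (X m - X n) + b * N (Y m - Y n)"
  shows "Z \<in> CS"
  unfolding CS_iff_Cauchy
proof (intro allI impI)
  fix e :: real assume e: "e > 0"
  define c where "c = 1 + \<bar>a\<bar> + \<bar>b\<bar>"
  define d where "d = e / c"
  have c: "c > 0" "\<bar>a\<bar> + \<bar>b\<bar> < c" by (auto simp: c_def)
  have d: "d > 0" "c * d = e" using e c by (auto simp: d_def)
  obtain M1 where M1: "\<And>m n. m \<ge> M1 \<Longrightarrow> n \<ge> M1 \<Longrightarrow> N (X m - X n) < d"
    using assms(1) d(1) unfolding CS_iff_Cauchy by blast
  obtain M2 where M2: "\<And>m n. m \<ge> M2 \<Longrightarrow> n \<ge> M2 \<Longrightarrow> N (Y m - Y n) < d"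
    using assms(2) d(1) unfolding CS_iff_Cauchy by blast
  have "N (Z m - Z n) < e" if mn: "m \<ge> max M1 M2" "n \<ge> max M1 M2" for m n
  proof -
    have "N (Z m - Z n) \<le> \<bar>a\<bar> * N (X m - X n) + \<bar>b\<bar> * N (Y m - Y n)"
      by (rule order_trans[OF assms(3)]) (intro add_mono mult_right_mono; simp)
    also have "\<dots> \<le> \<bar>a\<bar> * d + \<bar>b\<bar> * d"
      using mn M1[of m n] M2[of m n] by (intro add_mono mult_left_mono) auto
    also have "\<dots> < c * d"
      using c(2) d(1) by (simp flip: distrib_right)
    also have "\<dots> = e" by (rule d(2))
    finally show ?thesis .
  qed
  then show "\<exists>M. \<forall>m\<ge>M. \<forall>n\<ge>M. N (Z m - Z n) < e" by blast
qed

lemma CS_add: "X \<in> CS \<Longrightarrow> Y \<in> CS \<Longrightarrow> (\<lambda>n. X n + Y n) \<in> CS"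
proof (rule CS_dom[of X Y _ 1 1])
  fix m n show "N (X m + Y m - (X n + Y n)) \<le> 1 * N (X m - X n) + 1 * N (Y m - Y n)"
    using N_triangle[of "X m - X n" "Y m - Y n"] by (simp add: algebra_simps)
qed auto

lemma CS_scale: "X \<in> CS \<Longrightarrow> (\<lambda>n. free_scale c (X n)) \<in> CS"
  by (rule CS_dom[of X X _ "cmod c" 0]) (auto simp: N_scale simp flip: scale_diff)

lemma CS_star: "X \<in> CS \<Longrightarrow> (\<lambda>n. free_star (X n)) \<in> CS"
  by (rule CS_dom[of X X _ 1 0]) (auto simp flip: star_diff)

lemma CS_diff: "X \<in> CS \<Longrightarrow> Y \<in> CS \<Longrightarrow> (\<lambda>n. X n - Y n) \<in> CS"
  using CS_add[of X "\<lambda>n. free_scale (-1) (Y n)"] CS_scale[of Y "-1"] by (simp add: scale_neg_one)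

lemma CS_bounded:
  assumes "X \<in> CS" obtains B where "B > 0" "\<And>n. N (X n) \<le> B"
proof -
  obtain M where M: "\<And>m n. m \<ge> M \<Longrightarrow> n \<ge> M \<Longrightarrow> N (X m - X n) < 1"
    using assms zero_less_one unfolding CS_iff_Cauchy by blast
  let ?B = "1 + N (X M) + (\<Sum>i<M. N (X i))"
  have "N (X n) \<le> ?B" for n
  proof (cases "n < M")
    case True
    then have "N (X n) \<le> (\<Sum>i<M. N (X i))" by (intro member_le_sum) auto
    then show ?thesis using N_nonneg[of "X M"] by linarith
  next
    case False
    then have "N (X n) \<le> 1 + N (X M)"
      using M[of n M] N_abs_diff[of "X n" "X M"] by simp
    moreover have "(\<Sum>i<M. N (X i)) \<ge> 0" by (intro sum_nonneg) auto
    ultimately show ?thesis by simp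
  qed
  moreover have "?B > 0"
    by (intro add_pos_nonneg) (auto intro: sum_nonneg)
  ultimately show ?thesis using that by blast
qed

lemma N_mult_diff: "N (a * b - c * d) \<le> N a * N (b - d) + N (a - c) * N d"
proof -
  have "a * b - c * d = a * (b - d) + (a - c) * d" by (simp add: algebra_simps)
  then show ?thesis
    using N_triangle[of "a * (b - d)" "(a - c) * d"] N_mult[of a "b - d"] N_mult[of "a - c" d] by simp
qed

lemma CS_mult: assumes "X \<in> CS" "Y \<in> CS" shows "(\<lambda>n. X n * Y n) \<in> CS"
proof -
  obtain A B where A: "A > 0" "\<And>n. N (X n) \<le> A" and B: "B > 0" "\<And>n. N (Y n) \<le> B"
    using CS_bounded assms by metis
  show ?thesis
  proof (rule CS_dom[OF assms, of _ B A])
    fix m n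
    have "N (X m * Y m - X n * Y n) \<le> N (X m) * N (Y m - Y n) + N (X m - X n) * N (Y n)"
      by (rule N_mult_diff)
    also have "\<dots> \<le> A * N (Y m - Y n) + N (X m - X n) * B"
      using A B by (intro add_mono mult_right_mono mult_left_mono) auto
    finally show "N (X m * Y m - X n * Y n) \<le> B * N (X m - X n) + A * N (Y m - Y n)"
      by (simp add: algebra_simps)
  qed
qed

lemma CS_shift: "X \<in> CS \<Longrightarrow> (\<lambda>n. X (n + k)) \<in> CS"
  unfolding CS_iff_Cauchy by (meson trans_le_add1)

subsection \<open>Arithmetic of classes\<close>

abbreviation A where "A \<equiv> universal_cstar R"
abbreviation cls where "cls \<equiv> seq_class R"

lemma equiv_null: "equiv CS (null_rel R)"
proof (rule equivI)
  show "refl_on CS (null_rel R)"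
    by (auto simp: refl_on_def null_rel_def)
  show "sym (null_rel R)"
    by (auto simp: sym_def null_rel_def N_diff_commute)
  show "trans (null_rel R)"
  proof (rule transI)
    fix X Y Z assume a: "(X, Y) \<in> null_rel R" "(Y, Z) \<in> null_rel R"
    then have "(\<lambda>n. N (X n - Y n) + N (Y n - Z n)) \<longlonglongrightarrow> 0"
      by (auto simp: null_rel_def intro: tendsto_add_zero)
    then have "(\<lambda>n. N (X n - Z n)) \<longlonglongrightarrow> 0"
      by (rule Lim_null_comparison[rotated]) (simp add: N_diff_triangle)
    then show "(X, Z) \<in> null_rel R" using a by (auto simp: null_rel_def)
  qed
qed (auto simp: null_rel_def)

lemma cls_eq_iff: "X \<in> CS \<Longrightarrow> Y \<in> CS \<Longrightarrow> cls X = cls Y \<longleftrightarrow> (\<lambda>n. N (X n - Y n)) \<longlonglongrightarrow> 0"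
  unfolding seq_class_def using eq_equiv_class_iff[OF equiv_null, of X Y] by (simp add: null_rel_def)

lemma cls_eqI: "X \<in> CS \<Longrightarrow> Y \<in> CS \<Longrightarrow> (\<lambda>n. N (X n - Y n)) \<longlonglongrightarrow> 0 \<Longrightarrow> cls X = cls Y"
  by (simp add: cls_eq_iff)

lemma cls_in [simp]: "X \<in> CS \<Longrightarrow> cls X \<in> carrier A"
  by (simp add: universal_cstar_def seq_class_def quotientI)

lemma carrierE: assumes "S \<in> carrier A" obtains X where "X \<in> CS" "S = cls X"
  using assms by (auto simp: universal_cstar_def seq_class_def elim!: quotientE)

lemma mem_cls: "X' \<in> cls X \<longleftrightarrow> X \<in> CS \<and> X' \<in> CS \<and> (\<lambda>n. N (X n - X' n)) \<longlonglongrightarrow> 0"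
  by (auto simp: seq_class_def null_rel_def)

lemma cls_self: "X \<in> CS \<Longrightarrow> X \<in> cls X"
  by (simp add: mem_cls)

lemma UN_cls:
  assumes "X \<in> CS" "\<And>X'. X' \<in> cls X \<Longrightarrow> G X' = G X"
  shows "(\<Union>X'\<in>cls X. G X') = G X"
proof (rule UN_constant_eq)
  show "X \<in> cls X" using assms by (simp add: cls_self)
qed (intro ballI assms(2))

lemma UN_cls2:
  assumes "X \<in> CS" "Y \<in> CS" "\<And>X' Y'. X' \<in> cls X \<Longrightarrow> Y' \<in> cls Y \<Longrightarrow> G X' Y' = G X Y"
  shows "(\<Union>X'\<in>cls X. \<Union>Y'\<in>cls Y. G X' Y') = G X Y"
proof -
  have "(\<Union>Y'\<in>cls Y. G X' Y') = G X Y" if "X' \<in> cls X" for X'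
    by (rule UN_constant_eq[OF cls_self[OF assms(2)]]) (intro ballI assms(3) that)
  then show ?thesis by (intro UN_constant_eq[OF cls_self[OF assms(1)]] ballI)
qed

text \<open>The same estimate shows that the operations do not depend on the representatives.\<close>

lemma cls_dom_eq:
  assumes "X' \<in> cls X" "Y' \<in> cls Y" "Z \<in> CS" "Z' \<in> CS"
    "\<And>n. N (Z' n - Z n) \<le> a * N (X n - X' n) + b * N (Y n - Y' n)"
  shows "cls Z' = cls Z"
proof (rule cls_eqI)
  have "(\<lambda>n. a * N (X n - X' n) + b * N (Y n - Y' n)) \<longlonglongrightarrow> a * 0 + b * 0"
    using assms by (intro tendsto_intros) (auto simp: mem_cls)
  then have l: "(\<lambda>n. a * N (X n - X' n) + b * N (Y n - Y' n)) \<longlonglongrightarrow> 0" by simp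
  show "(\<lambda>n. N (Z' n - Z n)) \<longlonglongrightarrow> 0"
    by (rule Lim_null_comparison[OF _ l]) (simp add: assms(5))
qed (use assms in auto)

lemma cls_add [simp]:
  assumes "X \<in> CS" "Y \<in> CS" shows "cls X \<oplus>\<^bsub>A\<^esub> cls Y = cls (\<lambda>n. X n + Y n)"
proof -
  have *: "cls (\<lambda>n. X' n + Y' n) = cls (\<lambda>n. X n + Y n)" if "X' \<in> cls X" "Y' \<in> cls Y" for X' Y'
  proof (rule cls_dom_eq[OF that, of _ _ 1 1])
    fix n show "N (X' n + Y' n - (X n + Y n)) \<le> 1 * N (X n - X' n) + 1 * N (Y n - Y' n)"
      using N_triangle[of "X' n - X n" "Y' n - Y n"]
      by (simp add: algebra_simps N_diff_commute[of "X n"] N_diff_commute[of "Y n"])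
  qed (use that in \<open>auto simp: mem_cls intro: CS_add\<close>)
  show ?thesis
    using UN_cls2[OF assms, where G = "\<lambda>X Y. cls (\<lambda>n. X n + Y n)"] * by (simp add: universal_cstar_def)
qed

lemma cls_mult [simp]:
  assumes "X \<in> CS" "Y \<in> CS" shows "cls X \<otimes>\<^bsub>A\<^esub> cls Y = cls (\<lambda>n. X n * Y n)"
proof -
  have *: "cls (\<lambda>n. X' n * Y' n) = cls (\<lambda>n. X n * Y n)" if "X' \<in> cls X" "Y' \<in> cls Y" for X' Y'
  proof -
    have "X' \<in> CS" "Y \<in> CS" using that assms by (auto simp: mem_cls)
    then obtain C B where A: "\<And>n. N (X' n) \<le> C" and B: "\<And>n. N (Y n) \<le> B"
      using CS_bounded by metis
    show ?thesis
    proof (rule cls_dom_eq[OF that, of _ _ B C])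
      fix n
      have "N (X' n * Y' n - X n * Y n) \<le> N (X' n) * N (Y' n - Y n) + N (X' n - X n) * N (Y n)"
        by (rule N_mult_diff)
      also have "\<dots> \<le> C * N (Y' n - Y n) + N (X' n - X n) * B"
        using A B by (intro add_mono mult_right_mono mult_left_mono) auto
      finally show "N (X' n * Y' n - X n * Y n) \<le> B * N (X n - X' n) + C * N (Y n - Y' n)"
        by (simp add: algebra_simps N_diff_commute[of "X n"] N_diff_commute[of "Y n"])
    qed (use that in \<open>auto simp: mem_cls intro: CS_mult\<close>)
  qed
  show ?thesis
    using UN_cls2[OF assms, where G = "\<lambda>X Y. cls (\<lambda>n. X n * Y n)"] * by (simp add: universal_cstar_def)
qed

lemma cls_smult [simp]: assumes "X \<in> CS" shows "c \<odot>\<^bsub>A\<^esub> cls X = cls (\<lambda>n. free_scale c (X n))"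
proof -
  have "cls (\<lambda>n. free_scale c (X' n)) = cls (\<lambda>n. free_scale c (X n))" if "X' \<in> cls X" for X'
    by (rule cls_dom_eq[OF that that, of _ _ "cmod c" 0])
      (use that in \<open>auto simp: mem_cls CS_scale N_scale N_diff_commute[of "X _"] simp flip: scale_diff\<close>)
  then show ?thesis using UN_cls[OF assms, of "\<lambda>X. cls (\<lambda>n. free_scale c (X n))"] by (simp add: universal_cstar_def)
qed

lemma cls_star [simp]: assumes "X \<in> CS" shows "star A (cls X) = cls (\<lambda>n. free_star (X n))"
proof -
  have "cls (\<lambda>n. free_star (X' n)) = cls (\<lambda>n. free_star (X n))" if "X' \<in> cls X" for X'
    by (rule cls_dom_eq[OF that that, of _ _ 1 0])
      (use that in \<open>auto simp: mem_cls CS_star N_diff_commute[of "X _"] simp flip: star_diff\<close>)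
  then show ?thesis using UN_cls[OF assms, of "\<lambda>X. cls (\<lambda>n. free_star (X n))"] by (simp add: universal_cstar_def)
qed

lemma cls_one: "\<one>\<^bsub>A\<^esub> = cls (\<lambda>n. 1)" and cls_zero: "\<zero>\<^bsub>A\<^esub> = cls (\<lambda>n. 0)"
  by (simp_all add: universal_cstar_def)

lemma cls_shift: assumes "X \<in> CS" shows "cls (\<lambda>n. X (n + k)) = cls X"
proof (rule cls_eqI)
  show "(\<lambda>n. N (X (n + k) - X n)) \<longlonglongrightarrow> 0"
  proof (rule LIMSEQ_I)
    fix e :: real assume "e > 0"
    then obtain M where "\<And>m n. m \<ge> M \<Longrightarrow> n \<ge> M \<Longrightarrow> N (X m - X n) < e"
      using assms unfolding CS_iff_Cauchy by blast
    then show "\<exists>M. \<forall>n\<ge>M. norm (N (X (n + k) - X n) - 0) < e"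
      by (intro exI[of _ M]) (auto simp: trans_le_add1)
  qed
qed (use assms CS_shift in auto)

end

section \<open>Automatic continuity\<close>

text \<open>The form is the value of a positive functional at \<open>(x + z y)\<^sup>* (x + z y)\<close>. Its values at
  \<open>z = 1\<close> and \<open>z = \<i>\<close> give symmetry, and its minimum along the ray through \<open>- cnj b\<close> gives
  Cauchy--Schwarz.\<close>

lemma psd_pair:
  fixes a b b' c :: complex
  assumes "\<And>z. a + z * b + cnj z * b' + of_real ((cmod z)\<^sup>2) * c \<in> \<real>\<^sub>\<ge>\<^sub>0"
    and "a \<in> \<real>\<^sub>\<ge>\<^sub>0" "c \<in> \<real>\<^sub>\<ge>\<^sub>0"
  shows "b' = cnj b" "(cmod b)\<^sup>2 \<le> Re a * Re c"
proof -
  have a: "Im a = 0" "Re a \<ge> 0" and c: "Im c = 0" "Re c \<ge> 0"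
    using assms(2,3) by (auto simp: complex_nonneg_Reals_iff)
  show b: "b' = cnj b"
    using assms(1)[of 1] assms(1)[of \<i>] a c by (auto simp: complex_nonneg_Reals_iff complex_eq_iff)
  have q: "Re a + 2 * Re (z * b) + (cmod z)\<^sup>2 * Re c \<ge> 0" for z
    using assms(1)[of z] by (simp add: complex_nonneg_Reals_iff b algebra_simps)
  have bb: "Re (cnj b * b) = (cmod b)\<^sup>2"
    by (metis Re_complex_of_real complex_norm_square mult.commute of_real_power)
  have q': "Re a - 2 * t * (cmod b)\<^sup>2 + t\<^sup>2 * (cmod b)\<^sup>2 * Re c \<ge> 0" for t
  proof -
    have "(- of_real t * cnj b) * b = of_real (- t) * (cnj b * b)" by simp
    then have "Re ((- of_real t * cnj b) * b) = - t * (cmod b)\<^sup>2"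
      using bb by (simp only: Re_complex_of_real Im_complex_of_real complex.sel times_complex.simps)
    moreover have "(cmod (- of_real t * cnj b))\<^sup>2 = t\<^sup>2 * (cmod b)\<^sup>2"
      by (simp add: norm_mult power_mult_distrib)
    ultimately show ?thesis using q[of "- of_real t * cnj b"] by simp
  qed
  show "(cmod b)\<^sup>2 \<le> Re a * Re c"
  proof (cases "Re c = 0")
    case True
    have "cmod b = 0"
    proof (rule ccontr)
      assume "cmod b \<noteq> 0"
      \<comment> \<open>Without a quadratic term the form becomes negative far out on the ray.\<close>
      then have "(Re a + 1) / (cmod b)\<^sup>2 * (cmod b)\<^sup>2 = Re a + 1" by simp
      then have "0 \<le> Re a - 2 * (Re a + 1)"
        using q'[of "(Re a + 1) / (cmod b)\<^sup>2"] True by (simp only: mult.assoc mult_zero_right add_0_right)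
      then show False using a(2) by simp
    qed
    then show ?thesis using a c by simp
  next
    case False
    then show ?thesis using q'[of "1 / Re c"] c by (simp add: field_simps power2_eq_square)
  qed
qed

definition pos_functional :: "('g free_star_algebra \<Rightarrow> complex) \<Rightarrow> bool" where
  "pos_functional f \<longleftrightarrow> (\<forall>x y. f (x + y) = f x + f y) \<and> (\<forall>c x. f (free_scale c x) = c * f x) \<and>
     (\<forall>x. f (free_star x * x) \<in> \<real>\<^sub>\<ge>\<^sub>0)"

context
  fixes f :: "'g free_star_algebra \<Rightarrow> complex"
  assumes f: "pos_functional f"
begin

lemma pf_add: "f (x + y) = f x + f y"
  and pf_scale: "f (free_scale c x) = c * f x"
  and pf_pos: "f (free_star x * x) \<in> \<real>\<^sub>\<ge>\<^sub>0"
  using f by (auto simp: pos_functional_def)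

lemma pf_minus: "f (- x) = - f x"
  using pf_scale[of "-1" x] by (simp add: scale_neg_one)

lemma pf_diff: "f (x - y) = f x - f y"
  using pf_add[of x "- y"] by (simp add: pf_minus)

lemma pf_zero: "f 0 = 0"
  using pf_scale[of 0 0] by simp

lemma pf_sum: "f (sum g I) = (\<Sum>i\<in>I. f (g i))"
  by (induction I rule: infinite_finite_induct) (auto simp: pf_zero pf_add)

lemma pf_Re: "Re (f (free_star x * x)) \<ge> 0" "f (free_star x * x) = of_real (Re (f (free_star x * x)))"
  using pf_pos[of x] by (auto simp: complex_nonneg_Reals_iff complex_eq_iff)

lemma pf_psd:
  "f (free_star x * x) + z * f (free_star x * y) + cnj z * f (free_star y * x)
    + of_real ((cmod z)\<^sup>2) * f (free_star y * y) \<in> \<real>\<^sub>\<ge>\<^sub>0"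
  using pf_pos[of "x + free_scale z y"]
  by (simp add: star_add star_scale distrib_left distrib_right pf_add pf_scale
      complex_norm_square[of z] algebra_simps flip: of_real_power)

lemma pf_hermitian: "f (free_star y * x) = cnj (f (free_star x * y))"
  by (rule psd_pair(1)[OF pf_psd pf_pos pf_pos])

lemma pf_CS: "(cmod (f (free_star x * y)))\<^sup>2 \<le> Re (f (free_star x * x)) * Re (f (free_star y * y))"
  by (rule psd_pair(2)[OF pf_psd pf_pos pf_pos])

lemma pf_star: "f (free_star x) = cnj (f x)"
  using pf_hermitian[of x 1] by simp

end

context finite_univ_seminorm
begin

text \<open>A class is known only through its representatives, whose norms all have the same limit.\<close>

definition nrm :: "(nat \<Rightarrow> 'g free_star_algebra) set \<Rightarrow> real" where
  "nrm S = lim (\<lambda>n. N ((SOME X. X \<in> S) n))"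

lemma CS_convergent_N: "X \<in> CS \<Longrightarrow> convergent (\<lambda>n. N (X n))"
proof -
  assume X: "X \<in> CS"
  have "Cauchy (\<lambda>n. N (X n))"
    unfolding Cauchy_def
  proof (intro allI impI)
    fix e :: real assume "e > 0"
    then obtain M where M: "\<And>m n. m \<ge> M \<Longrightarrow> n \<ge> M \<Longrightarrow> N (X m - X n) < e"
      using X unfolding CS_iff_Cauchy by blast
    then have "dist (N (X m)) (N (X n)) < e" if "m \<ge> M" "n \<ge> M" for m n
      using N_abs_diff[of "X m" "X n"] M[OF that] by (simp add: dist_real_def)
    then show "\<exists>M. \<forall>m\<ge>M. \<forall>n\<ge>M. dist (N (X m)) (N (X n)) < e" by blast
  qed
  then show ?thesis by (rule Cauchy_convergent)
qed

lemma nrm_tendsto: assumes X: "X \<in> CS" shows "(\<lambda>n. N (X n)) \<longlonglongrightarrow> nrm (cls X)"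
proof -
  define Y where "Y = (SOME Y. Y \<in> cls X)"
  have Y: "Y \<in> cls X" unfolding Y_def by (rule someI[of "\<lambda>Y. Y \<in> cls X", OF cls_self[OF X]])
  then have "Y \<in> CS" "(\<lambda>n. N (X n - Y n)) \<longlonglongrightarrow> 0" by (auto simp: mem_cls)
  moreover have "(\<lambda>n. N (Y n)) \<longlonglongrightarrow> nrm (cls X)"
    using CS_convergent_N[OF \<open>Y \<in> CS\<close>] by (simp add: nrm_def Y_def convergent_LIMSEQ_iff)
  moreover have "(\<lambda>n. N (X n) - N (Y n)) \<longlonglongrightarrow> 0"
    by (rule Lim_null_comparison[OF _ calculation(2)]) (simp add: N_abs_diff)
  ultimately have "(\<lambda>n. (N (X n) - N (Y n)) + N (Y n)) \<longlonglongrightarrow> 0 + nrm (cls X)"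
    by (intro tendsto_add)
  then show ?thesis by simp
qed

lemma nrm_eqI: "X \<in> CS \<Longrightarrow> (\<lambda>n. N (X n)) \<longlonglongrightarrow> c \<Longrightarrow> nrm (cls X) = c"
  using nrm_tendsto LIMSEQ_unique by blast

lemma nrm_le: "X \<in> CS \<Longrightarrow> (\<And>n. N (X n) \<le> c) \<Longrightarrow> nrm (cls X) \<le> c"
  by (rule LIMSEQ_le_const2[OF nrm_tendsto]) auto

lemma nrm_const [simp]: "nrm (cls (\<lambda>n. x)) = N x"
  by (rule nrm_eqI) auto

lemma nrm_nonneg: "S \<in> carrier A \<Longrightarrow> nrm S \<ge> 0"
  by (elim carrierE) (auto intro: LIMSEQ_le_const[OF nrm_tendsto])

lemma nrm_add: "S \<in> carrier A \<Longrightarrow> T \<in> carrier A \<Longrightarrow> nrm (S \<oplus>\<^bsub>A\<^esub> T) \<le> nrm S + nrm T"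
proof (elim carrierE, simp)
  fix X Y assume *: "X \<in> CS" "Y \<in> CS"
  show "nrm (cls (\<lambda>n. X n + Y n)) \<le> nrm (cls X) + nrm (cls Y)"
    by (rule LIMSEQ_le[OF nrm_tendsto[OF CS_add[OF *]] tendsto_add[OF nrm_tendsto nrm_tendsto]])
      (use * N_triangle in auto)
qed

lemma nrm_smult: "S \<in> carrier A \<Longrightarrow> nrm (c \<odot>\<^bsub>A\<^esub> S) = cmod c * nrm S"
proof (elim carrierE, simp)
  fix X assume *: "X \<in> CS"
  have "(\<lambda>n. N (free_scale c (X n))) \<longlonglongrightarrow> cmod c * nrm (cls X)"
    unfolding N_scale by (intro tendsto_mult tendsto_const nrm_tendsto *)
  then show "nrm (cls (\<lambda>n. free_scale c (X n))) = cmod c * nrm (cls X)"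
    using * by (simp add: nrm_eqI CS_scale)
qed

lemma nrm_star: "S \<in> carrier A \<Longrightarrow> nrm (star A S) = nrm S"
  by (elim carrierE) (auto intro!: nrm_eqI nrm_tendsto CS_star)

lemma nrm_cstar: "S \<in> carrier A \<Longrightarrow> nrm (star A S \<otimes>\<^bsub>A\<^esub> S) = (nrm S)\<^sup>2"
  by (elim carrierE) (simp add: CS_star CS_mult nrm_eqI nrm_tendsto tendsto_power N_cstar)

subsection \<open>Square roots and unitaries\<close>

text \<open>The iteration tends to \<open>1 - sqrt (1 - a)\<close>: the fixed point equation \<open>2 b = a + b\<^sup>2\<close> says
  \<open>(1 - b)\<^sup>2 = 1 - a\<close>. All iterates are polynomials in \<open>a\<close>, so they stay in the free algebra.\<close>

primrec sqrt_iter :: "nat \<Rightarrow> 'g free_star_algebra \<Rightarrow> 'g free_star_algebra" where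
  "sqrt_iter 0 a = 0"
| "sqrt_iter (Suc k) a = free_scale (1/2) (a + sqrt_iter k a * sqrt_iter k a)"

lemma iter_star: "free_star a = a \<Longrightarrow> free_star (sqrt_iter k a) = sqrt_iter k a"
  by (induction k) (auto simp: star_scale star_add star_mult)

lemma iter_comm: "x * a = a * x \<Longrightarrow> x * sqrt_iter k a = sqrt_iter k a * x"
proof (induction k)
  case (Suc k)
  then have "x * (sqrt_iter k a * sqrt_iter k a) = sqrt_iter k a * sqrt_iter k a * x"
    by (metis mult.assoc)
  then show ?case using Suc by (simp add: distrib_left distrib_right)
qed simp

context
  fixes r \<beta> :: real
  \<comment> \<open>\<open>\<beta>\<close> is the limit of the scalar iteration, which dominates the norms of all iterates.\<close>
  assumes r: "0 \<le> r" "r < 1" and \<beta>_def: "\<beta> = 1 - sqrt (1 - r)"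
begin

lemma \<beta>: "0 \<le> \<beta>" "\<beta> < 1" "r + \<beta> * \<beta> = 2 * \<beta>"
proof -
  have "(1 - \<beta>)\<^sup>2 = 1 - r" using r by (simp add: \<beta>_def)
  then show "r + \<beta> * \<beta> = 2 * \<beta>" by (simp add: power2_eq_square algebra_simps)
qed (use r in \<open>auto simp: \<beta>_def\<close>)

lemma iter_bound: "N a \<le> r \<Longrightarrow> N (sqrt_iter k a) \<le> \<beta>"
proof (induction k)
  case (Suc k)
  have "N (a + sqrt_iter k a * sqrt_iter k a) \<le> r + \<beta> * \<beta>"
    using Suc N_triangle[of a "sqrt_iter k a * sqrt_iter k a"] N_mult[of "sqrt_iter k a" "sqrt_iter k a"]
      mult_mono[of "N (sqrt_iter k a)" \<beta> "N (sqrt_iter k a)" \<beta>] \<beta> by simp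
  then show ?case using \<beta> by (simp add: N_scale)
qed (use \<beta> in simp)

lemma N_square_diff:
  assumes "N x \<le> \<beta>" "N y \<le> \<beta>" shows "N (x * x - y * y) \<le> 2 * \<beta> * N (x - y)"
proof -
  have "N (x * x - y * y) \<le> N x * N (x - y) + N (x - y) * N y" by (rule N_mult_diff)
  also have "\<dots> \<le> \<beta> * N (x - y) + N (x - y) * \<beta>"
    using assms by (intro add_mono mult_right_mono mult_left_mono) auto
  finally show ?thesis by (simp add: algebra_simps)
qed

lemma iter_step: "N a \<le> r \<Longrightarrow> N (sqrt_iter (Suc k) a - sqrt_iter k a) \<le> \<beta> ^ k"
proof (induction k)
  case 0
  then show ?case using r by (simp add: N_scale)
next
  case (Suc k)
  have "sqrt_iter (Suc (Suc k)) a - sqrt_iter (Suc k) a =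
      free_scale (1/2) (sqrt_iter (Suc k) a * sqrt_iter (Suc k) a - sqrt_iter k a * sqrt_iter k a)"
    unfolding sqrt_iter.simps(2)[of "Suc k"] sqrt_iter.simps(2)[of k a] by (simp flip: scale_diff)
  then have "N (sqrt_iter (Suc (Suc k)) a - sqrt_iter (Suc k) a) \<le>
      \<beta> * N (sqrt_iter (Suc k) a - sqrt_iter k a)"
    using N_square_diff[OF iter_bound[OF Suc.prems] iter_bound[OF Suc.prems], of "Suc k" k]
    by (simp add: N_scale del: sqrt_iter.simps)
  also have "\<dots> \<le> \<beta> * \<beta> ^ k"
    using Suc \<beta> by (intro mult_left_mono) auto
  finally show ?case by simp
qed

lemma iter_lipschitz:
  assumes "N a \<le> r" "N b \<le> r"
  shows "N (sqrt_iter k a - sqrt_iter k b) \<le> N (a - b) / (1 - \<beta>)"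
proof (induction k)
  case (Suc k)
  let ?D = "N (a - b)"
  have e: "sqrt_iter (Suc k) a - sqrt_iter (Suc k) b =
      free_scale (1/2) ((a - b) + (sqrt_iter k a * sqrt_iter k a - sqrt_iter k b * sqrt_iter k b))"
    by (simp add: algebra_simps flip: scale_diff)
  have "N (sqrt_iter k a * sqrt_iter k a - sqrt_iter k b * sqrt_iter k b) \<le> 2 * \<beta> * (?D / (1 - \<beta>))"
    using N_square_diff[OF iter_bound[OF assms(1)] iter_bound[OF assms(2)], of k k] Suc \<beta>
    by (smt (verit) mult_left_mono)
  then have "N (sqrt_iter (Suc k) a - sqrt_iter (Suc k) b) \<le> (?D + 2 * \<beta> * (?D / (1 - \<beta>))) / 2"
    unfolding e N_scale using N_triangle[of "a - b" "sqrt_iter k a * sqrt_iter k a - sqrt_iter k b * sqrt_iter k b"]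
    by simp
  also have "\<dots> = (?D * (1 + \<beta>) / 2) / (1 - \<beta>)"
    using \<beta> by (simp add: field_simps)
  also have "\<dots> \<le> ?D / (1 - \<beta>)"
    using \<beta> mult_left_mono[of "1 + \<beta>" 2 ?D] by (intro divide_right_mono) simp_all
  finally show ?case .
qed (use \<beta> in simp)

lemma iter_diff:
  assumes "N a \<le> r"
  shows "N (sqrt_iter (m + k) a - sqrt_iter m a) \<le> \<beta> ^ m / (1 - \<beta>)"
proof -
  have "N (sqrt_iter (m + k) a - sqrt_iter m a) \<le> (\<beta> ^ m - \<beta> ^ (m + k)) / (1 - \<beta>)"
  proof (induction k)
    case (Suc k)
    have "N (sqrt_iter (m + Suc k) a - sqrt_iter m a) \<le> \<beta> ^ (m + k) + (\<beta> ^ m - \<beta> ^ (m + k)) / (1 - \<beta>)"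
      using N_diff_triangle[of "sqrt_iter (m + Suc k) a" "sqrt_iter m a" "sqrt_iter (m + k) a"]
        iter_step[OF assms, of "m + k"] Suc by (simp del: sqrt_iter.simps)
    also have "\<dots> = (\<beta> ^ m - \<beta> ^ (m + Suc k)) / (1 - \<beta>)"
      using \<beta> by (simp add: field_simps)
    finally show ?case .
  qed simp
  also have "\<dots> \<le> \<beta> ^ m / (1 - \<beta>)"
    using \<beta> by (intro divide_right_mono) auto
  finally show ?thesis .
qed

lemma iter_diff':
  assumes "N a \<le> r" "M \<le> m" "M \<le> n"
  shows "N (sqrt_iter m a - sqrt_iter n a) \<le> 2 * (\<beta> ^ M / (1 - \<beta>))"
proof -
  obtain k l where "m = M + k" "n = M + l" using assms(2,3) le_Suc_ex by blast
  then show ?thesis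
    using iter_diff[OF assms(1), of M k] iter_diff[OF assms(1), of M l]
      N_diff_triangle[of "sqrt_iter m a" "sqrt_iter n a" "sqrt_iter M a"]
      N_diff_commute[of "sqrt_iter M a" "sqrt_iter n a"]
    by simp
qed

text \<open>The approximations of the square root and the representative of the class advance together.\<close>

lemma iter_CS:
  assumes X: "X \<in> CS" "\<And>n. N (X n) \<le> r"
  shows "(\<lambda>n. sqrt_iter n (X n)) \<in> CS"
  unfolding CS_iff_Cauchy
proof (intro allI impI)
  fix e :: real assume e: "e > 0"
  have "e * (1 - \<beta>) / 4 > 0" using e \<beta> by simp
  then obtain M1 where M1: "\<beta> ^ M1 < e * (1 - \<beta>) / 4"
    using \<beta> real_arch_pow_inv by blast
  have "e * (1 - \<beta>) / 2 > 0" using e \<beta> by simp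
  then obtain M2 where M2: "\<And>m n. m \<ge> M2 \<Longrightarrow> n \<ge> M2 \<Longrightarrow> N (X m - X n) < e * (1 - \<beta>) / 2"
    using X(1) unfolding CS_iff_Cauchy by blast
  have "N (sqrt_iter m (X m) - sqrt_iter n (X n)) < e" if mn: "m \<ge> max M1 M2" "n \<ge> max M1 M2" for m n
  proof -
    have "N (sqrt_iter m (X m) - sqrt_iter n (X n)) \<le>
        N (sqrt_iter m (X m) - sqrt_iter n (X m)) + N (sqrt_iter n (X m) - sqrt_iter n (X n))"
      by (rule N_diff_triangle)
    also have "\<dots> \<le> 2 * (\<beta> ^ M1 / (1 - \<beta>)) + N (X m - X n) / (1 - \<beta>)"
      using mn by (intro add_mono iter_diff' iter_lipschitz X) auto
    also have "\<dots> < e / 2 + e / 2"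
    proof (rule add_strict_mono)
      show "2 * (\<beta> ^ M1 / (1 - \<beta>)) < e / 2" using M1 \<beta> by (simp add: field_simps)
      show "N (X m - X n) / (1 - \<beta>) < e / 2" using M2[of m n] mn \<beta> by (simp add: field_simps)
    qed
    finally show ?thesis by simp
  qed
  then show "\<exists>M. \<forall>m\<ge>M. \<forall>n\<ge>M. N (sqrt_iter m (X m) - sqrt_iter n (X n)) < e" by blast
qed

end

text \<open>The unitary is \<open>X + \<i> sqrt (1 - X\<^sup>2)\<close>. Everything that is bounded on unitaries is therefore
  bounded on selfadjoint contractions; this yields the continuity of states and of homomorphisms.\<close>

lemma selfadjoint_real_part_unitary:
  assumes X: "X \<in> CS" "\<And>n. free_star (X n) = X n" "\<And>n. N (X n) \<le> s" "s < 1"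
  obtains U where "U \<in> CS" "cls (\<lambda>n. free_star (U n) * U n) = cls (\<lambda>n. 1)"
    "cls X = cls (\<lambda>n. free_scale (1/2) (U n + free_star (U n)))"
proof -
  define T where "T n = X n * X n" for n
  define Z where "Z n = 1 - sqrt_iter n (T n)" for n
  define U where "U n = X n + free_scale \<i> (Z n)" for n
  have s: "0 \<le> s" using X(3)[of 0] N_nonneg[of "X 0"] by linarith
  define r where "r = s\<^sup>2"
  define \<beta> where "\<beta> = 1 - sqrt (1 - r)"
  have r: "0 \<le> r" "r < 1" using s X(4) by (auto simp: r_def power_less_one_iff abs_square_less_1)
  have T: "T \<in> CS" "\<And>n. N (T n) \<le> r"
  proof -
    show "T \<in> CS" unfolding T_def using X by (intro CS_mult)
    show "N (T n) \<le> r" for n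
      using N_cstar[of "X n"] X(2)[of n] X(3)[of n] by (simp add: T_def r_def power_mono)
  qed
  note iter = iter_CS[OF r \<beta>_def T]
  have Z: "Z \<in> CS" unfolding Z_def by (intro CS_diff iter) simp
  have Zs: "free_star (Z n) = Z n" for n
    using X(2)[of n] by (simp add: Z_def star_diff iter_star T_def star_mult)
  have U: "U \<in> CS" unfolding U_def by (intro CS_add CS_scale Z X)
  have Us: "free_star (U n) = X n - free_scale \<i> (Z n)" for n
    using X(2)[of n] Zs[of n] scale_scale[of "-1" \<i> "Z n"]
    by (simp add: U_def star_add star_scale scale_neg_one del: scale_scale)
  have comm: "X n * Z n = Z n * X n" for n
    using iter_comm[of "X n" "T n" n] by (simp add: Z_def T_def mult.assoc algebra_simps)
  have UU: "free_star (U n) * U n = T n + Z n * Z n" for n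
    unfolding Us unfolding U_def
    by (simp add: algebra_simps comm T_def scale_neg_one scale_diff scale_add)
  have "free_star (U n) * U n - 1 = free_scale 2 (sqrt_iter (Suc n) (T n) - sqrt_iter n (T n))" for n
  proof -
    have two: "free_scale 2 x = x + x" for x :: "'g free_star_algebra"
      using scale_add_left[of 1 1 x] by simp
    show ?thesis
      unfolding UU Z_def sqrt_iter.simps scale_diff scale_scale by (simp add: two left_diff_distrib right_diff_distrib)
  qed
  then have le: "N (free_star (U n) * U n - 1) \<le> 2 * \<beta> ^ n" for n
    using iter_step[OF r \<beta>_def T(2), of n n] by (simp add: N_scale del: sqrt_iter.simps)
  have "(\<lambda>n. 2 * \<beta> ^ n) \<longlonglongrightarrow> 2 * 0"
    using \<beta>[OF r \<beta>_def] by (intro tendsto_mult tendsto_const LIMSEQ_power_zero) simp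
  then have lim: "(\<lambda>n. 2 * \<beta> ^ n) \<longlonglongrightarrow> 0" by simp
  have "(\<lambda>n. N (free_star (U n) * U n - 1)) \<longlonglongrightarrow> 0"
  proof (rule Lim_null_comparison[OF always_eventually lim], rule allI)
    show "norm (N (free_star (U n) * U n - 1)) \<le> 2 * \<beta> ^ n" for n using le[of n] by simp
  qed
  then have "cls (\<lambda>n. free_star (U n) * U n) = cls (\<lambda>n. 1)"
    using U by (intro cls_eqI CS_mult CS_star) auto
  moreover have "free_scale (1/2) (U n + free_star (U n)) = X n" for n
    unfolding Us unfolding U_def
    using scale_add_left[of "1/2" "1/2" "X n"] by (simp add: scale_add scale_diff)
  ultimately show ?thesis by (intro that[of U] U) simp_all
qed

subsection \<open>States are contractive\<close>

context
  fixes \<phi> assumes \<phi>: "\<phi> \<in> states A"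
begin

lemma st_add: "X \<in> CS \<Longrightarrow> Y \<in> CS \<Longrightarrow> \<phi> (cls (\<lambda>n. X n + Y n)) = \<phi> (cls X) + \<phi> (cls Y)"
  using \<phi> by (simp add: states_def flip: cls_add)

lemma st_scale: "X \<in> CS \<Longrightarrow> \<phi> (cls (\<lambda>n. free_scale c (X n))) = c * \<phi> (cls X)"
  using \<phi> by (simp add: states_def flip: cls_smult)

lemma st_pos: "X \<in> CS \<Longrightarrow> \<phi> (cls (\<lambda>n. free_star (X n) * X n)) \<in> \<real>\<^sub>\<ge>\<^sub>0"
  using \<phi> by (simp add: states_def CS_star flip: cls_star cls_mult)

lemma st_one: "\<phi> (cls (\<lambda>n. 1)) = 1"
  using \<phi> by (simp add: states_def flip: cls_one)

lemma st_diff: "X \<in> CS \<Longrightarrow> Y \<in> CS \<Longrightarrow> \<phi> (cls (\<lambda>n. X n - Y n)) = \<phi> (cls X) - \<phi> (cls Y)"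
  using st_add[of X "\<lambda>n. free_scale (-1) (Y n)"] st_scale[of Y "-1"]
  by (simp add: CS_scale) (simp add: scale_neg_one)

lemma st_psd: assumes X: "X \<in> CS"
  shows "\<phi> (cls (\<lambda>n. 1)) + z * \<phi> (cls X) + cnj z * \<phi> (cls (\<lambda>n. free_star (X n)))
    + of_real ((cmod z)\<^sup>2) * \<phi> (cls (\<lambda>n. free_star (X n) * X n)) \<in> \<real>\<^sub>\<ge>\<^sub>0"
proof -
  have e: "free_star (1 + free_scale z x) * (1 + free_scale z x) =
     ((1 + free_scale z x) + free_scale (cnj z) (free_star x)) + free_scale (of_real ((cmod z)\<^sup>2)) (free_star x * x)"
    for x :: "'g free_star_algebra"
    by (simp add: star_add star_scale scale_add algebra_simps complex_norm_square flip: of_real_power)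
  show ?thesis
    using st_pos[of "\<lambda>n. 1 + free_scale z (X n)"] X
    unfolding e by (simp add: CS_add CS_scale CS_star CS_mult st_add st_scale)
qed

lemma st_star: "X \<in> CS \<Longrightarrow> \<phi> (cls (\<lambda>n. free_star (X n))) = cnj (\<phi> (cls X))"
  by (rule psd_pair(1)[OF st_psd]) (auto simp: st_one st_pos)

lemma st_CS: "X \<in> CS \<Longrightarrow> (cmod (\<phi> (cls X)))\<^sup>2 \<le> Re (\<phi> (cls (\<lambda>n. free_star (X n) * X n)))"
  using psd_pair(2)[OF st_psd] by (simp add: st_one st_pos)

text \<open>By Cauchy--Schwarz a state has modulus at most one on a unitary.\<close>

lemma st_selfadjoint_bound:
  assumes X: "X \<in> CS" "\<And>n. free_star (X n) = X n" "\<And>n. N (X n) \<le> s" "s < 1"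
  shows "cmod (\<phi> (cls X)) \<le> 1"
proof -
  obtain U where U: "U \<in> CS" "cls (\<lambda>n. free_star (U n) * U n) = cls (\<lambda>n. 1)"
    "cls X = cls (\<lambda>n. free_scale (1/2) (U n + free_star (U n)))"
    using selfadjoint_real_part_unitary[OF X] .
  have "\<phi> (cls X) = (\<phi> (cls U) + cnj (\<phi> (cls U))) / 2"
    using U(1,3) by (simp add: st_scale st_add st_star CS_add CS_star)
  moreover have "cmod (\<phi> (cls U)) \<le> 1"
    using st_CS[OF U(1)] by (simp add: U(2) st_one power_le_one_iff abs_square_le_1)
  ultimately show ?thesis
    using norm_triangle_ineq[of "\<phi> (cls U)" "cnj (\<phi> (cls U))"] by (simp only: norm_divide) simp
qed

lemma st_bound1:
  assumes X: "X \<in> CS" "\<And>n. N (X n) \<le> s" "s < 1"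
  shows "cmod (\<phi> (cls X)) \<le> 1"
proof -
  have s: "0 \<le> s" using X(2)[of 0] N_nonneg[of "X 0"] by linarith
  have "(cmod (\<phi> (cls X)))\<^sup>2 \<le> Re (\<phi> (cls (\<lambda>n. free_star (X n) * X n)))" by (rule st_CS[OF X(1)])
  also have "\<dots> \<le> cmod (\<phi> (cls (\<lambda>n. free_star (X n) * X n)))" by (rule complex_Re_le_cmod)
  also have "\<dots> \<le> 1"
    using X s by (intro st_selfadjoint_bound[where s = "s\<^sup>2"])
      (auto simp: CS_mult CS_star star_mult N_cstar power_mono abs_square_less_1)
  finally show ?thesis by (simp add: abs_square_le_1)
qed

lemma st_bound:
  assumes X: "X \<in> CS" "\<And>n. N (X n) \<le> d"
  shows "cmod (\<phi> (cls X)) \<le> d"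
proof (rule field_le_epsilon)
  fix e :: real assume e: "e > 0"
  have d: "0 \<le> d" using X(2)[of 0] N_nonneg[of "X 0"] by linarith
  have c: "d + e > 0" using d e by simp
  have "cmod (\<phi> (cls (\<lambda>n. free_scale (of_real (1 / (d + e))) (X n)))) \<le> 1"
  proof (rule st_bound1)
    show "N (free_scale (of_real (1 / (d + e))) (X n)) \<le> d / (d + e)" for n
      using X(2)[of n] c by (simp add: N_scale norm_divide divide_right_mono del: of_real_divide of_real_add)
  qed (use c e X in \<open>auto simp: CS_scale\<close>)
  then show "cmod (\<phi> (cls X)) \<le> d + e"
    using X(1) c by (simp add: st_scale norm_mult norm_divide field_simps del: of_real_add)
qed

text \<open>Continuity of a state in the form in which classes of Cauchy sequences require it: the terms
  of \<open>X\<close>, taken as constant sequences, approach the class of \<open>X\<close>.\<close>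

lemma st_tendsto: assumes X: "X \<in> CS" shows "(\<lambda>m. \<phi> (cls (\<lambda>n. X m))) \<longlonglongrightarrow> \<phi> (cls X)"
proof (rule LIMSEQ_I)
  fix e :: real assume "e > 0"
  then have "e / 2 > 0" by simp
  then obtain M where M: "\<And>m n. m \<ge> M \<Longrightarrow> n \<ge> M \<Longrightarrow> N (X m - X n) < e / 2"
    using X unfolding CS_iff_Cauchy by blast
  have "norm (\<phi> (cls (\<lambda>n. X m)) - \<phi> (cls X)) < e" if m: "m \<ge> M" for m
  proof -
    have "cmod (\<phi> (cls (\<lambda>n. X m - X (n + M)))) \<le> e / 2"
    proof (rule st_bound)
      show "(\<lambda>n. X m - X (n + M)) \<in> CS" by (rule CS_diff[OF CS_const CS_shift[OF X]])
      show "N (X m - X (n + M)) \<le> e / 2" for n using M[of m "n + M"] m by simp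
    qed
    moreover have "\<phi> (cls (\<lambda>n. X m - X (n + M))) = \<phi> (cls (\<lambda>n. X m)) - \<phi> (cls X)"
      using st_diff[of "\<lambda>n. X m" "\<lambda>n. X (n + M)"] X CS_shift[OF X] cls_shift[OF X] by simp
    ultimately show ?thesis using \<open>e > 0\<close> by simp
  qed
  then show "\<exists>M. \<forall>m\<ge>M. norm (\<phi> (cls (\<lambda>n. X m)) - \<phi> (cls X)) < e" by blast
qed

end

subsection \<open>Homomorphisms are continuous\<close>

lemma CS_minus: "X \<in> CS \<Longrightarrow> (\<lambda>n. - X n) \<in> CS"
  using CS_scale[of X "-1"] by (simp add: scale_neg_one)

lemma carrier_add: "S \<in> carrier A \<Longrightarrow> T \<in> carrier A \<Longrightarrow> S \<oplus>\<^bsub>A\<^esub> T \<in> carrier A"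
  by (elim carrierE) (simp add: CS_add)

lemma carrier_star: "S \<in> carrier A \<Longrightarrow> star A S \<in> carrier A"
  by (elim carrierE) (simp add: CS_star)

lemma nrm_le_zero: "S \<in> carrier A \<Longrightarrow> T \<in> carrier A \<Longrightarrow> nrm (S \<oplus>\<^bsub>A\<^esub> (-1) \<odot>\<^bsub>A\<^esub> T) \<le> 0 \<Longrightarrow> S = T"
proof (elim carrierE)
  fix X Y assume *: "nrm (S \<oplus>\<^bsub>A\<^esub> (-1) \<odot>\<^bsub>A\<^esub> T) \<le> 0" "X \<in> CS" "S = cls X" "Y \<in> CS" "T = cls Y"
  then have "nrm (cls (\<lambda>n. X n - Y n)) \<le> 0"
    by (simp add: CS_scale CS_minus scale_neg_one)
  moreover have "nrm (cls (\<lambda>n. X n - Y n)) \<ge> 0"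
    using * by (intro nrm_nonneg cls_in CS_diff)
  ultimately have "nrm (cls (\<lambda>n. X n - Y n)) = 0"
    by (rule order_antisym)
  then have "(\<lambda>n. N (X n - Y n)) \<longlonglongrightarrow> 0"
    using nrm_tendsto[OF CS_diff[OF *(2) *(4)]] by simp
  then show "S = T" unfolding *(3,5) by (rule cls_eqI[OF *(2,4)])
qed

context
  fixes \<Phi> assumes \<Phi>: "\<Phi> \<in> star_hom A A"
begin

lemma hom_in: "S \<in> carrier A \<Longrightarrow> \<Phi> S \<in> carrier A"
  and hom_add: "S \<in> carrier A \<Longrightarrow> T \<in> carrier A \<Longrightarrow> \<Phi> (S \<oplus>\<^bsub>A\<^esub> T) = \<Phi> S \<oplus>\<^bsub>A\<^esub> \<Phi> T"
  and hom_mult: "S \<in> carrier A \<Longrightarrow> T \<in> carrier A \<Longrightarrow> \<Phi> (S \<otimes>\<^bsub>A\<^esub> T) = \<Phi> S \<otimes>\<^bsub>A\<^esub> \<Phi> T"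
  and hom_one: "\<Phi> \<one>\<^bsub>A\<^esub> = \<one>\<^bsub>A\<^esub>"
  and hom_smult: "S \<in> carrier A \<Longrightarrow> \<Phi> (c \<odot>\<^bsub>A\<^esub> S) = c \<odot>\<^bsub>A\<^esub> \<Phi> S"
  and hom_star: "S \<in> carrier A \<Longrightarrow> \<Phi> (star A S) = star A (\<Phi> S)"
  using \<Phi> by (auto simp: star_hom_def ring_hom_def)

lemma hom_bound1:
  assumes X: "X \<in> CS" "\<And>n. N (X n) \<le> s" "s < 1"
  shows "nrm (\<Phi> (cls X)) \<le> 1"
proof -
  have sa: "nrm (\<Phi> (cls Y)) \<le> 1"
    if Y: "Y \<in> CS" "\<And>n. free_star (Y n) = Y n" "\<And>n. N (Y n) \<le> t" "t < 1" for Y t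
  proof -
    obtain U where U: "U \<in> CS" "cls (\<lambda>n. free_star (U n) * U n) = cls (\<lambda>n. 1)"
      "cls Y = cls (\<lambda>n. free_scale (1/2) (U n + free_star (U n)))"
      using selfadjoint_real_part_unitary[OF Y] .
    have "star A (\<Phi> (cls U)) \<otimes>\<^bsub>A\<^esub> \<Phi> (cls U) = \<Phi> (star A (cls U) \<otimes>\<^bsub>A\<^esub> cls U)"
      using U(1) by (metis CS_star cls_in cls_star hom_mult hom_star)
    also have "star A (cls U) \<otimes>\<^bsub>A\<^esub> cls U = cls (\<lambda>n. 1)"
      using U(1,2) by (simp add: CS_star)
    finally have "(nrm (\<Phi> (cls U)))\<^sup>2 = nrm (cls (\<lambda>n. 1))"
      using U(1) by (metis cls_in hom_in hom_one cls_one nrm_cstar)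
    then have n: "nrm (\<Phi> (cls U)) \<le> 1"
      using N_one_le by (simp add: power2_le_imp_le)
    have "cls Y = (1/2) \<odot>\<^bsub>A\<^esub> (cls U \<oplus>\<^bsub>A\<^esub> star A (cls U))"
      using U(1,3) by (simp add: CS_star CS_add)
    then have "\<Phi> (cls Y) = (1/2) \<odot>\<^bsub>A\<^esub> (\<Phi> (cls U) \<oplus>\<^bsub>A\<^esub> star A (\<Phi> (cls U)))"
      using U(1) by (simp only: hom_smult hom_add hom_star carrier_add carrier_star cls_in)
    moreover have "star A (\<Phi> (cls U)) \<in> carrier A"
      using U(1) by (simp only: hom_in carrier_star cls_in)
    moreover have "nrm (\<Phi> (cls U) \<oplus>\<^bsub>A\<^esub> star A (\<Phi> (cls U))) \<le> 2"
      using n nrm_add[of "\<Phi> (cls U)" "star A (\<Phi> (cls U))"] nrm_star[of "\<Phi> (cls U)"]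
        hom_in[OF cls_in[OF U(1)]] calculation(2) by linarith
    ultimately show ?thesis
      using hom_in[OF cls_in[OF U(1)]] by (simp add: nrm_smult carrier_add norm_divide)
  qed
  have s: "0 \<le> s" using X(2)[of 0] N_nonneg[of "X 0"] by linarith
  have "nrm (\<Phi> (cls (\<lambda>n. free_star (X n) * X n))) \<le> 1"
  proof (rule sa[where t = "s\<^sup>2"])
    show "(\<lambda>n. free_star (X n) * X n) \<in> CS" using X by (intro CS_mult CS_star)
    show "N (free_star (X n) * X n) \<le> s\<^sup>2" for n using X(2)[of n] by (simp add: N_cstar power_mono)
    show "s\<^sup>2 < 1" using s X(3) by (simp add: abs_square_less_1)
  qed (simp add: star_mult)
  moreover have "\<Phi> (cls (\<lambda>n. free_star (X n) * X n)) = star A (\<Phi> (cls X)) \<otimes>\<^bsub>A\<^esub> \<Phi> (cls X)"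
    using X(1) by (simp only: carrier_star cls_in flip: hom_star hom_mult) (simp add: CS_star)
  ultimately have "(nrm (\<Phi> (cls X)))\<^sup>2 \<le> 1"
    using X(1) by (simp add: nrm_cstar hom_in)
  then show ?thesis by (simp add: abs_square_le_1)
qed

lemma hom_bound:
  assumes X: "X \<in> CS" "\<And>n. N (X n) \<le> d" and d: "d > 0"
  shows "nrm (\<Phi> (cls X)) \<le> 2 * d"
proof -
  \<comment> \<open>Dividing by \<open>2 d\<close> rather than \<open>d\<close> makes the norms smaller than one by a margin.\<close>
  have "nrm (\<Phi> (cls (\<lambda>n. free_scale (of_real (1 / (2 * d))) (X n)))) \<le> 1"
  proof (rule hom_bound1)
    show "N (free_scale (of_real (1 / (2 * d))) (X n)) \<le> 1 / 2" for n
      using X(2)[of n] d by (simp only: N_scale norm_of_real) (simp add: field_simps)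
  qed (use X in \<open>auto simp: CS_scale\<close>)
  moreover have "\<Phi> (cls (\<lambda>n. free_scale (of_real (1 / (2 * d))) (X n))) = of_real (1 / (2 * d)) \<odot>\<^bsub>A\<^esub> \<Phi> (cls X)"
    using X(1) by (metis cls_in cls_smult hom_smult)
  ultimately have "\<bar>1 / (2 * d)\<bar> * nrm (\<Phi> (cls X)) \<le> 1"
    using X(1) by (simp only: nrm_smult hom_in cls_in norm_of_real)
  then show ?thesis using d by (simp add: field_simps)
qed

text \<open>A homomorphism of a universal algebra is continuous, hence determined by its values on the
  free algebra.\<close>

lemma hom_determined:
  assumes T: "\<And>x. \<Phi> (cls (\<lambda>n. x)) = cls (\<lambda>n. T x)"
    and T_diff: "\<And>x y. T (x - y) = T x - T y" and T_le: "\<And>x. N (T x) \<le> N x" and X: "X \<in> CS"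
  shows "\<Phi> (cls X) = cls (\<lambda>n. T (X n))"
proof (rule nrm_le_zero)
  have TX: "(\<lambda>n. T (X n)) \<in> CS"
    using X by (rule CS_dom[of X X _ 1 0]) (use X in \<open>auto simp: T_le simp flip: T_diff\<close>)
  show in1: "\<Phi> (cls X) \<in> carrier A" "cls (\<lambda>n. T (X n)) \<in> carrier A" using X TX by (auto intro: hom_in)
  show "nrm (\<Phi> (cls X) \<oplus>\<^bsub>A\<^esub> (-1) \<odot>\<^bsub>A\<^esub> cls (\<lambda>n. T (X n))) \<le> 0"
  proof (rule field_le_epsilon)
    fix e :: real assume "e > 0"
    then have e: "e / 3 > 0" by simp
    then obtain M where M: "\<And>m n. m \<ge> M \<Longrightarrow> n \<ge> M \<Longrightarrow> N (X m - X n) < e / 3"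
      using X unfolding CS_iff_Cauchy by blast
    define D where "D n = X (n + M) - X M" for n
    have D: "D \<in> CS" unfolding D_def by (rule CS_diff[OF CS_shift[OF X] CS_const])
    have ND: "N (D n) \<le> e / 3" for n using M[of "n + M" M] by (simp add: D_def less_imp_le)
    have TD: "(\<lambda>n. T (D n)) \<in> CS"
      using D by (rule CS_dom[of D D _ 1 0]) (use D in \<open>auto simp: T_le simp flip: T_diff\<close>)
    have "cls X = cls D \<oplus>\<^bsub>A\<^esub> cls (\<lambda>n. X M)"
      using cls_shift[OF X, of M] D by (simp add: D_def)
    then have "\<Phi> (cls X) = \<Phi> (cls D) \<oplus>\<^bsub>A\<^esub> cls (\<lambda>n. T (X M))"
      using D by (simp only: hom_add cls_in CS_const T)
    moreover obtain Y where Y: "Y \<in> CS" "\<Phi> (cls D) = cls Y"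
      using hom_in[OF cls_in[OF D]] carrierE by blast
    moreover have "cls (\<lambda>n. T (X n)) = cls (\<lambda>n. T (D n) + T (X M))"
      using cls_shift[OF TX, of M] by (simp add: D_def T_diff)
    ultimately have "\<Phi> (cls X) \<oplus>\<^bsub>A\<^esub> (-1) \<odot>\<^bsub>A\<^esub> cls (\<lambda>n. T (X n)) = cls Y \<oplus>\<^bsub>A\<^esub> (-1) \<odot>\<^bsub>A\<^esub> cls (\<lambda>n. T (D n))"
      using TD by (simp add: CS_add CS_scale CS_diff CS_minus scale_neg_one)
    also have "nrm \<dots> \<le> nrm (cls Y) + nrm ((-1) \<odot>\<^bsub>A\<^esub> cls (\<lambda>n. T (D n)))"
      using Y TD by (intro nrm_add) (auto simp: CS_scale)
    also have "\<dots> \<le> 2 * (e / 3) + e / 3"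
    proof (rule add_mono)
      show "nrm (cls Y) \<le> 2 * (e / 3)"
        using hom_bound[OF D ND e] by (simp add: Y)
      show "nrm ((-1) \<odot>\<^bsub>A\<^esub> cls (\<lambda>n. T (D n))) \<le> e / 3"
        using nrm_le[OF TD order_trans[OF T_le ND]] TD by (simp add: nrm_smult del: cls_smult)
    qed
    finally show "nrm (\<Phi> (cls X) \<oplus>\<^bsub>A\<^esub> (-1) \<odot>\<^bsub>A\<^esub> cls (\<lambda>n. T (X n))) \<le> 0 + e" by simp
  qed
qed

end

subsection \<open>Extending functionals\<close>

definition ext_fun :: "('g free_star_algebra \<Rightarrow> complex) \<Rightarrow> (nat \<Rightarrow> 'g free_star_algebra) set \<Rightarrow> complex" where
  "ext_fun f S = (if S \<in> carrier A then lim (\<lambda>n. f ((SOME X. X \<in> S) n)) else 0)"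

context
  fixes f :: "'g free_star_algebra \<Rightarrow> complex" and C :: real
  assumes pf: "pos_functional f" and le: "\<And>x. cmod (f x) \<le> C * N x"
begin

lemma f_convergent: assumes X: "X \<in> CS" shows "convergent (\<lambda>n. f (X n))"
proof -
  have "Cauchy (\<lambda>n. f (X n))"
    unfolding Cauchy_def
  proof (intro allI impI)
    fix e :: real assume e: "e > 0"
    have "e / (\<bar>C\<bar> + 1) > 0" using e by simp
    then obtain M where M: "\<And>m n. m \<ge> M \<Longrightarrow> n \<ge> M \<Longrightarrow> N (X m - X n) < e / (\<bar>C\<bar> + 1)"
      using X unfolding CS_iff_Cauchy by blast
    have "dist (f (X m)) (f (X n)) < e" if "m \<ge> M" "n \<ge> M" for m n
    proof -
      have "dist (f (X m)) (f (X n)) \<le> C * N (X m - X n)"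
        using le[of "X m - X n"] by (simp add: dist_norm pf_diff[OF pf])
      also have "\<dots> \<le> (\<bar>C\<bar> + 1) * N (X m - X n)" by (intro mult_right_mono) auto
      also have "\<dots> < e" using M[OF that] by (simp add: field_simps)
      finally show ?thesis .
    qed
    then show "\<exists>M. \<forall>m\<ge>M. \<forall>n\<ge>M. dist (f (X m)) (f (X n)) < e" by blast
  qed
  then show ?thesis by (rule Cauchy_convergent)
qed

lemma ext_tendsto: assumes X: "X \<in> CS" shows "(\<lambda>n. f (X n)) \<longlonglongrightarrow> ext_fun f (cls X)"
proof -
  define Y where "Y = (SOME Y. Y \<in> cls X)"
  have Y: "Y \<in> cls X" unfolding Y_def by (rule someI[of "\<lambda>Y. Y \<in> cls X", OF cls_self[OF X]])
  then have Y': "Y \<in> CS" "(\<lambda>n. N (X n - Y n)) \<longlonglongrightarrow> 0" by (auto simp: mem_cls)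
  have 1: "(\<lambda>n. f (Y n)) \<longlonglongrightarrow> ext_fun f (cls X)"
    using f_convergent[OF Y'(1)] X by (simp add: ext_fun_def Y_def convergent_LIMSEQ_iff)
  have 2: "(\<lambda>n. C * N (X n - Y n)) \<longlonglongrightarrow> 0"
    using tendsto_mult[OF tendsto_const Y'(2), of C] by simp
  have "(\<lambda>n. f (X n - Y n)) \<longlonglongrightarrow> 0"
    by (rule Lim_null_comparison[OF always_eventually 2]) (simp add: le)
  then have "(\<lambda>n. f (X n - Y n) + f (Y n)) \<longlonglongrightarrow> 0 + ext_fun f (cls X)"
    using 1 by (intro tendsto_add)
  then show ?thesis by (simp add: pf_diff[OF pf])
qed

lemma ext_eqI: "X \<in> CS \<Longrightarrow> (\<lambda>n. f (X n)) \<longlonglongrightarrow> c \<Longrightarrow> ext_fun f (cls X) = c"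
  using ext_tendsto LIMSEQ_unique by blast

lemma ext_const: "ext_fun f (cls (\<lambda>n. x)) = f x"
  by (rule ext_eqI) auto

text \<open>Every bounded positive functional on the free algebra extends to the completion.\<close>

lemma ext_state: assumes one: "f 1 = 1" shows "ext_fun f \<in> states A"
  unfolding states_def mem_Collect_eq
proof (intro conjI allI ballI impI)
  fix S assume "S \<notin> carrier A" then show "ext_fun f S = 0" by (simp add: ext_fun_def)
next
  fix S T assume "S \<in> carrier A" "T \<in> carrier A"
  then obtain X Y where *: "X \<in> CS" "S = cls X" "Y \<in> CS" "T = cls Y" by (metis carrierE)
  show "ext_fun f (S \<oplus>\<^bsub>A\<^esub> T) = ext_fun f S + ext_fun f T"
    using * by (auto simp: pf_add[OF pf] intro!: ext_eqI CS_add tendsto_add ext_tendsto)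
next
  fix c S assume "S \<in> carrier A"
  then obtain X where *: "X \<in> CS" "S = cls X" by (metis carrierE)
  show "ext_fun f (c \<odot>\<^bsub>A\<^esub> S) = c * ext_fun f S"
    using * by (auto simp: pf_scale[OF pf] intro!: ext_eqI CS_scale tendsto_mult ext_tendsto)
next
  fix S assume "S \<in> carrier A"
  then obtain X where *: "X \<in> CS" "S = cls X" by (metis carrierE)
  have m: "(\<lambda>n. free_star (X n) * X n) \<in> CS" using * by (intro CS_mult CS_star)
  have "ext_fun f (cls (\<lambda>n. free_star (X n) * X n)) \<in> \<real>\<^sub>\<ge>\<^sub>0"
    by (rule Lim_in_closed_set[OF closed_nonneg_Reals_complex _ _ ext_tendsto[OF m]])
      (auto intro: always_eventually pf_pos[OF pf])
  then show "ext_fun f (star A S \<otimes>\<^bsub>A\<^esub> S) \<in> \<real>\<^sub>\<ge>\<^sub>0"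
    using * by (simp add: CS_star)
next
  show "ext_fun f \<one>\<^bsub>A\<^esub> = 1" by (simp add: cls_one ext_const one)
qed

end

lemma state_pos_functional:
  assumes "\<phi> \<in> states A"
  shows "pos_functional (\<lambda>x. \<phi> (cls (\<lambda>n. x)))" "cmod (\<phi> (cls (\<lambda>n. x))) \<le> N x" "\<phi> (cls (\<lambda>n. 1)) = 1"
  using st_add[OF assms, of "\<lambda>n. _" "\<lambda>n. _"] st_scale[OF assms, of "\<lambda>n. _"]
    st_pos[OF assms, of "\<lambda>n. _"] st_bound[OF assms, of "\<lambda>n. _"] st_one[OF assms]
  by (auto simp: pos_functional_def)

lemma states_eqI:
  assumes "\<phi> \<in> states A" "\<psi> \<in> states A" "\<And>x. \<phi> (cls (\<lambda>n. x)) = \<psi> (cls (\<lambda>n. x))"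
  shows "\<phi> = \<psi>"
proof
  fix S
  show "\<phi> S = \<psi> S"
  proof (cases "S \<in> carrier A")
    case True
    then obtain X where X: "X \<in> CS" "S = cls X" by (metis carrierE)
    show ?thesis
      using st_tendsto[OF assms(1) X(1)] st_tendsto[OF assms(2) X(1)] LIMSEQ_unique
      unfolding assms(3) X(2) by blast
  qed (use assms(1,2) in \<open>auto simp: states_def\<close>)
qed

end

section \<open>Relations that make the generators unitary\<close>

locale unitary_relations =
  fixes R :: "'g free_star_algebra set"
  assumes isometry: "free_star (free_gen g) * free_gen g - 1 \<in> R"
    and coisometry: "free_gen g * free_star (free_gen g) - 1 \<in> R"
begin

abbreviation letter :: "'g \<times> bool \<Rightarrow> 'g free_star_algebra" where
  "letter l \<equiv> Poly_Mapping.single (Word [l]) 1"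

lemma letter_isometry: "free_star (letter l) * letter l - 1 \<in> R"
proof (cases l)
  case (Pair g b)
  have "letter (g, True) = free_star (free_gen g)"
    by (simp add: free_gen_def star_single star_word_def)
  then show ?thesis using isometry[of g] coisometry[of g] Pair
    by (cases b) (simp_all add: free_gen_def)
qed

lemma word_Cons: "Poly_Mapping.single (Word (l # w)) 1 = letter l * Poly_Mapping.single (Word w) (1::complex)"
  by (simp add: mult_single plus_star_word_def)

lemma word_Nil: "Poly_Mapping.single (Word []) (1::complex) = 1"
  by (metis single_one zero_star_word_def)

lemma csn_word_le:
  assumes p: "cstar_seminorm p" "\<And>r. r \<in> R \<Longrightarrow> p r = 0"
  shows "p (Poly_Mapping.single (Word w) 1) \<le> 1"
proof (induction w)
  case Nil
  then show ?case using csn_one_le[OF p(1)] by (simp add: word_Nil)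
next
  case (Cons l w)
  have "p (letter l) \<le> 1" by (rule csn_isometry_le[OF p(1) p(2)[OF letter_isometry]])
  then have "p (letter l) * p (Poly_Mapping.single (Word w) 1) \<le> 1 * 1"
    using Cons csn_nonneg[OF p(1)] by (intro mult_mono) auto
  then show ?case
    by (subst word_Cons) (rule order_trans[OF csn_mult[OF p(1)]], simp)
qed

sublocale finite_univ_seminorm R
proof
  fix x :: "'g free_star_algebra"
  have "\<exists>c. \<forall>p. cstar_seminorm p \<and> (\<forall>r\<in>R. p r = 0) \<longrightarrow> p x \<le> c"
  proof (induction x rule: free_induct)
    case (single w c)
    have "p (Poly_Mapping.single w c) \<le> cmod c" if "cstar_seminorm p" "\<forall>r\<in>R. p r = 0" for p
    proof -
      have "Poly_Mapping.single w c = free_scale c (Poly_Mapping.single (Word (letters w)) 1)"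
        by (simp add: scale_single)
      then show ?thesis
        using csn_word_le[of p "letters w"] that mult_left_mono[of _ 1 "cmod c"]
        by (metis csn_scale mult.right_neutral norm_ge_zero)
    qed
    then show ?case by blast
  next
    case (add x y)
    then obtain c d where *: "\<forall>p. cstar_seminorm p \<and> (\<forall>r\<in>R. p r = 0) \<longrightarrow> p x \<le> c"
      "\<forall>p. cstar_seminorm p \<and> (\<forall>r\<in>R. p r = 0) \<longrightarrow> p y \<le> d" by blast
    have "p (x + y) \<le> c + d" if "cstar_seminorm p \<and> (\<forall>r\<in>R. p r = 0)" for p
      using * csn_triangle[of p x y] that by (smt (verit))
    then show ?case by blast
  qed
  then show "bdd_above ((\<lambda>p. p x) ` {p. cstar_seminorm p \<and> (\<forall>r\<in>R. p r = 0)})"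
    by (auto simp: bdd_above_def)
qed

lemma word_N_le: "N (Poly_Mapping.single w 1) \<le> 1"
  using csn_word_le[OF cstar_N N_rel, of "letters w"] by simp

subsection \<open>The GNS bound for positive functionals\<close>

text \<open>The operator norm of left multiplication in the GNS space of \<open>f\<close> needs only the seminorm of
  that space, so that neither the quotient nor its completion has to be formed.\<close>

context
  fixes f :: "'g free_star_algebra \<Rightarrow> complex"
  assumes pf: "pos_functional f" and kill: "\<And>r x y. r \<in> R \<Longrightarrow> f (x * r * y) = 0"
begin

definition gns :: "'g free_star_algebra \<Rightarrow> real" where
  "gns x = sqrt (Re (f (free_star x * x)))"

lemma gns_nonneg: "gns x \<ge> 0"
  using pf_Re[OF pf] by (simp add: gns_def)

lemma gns_power2: "(gns x)\<^sup>2 = Re (f (free_star x * x))"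
  using pf_Re[OF pf] by (simp add: gns_def)

lemma gns_CS: "cmod (f (free_star x * y)) \<le> gns x * gns y"
  using pf_CS[OF pf, of x y] by (simp add: gns_def real_le_rsqrt flip: real_sqrt_mult)

lemma gns_scale: "gns (free_scale c x) = cmod c * gns x"
proof -
  have "f (free_star (free_scale c x) * free_scale c x) = of_real ((cmod c)\<^sup>2) * f (free_star x * x)"
    by (simp add: star_scale pf_scale[OF pf] complex_norm_square mult.commute flip: of_real_power)
  then show ?thesis by (simp add: gns_def real_sqrt_mult)
qed

lemma gns_triangle: "gns (x + y) \<le> gns x + gns y"
proof -
  have "f (free_star (x + y) * (x + y)) = f (free_star x * x) + f (free_star x * y) + f (free_star y * x) + f (free_star y * y)"
    by (simp add: star_add algebra_simps pf_add[OF pf])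
  then have e: "(gns (x + y))\<^sup>2 = (gns x)\<^sup>2 + Re (f (free_star x * y)) + Re (f (free_star y * x)) + (gns y)\<^sup>2"
    unfolding gns_power2 by simp
  have "Re (f (free_star x * y)) \<le> gns x * gns y" "Re (f (free_star y * x)) \<le> gns x * gns y"
    using order_trans[OF complex_Re_le_cmod gns_CS[of x y]] order_trans[OF complex_Re_le_cmod gns_CS[of y x]]
    by (simp_all only: mult.commute[of "gns y"])
  then have "(gns (x + y))\<^sup>2 \<le> (gns x)\<^sup>2 + 2 * (gns x * gns y) + (gns y)\<^sup>2"
    unfolding e by linarith
  also have "\<dots> = (gns x + gns y)\<^sup>2" by (simp add: power2_sum)
  finally show ?thesis by (rule power2_le_imp_le) (simp add: gns_nonneg)
qed

text \<open>Letters act isometrically because \<open>f\<close> kills the ideal generated by the relations.\<close>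

lemma gns_bounded: "\<exists>c\<ge>0. \<forall>y. gns (x * y) \<le> c * gns y"
proof (induction x rule: free_induct)
  case (single w c)
  have l: "gns (letter l * y) = gns y" for l y
  proof -
    have "f (free_star (letter l * y) * (letter l * y)) = f (free_star y * (free_star (letter l) * letter l - 1) * y) + f (free_star y * y)"
      by (simp add: star_mult algebra_simps flip: pf_add[OF pf])
    then show ?thesis by (simp add: gns_def kill[OF letter_isometry])
  qed
  have "gns (Poly_Mapping.single (Word v) 1 * y) = gns y" for v y
  proof (induction v)
    case (Cons a v)
    then show ?case by (subst word_Cons) (simp only: mult.assoc l)
  qed (simp add: word_Nil)
  then have "gns (free_scale c (Poly_Mapping.single (Word (letters w)) 1) * y) \<le> cmod c * gns y" for y
    by (simp add: gns_scale del: star_word.collapse)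
  then show ?case by (intro exI[of _ "cmod c"]) (simp add: scale_single)
next
  case (add x z)
  then obtain c d where "c \<ge> 0" "\<forall>y. gns (x * y) \<le> c * gns y" "d \<ge> 0" "\<forall>y. gns (z * y) \<le> d * gns y"
    by blast
  then have "gns ((x + z) * y) \<le> (c + d) * gns y" for y
    using gns_triangle[of "x * y" "z * y"] by (simp add: distrib_right) (smt (verit))
  then show ?case using \<open>c \<ge> 0\<close> \<open>d \<ge> 0\<close> by (intro exI[of _ "c + d"]) auto
qed

definition op_norm :: "'g free_star_algebra \<Rightarrow> real" where
  "op_norm x = Inf {c. c \<ge> 0 \<and> (\<forall>y. gns (x * y) \<le> c * gns y)}"

lemma op_norm_bound: "gns (x * y) \<le> op_norm x * gns y"
proof (cases "gns y = 0")
  case True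
  then show ?thesis
    using gns_bounded[of x] gns_nonneg[of "x * y"] by (metis mult_zero_right order_antisym order_refl)
next
  case False
  then have pos: "gns y > 0" using gns_nonneg[of y] by simp
  have "gns (x * y) / gns y \<le> op_norm x"
    unfolding op_norm_def
  proof (rule cInf_greatest)
    show "{c. c \<ge> 0 \<and> (\<forall>y. gns (x * y) \<le> c * gns y)} \<noteq> {}" using gns_bounded[of x] by blast
  qed (use pos in \<open>auto simp: field_simps\<close>)
  then show ?thesis using pos by (simp add: field_simps)
qed

lemma op_norm_le: "c \<ge> 0 \<Longrightarrow> (\<And>y. gns (x * y) \<le> c * gns y) \<Longrightarrow> op_norm x \<le> c"
  unfolding op_norm_def by (intro cInf_lower) (auto intro!: bdd_belowI[of _ 0])

lemma op_norm_nonneg: "op_norm x \<ge> 0"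
  unfolding op_norm_def using gns_bounded[of x] by (intro cInf_greatest) auto

lemma op_norm_mult: "op_norm (x * y) \<le> op_norm x * op_norm y"
proof (rule op_norm_le)
  fix z
  have "gns (x * y * z) \<le> op_norm x * gns (y * z)" using op_norm_bound[of x "y * z"] by (simp add: mult.assoc)
  also have "\<dots> \<le> op_norm x * (op_norm y * gns z)"
    by (intro mult_left_mono op_norm_bound op_norm_nonneg)
  finally show "gns (x * y * z) \<le> op_norm x * op_norm y * gns z" by (simp add: mult.assoc)
qed (simp add: op_norm_nonneg)

lemma op_norm_square_le: "(op_norm x)\<^sup>2 \<le> op_norm (free_star x * x)"
proof -
  have "op_norm x \<le> sqrt (op_norm (free_star x * x))"
  proof (rule op_norm_le)
    fix y
    have "(gns (x * y))\<^sup>2 = Re (f (free_star y * (free_star x * x * y)))"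
      by (simp add: gns_power2 star_mult mult.assoc)
    also have "\<dots> \<le> gns y * gns (free_star x * x * y)"
      by (rule order_trans[OF complex_Re_le_cmod gns_CS])
    also have "\<dots> \<le> gns y * (op_norm (free_star x * x) * gns y)"
      by (intro mult_left_mono op_norm_bound gns_nonneg)
    also have "\<dots> = (sqrt (op_norm (free_star x * x)) * gns y)\<^sup>2"
      using op_norm_nonneg by (simp add: power_mult_distrib power2_eq_square)
    finally show "gns (x * y) \<le> sqrt (op_norm (free_star x * x)) * gns y"
      by (rule power2_le_imp_le) (simp add: gns_nonneg op_norm_nonneg)
  qed (simp add: op_norm_nonneg)
  then have "(op_norm x)\<^sup>2 \<le> (sqrt (op_norm (free_star x * x)))\<^sup>2"
    using op_norm_nonneg by (intro power_mono)
  then show ?thesis using op_norm_nonneg by simp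
qed

lemma op_norm_star_ge: "op_norm x \<le> op_norm (free_star x)"
proof (cases "op_norm x = 0")
  case False
  have "op_norm x * op_norm x \<le> op_norm (free_star x) * op_norm x"
    using op_norm_square_le[of x] op_norm_mult[of "free_star x" x] by (simp add: power2_eq_square)
  then show ?thesis using False op_norm_nonneg[of x] by (simp add: mult_le_cancel_right)
qed (simp add: op_norm_nonneg)

lemma cstar_op_norm: "cstar_seminorm op_norm"
  unfolding cstar_seminorm_def
proof (intro conjI allI op_norm_mult)
  fix x y :: "'g free_star_algebra" and c :: complex
  show "op_norm (x + y) \<le> op_norm x + op_norm y"
  proof (rule op_norm_le)
    fix z show "gns ((x + y) * z) \<le> (op_norm x + op_norm y) * gns z"
      using gns_triangle[of "x * z" "y * z"] op_norm_bound[of x z] op_norm_bound[of y z]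
      by (simp add: distrib_right)
  qed (simp add: op_norm_nonneg)
  have sc: "op_norm (free_scale c x) \<le> cmod c * op_norm x" for c x
  proof (rule op_norm_le)
    fix z show "gns (free_scale c x * z) \<le> cmod c * op_norm x * gns z"
      using mult_left_mono[OF op_norm_bound[of x z], of "cmod c"] by (simp add: gns_scale mult.assoc)
  qed (simp add: op_norm_nonneg)
  show "op_norm (free_scale c x) = cmod c * op_norm x"
  proof (cases "c = 0")
    case True
    then show ?thesis using sc[of c x] op_norm_nonneg[of "free_scale c x"] by simp
  next
    case False
    have "cmod c * op_norm x = cmod c * op_norm (free_scale (inverse c) (free_scale c x))" using False by simp
    also have "\<dots> \<le> cmod c * (cmod (inverse c) * op_norm (free_scale c x))"
      by (intro mult_left_mono sc) auto
    also have "\<dots> = op_norm (free_scale c x)" using False by (simp add: norm_inverse)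
    finally show ?thesis using sc[of c x] by simp
  qed
  show "op_norm (free_star x * x) = (op_norm x)\<^sup>2"
  proof (rule antisym[OF _ op_norm_square_le])
    have "op_norm (free_star x) = op_norm x"
      using op_norm_star_ge[of x] op_norm_star_ge[of "free_star x"] by simp
    then show "op_norm (free_star x * x) \<le> (op_norm x)\<^sup>2"
      using op_norm_mult[of "free_star x" x] by (simp add: power2_eq_square)
  qed
qed

text \<open>The operator norm is a \<open>C\<^sup>*\<close>-seminorm that vanishes on the relations, so it lies below the
  universal one; the cyclic vector \<open>1\<close> turns this into a bound on \<open>f\<close>.\<close>

lemma pos_functional_le_N: "cmod (f x) \<le> Re (f 1) * N x"
proof -
  have "op_norm r = 0" if "r \<in> R" for r
  proof -
    have "gns (r * y) = 0" for y
      using kill[OF that, of "free_star (r * y)" y] by (simp add: gns_def mult.assoc)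
    then have "op_norm r \<le> 0" by (intro op_norm_le) (auto simp: gns_nonneg)
    then show ?thesis using op_norm_nonneg[of r] by simp
  qed
  then have "op_norm x \<le> N x" by (intro seminorm_le_N cstar_op_norm)
  then have "gns (x * 1) \<le> N x * gns 1"
    using op_norm_bound[of x 1] mult_right_mono[of "op_norm x" "N x" "gns 1"] gns_nonneg[of 1] by linarith
  then have "gns 1 * gns (x * 1) \<le> gns 1 * (N x * gns 1)"
    using gns_nonneg by (intro mult_left_mono)
  moreover have "gns 1 * gns 1 = Re (f 1)" using gns_power2[of 1] by (simp add: power2_eq_square)
  ultimately show ?thesis
    using gns_CS[of 1 x] by (simp add: algebra_simps)
qed

end
end

section \<open>The noncommutative torus\<close>

locale nc_torus = fixes \<alpha> :: real

sublocale nc_torus \<subseteq> unitary_relations "torus_rels \<alpha>"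
  by standard (auto simp: torus_rels_def)

context nc_torus
begin

text \<open>Two elements of the free algebra are related if they agree in the completion.\<close>

definition eqv :: "int free_star_algebra \<Rightarrow> int free_star_algebra \<Rightarrow> bool" (infix \<open>\<doteq>\<close> 50) where
  "x \<doteq> y \<longleftrightarrow> N (x - y) = 0"

lemma eqv_refl [simp]: "x \<doteq> x" by (simp add: eqv_def)

lemma eqv_sym: "x \<doteq> y \<Longrightarrow> y \<doteq> x" by (simp add: eqv_def N_diff_commute)

lemma eqv_trans [trans]: "x \<doteq> y \<Longrightarrow> y \<doteq> z \<Longrightarrow> x \<doteq> z"
  using N_diff_triangle[of x z y] N_nonneg[of "x - z"] by (simp add: eqv_def)

lemma eqv_eq_trans [trans]: "x \<doteq> y \<Longrightarrow> y = z \<Longrightarrow> x \<doteq> z" by simp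

lemma eq_eqv_trans [trans]: "x = y \<Longrightarrow> y \<doteq> z \<Longrightarrow> x \<doteq> z" by simp

lemma eqv_mult: assumes "x \<doteq> y" "z \<doteq> w" shows "x * z \<doteq> y * w"
  using N_mult_diff[of x z y w] assms N_nonneg[of "x * z - y * w"]
  by (simp add: eqv_def order_antisym)

lemma eqv_mult_left: "z \<doteq> w \<Longrightarrow> x * z \<doteq> x * w" by (simp add: eqv_mult)

lemma eqv_mult_right: "x \<doteq> y \<Longrightarrow> x * z \<doteq> y * z" by (simp add: eqv_mult)

lemma eqv_scale: "x \<doteq> y \<Longrightarrow> free_scale c x \<doteq> free_scale c y"
  by (simp add: eqv_def N_scale flip: scale_diff)

lemma eqv_rel: "x - y \<in> torus_rels \<alpha> \<Longrightarrow> x \<doteq> y"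
  by (simp add: eqv_def N_rel)

lemma eqv_cls: "x \<doteq> y \<Longrightarrow> cls (\<lambda>n. x) = cls (\<lambda>n. y)"
  by (intro cls_eqI) (simp_all add: eqv_def)

definition ph :: "int \<Rightarrow> complex" where "ph n = cis (\<alpha> * of_int n)"

lemma ph_add: "ph (a + b) = ph a * ph b"
  by (simp add: ph_def cis_mult distrib_left)

lemma ph_0 [simp]: "ph 0 = 1" by (simp add: ph_def)

lemma norm_ph [simp]: "cmod (ph n) = 1" by (simp add: ph_def)

lemma ph_nonzero [simp]: "ph n \<noteq> 0" by (simp add: ph_def)

lemma ph_cancel [simp]: "ph n * ph (- n) = 1" "ph (- n) * ph n = 1"
  by (simp_all flip: ph_add)

lemma cnj_ph: "cnj (ph n) = ph (- n)" by (simp add: ph_def cis_cnj)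

text \<open>Integer powers of a generator; in the free algebra only the adjoint can serve as its
  inverse.\<close>

definition U :: "int \<Rightarrow> int \<Rightarrow> int free_star_algebra" where
  "U j k = (if k \<ge> 0 then free_gen j ^ nat k else free_star (free_gen j) ^ nat (- k))"

lemma star_power: "free_star (x ^ n) = free_star x ^ n"
  by (induction n) (auto simp: star_mult power_commutes)

lemma star_U: "free_star (U j k) = U j (- k)"
  by (auto simp: U_def star_power)

lemma U_0 [simp]: "U j 0 = 1" by (simp add: U_def)

lemma U_1: "U j 1 = free_gen j" by (simp add: U_def)

lemma U_m1: "U j (- 1) = free_star (free_gen j)" by (simp add: U_def)

lemma gen_star_gen: "free_gen j * free_star (free_gen j) \<doteq> 1" "free_star (free_gen j) * free_gen j \<doteq> 1"
  by (rule eqv_rel, rule coisometry) (rule eqv_rel, rule isometry)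

lemma gen_U: "free_gen j * U j k \<doteq> U j (k + 1)"
proof (cases "k \<ge> 0")
  case True
  then have "free_gen j * U j k = U j (k + 1)" by (simp add: U_def nat_add_distrib)
  then show ?thesis by simp
next
  case False
  define m where "m = nat (- k - 1)"
  have k: "k = - int (Suc m)" using False by (simp add: m_def)
  have "free_gen j * U j k = (free_gen j * free_star (free_gen j)) * free_star (free_gen j) ^ m"
    unfolding k U_def by (simp add: mult.assoc nat_add_distrib)
  also have "\<dots> \<doteq> 1 * free_star (free_gen j) ^ m"
    by (intro eqv_mult_right gen_star_gen)
  also have "1 * free_star (free_gen j) ^ m = U j (k + 1)"
    unfolding k U_def by simp
  finally show ?thesis .
qed

lemma gen'_U: "free_star (free_gen j) * U j k \<doteq> U j (k - 1)"
proof -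
  have "free_star (free_gen j) * U j k \<doteq> free_star (free_gen j) * (free_gen j * U j (k - 1))"
    using eqv_sym[OF gen_U[of j "k - 1"]] by (intro eqv_mult_left) simp
  also have "\<dots> = (free_star (free_gen j) * free_gen j) * U j (k - 1)" by (simp add: mult.assoc)
  also have "\<dots> \<doteq> 1 * U j (k - 1)" by (intro eqv_mult_right gen_star_gen)
  finally show ?thesis by simp
qed

lemma U_add: "U j a * U j b \<doteq> U j (a + b)"
proof (induction a rule: int_induct[of _ 0])
  case (step1 a)
  have "U j (a + 1) * U j b \<doteq> (free_gen j * U j a) * U j b"
    by (intro eqv_mult_right eqv_sym[OF gen_U])
  also have "\<dots> = free_gen j * (U j a * U j b)" by (simp add: mult.assoc)
  also have "\<dots> \<doteq> free_gen j * U j (a + b)" by (intro eqv_mult_left step1)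
  also have "\<dots> \<doteq> U j (a + b + 1)" by (rule gen_U)
  finally show ?case by (simp add: algebra_simps)
next
  case (step2 a)
  have "U j (a - 1) * U j b \<doteq> (free_star (free_gen j) * U j a) * U j b"
    by (intro eqv_mult_right eqv_sym[OF gen'_U])
  also have "\<dots> = free_star (free_gen j) * (U j a * U j b)" by (simp add: mult.assoc)
  also have "\<dots> \<doteq> free_star (free_gen j) * U j (a + b)" by (intro eqv_mult_left step2)
  also have "\<dots> \<doteq> U j (a + b - 1)" by (rule gen'_U)
  finally show ?case by (simp add: algebra_simps)
qed simp

text \<open>A commutation phase with a generator passes to all its powers; the step to negative powers
  cancels a generator on both sides.\<close>

lemma comm_power:
  assumes "free_gen i * y \<doteq> free_scale (ph s) (y * free_gen i)"
  shows "U i a * y \<doteq> free_scale (ph (s * a)) (y * U i a)"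
proof (induction a rule: int_induct[of _ 0])
  case (step1 a)
  have "U i (a + 1) * y \<doteq> (free_gen i * U i a) * y"
    by (intro eqv_mult_right eqv_sym[OF gen_U])
  also have "\<dots> = free_gen i * (U i a * y)" by (simp add: mult.assoc)
  also have "\<dots> \<doteq> free_gen i * free_scale (ph (s * a)) (y * U i a)" by (intro eqv_mult_left step1)
  also have "\<dots> = free_scale (ph (s * a)) ((free_gen i * y) * U i a)" by (simp add: mult.assoc)
  also have "\<dots> \<doteq> free_scale (ph (s * a)) (free_scale (ph s) (y * free_gen i) * U i a)"
    by (intro eqv_scale eqv_mult_right assms)
  also have "\<dots> = free_scale (ph (s * (a + 1))) (y * (free_gen i * U i a))"
    by (simp add: mult.assoc distrib_left ph_add)
  also have "\<dots> \<doteq> free_scale (ph (s * (a + 1))) (y * U i (a + 1))"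
    by (intro eqv_scale eqv_mult_left gen_U)
  finally show ?case .
next
  case (step2 a)
  let ?g = "free_star (free_gen i)"
  have "y * ?g \<doteq> (?g * free_gen i) * (y * ?g)"
    using eqv_mult_right[OF eqv_sym[OF gen_star_gen(2)], of "y * ?g"] by simp
  also have "\<dots> = ?g * (free_gen i * y) * ?g" by (simp add: mult.assoc)
  also have "\<dots> \<doteq> ?g * free_scale (ph s) (y * free_gen i) * ?g"
    by (intro eqv_mult_right eqv_mult_left assms)
  also have "\<dots> = free_scale (ph s) (?g * y * (free_gen i * ?g))" by (simp add: mult.assoc)
  also have "\<dots> \<doteq> free_scale (ph s) (?g * y * 1)"
    by (intro eqv_scale eqv_mult_left gen_star_gen)
  finally have "free_scale (ph (- s)) (y * ?g) \<doteq> free_scale (ph (- s)) (free_scale (ph s) (?g * y))"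
    by (intro eqv_scale) simp
  then have g: "?g * y \<doteq> free_scale (ph (- s)) (y * ?g)" using eqv_sym by simp
  have "U i (a - 1) * y \<doteq> (?g * U i a) * y"
    by (intro eqv_mult_right eqv_sym[OF gen'_U])
  also have "\<dots> = ?g * (U i a * y)" by (simp add: mult.assoc)
  also have "\<dots> \<doteq> ?g * free_scale (ph (s * a)) (y * U i a)" by (intro eqv_mult_left step2)
  also have "\<dots> = free_scale (ph (s * a)) ((?g * y) * U i a)" by (simp add: mult.assoc)
  also have "\<dots> \<doteq> free_scale (ph (s * a)) (free_scale (ph (- s)) (y * ?g) * U i a)"
    by (intro eqv_scale eqv_mult_right g)
  also have "\<dots> = free_scale (ph (s * (a - 1))) (y * (?g * U i a))"
    by (simp add: mult.assoc right_diff_distrib flip: ph_add)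
  also have "\<dots> \<doteq> free_scale (ph (s * (a - 1))) (y * U i (a - 1))"
    by (intro eqv_scale eqv_mult_left gen'_U)
  finally show ?case .
qed simp

lemma eqv_scale_flip: "x \<doteq> free_scale (ph s) y \<Longrightarrow> y \<doteq> free_scale (ph (- s)) x"
  using eqv_sym[OF eqv_scale[of x "free_scale (ph s) y" "ph (- s)"]] by simp

lemma U_comm: assumes "i \<noteq> j" shows "U i a * U j b \<doteq> free_scale (ph (sgn (j - i) * a * b)) (U j b * U i a)"
proof -
  have less: "free_gen l * free_gen k \<doteq> free_scale (ph 1) (free_gen k * free_gen l)" if "l < k" for l k
    by (rule eqv_rel) (use that in \<open>auto simp: torus_rels_def ph_def cis_conv_exp\<close>)
  have gg: "free_gen i * free_gen j \<doteq> free_scale (ph (sgn (j - i))) (free_gen j * free_gen i)"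
  proof (cases "i < j")
    case False
    then show ?thesis using assms eqv_scale_flip[OF less[of j i]] by simp
  qed (simp add: less)
  have "U i a * free_gen j \<doteq> free_scale (ph (sgn (j - i) * a)) (free_gen j * U i a)"
    by (rule comm_power[OF gg])
  then have "free_gen j * U i a \<doteq> free_scale (ph (- (sgn (j - i) * a))) (U i a * free_gen j)"
    by (rule eqv_scale_flip)
  then have "U j b * U i a \<doteq> free_scale (ph (- (sgn (j - i) * a) * b)) (U i a * U j b)"
    by (rule comm_power)
  from eqv_scale_flip[OF this] show ?thesis by simp
qed

subsection \<open>Words\<close>

definition P :: "(int \<times> bool) list \<Rightarrow> int free_star_algebra" where
  "P ws = Poly_Mapping.single (Word ws) 1"

abbreviation sg :: "bool \<Rightarrow> int" where "sg b \<equiv> (if b then - 1 else 1)"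

abbreviation supp :: "(int \<times> bool) list \<Rightarrow> int set" where "supp ws \<equiv> fst ` set ws"

text \<open>\<open>ex w j\<close> is the total exponent of \<open>u\<^sub>j\<close> in \<open>w\<close>, and moving \<open>u\<^sub>j\<^sup>a\<close> past a word \<open>w\<close> that
  avoids \<open>j\<close> costs the phase \<open>ph (a * kap j w)\<close>.\<close>

fun ex :: "(int \<times> bool) list \<Rightarrow> int \<Rightarrow> int" where
  "ex [] j = 0"
| "ex ((i, b) # ws) j = (if i = j then sg b else 0) + ex ws j"

fun kap :: "int \<Rightarrow> (int \<times> bool) list \<Rightarrow> int" where
  "kap j [] = 0"
| "kap j ((i, b) # ws) = sgn (i - j) * sg b + kap j ws"

lemma ex_append: "ex (v @ w) j = ex v j + ex w j"
  by (induction v j rule: ex.induct) auto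

lemma ex_notin: "j \<notin> supp w \<Longrightarrow> ex w j = 0"
  by (induction w j rule: ex.induct) auto

lemma ex_filter: "ex (filter (\<lambda>l. fst l \<noteq> j) w) i = (if i = j then 0 else ex w i)"
  by (induction w i rule: ex.induct) auto

lemma P_Nil [simp]: "P [] = 1" by (simp add: P_def word_Nil)

lemma P_append: "P (v @ w) = P v * P w"
  by (simp add: P_def mult_single plus_star_word_def)

lemma P_letter: "P [(j, b)] = U j (sg b)"
  by (simp add: P_def U_m1 U_1 free_gen_def star_single star_word_def)

lemma P_Cons: "P ((j, b) # w) = U j (sg b) * P w"
  using P_append[of "[(j, b)]" w] by (simp only: P_letter append.simps)

lemma star_P: "free_star (P w) * P w \<doteq> 1"
proof (induction w)
  case (Cons l w)
  obtain j b where l: "l = (j, b)" by fastforce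
  have "free_star (P (l # w)) * P (l # w) = free_star (P w) * (U j (- sg b) * U j (sg b)) * P w"
    by (simp only: l P_Cons star_mult star_U mult.assoc)
  also have "\<dots> \<doteq> free_star (P w) * U j (- sg b + sg b) * P w"
    by (intro eqv_mult_right eqv_mult_left U_add)
  also have "\<dots> = free_star (P w) * P w" by simp
  also have "\<dots> \<doteq> 1" by (rule Cons)
  finally show ?case .
qed simp

lemma free_eq_sum_P: "x = (\<Sum>w\<in>Poly_Mapping.keys x. free_scale (Poly_Mapping.lookup x w) (P (letters w)))"
  by (rule poly_mapping_eqI) (auto simp: P_def scale_single lookup_sum lookup_single when_def in_keys_iff)

lemma U_P_comm: "j \<notin> supp w \<Longrightarrow> U j a * P w \<doteq> free_scale (ph (a * kap j w)) (P w * U j a)"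
proof (induction w)
  case (Cons l w)
  obtain i b where l: "l = (i, b)" by fastforce
  with Cons have ij: "j \<noteq> i" by auto
  have "U j a * P (l # w) = (U j a * U i (sg b)) * P w"
    by (simp only: l P_Cons mult.assoc)
  also have "\<dots> \<doteq> free_scale (ph (sgn (i - j) * a * sg b)) (U i (sg b) * U j a) * P w"
    by (intro eqv_mult_right U_comm ij)
  also have "\<dots> = free_scale (ph (sgn (i - j) * a * sg b)) (U i (sg b) * (U j a * P w))"
    by (simp add: mult.assoc)
  also have "\<dots> \<doteq> free_scale (ph (sgn (i - j) * a * sg b)) (U i (sg b) * free_scale (ph (a * kap j w)) (P w * U j a))"
    by (intro eqv_scale eqv_mult_left Cons.IH) (use Cons.prems in auto)
  also have "\<dots> = free_scale (ph (sgn (i - j) * a * sg b + a * kap j w)) (P (l # w) * U j a)"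
    by (simp only: l P_Cons mult.assoc scale_mult_left scale_mult_right scale_scale ph_add)
  also have "sgn (i - j) * a * sg b + a * kap j w = a * kap j (l # w)"
    by (simp add: l algebra_simps)
  finally show ?case .
qed simp

lemma reorder: "\<exists>n. P w \<doteq> free_scale (ph n) (P (filter (\<lambda>l. fst l \<noteq> j) w) * U j (ex w j))"
proof (induction w)
  case Nil
  show ?case by (rule exI[of _ 0]) simp
next
  case (Cons l w)
  obtain i b where l: "l = (i, b)" by fastforce
  let ?w = "filter (\<lambda>l. fst l \<noteq> j) w"
  obtain n where n: "P w \<doteq> free_scale (ph n) (P ?w * U j (ex w j))" using Cons by blast
  have 1: "P (l # w) \<doteq> free_scale (ph n) (U i (sg b) * P ?w * U j (ex w j))"
    using eqv_mult_left[OF n, of "U i (sg b)"] by (simp only: l P_Cons scale_mult_right mult.assoc)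
  show ?case
  proof (cases "i = j")
    case False
    then have "P (filter (\<lambda>l. fst l \<noteq> j) (l # w)) = U i (sg b) * P ?w" "ex (l # w) j = ex w j"
      by (simp_all only: l filter.simps fst_conv P_Cons ex.simps if_False add_0_left simp_thms if_True)
    then show ?thesis using 1 by auto
  next
    case True
    have "U i (sg b) * P ?w \<doteq> free_scale (ph (sg b * kap j ?w)) (P ?w * U j (sg b))"
      unfolding True by (rule U_P_comm) auto
    then have "U i (sg b) * P ?w * U j (ex w j) \<doteq> free_scale (ph (sg b * kap j ?w)) (P ?w * U j (sg b)) * U j (ex w j)"
      by (rule eqv_mult_right)
    also have "\<dots> = free_scale (ph (sg b * kap j ?w)) (P ?w * (U j (sg b) * U j (ex w j)))"
      by (simp only: scale_mult_left mult.assoc)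
    also have "\<dots> \<doteq> free_scale (ph (sg b * kap j ?w)) (P ?w * U j (sg b + ex w j))"
      by (intro eqv_scale eqv_mult_left U_add)
    finally have "P (l # w) \<doteq> free_scale (ph n) (free_scale (ph (sg b * kap j ?w)) (P ?w * U j (sg b + ex w j)))"
      using eqv_trans[OF 1 eqv_scale] by blast
    moreover have "filter (\<lambda>l. fst l \<noteq> j) (l # w) = ?w" "ex (l # w) j = sg b + ex w j"
      using True by (simp_all add: l)
    ultimately show ?thesis
      by (intro exI[of _ "n + sg b * kap j ?w"]) (simp only: scale_scale ph_add)
  qed
qed

definition mono :: "(int \<times> int) list \<Rightarrow> int free_star_algebra" where
  "mono jks = foldr (*) (map (\<lambda>(j, k). U j k) jks) 1"

lemma mono_Nil [simp]: "mono [] = 1" by (simp add: mono_def)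

lemma mono_Cons [simp]: "mono ((j, k) # jks) = U j k * mono jks" by (simp add: mono_def)

lemma mono_append: "mono (xs @ ys) = mono xs * mono ys"
  by (induction xs) (auto simp: mult.assoc)

text \<open>Collecting the letters of one site after the other, each time at the cost of a phase.
  Functionals that respect the relations are thus determined by monomials with pairwise distinct
  sites.\<close>

lemma word_normal_form:
  "\<exists>n ds. distinct ds \<and> set ds = supp w \<and> P w \<doteq> free_scale (ph n) (mono (map (\<lambda>j. (j, ex w j)) ds))"
proof (induction w rule: length_induct)
  case (1 w)
  show ?case
  proof (cases w)
    case Nil
    then show ?thesis by (intro exI[of _ 0] exI[of _ "[]"]) simp
  next
    case (Cons l v)
    define j where "j = fst l"
    let ?w = "filter (\<lambda>l. fst l \<noteq> j) w"
    have "length ?w < length w" using Cons j_def by (simp add: le_imp_less_Suc)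
    then obtain n ds where ds: "distinct ds" "set ds = supp ?w"
      "P ?w \<doteq> free_scale (ph n) (mono (map (\<lambda>j. (j, ex ?w j)) ds))"
      using 1 by blast
    obtain m where m: "P w \<doteq> free_scale (ph m) (P ?w * U j (ex w j))" using reorder by blast
    have e: "map (\<lambda>i. (i, ex ?w i)) ds = map (\<lambda>i. (i, ex w i)) ds"
      using ds(2) by (auto simp: ex_filter)
    have "P w \<doteq> free_scale (ph m) (free_scale (ph n) (mono (map (\<lambda>i. (i, ex w i)) ds)) * U j (ex w j))"
      using eqv_trans[OF m eqv_scale[OF eqv_mult_right[OF ds(3)]]] unfolding e .
    also have "\<dots> = free_scale (ph (m + n)) (mono (map (\<lambda>i. (i, ex w i)) (ds @ [j])))"
      by (simp add: mono_append ph_add)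
    finally have "P w \<doteq> \<dots>" .
    moreover have "distinct (ds @ [j])" "set (ds @ [j]) = supp w"
      using ds Cons j_def by auto
    ultimately show ?thesis by blast
  qed
qed

lemma U_eq_P: "U j k = P (replicate (nat \<bar>k\<bar>) (j, k < 0))"
proof -
  have r: "P (replicate n (j, b)) = U j (sg b) ^ n" for n b
    by (induction n) (simp_all only: replicate.simps P_Cons P_Nil power.simps)
  show ?thesis unfolding r by (simp add: U_m1 U_1 U_def)
qed

lemma mono_eqv_P: "\<exists>w. mono jks = P w \<and> supp w \<subseteq> fst ` set jks"
proof (induction jks)
  case Nil
  show ?case by (rule exI[of _ "[]"]) simp
next
  case (Cons x jks)
  obtain j k where x: "x = (j, k)" by fastforce
  obtain w where "mono jks = P w" "supp w \<subseteq> fst ` set jks" using Cons by blast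
  then show ?case
    by (intro exI[of _ "replicate (nat \<bar>k\<bar>) (j, k < 0) @ w"]) (auto simp: x U_eq_P P_append)
qed

subsection \<open>Monomials of the completion\<close>

abbreviation \<iota> where "\<iota> x \<equiv> cls (\<lambda>n::nat. x)"

lemma torus_eq: "torus \<alpha> = A" by (simp add: torus_def)

lemma m_inv_eq:
  assumes "x * y \<doteq> 1" "y * x \<doteq> 1" shows "inv\<^bsub>A\<^esub> (\<iota> x) = \<iota> y"
  unfolding m_inv_def
proof (rule the_equality)
  show "\<iota> y \<in> carrier A \<and> \<iota> x \<otimes>\<^bsub>A\<^esub> \<iota> y = \<one>\<^bsub>A\<^esub> \<and> \<iota> y \<otimes>\<^bsub>A\<^esub> \<iota> x = \<one>\<^bsub>A\<^esub>"
    using eqv_cls assms by (auto simp: cls_one)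
  fix z assume z: "z \<in> carrier A \<and> \<iota> x \<otimes>\<^bsub>A\<^esub> z = \<one>\<^bsub>A\<^esub> \<and> z \<otimes>\<^bsub>A\<^esub> \<iota> x = \<one>\<^bsub>A\<^esub>"
  then obtain Z where Z: "Z \<in> CS" "z = cls Z" by (metis carrierE)
  have "z = z \<otimes>\<^bsub>A\<^esub> (\<iota> x \<otimes>\<^bsub>A\<^esub> \<iota> y)" using Z eqv_cls[OF assms(1)] by simp
  also have "\<dots> = (z \<otimes>\<^bsub>A\<^esub> \<iota> x) \<otimes>\<^bsub>A\<^esub> \<iota> y" using Z by (simp add: CS_mult mult.assoc)
  also have "\<dots> = \<iota> y" using z by (simp add: cls_one)
  finally show "z = \<iota> y" .
qed

lemma torus_gen_pow: "torus_gen \<alpha> j [^]\<^bsub>torus \<alpha>\<^esub> (k::int) = \<iota> (U j k)"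
proof -
  have p: "rec_nat \<one>\<^bsub>A\<^esub> (\<lambda>u b. b \<otimes>\<^bsub>A\<^esub> torus_gen \<alpha> j) n = \<iota> (U j (int n))" for n
  proof (induction n)
    case (Suc n)
    then show ?case by (simp add: torus_gen_def U_def power_commutes nat_add_distrib flip: power_Suc2)
  qed (simp add: cls_one)
  show ?thesis
  proof (cases "k < 0")
    case True
    have "inv\<^bsub>A\<^esub> (\<iota> (U j (- k))) = \<iota> (U j k)"
      using U_add[of j k "- k"] U_add[of j "- k" k] by (intro m_inv_eq) auto
    then show ?thesis using True by (simp add: int_pow_def torus_eq Let_def p)
  qed (simp add: int_pow_def torus_eq Let_def p)
qed

lemma torus_monomial_eq: "torus_monomial \<alpha> jks = \<iota> (mono jks)"
proof (induction jks)
  case Nil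
  show ?case by (simp add: torus_monomial_def torus_eq cls_one)
next
  case (Cons x jks)
  then show ?case
    by (cases x) (simp add: torus_monomial_def torus_gen_pow, simp add: torus_eq)
qed

end

lemma le_of_le_add_div:
  fixes a b c :: real assumes "\<And>n::nat. (0::nat) < n \<Longrightarrow> a \<le> b + c / n" shows "a \<le> b"
proof (rule LIMSEQ_le_const)
  have "(\<lambda>n. b + c * inverse (of_nat n)) \<longlonglongrightarrow> b + c * 0"
    by (intro tendsto_intros lim_inverse_n)
  then show "(\<lambda>n. b + c / real n) \<longlonglongrightarrow> b" by (simp add: divide_inverse)
  show "\<exists>N. \<forall>n\<ge>N. a \<le> b + c / real n" using assms by (intro exI[of _ 1]) auto
qed

context nc_torus
begin

subsection \<open>Relabelling of generators\<close>

definition shl :: "(int \<Rightarrow> int) \<Rightarrow> (int \<times> bool) list \<Rightarrow> (int \<times> bool) list" where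
  "shl h ws = map (\<lambda>(j, b). (h j, b)) ws"

definition shift :: "(int \<Rightarrow> int) \<Rightarrow> int free_star_algebra \<Rightarrow> int free_star_algebra" where
  "shift h x = (\<Sum>w\<in>Poly_Mapping.keys x. Poly_Mapping.single (Word (shl h (letters w))) (Poly_Mapping.lookup x w))"

lemma shift_add: "shift h (x + y) = shift h x + shift h y"
  unfolding shift_def
  by (rule lin_ext_add[where F = "\<lambda>w. Poly_Mapping.single (Word (shl h (letters w)))"]) (auto simp: single_add)

lemma shift_single: "shift h (Poly_Mapping.single w c) = Poly_Mapping.single (Word (shl h (letters w))) c"
  by (simp add: shift_def)

lemma shift_scale: "shift h (free_scale c x) = free_scale c (shift h x)"
  by (induction x rule: free_induct) (simp_all add: shift_single scale_single scale_add shift_add)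

lemma shift_diff: "shift h (x - y) = shift h x - shift h y"
  using shift_add[of h x "free_scale (-1) y"] by (simp add: shift_scale) (simp add: scale_neg_one)

lemma shift_mult: "shift h (x * y) = shift h x * shift h y"
proof (induction x rule: free_induct)
  case (single w c)
  show ?case
    by (induction y rule: free_induct)
      (simp_all add: mult_single shift_single shift_add plus_star_word_def shl_def distrib_left)
qed (simp add: shift_add distrib_right)

lemma shift_one [simp]: "shift h 1 = 1"
  using shift_single[of h 0 1] by (simp add: shl_def zero_star_word_def word_Nil)

lemma shift_star: "shift h (free_star x) = free_star (shift h x)"
proof (induction x rule: free_induct)
  case (single w c)
  show ?case by (simp add: star_single shift_single star_word_def shl_def rev_map o_def case_prod_unfold)
qed (simp add: shift_add star_add)

lemma shift_P: "shift h (P w) = P (shl h w)"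
  by (simp add: P_def shift_single)

lemma shift_gen: "shift h (free_gen j) = free_gen (h j)"
  by (simp add: free_gen_def shift_single shl_def)

lemma shift_U: "shift h (U j k) = U (h j) k"
proof -
  have "shift h (x ^ n) = shift h x ^ n" for x n
    by (induction n) (simp_all add: shift_mult)
  then show ?thesis by (simp add: U_def shift_gen shift_star)
qed

lemma supp_shl: "supp (shl h w) = h ` supp w"
  by (force simp: shl_def)

lemma shl_notin: "strict_mono h \<Longrightarrow> j \<notin> supp w \<Longrightarrow> h j \<notin> supp (shl h w)"
  by (simp add: supp_shl inj_image_mem_iff strict_mono_imp_inj_on)

text \<open>An increasing map permits to pull back seminorms, since it carries relations to relations.\<close>

lemma N_shift_le:
  assumes "strict_mono h" shows "N (shift h x) \<le> N x"
proof (rule seminorm_le_N)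
  show "cstar_seminorm (\<lambda>x. N (shift h x))"
    by (simp add: cstar_seminorm_def shift_add shift_scale shift_mult shift_star N_triangle N_scale N_mult N_cstar)
  fix r assume "r \<in> torus_rels \<alpha>"
  then consider (1) l where "r = free_star (free_gen l) * free_gen l - 1"
    | (2) l where "r = free_gen l * free_star (free_gen l) - 1"
    | (3) l k where "l < k"
      "r = free_gen l * free_gen k - free_scale (exp (\<i> * of_real \<alpha>)) (free_gen k * free_gen l)"
    unfolding torus_rels_def by blast
  then have "shift h r \<in> torus_rels \<alpha>"
  proof cases
    case 3
    then have "h l < h k" using assms by (simp add: strict_mono_less)
    then show ?thesis unfolding 3(2) torus_rels_def shift_diff shift_mult shift_gen shift_scale by blast
  qed (auto simp: torus_rels_def shift_diff shift_mult shift_star shift_gen)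
  then show "N (shift h r) = 0" by (rule N_rel)
qed

lemma CS_shift_word: "strict_mono h \<Longrightarrow> X \<in> CS \<Longrightarrow> (\<lambda>n. shift h (X n)) \<in> CS"
  by (rule CS_dom[of X X _ 1 0]) (auto simp: N_shift_le simp flip: shift_diff)

text \<open>Relabelling the representatives gives one homomorphism with the required values on
  generators, and by continuity there is no other.\<close>

lemma torus_endo_cls:
  assumes h: "strict_mono h" and X: "X \<in> CS"
  shows "torus_endo \<alpha> h (cls X) = cls (\<lambda>n. shift h (X n))"
proof -
  define \<Phi> where "\<Phi> = restrict (\<lambda>S. cls (\<lambda>n. shift h ((SOME X. X \<in> S) n))) (carrier A)"
  have \<Phi>: "\<Phi> (cls X) = cls (\<lambda>n. shift h (X n))" if X: "X \<in> CS" for X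
  proof -
    define Y where "Y = (SOME Y. Y \<in> cls X)"
    have Y: "Y \<in> cls X" unfolding Y_def by (rule someI[of "\<lambda>Y. Y \<in> cls X", OF cls_self[OF X]])
    have "cls (\<lambda>n. shift h (Y n)) = cls (\<lambda>n. shift h (X n))"
    proof (rule cls_dom_eq[OF Y Y, of _ _ 1 0])
      show "(\<lambda>n. shift h (X n)) \<in> CS" "(\<lambda>n. shift h (Y n)) \<in> CS"
        using X Y h by (auto simp: mem_cls CS_shift_word)
      show "N (shift h (Y n) - shift h (X n)) \<le> 1 * N (X n - Y n) + 0 * N (X n - Y n)" for n
        using N_shift_le[OF h, of "Y n - X n"] by (simp add: shift_diff N_diff_commute[of "X n"])
    qed
    then show ?thesis using X by (simp add: \<Phi>_def Y_def)
  qed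
  have "\<Phi> \<in> ring_hom A A"
  proof (rule ring_hom_memI)
    show "\<Phi> S \<in> carrier A" if "S \<in> carrier A" for S
    proof -
      obtain X where "X \<in> CS" "S = cls X" using \<open>S \<in> carrier A\<close> by (rule carrierE)
      then show ?thesis using h by (simp add: \<Phi> CS_shift_word)
    qed
    show "\<Phi> \<one>\<^bsub>A\<^esub> = \<one>\<^bsub>A\<^esub>" by (simp add: cls_one \<Phi>)
  next
    fix S T assume "S \<in> carrier A" "T \<in> carrier A"
    then obtain X Y where *: "X \<in> CS" "S = cls X" "Y \<in> CS" "T = cls Y" by (metis carrierE)
    show "\<Phi> (S \<otimes>\<^bsub>A\<^esub> T) = \<Phi> S \<otimes>\<^bsub>A\<^esub> \<Phi> T" "\<Phi> (S \<oplus>\<^bsub>A\<^esub> T) = \<Phi> S \<oplus>\<^bsub>A\<^esub> \<Phi> T"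
      using h * by (simp_all add: \<Phi> CS_mult CS_add CS_shift_word shift_mult shift_add)
  qed
  moreover have "\<Phi> (c \<odot>\<^bsub>A\<^esub> S) = c \<odot>\<^bsub>A\<^esub> \<Phi> S \<and> \<Phi> (star A S) = star A (\<Phi> S)" if "S \<in> carrier A" for S c
  proof -
    obtain X where "X \<in> CS" "S = cls X" using \<open>S \<in> carrier A\<close> by (rule carrierE)
    then show ?thesis
      using h by (simp add: \<Phi> CS_scale CS_star CS_shift_word shift_scale shift_star)
  qed
  ultimately have hom: "\<Phi> \<in> star_hom A A"
    by (simp add: star_hom_def)
  have "torus_endo \<alpha> h = \<Phi>"
    unfolding torus_endo_def torus_eq
  proof (rule the_equality)
    show "\<Phi> \<in> star_hom A A \<inter> extensional (carrier A) \<and> (\<forall>l. \<Phi> (torus_gen \<alpha> l) = torus_gen \<alpha> (h l))"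
      using hom by (auto simp: torus_gen_def \<Phi> shift_gen) (simp add: \<Phi>_def)
    fix \<Psi> assume "\<Psi> \<in> star_hom A A \<inter> extensional (carrier A) \<and> (\<forall>l. \<Psi> (torus_gen \<alpha> l) = torus_gen \<alpha> (h l))"
    then have \<Psi>: "\<Psi> \<in> star_hom A A" "\<Psi> \<in> extensional (carrier A)" "\<And>l. \<Psi> (\<iota> (free_gen l)) = \<iota> (free_gen (h l))"
      by (auto simp: torus_gen_def)
    note hom_facts = hom_mult[OF \<Psi>(1), of "\<iota> _" "\<iota> _", simplified] hom_add[OF \<Psi>(1), of "\<iota> _" "\<iota> _", simplified]
      hom_smult[OF \<Psi>(1), of "\<iota> _", simplified] hom_star[OF \<Psi>(1), of "\<iota> _", simplified]
    have U: "\<Psi> (\<iota> (U j (sg b))) = \<iota> (shift h (U j (sg b)))" for j b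
      by (cases b) (simp_all add: U_m1 U_1 shift_star shift_gen \<Psi>(3) hom_facts)
    have P: "\<Psi> (\<iota> (P w)) = \<iota> (shift h (P w))" for w
    proof (induction w)
      case Nil
      then show ?case using hom_one[OF \<Psi>(1)] by (simp add: cls_one)
    next
      case (Cons l w)
      then show ?case by (cases l) (simp only: P_Cons shift_mult hom_facts U cls_mult CS_const)
    qed
    have "\<Psi> (\<iota> x) = \<iota> (shift h x)" for x
    proof (induction x rule: free_induct)
      case (single w c)
      have "Poly_Mapping.single w c = free_scale c (P (letters w))" by (simp add: P_def scale_single)
      then show ?case by (simp add: hom_facts P shift_scale)
    qed (simp add: hom_facts shift_add)
    then have det: "\<Psi> (cls X) = cls (\<lambda>n. shift h (X n))" if "X \<in> CS" for X
      by (rule hom_determined[OF \<Psi>(1) _ shift_diff N_shift_le[OF h] that])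
    show "\<Psi> = \<Phi>"
    proof (rule extensionalityI[OF \<Psi>(2)])
      show "\<Phi> \<in> extensional (carrier A)" by (simp add: \<Phi>_def)
      fix S assume "S \<in> carrier A"
      then obtain X where "X \<in> CS" "S = cls X" by (rule carrierE)
      then show "\<Psi> S = \<Phi> S" by (simp add: det \<Phi>)
    qed
  qed
  then show ?thesis using \<Phi>[OF X] by simp
qed

lemma spreadable_iff:
  "\<phi> \<in> spreadable_states \<alpha> \<longleftrightarrow>
     \<phi> \<in> states A \<and> (\<forall>h x. strict_mono h \<longrightarrow> \<phi> (\<iota> (shift h x)) = \<phi> (\<iota> x))"
proof (intro iffI conjI allI impI)
  assume "\<phi> \<in> spreadable_states \<alpha>"
  then show "\<phi> \<in> states A" by (simp add: spreadable_states_def torus_eq)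
  fix h x assume "strict_mono (h :: int \<Rightarrow> int)"
  then have "\<phi> (torus_endo \<alpha> h (\<iota> x)) = \<phi> (\<iota> x)"
    using \<open>\<phi> \<in> spreadable_states \<alpha>\<close> by (simp add: spreadable_states_def torus_eq)
  then show "\<phi> (\<iota> (shift h x)) = \<phi> (\<iota> x)" using \<open>strict_mono h\<close> by (simp add: torus_endo_cls)
next
  assume \<phi>: "\<phi> \<in> states A \<and> (\<forall>h x. strict_mono h \<longrightarrow> \<phi> (\<iota> (shift h x)) = \<phi> (\<iota> x))"
  have "\<phi> (torus_endo \<alpha> h S) = \<phi> S" if h: "strict_mono h" and "S \<in> carrier A" for h S
  proof -
    obtain X where X: "X \<in> CS" "S = cls X" using \<open>S \<in> carrier A\<close> by (rule carrierE)
    have "(\<lambda>m. \<phi> (\<iota> (shift h (X m)))) \<longlonglongrightarrow> \<phi> (cls (\<lambda>n. shift h (X n)))"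
      using \<phi> by (intro st_tendsto CS_shift_word h X) auto
    then have "(\<lambda>m. \<phi> (\<iota> (X m))) \<longlonglongrightarrow> \<phi> (cls (\<lambda>n. shift h (X n)))" using \<phi> h by simp
    moreover have "(\<lambda>m. \<phi> (\<iota> (X m))) \<longlonglongrightarrow> \<phi> (cls X)" using \<phi> X by (intro st_tendsto) auto
    ultimately show ?thesis using LIMSEQ_unique X h by (metis torus_endo_cls)
  qed
  then show "\<phi> \<in> spreadable_states \<alpha>" using \<phi> by (simp add: spreadable_states_def torus_eq)
qed

section \<open>Moments of spreadable states\<close>

text \<open>Spreadable states, restricted to the free algebra.\<close>

definition spr :: "(int free_star_algebra \<Rightarrow> complex) \<Rightarrow> bool" where
  "spr f \<longleftrightarrow> pos_functional f \<and> (\<forall>x. cmod (f x) \<le> N x) \<and> f 1 = 1 \<and>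
     (\<forall>h x. strict_mono h \<longrightarrow> f (shift h x) = f x)"

lemma spr_of_state: "\<phi> \<in> spreadable_states \<alpha> \<Longrightarrow> spr (\<lambda>x. \<phi> (\<iota> x))"
  using state_pos_functional by (auto simp: spreadable_iff spr_def)

lemma state_of_spr:
  assumes "spr f" shows "ext_fun f \<in> spreadable_states \<alpha>" "ext_fun f (\<iota> x) = f x"
proof -
  have *: "pos_functional f" "\<And>x. cmod (f x) \<le> 1 * N x" "f 1 = 1" using assms by (simp_all add: spr_def)
  show e: "ext_fun f (\<iota> x) = f x" for x by (rule ext_const[OF *(1,2)])
  show "ext_fun f \<in> spreadable_states \<alpha>"
    using ext_state[OF *] assms by (simp add: spreadable_iff e spr_def)
qed

definition Del :: "int set" where "Del = {k. ph (k * k) = 1}"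

lemma Delta_eq: "Delta \<alpha> = Del"
  by (simp add: Delta_def Del_def ph_def cis_conv_exp power2_eq_square mult.assoc)

context
  fixes f assumes f: "spr f"
begin

lemma f_pf: "pos_functional f" and f_le: "cmod (f x) \<le> N x" and f_one: "f 1 = 1"
  and f_shift: "strict_mono h \<Longrightarrow> f (shift h x) = f x"
  using f by (auto simp: spr_def)

lemmas f_rules = pf_add[OF f_pf] pf_diff[OF f_pf] pf_scale[OF f_pf] pf_sum[OF f_pf] f_one

lemma f_eqv: "x \<doteq> y \<Longrightarrow> f x = f y"
  using f_le[of "x - y"] by (simp add: eqv_def f_rules)

lemma f_U: "f (U j k) = f (U 0 k)"
  using f_shift[of "\<lambda>x. x + j" "U 0 k"] by (simp add: shift_U strict_mono_def)

lemma f_UU: assumes "i < j" shows "f (U i a * U j b) = f (U 0 a * U 1 b)"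
proof -
  \<comment> \<open>The map sends \<open>0\<close> to \<open>i\<close> and \<open>1\<close> to \<open>j\<close>.\<close>
  have "strict_mono (\<lambda>x. if x \<le> 0 then i + x else j + x - 1)"
    using assms by (auto simp: strict_mono_def)
  from f_shift[OF this, of "U 0 a * U 1 b"] show ?thesis by (simp add: shift_U shift_mult)
qed

definition mom :: "int \<Rightarrow> complex" where "mom k = f (U 0 k)"
lemma f_U_mom: "f (U j k) = mom k" unfolding mom_def by (rule f_U)

text \<open>The correlation of \<open>k\<close>-th powers at two sites. It does not depend on the sites, but
  exchanging them conjugates it.\<close>

definition cor :: "int \<Rightarrow> complex" where "cor k = f (U 0 (- k) * U 1 k)"

lemma f_UstarU: "f (U s (- k) * U t k) = (if s = t then 1 else if s < t then cor k else cnj (cor k))"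
proof -
  have "f (U s (- k) * U t k) = cnj (cor k)" if "t < s"
  proof -
    have "U s (- k) * U t k = free_star (U t (- k) * U s k)" by (simp add: star_mult star_U)
    then show ?thesis using f_UU[OF that, of "- k" k] by (simp add: pf_star[OF f_pf] cor_def)
  qed
  moreover have "f (U t (- k) * U t k) = 1" using f_eqv[OF U_add[of t "- k" k]] by (simp add: f_one)
  ultimately show ?thesis using f_UU[of s t "- k" k] by (auto simp: cor_def)
qed

definition av :: "int set \<Rightarrow> int \<Rightarrow> int free_star_algebra" where
  "av J k = free_scale (1 / of_nat (card J)) (\<Sum>t\<in>J. U t k)"

lemma f_mult_av:
  assumes "finite J" "J \<noteq> {}" "\<And>t. t \<in> J \<Longrightarrow> f (x * U t k) = z"
  shows "f (x * av J k) = z"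
  using assms by (simp add: av_def sum_distrib_left f_rules)

lemma f_av_av: "f (free_star (av I k) * av J k) = (\<Sum>s\<in>I. \<Sum>t\<in>J. f (U s (- k) * U t k)) / (of_nat (card I) * of_nat (card J))"
  by (simp add: av_def star_scale star_sum star_U sum_product f_rules)

lemma f_av_av_less:
  assumes "finite I" "finite J" "I \<noteq> {}" "J \<noteq> {}" "\<And>s t. s \<in> I \<Longrightarrow> t \<in> J \<Longrightarrow> s < t"
  shows "f (free_star (av I k) * av J k) = cor k"
proof -
  have "(\<Sum>s\<in>I. \<Sum>t\<in>J. f (U s (- k) * U t k)) = (\<Sum>s\<in>I. \<Sum>t\<in>J. cor k)"
    using assms(5) by (intro sum.cong) (auto simp: f_UstarU)
  then show ?thesis using assms by (simp add: f_av_av)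
qed

lemma Re_f_av_av:
  assumes "finite J" "J \<noteq> {}"
  shows "Re (f (free_star (av J k) * av J k)) = Re (cor k) + (1 - Re (cor k)) / card J"
proof -
  have c: "card J > 0" using assms by (simp add: card_gt_0_iff)
  have "Re (\<Sum>s\<in>J. \<Sum>t\<in>J. f (U s (- k) * U t k)) = (\<Sum>s\<in>J. \<Sum>t\<in>J. Re (cor k) + (if t = s then 1 - Re (cor k) else 0))"
    unfolding Re_sum by (intro sum.cong) (auto simp: f_UstarU)
  also have "\<dots> = real (card J) * real (card J) * Re (cor k) + real (card J) * (1 - Re (cor k))"
    using assms by (simp add: sum.distrib distrib_left)
  finally have *: "Re (\<Sum>s\<in>J. \<Sum>t\<in>J. f (U s (- k) * U t k)) = \<dots>" .
  define n where "n = real (card J)"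
  have n: "n > 0" using c by (simp add: n_def)
  have "f (free_star (av J k) * av J k) = (\<Sum>s\<in>J. \<Sum>t\<in>J. f (U s (- k) * U t k)) / of_real (n * n)"
    unfolding f_av_av by (simp add: n_def)
  then have "Re (f (free_star (av J k) * av J k)) = (n * n * Re (cor k) + n * (1 - Re (cor k))) / (n * n)"
    using * by (simp only: Re_divide_of_real n_def)
  also have "\<dots> = Re (cor k) + (1 - Re (cor k)) / n"
    using n by (simp add: add_divide_distrib)
  finally show ?thesis by (simp add: n_def)
qed

text \<open>For the averages over two consecutive blocks of length \<open>n\<close>, the scalar product is \<open>cor k\<close>
  and the square norms are \<open>Re (cor k)\<close> up to an error of order \<open>1 / n\<close>; so Cauchy--Schwarz gives
  \<open>cmod (cor k) \<le> Re (cor k)\<close>.\<close>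

lemma cor_nonneg: "Re (cor k) \<ge> 0" "cor k = of_real (Re (cor k))"
proof -
  have "cmod (cor k) \<le> Re (cor k) + (1 - Re (cor k)) / n" if n: "n > 0" for n :: nat
  proof -
    let ?I = "{0..<int n}" and ?J = "{int n..<2 * int n}"
    let ?a = "Re (cor k) + (1 - Re (cor k)) / n"
    have "(cmod (f (free_star (av ?I k) * av ?J k)))\<^sup>2 \<le> ?a * ?a"
      using pf_CS[OF f_pf, of "av ?I k" "av ?J k"] Re_f_av_av[of ?I k] Re_f_av_av[of ?J k] n by simp
    moreover have "?a \<ge> 0"
      using pf_Re(1)[OF f_pf, of "av ?I k"] Re_f_av_av[of ?I k] n by simp
    moreover have "f (free_star (av ?I k) * av ?J k) = cor k"
    proof (rule f_av_av_less)
      show "?I \<noteq> {}" "?J \<noteq> {}" using n by simp_all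
    qed simp_all
    ultimately show ?thesis by (metis power2_eq_square power2_le_imp_le)
  qed
  then have le: "cmod (cor k) \<le> Re (cor k)" by (rule le_of_le_add_div) simp
  then show "Re (cor k) \<ge> 0" using norm_ge_zero order_trans by blast
  have "cmod (cor k) = \<bar>Re (cor k)\<bar>" using le abs_Re_le_cmod[of "cor k"] by linarith
  then show "cor k = of_real (Re (cor k))"
    using cmod_power2[of "cor k"] by (simp add: complex_eq_iff)
qed

text \<open>Commuting the factors shows that \<open>cor (- k)\<close> is \<open>ph (- (k * k))\<close> times \<open>cor k\<close>; as both are
  nonnegative, the phase is one unless they vanish.\<close>

lemma cor_zero: assumes "k \<notin> Del" shows "cor k = 0"
proof (rule ccontr)
  assume nz: "cor k \<noteq> 0"
  have "cor (- k) = f (U 0 k * U 1 (- k))" by (simp add: cor_def)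
  also have "\<dots> = f (free_scale (ph (sgn (1 - 0) * k * (- k))) (U 1 (- k) * U 0 k))"
    by (rule f_eqv[OF U_comm]) simp
  also have "\<dots> = ph (- (k * k)) * cnj (cor k)"
    using f_UstarU[of 1 k 0] by (simp add: f_rules)
  also have "cnj (cor k) = of_real (Re (cor k))"
    by (metis complex_cnj_complex_of_real cor_nonneg(2))
  finally have e: "cor (- k) = ph (- (k * k)) * of_real (Re (cor k))" .
  have pos: "Re (cor k) > 0" using cor_nonneg[of k] nz by (metis less_eq_real_def of_real_0)
  have "ph (- (k * k)) = of_real (Re (cor (- k)) / Re (cor k))"
    using e cor_nonneg(2)[of "- k"] pos by (metis nonzero_eq_divide_eq of_real_divide of_real_eq_0_iff less_numeral_extra(3))
  moreover have "Re (cor (- k)) / Re (cor k) = 1"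
    using calculation norm_ph[of "- (k * k)"] cor_nonneg(1)[of "- k"] pos by (simp add: norm_divide)
  ultimately have "ph (- (k * k)) = 1" by simp
  then have "ph (k * k) = 1" by (metis cnj_ph complex_cnj_one minus_minus)
  then show False using assms by (simp add: Del_def)
qed

lemma P_star: "P w * free_star (P w) \<doteq> 1"
proof -
  have "free_star (P w) = P (letters (star_word (Word w)))" by (simp add: P_def star_single)
  then show ?thesis using star_P[of "letters (star_word (Word w))"] by (metis star_star)
qed

lemma f_P_CS: "(cmod (f (P w * y)))\<^sup>2 \<le> Re (f (free_star y * y))"
  using pf_CS[OF f_pf, of "free_star (P w)" y] f_eqv[OF P_star[of w]] by (simp add: f_one)

lemma shl_cong: "(\<And>j. j \<in> supp w \<Longrightarrow> g j = h j) \<Longrightarrow> shl g w = shl h w"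
  by (force simp: shl_def)

text \<open>The map \<open>h t\<close> opens a gap of length \<open>n\<close> above \<open>j\<close> and moves \<open>j\<close> to any place in it, with the
  same effect on \<open>w\<close> for all \<open>t\<close>. So \<open>U j k\<close> may be averaged over the gap, and the bound is the
  limit of the square norms of the average minus \<open>z\<close>. It is used with \<open>z = 0\<close> for words outside
  \<open>\<Delta>\<^sub>\<alpha>\<close>, and with one-site moments as \<open>z\<close>, where it becomes a mean square deviation.\<close>

lemma f_word_U_bound:
  assumes j: "j \<notin> supp w"
  shows "(cmod (f (P w * U j k) - z * f (P w)))\<^sup>2 \<le> Re (cor k) - 2 * Re (cnj z * mom k) + (cmod z)\<^sup>2"
proof (rule le_of_le_add_div)
  fix n :: nat assume n: "(0::nat) < n"
  let ?J = "{j..<j + int n}"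
  define h where "h t = (\<lambda>x. if x < j then x else if x = j then j + t else x + int n)" for t
  define w' where "w' = shl (h 0) w"
  have sm: "strict_mono (h t)" if "0 \<le> t" "t \<le> int n" for t
    using that by (auto simp: strict_mono_def h_def)
  have w': "shl (h t) w = w'" for t
    unfolding w'_def using j by (intro shl_cong) (auto simp: h_def)
  have hj: "h t j = j + t" for t by (simp add: h_def)
  have 1: "f (P w' * U (j + t) k) = f (P w * U j k)" if "0 \<le> t" "t \<le> int n" for t
    using f_shift[OF sm[OF that], of "P w * U j k"] by (simp add: shift_mult shift_P shift_U w' hj)
  have 2: "f (P w') = f (P w)"
    using f_shift[OF sm[of 0], of "P w"] by (simp add: shift_P w')
  have 3: "f (P w' * av ?J k) = f (P w * U j k)"
    using n by (intro f_mult_av) (use 1[of "_ - j"] in auto)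
  let ?y = "av ?J k - free_scale z 1"
  have "(cmod (f (P w' * ?y)))\<^sup>2 \<le> Re (f (free_star ?y * ?y))" by (rule f_P_CS)
  also have "f (P w' * ?y) = f (P w * U j k) - z * f (P w)"
    by (simp add: right_diff_distrib f_rules 3 2)
  also have "Re (f (free_star ?y * ?y)) = Re (cor k) - 2 * Re (cnj z * mom k) + (cmod z)\<^sup>2 + (1 - Re (cor k)) / n"
  proof -
    have m: "f (av ?J k) = mom k"
      using f_mult_av[of ?J 1 k "mom k"] n by (simp add: f_U_mom)
    have "free_star ?y * ?y = free_star (av ?J k) * av ?J k - free_scale z (free_star (av ?J k))
        - free_scale (cnj z) (av ?J k) + free_scale (cnj z * z) 1"
      by (simp add: star_diff star_scale left_diff_distrib right_diff_distrib scale_diff mult.commute)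
    then have "f (free_star ?y * ?y) = f (free_star (av ?J k) * av ?J k) - z * cnj (mom k) - cnj z * mom k + cnj z * z"
      by (simp only: f_rules pf_star[OF f_pf] m mult_1_right)
    moreover have "Re (cnj z * z) = (cmod z)\<^sup>2" by (simp add: cmod_power2) (simp add: power2_eq_square)
    moreover have "Re (z * cnj (mom k)) = Re (cnj z * mom k)" by simp
    ultimately have "Re (f (free_star ?y * ?y)) = Re (f (free_star (av ?J k) * av ?J k)) - 2 * Re (cnj z * mom k) + (cmod z)\<^sup>2"
      by simp
    then show ?thesis using Re_f_av_av[of ?J k] n by simp
  qed
  finally show "(cmod (f (P w * U j k) - z * f (P w)))\<^sup>2 \<le>
    Re (cor k) - 2 * Re (cnj z * mom k) + (cmod z)\<^sup>2 + (1 - Re (cor k)) / n" .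
qed

lemma f_word_zero: assumes "ex w j \<notin> Del" shows "f (P w) = 0"
proof -
  let ?w = "filter (\<lambda>l. fst l \<noteq> j) w"
  obtain n where n: "P w \<doteq> free_scale (ph n) (P ?w * U j (ex w j))" using reorder by blast
  have "(cmod (f (P ?w * U j (ex w j))))\<^sup>2 \<le> 0"
    using f_word_U_bound[of j ?w "ex w j" 0] cor_zero[OF assms] by auto
  then show ?thesis using f_eqv[OF n] by (simp add: f_rules)
qed

text \<open>The averages over two long blocks have a difference of small norm, so the site of a factor
  does not matter as long as it is not used by the rest of the word.\<close>

lemma f_word_U_less:
  assumes i: "i \<notin> supp w" and j: "j \<notin> supp w" and ij: "i < j"
  shows "f (P w * U i k) = f (P w * U j k)"
proof -
  have "(cmod (f (P w * U i k) - f (P w * U j k)))\<^sup>2 \<le> 0"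
  proof (rule le_of_le_add_div[where c = "2 * (1 - Re (cor k))"])
    fix n :: nat assume n: "(0::nat) < n"
    let ?I = "{i..<i + int n}" and ?J = "{j + int n..<j + 2 * int n}"
    define h where "h s t = (\<lambda>x. if x < i then x else if x = i then i + s else if x < j then x + int n
      else if x = j then j + int n + t else x + 2 * int n)" for s t
    define w' where "w' = shl (h 0 0) w"
    have sm: "strict_mono (h s t)" if "0 \<le> s" "s \<le> int n" "0 \<le> t" "t \<le> int n" for s t
      using that ij by (auto simp: strict_mono_def h_def)
    have w': "shl (h s t) w = w'" for s t
      unfolding w'_def using i j by (intro shl_cong) (auto simp: h_def)
    have hij: "h s t i = i + s" "h s t j = j + n + t" for s t using ij by (simp_all add: h_def)
    have 1: "f (P w' * U (i + s) k) = f (P w * U i k)" if "0 \<le> s" "s \<le> int n" for s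
      using f_shift[OF sm[OF that, of 0], of "P w * U i k"] by (simp add: shift_mult shift_P shift_U w' hij)
    have 2: "f (P w' * U (j + n + t) k) = f (P w * U j k)" if "0 \<le> t" "t \<le> int n" for t
      using f_shift[OF sm[of 0, OF _ _ that], of "P w * U j k"] ij by (simp add: shift_mult shift_P shift_U w' hij)
    have 3: "f (P w' * av ?I k) = f (P w * U i k)"
      using n by (intro f_mult_av) (use 1[of "_ - i"] in auto)
    have 4: "f (P w' * av ?J k) = f (P w * U j k)"
      using n by (intro f_mult_av) (use 2[of "_ - j - n"] in auto)
    have c: "f (free_star (av ?I k) * av ?J k) = cor k"
      using n ij by (intro f_av_av_less) auto
    let ?y = "av ?I k - av ?J k"
    have "(cmod (f (P w' * ?y)))\<^sup>2 \<le> Re (f (free_star ?y * ?y))" by (rule f_P_CS)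
    also have "f (P w' * ?y) = f (P w * U i k) - f (P w * U j k)"
      by (simp add: right_diff_distrib f_rules 3 4)
    also have "Re (f (free_star ?y * ?y)) = 0 + (2 * (1 - Re (cor k))) / n"
    proof -
      have "f (free_star ?y * ?y) = f (free_star (av ?I k) * av ?I k) - cor k - cnj (cor k) + f (free_star (av ?J k) * av ?J k)"
        using c pf_hermitian[OF f_pf, of "av ?J k" "av ?I k"]
        by (simp add: star_diff left_diff_distrib right_diff_distrib f_rules)
      then show ?thesis using Re_f_av_av[of ?I k] Re_f_av_av[of ?J k] n by simp
    qed
    finally show "(cmod (f (P w * U i k) - f (P w * U j k)))\<^sup>2 \<le> 0 + (2 * (1 - Re (cor k))) / n" .
  qed
  then show ?thesis by simp
qed

lemma f_word_U_indep:
  assumes "i \<notin> supp w" "j \<notin> supp w" shows "f (P w * U i k) = f (P w * U j k)"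
  using f_word_U_less[OF assms, of k] f_word_U_less[OF assms(2,1), of k] by (metis linorder_less_linear)

end

section \<open>Arithmetic of \<open>\<Delta>\<^sub>\<alpha>\<close>\<close>

lemma ph_eq_1_iff: "ph n = 1 \<longleftrightarrow> (\<exists>q::int. \<alpha> * of_int n = 2 * pi * of_int q)"
  unfolding ph_def cis_conv_exp exp_eq_1 by (auto simp: algebra_simps)

text \<open>From \<open>\<alpha> a\<^sup>2 = 2 \<pi> p\<close> and \<open>\<alpha> b\<^sup>2 = 2 \<pi> q\<close> one gets \<open>(p b)\<^sup>2 = p q a\<^sup>2\<close>, so that \<open>a\<close> divides
  \<open>p b\<close>; the quotient \<open>r\<close> satisfies \<open>\<alpha> a b = 2 \<pi> r\<close>.\<close>

lemma Del_mult: assumes "a \<in> Del" "b \<in> Del" shows "ph (a * b) = 1"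
proof (cases "a = 0 \<or> b = 0")
  case False
  obtain p q :: int where p: "\<alpha> * of_int (a * a) = 2 * pi * of_int p" and q: "\<alpha> * of_int (b * b) = 2 * pi * of_int q"
    using assms by (auto simp: Del_def ph_eq_1_iff)
  have a: "real_of_int a \<noteq> 0" and b: "real_of_int b \<noteq> 0" using False by auto
  have \<alpha>: "\<alpha> = 2 * pi * p / (a * a)" "\<alpha> = 2 * pi * q / (b * b)"
    using p q a b by (simp_all add: field_simps)
  have "2 * pi * p / (a * a) = 2 * pi * q / (b * b)" using \<alpha> by metis
  then have "real_of_int p * (b * b) = q * (a * a)" using a b by (simp add: field_simps)
  then have "p * (b * b) = q * (a * a)" by (metis of_int_eq_iff of_int_mult)
  then have "(p * b)\<^sup>2 = p * q * a\<^sup>2" by (simp add: power2_eq_square algebra_simps)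
  then have "a\<^sup>2 dvd (p * b)\<^sup>2" by simp
  then have "a dvd p * b" by (simp only: pow_divides_pow_iff[OF pos2])
  then obtain r where r: "p * b = a * r" by (rule dvdE)
  have "\<alpha> * of_int (a * b) = 2 * pi * of_int (p * b) / of_int a"
    using a unfolding \<alpha>(1) by (simp add: field_simps)
  also have "\<dots> = 2 * pi * of_int r" using a unfolding r by simp
  finally show ?thesis unfolding ph_eq_1_iff by blast
qed auto

lemma Del_0 [simp]: "0 \<in> Del" by (simp add: Del_def)

lemma Del_minus: "a \<in> Del \<Longrightarrow> - a \<in> Del" by (simp add: Del_def)

lemma ph_mult_sum:
  assumes "\<And>i. i \<in> S \<Longrightarrow> ph (a * g i) = 1" shows "ph (a * (\<Sum>i\<in>S. g i)) = 1"
  using assms by (induction S rule: infinite_finite_induct) (auto simp: distrib_left ph_add)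

lemma kap_sum:
  assumes "finite S" "supp w \<subseteq> S"
  shows "kap j w = (\<Sum>i\<in>S. sgn (i - j) * ex w i)"
  using assms(2)
proof (induction w)
  case (Cons l w)
  obtain i b where l: "l = (i, b)" by fastforce
  have "(\<Sum>i'\<in>S. sgn (i' - j) * (if i = i' then sg b else 0)) = (\<Sum>i'\<in>S. if i' = i then sgn (i - j) * sg b else 0)"
    by (intro sum.cong) auto
  also have "\<dots> = sgn (i - j) * sg b" using assms(1) Cons.prems by (simp add: l)
  finally show ?case using Cons by (simp add: l distrib_left sum.distrib)
qed simp

lemma ph_kap: assumes "a \<in> Del" "\<And>i. ex w i \<in> Del" shows "ph (a * kap j w) = 1"
proof -
  have "ph (a * (sgn (i - j) * ex w i)) = 1" for i
  proof -
    have "sgn (i - j) * ex w i \<in> Del"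
      using assms(2)[of i] Del_minus by (cases i j rule: linorder_cases) auto
    then show ?thesis by (rule Del_mult[OF assms(1)])
  qed
  then show ?thesis unfolding kap_sum[OF finite_imageI[OF finite_set] order_refl] by (rule ph_mult_sum)
qed

section \<open>Functionals with product moments\<close>

lemma U_word: obtains v where "U j k = P v" "supp v \<subseteq> {j}" "\<And>i. ex v i = (if i = j then k else 0)"
proof -
  have "ex (replicate n (j, b)) i = (if i = j then int n * sg b else 0)" for n b i
    by (induction n) auto
  then show ?thesis
    by (intro that[of "replicate (nat \<bar>k\<bar>) (j, k < 0)"]) (auto simp: U_eq_P)
qed

text \<open>Functionals that are compared on words need not be positive or normalized.\<close>

definition bounded_fun :: "(int free_star_algebra \<Rightarrow> complex) \<Rightarrow> bool" where
  "bounded_fun f \<longleftrightarrow> (\<forall>x y. f (x + y) = f x + f y) \<and> (\<forall>c x. f (free_scale c x) = c * f x) \<and>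
     (\<exists>C. \<forall>x. cmod (f x) \<le> C * N x)"

lemma bf_eqv: assumes "bounded_fun f" "x \<doteq> y" shows "f x = f y"
proof -
  have "f (x + free_scale (-1) y) = f x + (-1) * f y" using assms(1) by (simp only: bounded_fun_def)
  then have "f (x - y) = f x - f y" by (simp add: scale_neg_one)
  moreover obtain C where "cmod (f (x - y)) \<le> C * N (x - y)" using assms(1) unfolding bounded_fun_def by blast
  ultimately show ?thesis using assms(2) by (simp add: eqv_def)
qed

lemma bf_scale: "bounded_fun f \<Longrightarrow> f (free_scale c x) = c * f x"
  by (simp add: bounded_fun_def)

lemma bf_eq_on_words:
  assumes "bounded_fun f" "bounded_fun g" "\<And>w. f (P w) = g (P w)" shows "f = g"
proof
  fix x show "f x = g x"
  proof (induction x rule: free_induct)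
    case (single w c)
    have "Poly_Mapping.single w c = free_scale c (P (letters w))" by (simp add: P_def scale_single)
    then show ?case using assms by (simp add: bf_scale)
  next
    case (add x y)
    then show ?case using assms by (simp add: bounded_fun_def)
  qed
qed

definition product_moments :: "(int free_star_algebra \<Rightarrow> complex) \<Rightarrow> (int \<Rightarrow> complex) \<Rightarrow> bool" where
  "product_moments f m \<longleftrightarrow> (\<forall>jks. distinct (map fst jks) \<longrightarrow> f (mono jks) = prod_list (map (\<lambda>(j, k). m k) jks))"

lemma product_moments_unique:
  assumes f: "bounded_fun f" "product_moments f m" and g: "bounded_fun g" "product_moments g m"
  shows "f = g"
proof (rule bf_eq_on_words[OF f(1) g(1)])
  fix w
  obtain n ds where ds: "distinct ds" "P w \<doteq> free_scale (ph n) (mono (map (\<lambda>j. (j, ex w j)) ds))"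
    using word_normal_form by blast
  have "f (mono (map (\<lambda>j. (j, ex w j)) ds)) = g (mono (map (\<lambda>j. (j, ex w j)) ds))"
    using f(2) g(2) ds(1) by (simp add: product_moments_def o_def)
  then show "f (P w) = g (P w)"
    using bf_eqv[OF f(1) ds(2)] bf_eqv[OF g(1) ds(2)] f(1) g(1) by (simp add: bf_scale)
qed

lemma product_moments_iff:
  assumes "bounded_fun f"
  shows "product_moments f m \<longleftrightarrow> f 1 = 1 \<and> (\<forall>w j k. j \<notin> supp w \<longrightarrow> f (P w * U j k) = f (P w) * m k)"
proof (intro iffI conjI allI impI)
  assume p: "product_moments f m"
  show "f 1 = 1" using p[unfolded product_moments_def, rule_format, of "[]"] by simp
  fix w j k assume j: "j \<notin> supp w"
  obtain n ds where ds: "distinct ds" "set ds = supp w" "P w \<doteq> free_scale (ph n) (mono (map (\<lambda>j. (j, ex w j)) ds))"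
    using word_normal_form by blast
  let ?x = "map (\<lambda>j. (j, ex w j)) ds"
  have "P w * U j k \<doteq> free_scale (ph n) (mono ?x) * U j k" by (rule eqv_mult_right[OF ds(3)])
  also have "\<dots> = free_scale (ph n) (mono (?x @ [(j, k)]))" by (simp add: mono_append)
  finally have "f (P w * U j k) = ph n * f (mono (?x @ [(j, k)]))"
    using bf_eqv[OF assms] bf_scale[OF assms] by metis
  moreover have "f (P w) = ph n * f (mono ?x)" using bf_eqv[OF assms ds(3)] by (simp add: bf_scale[OF assms])
  moreover have "f (mono (?x @ [(j, k)])) = f (mono ?x) * m k"
    using p[unfolded product_moments_def, rule_format, of ?x] p[unfolded product_moments_def, rule_format, of "?x @ [(j, k)]"] ds j
    by (simp add: o_def)
  ultimately show "f (P w * U j k) = f (P w) * m k" by simp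
next
  assume p: "f 1 = 1 \<and> (\<forall>w j k. j \<notin> supp w \<longrightarrow> f (P w * U j k) = f (P w) * m k)"
  show "product_moments f m"
    unfolding product_moments_def
  proof (intro allI impI)
    fix jks :: "(int \<times> int) list" assume "distinct (map fst jks)"
    then show "f (mono jks) = prod_list (map (\<lambda>(j, k). m k) jks)"
    proof (induction jks rule: rev_induct)
      case (snoc x jks)
      obtain j k where x: "x = (j, k)" by fastforce
      obtain w where w: "mono jks = P w" "supp w \<subseteq> fst ` set jks" using mono_eqv_P by blast
      have "j \<notin> supp w" using w snoc.prems x by auto
      then show ?case using p snoc w(1) by (simp add: x mono_append)
    qed (use p in simp)
  qed
qed

lemma spr_bounded: "spr f \<Longrightarrow> bounded_fun f"
  unfolding spr_def bounded_fun_def pos_functional_def by (metis mult_1)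

section \<open>Extreme spreadable states\<close>

text \<open>Extremality of a spreadable state in terms of its restriction to the free algebra.\<close>

definition extreme_spr :: "(int free_star_algebra \<Rightarrow> complex) \<Rightarrow> bool" where
  "extreme_spr f \<longleftrightarrow> spr f \<and> (\<forall>g h t. spr g \<longrightarrow> spr h \<longrightarrow> 0 < t \<longrightarrow> t < 1 \<longrightarrow>
     (\<forall>x. f x = of_real (1 - t) * g x + of_real t * h x) \<longrightarrow> g = f \<and> h = f)"

lemma cor_product: assumes f: "spr f" and p: "product_moments f (mom f)"
  shows "Re (cor f k) = (cmod (mom f k))\<^sup>2"
proof -
  obtain v where v: "U 0 (- k) = P v" "supp v \<subseteq> {0}" using U_word by metis
  have "cor f k = f (P v) * mom f k"
  proof -
    have "1 \<notin> supp v" using v(2) by auto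
    then show ?thesis
      using p unfolding product_moments_iff[OF spr_bounded[OF f]] cor_def[OF f] v(1) by blast
  qed
  also have "f (P v) = cnj (mom f k)"
    using pf_star[OF f_pf[OF f], of "U 0 k"] by (simp add: v(1)[symmetric] star_U mom_def[OF f])
  finally have "cor f k = cnj (mom f k) * mom f k" .
  then show ?thesis by (simp add: cmod_power2) (simp add: power2_eq_square)
qed

text \<open>The quantity \<open>?V g k\<close> is the mean square deviation from \<open>mom f k\<close> of the averages of \<open>U j k\<close>
  in the state \<open>g\<close>. It is nonnegative, affine in \<open>g\<close>, and zero for \<open>g = f\<close>, so it is zero for both
  parts of a decomposition of \<open>f\<close>. By the averaging bound both parts then have the moments of \<open>f\<close>.\<close>

lemma product_moments_extreme:
  assumes f: "spr f" and p: "product_moments f (mom f)"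
  shows "extreme_spr f"
  unfolding extreme_spr_def
proof (intro conjI[OF f] allI impI)
  fix g h and t :: real
  assume g: "spr g" and h: "spr h" and t: "0 < t" "t < 1"
    and eq: "\<forall>x. f x = of_real (1 - t) * g x + of_real t * h x"
  let ?V = "\<lambda>g k. Re (cor g k) - 2 * Re (cnj (mom f k) * mom g k) + (cmod (mom f k))\<^sup>2"
  have nn: "?V g' k \<ge> 0" if "spr g'" for g' k
    using f_word_U_bound[OF that, of 0 "[]" k "mom f k"] by (auto intro: order_trans[OF zero_le_power2])
  have z: "(1 - t) * ?V g k + t * ?V h k = 0" for k
  proof -
    have c: "Re (cor f k) = (1 - t) * Re (cor g k) + t * Re (cor h k)"
      using eq by (simp add: cor_def[OF f] cor_def[OF g] cor_def[OF h])
    have "mom f k = of_real (1 - t) * mom g k + of_real t * mom h k"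
      using eq by (simp add: mom_def[OF f] mom_def[OF g] mom_def[OF h])
    then have "Re (cnj (mom f k) * mom f k) = Re (cnj (mom f k) * (of_real (1 - t) * mom g k + of_real t * mom h k))"
      by (rule arg_cong)
    moreover have "Re (z * (of_real (1 - t) * a + of_real t * b)) = (1 - t) * Re (z * a) + t * Re (z * b)" for z a b
      by (simp add: algebra_simps)
    ultimately have "Re (cnj (mom f k) * mom f k) = (1 - t) * Re (cnj (mom f k) * mom g k) + t * Re (cnj (mom f k) * mom h k)"
      by metis
    moreover have "Re (cnj (mom f k) * mom f k) = (cmod (mom f k))\<^sup>2"
      by (simp add: cmod_power2) (simp add: power2_eq_square)
    ultimately show ?thesis using cor_product[OF f p, of k] c by (simp add: algebra_simps)
  qed
  have V: "?V g k = 0" "?V h k = 0" for k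
    using z[of k] nn[OF g, of k] nn[OF h, of k] t
      mult_nonneg_nonneg[of "1 - t" "?V g k"] mult_nonneg_nonneg[of t "?V h k"]
      add_nonneg_eq_0_iff[of "(1 - t) * ?V g k" "t * ?V h k"]
    by (auto simp del: times_complex.sel)
  have "g' = f" if g': "spr g'" "\<And>k. ?V g' k = 0" for g'
  proof -
    have "g' (P w * U j k) = g' (P w) * mom f k" if "j \<notin> supp w" for w j k
      using f_word_U_bound[OF g'(1) that, of k "mom f k"] by (simp only: g'(2)) simp
    then have "product_moments g' (mom f)"
      unfolding product_moments_iff[OF spr_bounded[OF g'(1)]] using g'(1) by (simp add: spr_def)
    then show "g' = f" using product_moments_unique p f g' spr_bounded by blast
  qed
  then show "g = f \<and> h = f" using g h V by blast
qed

text \<open>Any constant \<open>C\<close> will do: the estimate shows that \<open>g\<close> kills the ideal of the relations, and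
  then the GNS bound supplies the sharp constant.\<close>

lemma spr_normalize:
  assumes g: "pos_functional g" and le: "\<And>x. cmod (g x) \<le> C * N x" and one: "g 1 = of_real c" "c > 0"
    and sh: "\<And>h w. strict_mono h \<Longrightarrow> g (P (shl h w)) = g (P w)"
  shows "spr (\<lambda>x. g x / of_real c)"
  unfolding spr_def
proof (intro conjI allI impI)
  show "pos_functional (\<lambda>x. g x / of_real c)"
    using g one(2) by (auto simp: pos_functional_def add_divide_distrib complex_nonneg_Reals_iff Re_divide_of_real Im_divide_of_real)
  have "g (x * r * y) = 0" if "r \<in> torus_rels \<alpha>" for x r y
  proof -
    have "r \<doteq> 0" using that by (simp add: eqv_def N_rel)
    from eqv_mult_right[OF eqv_mult_left[OF this, of x], of y] have "N (x * r * y) = 0" by (simp add: eqv_def)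
    then show ?thesis using le[of "x * r * y"] by simp
  qed
  then have "cmod (g x) \<le> c * N x" for x
    using pos_functional_le_N[OF g, of x] by (simp add: one(1))
  then show "cmod (g x / of_real c) \<le> N x" for x
    using one(2) by (simp add: norm_divide field_simps)
  show "g 1 / of_real c = 1" using one by simp
  fix h :: "int \<Rightarrow> int" and x assume h: "strict_mono h"
  have "g (shift h x) = g x"
  proof (induction x rule: free_induct)
    case (single w d)
    have "Poly_Mapping.single w d = free_scale d (P (letters w))" by (simp add: P_def scale_single)
    then show ?case using sh[OF h] by (simp add: shift_scale shift_P pf_scale[OF g])
  qed (simp add: shift_add pf_add[OF g])
  then show "g (shift h x) / of_real c = g x / of_real c" by simp
qed

context
  fixes f k assumes f: "spr f" and k: "k \<in> Del"
begin

text \<open>The perturbation takes place at site \<open>0\<close>, after the word has been moved away from it.\<close>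

definition gap :: "int \<Rightarrow> int" where "gap x = (if x < 0 then x else x + 1)"

definition tilt :: "complex \<Rightarrow> int free_star_algebra \<Rightarrow> complex" where
  "tilt l x = f (free_star (1 + free_scale l (U 0 k)) * shift gap x * (1 + free_scale l (U 0 k)))"

lemma gap: "strict_mono gap" "0 \<notin> supp (shl gap w)"
  by (auto simp: gap_def strict_mono_def supp_shl)

lemma tilt_pf: "pos_functional (tilt l)"
  unfolding pos_functional_def
proof (intro conjI allI)
  fix x y c
  show "tilt l (x + y) = tilt l x + tilt l y" "tilt l (free_scale c x) = c * tilt l x"
    by (simp_all only: tilt_def shift_add shift_scale distrib_left[where a = "free_star _"] distrib_right[where c = "1 + _"]
        scale_mult_left scale_mult_right pf_add[OF f_pf[OF f]] pf_scale[OF f_pf[OF f]])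
  have "tilt l (free_star x * x) = f (free_star (shift gap x * (1 + free_scale l (U 0 k))) * (shift gap x * (1 + free_scale l (U 0 k))))"
    by (simp only: tilt_def shift_mult shift_star star_mult mult.assoc)
  then show "tilt l (free_star x * x) \<in> \<real>\<^sub>\<ge>\<^sub>0" using pf_pos[OF f_pf[OF f]] by simp
qed

lemma tilt_le: "cmod (tilt l x) \<le> (N (1 + free_scale l (U 0 k)))\<^sup>2 * N x"
proof -
  let ?V = "1 + free_scale l (U 0 k)"
  have "cmod (tilt l x) \<le> N (free_star ?V * shift gap x * ?V)" unfolding tilt_def by (rule f_le[OF f])
  also have "\<dots> \<le> N (free_star ?V * shift gap x) * N ?V" by (rule N_mult)
  also have "\<dots> \<le> (N (free_star ?V) * N (shift gap x)) * N ?V" by (intro mult_right_mono N_mult N_nonneg)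
  also have "\<dots> \<le> (N ?V * N x) * N ?V"
    using N_shift_le[OF gap(1), of x] by (intro mult_right_mono mult_mono) auto
  finally show ?thesis by (simp add: power2_eq_square algebra_simps)
qed

lemma f_word_U_zero: assumes "j \<notin> supp w" "ex w i \<notin> Del" shows "f (P w * U j a) = 0"
proof -
  obtain v where v: "U j a = P v" "\<And>i. ex v i = (if i = j then a else 0)" using U_word by metis
  have "i \<noteq> j" using assms ex_notin by fastforce
  then have "ex (w @ v) i \<notin> Del" using assms(2) by (simp add: ex_append v)
  from f_word_zero[OF f this] show ?thesis by (simp add: P_append v)
qed

text \<open>The perturbing factor on the left is carried across the word. This costs no phase, unless
  the word has exponents outside \<open>\<Delta>\<^sub>\<alpha>\<close>, in which case all terms vanish. Afterwards the site \<open>0\<close>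
  may be renamed \<open>j\<close>.\<close>

lemma tilt_word:
  assumes j: "j \<notin> supp w"
  shows "tilt l (P w) = (1 + of_real ((cmod l)\<^sup>2)) * f (P w) + l * f (P w * U j k) + cnj l * f (P w * U j (- k))"
proof -
  define w' where "w' = shl gap w"
  have w': "0 \<notin> supp w'" "shift gap (P w) = P w'" using gap(2) by (simp_all add: w'_def shift_P)
  have fw: "f (P w') = f (P w)" using f_shift[OF f gap(1), of "P w"] by (simp add: w')
  have fwU: "f (P w' * U 0 a) = f (P w * U j a)" for a
  proof -
    have "f (P w' * U 0 a) = f (P w' * U (gap j) a)"
      using shl_notin[OF gap(1) j] by (intro f_word_U_indep[OF f] w') (simp add: w'_def)
    also have "\<dots> = f (shift gap (P w * U j a))" by (simp add: shift_mult shift_U w')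
    finally show ?thesis using f_shift[OF f gap(1)] by simp
  qed
  let ?c = "ph (- k * kap 0 w')"
  have c: "?c * f (P w') = f (P w')" "?c * f (P w' * U 0 (- k)) = f (P w' * U 0 (- k))"
  proof -
    have "?c = 1 \<or> f (P w') = 0 \<and> f (P w' * U 0 (- k)) = 0"
      using ph_kap[OF Del_minus[OF k], of w' 0] f_word_zero[OF f, of w'] f_word_U_zero[OF w'(1)] by blast
    then show "?c * f (P w') = f (P w')" "?c * f (P w' * U 0 (- k)) = f (P w' * U 0 (- k))" by auto
  qed
  have comm: "U 0 (- k) * P w' \<doteq> free_scale ?c (P w' * U 0 (- k))" by (rule U_P_comm[OF w'(1)])
  have 1: "f (U 0 (- k) * P w') = f (P w' * U 0 (- k))"
    using f_eqv[OF f comm] c by (simp add: f_rules[OF f])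
  have "U 0 (- k) * P w' * U 0 k \<doteq> free_scale ?c (P w' * U 0 (- k)) * U 0 k" by (rule eqv_mult_right[OF comm])
  also have "\<dots> = free_scale ?c (P w' * (U 0 (- k) * U 0 k))" by (simp add: mult.assoc)
  also have "\<dots> \<doteq> free_scale ?c (P w' * U 0 (- k + k))" by (intro eqv_scale eqv_mult_left U_add)
  finally have 2: "f (U 0 (- k) * P w' * U 0 k) = f (P w')"
    using f_eqv[OF f] c by (simp add: f_rules[OF f])
  have "free_star (1 + free_scale l (U 0 k)) * P w' * (1 + free_scale l (U 0 k)) =
      P w' + free_scale l (P w' * U 0 k) + free_scale (cnj l) (U 0 (- k) * P w') + free_scale (cnj l * l) (U 0 (- k) * P w' * U 0 k)"
    by (simp add: star_add star_scale star_U distrib_left distrib_right scale_add mult.commute)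
  then have "tilt l (P w) = f (P w') + l * f (P w' * U 0 k) + cnj l * f (U 0 (- k) * P w') + cnj l * l * f (U 0 (- k) * P w' * U 0 k)"
    by (simp only: tilt_def w' f_rules[OF f])
  also have "cnj l * l = of_real ((cmod l)\<^sup>2)" by (simp only: complex_norm_square mult.commute)
  finally show ?thesis by (simp add: 1 2 2[unfolded mult.assoc] fw fwU algebra_simps)
qed

lemma exists_notin_supp: "\<exists>j::int. j \<notin> supp w"
  using ex_new_if_finite[OF infinite_UNIV_int, of "supp w"] by simp

lemma tilt_shift: assumes "strict_mono h" shows "tilt l (P (shl h w)) = tilt l (P w)"
proof -
  obtain j where j: "j \<notin> supp w" using exists_notin_supp by blast
  then have hj: "h j \<notin> supp (shl h w)"
    using assms by (intro shl_notin)
  have "f (P (shl h w) * U (h j) a) = f (P w * U j a)" for a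
    using f_shift[OF f assms, of "P w * U j a"] by (simp add: shift_mult shift_P shift_U)
  moreover have "f (P (shl h w)) = f (P w)"
    using f_shift[OF f assms, of "P w"] by (simp add: shift_P)
  ultimately show ?thesis by (simp add: tilt_word[OF j] tilt_word[OF hj])
qed

lemma norm_mom_le: "cmod (mom f a) \<le> 1"
  using f_le[OF f, of "U 0 a"] word_N_le[of "Word _"] by (metis P_def U_eq_P mom_def[OF f] order_trans)

lemma tilt_one:
  assumes "cmod l = 1 / 2"
  shows "tilt l 1 = of_real (5 / 4 + 2 * Re (l * mom f k))" "5 / 4 + 2 * Re (l * mom f k) > 0"
proof -
  have "mom f (- k) = cnj (mom f k)"
    using pf_star[OF f_pf[OF f], of "U 0 k"] by (simp add: star_U mom_def[OF f])
  then have "tilt l 1 = 1 + of_real ((cmod l)\<^sup>2) + (l * mom f k + cnj (l * mom f k))"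
    using tilt_word[of 0 "[]" l] f by (simp add: spr_def mom_def[OF f])
  then show "tilt l 1 = of_real (5 / 4 + 2 * Re (l * mom f k))"
    unfolding complex_add_cnj assms by (simp add: power2_eq_square)
  have "\<bar>Re (l * mom f k)\<bar> \<le> 1 / 2 * 1"
    using abs_Re_le_cmod[of "l * mom f k"] norm_mom_le[of k] by (simp only: norm_mult assms)
  then show "5 / 4 + 2 * Re (l * mom f k) > 0" by linarith
qed

text \<open>The terms linear in \<open>l\<close> cancel, so \<open>f\<close> is a convex combination of the two normalized
  perturbations. The value \<open>1 / 2\<close> of the modulus keeps both of them nonzero.\<close>

lemma tilt_sum: assumes "cmod l = 1 / 2" shows "tilt l x + tilt (- l) x = of_real (5 / 2) * f x"
proof -
  have "(\<lambda>x. tilt l x + tilt (- l) x) = (\<lambda>x. of_real (5 / 2) * f x)"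
  proof (rule bf_eq_on_words)
    have "cmod (tilt l x + tilt (- l) x) \<le> ((N (1 + free_scale l (U 0 k)))\<^sup>2 + (N (1 + free_scale (- l) (U 0 k)))\<^sup>2) * N x" for x
      using norm_triangle_ineq[of "tilt l x" "tilt (- l) x"] tilt_le[of l x] tilt_le[of "- l" x]
      by (simp only: distrib_right)
    then show "bounded_fun (\<lambda>x. tilt l x + tilt (- l) x)"
      unfolding bounded_fun_def
      by (auto simp: pf_add[OF tilt_pf] pf_scale[OF tilt_pf] distrib_left intro!: exI)
    have "cmod (of_real (5 / 2) * f x) \<le> (5 / 2) * N x" for x
      using f_le[OF f, of x] by (simp add: norm_mult)
    then show "bounded_fun (\<lambda>x. of_real (5 / 2) * f x)"
      unfolding bounded_fun_def by (auto simp: f_rules[OF f] distrib_left intro!: exI[of _ "5 / 2"])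
    fix w obtain j where j: "j \<notin> supp w" using exists_notin_supp by blast
    show "tilt l (P w) + tilt (- l) (P w) = of_real (5 / 2) * f (P w)"
    proof -
      have q: "complex_of_real ((cmod l)\<^sup>2) = 1 / 4" by (simp only: assms) (simp add: power2_eq_square)
      show ?thesis unfolding tilt_word[OF j] norm_minus_cancel q by (simp add: algebra_simps)
    qed
  qed
  then show ?thesis by (rule fun_cong)
qed

lemma tilt_extreme:
  assumes e: "extreme_spr f" and l: "cmod l = 1 / 2"
  shows "tilt l x = tilt l 1 * f x"
proof -
  have l': "cmod (- l) = 1 / 2" using l by simp
  define c where "c = 5 / 4 + 2 * Re (l * mom f k)"
  define d where "d = 5 / 4 + 2 * Re (- l * mom f k)"
  have c: "tilt l 1 = of_real c" "c > 0" and d: "tilt (- l) 1 = of_real d" "d > 0"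
    using tilt_one[OF l] tilt_one[OF l'] unfolding c_def d_def by blast+
  have cd: "c + d = 5 / 2" by (simp add: c_def d_def)
  note s1 = spr_normalize[OF tilt_pf tilt_le c tilt_shift]
  note s2 = spr_normalize[OF tilt_pf tilt_le d tilt_shift]
  let ?t = "d / (5 / 2)"
  have eq: "f x = of_real (1 - ?t) * (tilt l x / of_real c) + of_real ?t * (tilt (- l) x / of_real d)" for x
  proof -
    have "1 - ?t = c / (5 / 2)" using cd by (simp add: field_simps)
    then have e: "of_real (1 - ?t) = of_real c / (of_real (5 / 2) :: complex)" by (metis of_real_divide)
    have "of_real (1 - ?t) * (tilt l x / of_real c) = tilt l x / of_real (5 / 2)"
      unfolding e using c(2) by simp
    moreover have "of_real ?t * (tilt (- l) x / of_real d) = tilt (- l) x / of_real (5 / 2)"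
      using d(2) by simp
    ultimately have "of_real (1 - ?t) * (tilt l x / of_real c) + of_real ?t * (tilt (- l) x / of_real d)
        = (of_real (5 / 2) * f x) / of_real (5 / 2)"
      unfolding tilt_sum[OF l, of x, symmetric] by (simp only: add_divide_distrib)
    then show ?thesis by simp
  qed
  have t: "0 < ?t" "?t < 1" using c d cd by auto
  have "(\<lambda>x. tilt l x / of_real c) = f"
    using e[unfolded extreme_spr_def, THEN conjunct2, rule_format, OF s1 s2 t] eq by blast
  then have "f x = tilt l x / of_real c" by (rule fun_cong[symmetric])
  then show ?thesis using c by simp
qed

end

text \<open>Outside \<open>\<Delta>\<^sub>\<alpha>\<close> both sides vanish. Otherwise the perturbations with \<open>l = 1 / 2\<close> and
  \<open>l = \<i> / 2\<close> give the sum and the difference of the claims for \<open>k\<close> and \<open>- k\<close>.\<close>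

lemma extreme_product_moments:
  assumes e: "extreme_spr f" shows "product_moments f (mom f)"
proof -
  have f: "spr f" using e by (simp add: extreme_spr_def)
  have "f (P w * U j k) = f (P w) * mom f k" if j: "j \<notin> supp w" for w j k
  proof (cases "k \<in> Del")
    case False
    have "f (P v * U j k) = 0" if "j \<notin> supp v" for v j
      using f_word_U_bound[OF f that, of k 0] cor_zero[OF f False] by simp
    from this[OF j] this[of 0 "[]"] show ?thesis by (simp add: mom_def[OF f])
  next
    case True
    note F = tilt_extreme[OF f True e, of "1/2" "P w"] tilt_extreme[OF f True e, of "\<i>/2" "P w"]
    note G = tilt_word[OF f True j] tilt_word[OF f True, of 0 "[]"]
    have g: "f 1 = 1" "f (U 0 a) = mom f a" for a using f by (simp_all add: spr_def mom_def[OF f])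
    have "(f (P w * U j k) + f (P w * U j (- k))) / 2 = (mom f k + mom f (- k)) * f (P w) / 2"
      using F(1) G[of "1/2"] by (simp add: g algebra_simps add_divide_distrib)
    then have "f (P w * U j k) + f (P w * U j (- k)) = (mom f k + mom f (- k)) * f (P w)"
      by (simp only: divide_cancel_right) simp
    moreover have "\<i> / 2 * (f (P w * U j k) - f (P w * U j (- k))) = \<i> / 2 * ((mom f k - mom f (- k)) * f (P w))"
    proof -
      have "(1 + of_real ((cmod (\<i>/2))\<^sup>2)) * f (P w) + \<i>/2 * f (P w * U j k) + cnj (\<i>/2) * f (P w * U j (- k)) =
          ((1 + of_real ((cmod (\<i>/2))\<^sup>2)) + \<i>/2 * mom f k + cnj (\<i>/2) * mom f (- k)) * f (P w)"
        using F(2) G[of "\<i>/2"] by (simp only: g P_Nil mult_1 mult_1_right list.set image_empty empty_iff simp_thms) (simp add: norm_divide)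
      moreover have "cnj (\<i>/2) = - (\<i>/2)" by simp
      ultimately show ?thesis by (simp only: ring_distribs mult_minus_left) (simp add: mult.assoc)
    qed
    then have "f (P w * U j k) - f (P w * U j (- k)) = (mom f k - mom f (- k)) * f (P w)"
      unfolding mult_cancel_left by simp
    ultimately have "(f (P w * U j k) + f (P w * U j (- k))) + (f (P w * U j k) - f (P w * U j (- k))) =
        (mom f k + mom f (- k)) * f (P w) + (mom f k - mom f (- k)) * f (P w)" by (simp only:)
    then have "2 * f (P w * U j k) = 2 * (f (P w) * mom f k)" by (simp add: algebra_simps)
    then show ?thesis by simp
  qed
  then show ?thesis
    unfolding product_moments_iff[OF spr_bounded[OF f]] using f by (simp add: spr_def)
qed

end

section \<open>Finite measures on the circle with prescribed moments\<close>

definition pos_def :: "(int \<Rightarrow> complex) \<Rightarrow> bool" where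
  "pos_def m \<longleftrightarrow> (\<forall>(n::nat) a. (\<Sum>s<n. \<Sum>t<n. cnj (a s) * a t * m (int t - int s)) \<in> \<real>\<^sub>\<ge>\<^sub>0)"

text \<open>The Fejer mean of \<open>m\<close>, sampled at the roots of unity of order \<open>2 n\<close>. The frequencies of the
  mean are less than \<open>n\<close> in modulus, so that multiplication with a monomial of order up to \<open>n\<close>
  causes no aliasing, and the sampled measure has exactly the moments of the mean up to this
  order.\<close>

definition node :: "nat \<Rightarrow> nat \<Rightarrow> complex" where
  "node n r = cis (2 * pi * real r / real (2 * n))"

definition fejer_weight :: "(int \<Rightarrow> complex) \<Rightarrow> nat \<Rightarrow> nat \<Rightarrow> real" where
  "fejer_weight m n r =
     Re (\<Sum>s<n. \<Sum>t<n. cnj (node n r powi (- int s)) * node n r powi (- int t) * m (int t - int s)) / (2 * n * n)"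

lemma node_powi: "node n r powi k = cis (2 * pi * real r * of_int k / real (2 * n))"
  unfolding node_def by (simp add: cis_power_int mult.commute)

lemma norm_node [simp]: "cmod (node n r) = 1" by (simp add: node_def)

lemma node_nonzero [simp]: "node n r \<noteq> 0" using norm_node[of n r] by (metis norm_zero zero_neq_one)

lemma sum_node_powi:
  assumes n: "n > 0" and d: "\<bar>d\<bar> < 2 * int n"
  shows "(\<Sum>r<2*n. node n r powi d) = (if d = 0 then of_nat (2 * n) else 0)"
proof (cases "d = 0")
  case False
  define q where "q = cis (2 * pi * of_int d / real (2 * n))"
  have p: "node n r powi d = q ^ r" for r
  proof -
    have "q ^ r = cis (real r * (2 * pi * of_int d / real (2 * n)))" unfolding q_def by (rule Complex.DeMoivre)
    then show ?thesis unfolding node_powi by (simp add: mult_ac)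
  qed
  have "q \<noteq> 1"
  proof
    assume "q = 1"
    then obtain k :: int where "2 * pi * of_int d / real (2 * n) = of_int (2 * k) * pi"
      unfolding q_def cis_conv_exp exp_eq_1 by auto
    then have "2 * pi * real_of_int d = 2 * pi * of_int (k * (2 * int n))"
      using n by (simp add: field_simps)
    then have "d = k * (2 * int n)" by (simp only: mult_cancel_left of_int_eq_iff) simp
    moreover from this have "\<bar>k\<bar> \<ge> 1" using False by auto
    then have "1 * (2 * int n) \<le> \<bar>k\<bar> * (2 * int n)" by (intro mult_right_mono) auto
    ultimately show False using d by (simp add: abs_mult)
  qed
  moreover have "q ^ (2 * n) = 1"
  proof -
    have "real (2 * n) * (2 * pi * of_int d / real (2 * n)) = 2 * pi * of_int d" using n by simp
    then show ?thesis unfolding q_def Complex.DeMoivre by (metis cis_multiple_2pi Ints_of_int mult.assoc)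
  qed
  ultimately show ?thesis using False by (simp add: p sum_gp_strict)
qed simp

lemma sum_diagonal:
  fixes c :: complex
  assumes "\<bar>k\<bar> \<le> int n"
  shows "(\<Sum>s<n. \<Sum>t<n. if int t - int s = k then c else 0) = of_nat (n - nat \<bar>k\<bar>) * c"
proof -
  have pos: "(\<Sum>s<n. \<Sum>t<n. if int t - int s = int l then c else 0) = of_nat (n - l) * c" if "l \<le> n" for l
  proof -
    have "(\<Sum>t<n. if int t - int s = int l then c else 0) = (if s < n - l then c else 0)" for s
    proof -
      have "(\<Sum>t<n. if int t - int s = int l then c else 0) = (\<Sum>t<n. if t = s + l then c else 0)"
        by (intro sum.cong) auto
      then show ?thesis by (auto simp: less_diff_conv)
    qed
    then have "(\<Sum>s<n. \<Sum>t<n. if int t - int s = int l then c else 0) = (\<Sum>s\<in>{..<n} \<inter> {s. s < n - l}. c)"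
      by (simp add: sum.If_cases)
    also have "{..<n} \<inter> {s. s < n - l} = {..<n - l}" by auto
    finally show ?thesis by simp
  qed
  show ?thesis
  proof (cases "k \<ge> 0")
    case True
    then show ?thesis using pos[of "nat k"] assms by simp
  next
    case False
    have "(\<Sum>s<n. \<Sum>t<n. if int t - int s = k then c else 0) = (\<Sum>t<n. \<Sum>s<n. if int t - int s = k then c else 0)"
      by (rule sum.swap)
    also have "\<dots> = (\<Sum>t<n. \<Sum>s<n. if int s - int t = int (nat (- k)) then c else 0)"
      using False by (intro sum.cong) auto
    also have "\<dots> = of_nat (n - nat (- k)) * c" using False assms by (intro pos) auto
    finally show ?thesis using False by simp
  qed
qed

context
  fixes m :: "int \<Rightarrow> complex" assumes m: "pos_def m" "m 0 = 1"
begin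

lemma fejer_complex:
  "(\<Sum>s<n. \<Sum>t<n. cnj (node n r powi (- int s)) * node n r powi (- int t) * m (int t - int s)) / (2 * n * n)
    = of_real (fejer_weight m n r)"
  and fejer_nonneg: "fejer_weight m n r \<ge> 0"
proof -
  let ?S = "\<Sum>s<n. \<Sum>t<n. cnj (node n r powi (- int s)) * node n r powi (- int t) * m (int t - int s)"
  have "?S \<in> \<real>\<^sub>\<ge>\<^sub>0" by (rule m(1)[unfolded pos_def_def, rule_format])
  then have S: "?S = of_real (Re ?S)" "Re ?S \<ge> 0" by (auto simp: complex_nonneg_Reals_iff complex_eq_iff)
  then show "fejer_weight m n r \<ge> 0" by (simp add: fejer_weight_def)
  have "of_real (fejer_weight m n r) = of_real (Re ?S) / (2 * n * n)"
    by (simp add: fejer_weight_def)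
  then show "?S / (2 * n * n) = of_real (fejer_weight m n r)" using S(1) by simp
qed

text \<open>Orthogonality of the roots of unity leaves the terms with \<open>t - s = k\<close>, of which there are
  \<open>n - \<bar>k\<bar>\<close>.\<close>

lemma fejer_moment:
  assumes n: "n > 0" and k: "\<bar>k\<bar> \<le> int n"
  shows "(\<Sum>r<2*n. of_real (fejer_weight m n r) * node n r powi k) = of_nat (n - nat \<bar>k\<bar>) / of_nat n * m k"
proof -
  have t: "cnj (node n r powi (- int s)) * node n r powi (- int t) * c * node n r powi k
      = c * node n r powi (k - (int t - int s))" for r s t c
  proof -
    have "cnj (node n r powi (- int s)) = node n r powi int s"
      unfolding node_powi cis_cnj by simp
    then have "cnj (node n r powi (- int s)) * node n r powi (- int t) * node n r powi k = node n r powi (k - (int t - int s))"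
    proof -
      have "k - (int t - int s) = int s + - int t + k" by simp
      then show ?thesis
        using \<open>cnj (node n r powi (- int s)) = _\<close> by (simp only: power_int_add node_nonzero not_False_eq_True simp_thms)
    qed
    then show ?thesis by (simp add: algebra_simps)
  qed
  have "(\<Sum>r<2*n. of_real (fejer_weight m n r) * node n r powi k)
    = (\<Sum>r<2*n. \<Sum>s<n. \<Sum>t<n. m (int t - int s) * node n r powi (k - (int t - int s))) / (2 * n * n)"
    unfolding fejer_complex[symmetric] sum_divide_distrib
    by (simp only: sum_distrib_right times_divide_eq_left t sum_divide_distrib)
  also have "(\<Sum>r<2*n. \<Sum>s<n. \<Sum>t<n. m (int t - int s) * node n r powi (k - (int t - int s)))
    = (\<Sum>s<n. \<Sum>r<2*n. \<Sum>t<n. m (int t - int s) * node n r powi (k - (int t - int s)))"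
    by (rule sum.swap)
  also have "\<dots> = (\<Sum>s<n. \<Sum>t<n. \<Sum>r<2*n. m (int t - int s) * node n r powi (k - (int t - int s)))"
    by (intro sum.cong refl sum.swap)
  also have "\<dots> = (\<Sum>s<n. \<Sum>t<n. if int t - int s = k then of_nat (2 * n) * m k else 0)"
  proof (intro sum.cong refl)
    fix s t assume "s \<in> {..<n}" "t \<in> {..<n}"
    then have "\<bar>k - (int t - int s)\<bar> < 2 * int n" using k by auto
    from sum_node_powi[OF n this]
    show "(\<Sum>r<2*n. m (int t - int s) * node n r powi (k - (int t - int s))) = (if int t - int s = k then of_nat (2 * n) * m k else 0)"
      by (auto simp flip: sum_distrib_left)
  qed
  also have "\<dots> = of_nat (n - nat \<bar>k\<bar>) * (of_nat (2 * n) * m k)" by (rule sum_diagonal[OF k])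
  finally show ?thesis using n by simp
qed

lemma fejer_total: "n > 0 \<Longrightarrow> (\<Sum>r<2*n. fejer_weight m n r) = 1"
  using fejer_moment[of n 0] m(2) by (simp flip: of_real_sum)

lemma fejer_tendsto:
  "(\<lambda>n. \<Sum>r<2*n. of_real (fejer_weight m n r) * node n r powi k) \<longlonglongrightarrow> m k"
proof -
  have "(\<lambda>n. 1 - of_nat (nat \<bar>k\<bar>) * inverse (of_nat n :: complex)) \<longlonglongrightarrow> 1 - of_nat (nat \<bar>k\<bar>) * 0"
    by (rule tendsto_diff[OF tendsto_const tendsto_mult[OF tendsto_const lim_inverse_n]])
  then have "(\<lambda>n. (1 - of_nat (nat \<bar>k\<bar>) * inverse (of_nat n)) * m k) \<longlonglongrightarrow> (1 - of_nat (nat \<bar>k\<bar>) * 0) * m k"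
    by (rule tendsto_mult[OF _ tendsto_const])
  then have l: "(\<lambda>n. (1 - of_nat (nat \<bar>k\<bar>) * inverse (of_nat n)) * m k) \<longlonglongrightarrow> m k" by simp
  have "\<forall>\<^sub>F n in sequentially. (1 - of_nat (nat \<bar>k\<bar>) * inverse (of_nat n)) * m k =
      (\<Sum>r<2*n. of_real (fejer_weight m n r) * node n r powi k)"
    using eventually_gt_at_top[of "nat \<bar>k\<bar>"]
  proof eventually_elim
    case (elim n)
    then have "n > 0" "\<bar>k\<bar> \<le> int n" "nat \<bar>k\<bar> \<le> n" by auto
    then show ?case by (simp add: fejer_moment of_nat_diff diff_divide_distrib divide_inverse left_diff_distrib)
  qed
  from Lim_transform_eventually[OF l this] show ?thesis .
qed

end

text \<open>A block diagonal matrix whose blocks have rank one, with the fibres of \<open>r\<close> as blocks.\<close>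

lemma psd_blocks:
  fixes y :: "'a \<Rightarrow> complex"
  assumes "finite K"
  shows "(\<Sum>v\<in>K. \<Sum>w\<in>K. if r v = r w then cnj (y v) * y w else 0) \<in> \<real>\<^sub>\<ge>\<^sub>0"
proof -
  define Y where "Y c = (\<Sum>w\<in>{w \<in> K. r w = c}. y w)" for c
  have "(\<Sum>v\<in>K. \<Sum>w\<in>K. if r v = r w then cnj (y v) * y w else 0)
      = (\<Sum>c\<in>r ` K. \<Sum>v\<in>{v \<in> K. r v = c}. \<Sum>w\<in>K. if r v = r w then cnj (y v) * y w else 0)"
    by (rule sum.image_gen[OF assms])
  also have "\<dots> = (\<Sum>c\<in>r ` K. \<Sum>v\<in>{v \<in> K. r v = c}. cnj (y v) * Y c)"
  proof (intro sum.cong refl)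
    fix c v assume "v \<in> {v \<in> K. r v = c}"
    then have "(\<Sum>w\<in>K. if r v = r w then cnj (y v) * y w else 0) = (\<Sum>w\<in>K. if r w = c then cnj (y v) * y w else 0)"
      by (intro sum.cong) auto
    also have "\<dots> = (\<Sum>w\<in>{w \<in> K. r w = c}. cnj (y v) * y w)"
      using assms by (simp add: sum.inter_filter)
    finally show "(\<Sum>w\<in>K. if r v = r w then cnj (y v) * y w else 0) = cnj (y v) * Y c"
      by (simp add: Y_def sum_distrib_left)
  qed
  also have "\<dots> = (\<Sum>c\<in>r ` K. of_real ((cmod (Y c))\<^sup>2))"
    unfolding complex_norm_square by (intro sum.cong refl) (simp add: Y_def mult.commute flip: sum_distrib_right)
  also have "\<dots> = of_real (\<Sum>c\<in>r ` K. (cmod (Y c))\<^sup>2)" by simp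
  finally show ?thesis by (simp only: nonneg_Reals_of_real_iff sum_nonneg zero_le_power2)
qed

context nc_torus
begin

section \<open>Existence of product states\<close>

text \<open>\<open>ph (theta w)\<close> is the phase that arises when the letters of \<open>w\<close> are put into increasing
  order of their sites, and \<open>ph (swaps v w)\<close> the additional phase for merging two ordered words;
  \<open>low i w\<close> sums the exponents of the letters of \<open>w\<close> that have to pass a letter at \<open>i\<close>. The value
  of \<open>swaps\<close> depends on the two words only through their total exponents.\<close>

fun low :: "int \<Rightarrow> (int \<times> bool) list \<Rightarrow> int" where
  "low i [] = 0"
| "low i ((l, b) # w) = (if l < i then sg b else 0) + low i w"

fun swaps :: "(int \<times> bool) list \<Rightarrow> (int \<times> bool) list \<Rightarrow> int" where
  "swaps [] w = 0"
| "swaps ((i, b) # v) w = - sg b * low i w + swaps v w"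

fun theta :: "(int \<times> bool) list \<Rightarrow> int" where
  "theta [] = 0"
| "theta ((i, b) # w) = theta w - sg b * low i w"

definition inv_word :: "(int \<times> bool) list \<Rightarrow> (int \<times> bool) list" where
  "inv_word w = rev (map (\<lambda>(j, b). (j, \<not> b)) w)"

lemma inv_word_Cons: "inv_word ((i, b) # w) = inv_word w @ [(i, \<not> b)]"
  by (simp add: inv_word_def)

lemma low_append: "low i (v @ w) = low i v + low i w"
  by (induction i v rule: low.induct) auto

lemma swaps_append_left: "swaps (u @ v) w = swaps u w + swaps v w"
  by (induction u w rule: swaps.induct) auto

lemma swaps_append_right: "swaps v (u @ w) = swaps v u + swaps v w"
  by (induction v u rule: swaps.induct) (auto simp: low_append algebra_simps)

lemma theta_append: "theta (v @ w) = theta v + theta w + swaps v w"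
  by (induction v rule: theta.induct) (auto simp: low_append algebra_simps)

lemma swaps_inv_left: "swaps (inv_word v) w = - swaps v w"
  by (induction v w rule: swaps.induct) (auto simp: inv_word_Cons swaps_append_left, simp add: inv_word_def)

lemma ex_inv: "ex (inv_word w) j = - ex w j"
  by (induction w j rule: ex.induct) (auto simp: inv_word_Cons ex_append, simp add: inv_word_def)

lemma swaps_letter_inv: "swaps v [(i, \<not> b)] = - swaps v [(i, b)]"
  by (induction v "[(i, b)]" rule: swaps.induct) auto

lemma theta_inv: "theta (inv_word v) = - theta v + swaps v v"
proof (induction v)
  case Nil
  show ?case by (simp add: inv_word_def)
next
  case (Cons l v)
  obtain i b where l: "l = (i, b)" by fastforce
  have "swaps v ((i, b) # v) = swaps v [(i, b)] + swaps v v"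
    using swaps_append_right[of v "[(i, b)]" v] by simp
  then show ?case
    using Cons by (simp add: l inv_word_Cons theta_append swaps_inv_left swaps_letter_inv)
qed

lemma low_sum:
  assumes "finite S" "supp w \<subseteq> S" shows "low i w = (\<Sum>l\<in>S. if l < i then ex w l else 0)"
  using assms(2)
proof (induction w)
  case (Cons x w)
  obtain l b where x: "x = (l, b)" by fastforce
  have "(\<Sum>l'\<in>S. if l' < i then ex (x # w) l' else 0) =
      (\<Sum>l'\<in>S. (if l' = l then (if l < i then sg b else 0) else 0) + (if l' < i then ex w l' else 0))"
    by (intro sum.cong) (auto simp: x)
  also have "\<dots> = (if l < i then sg b else 0) + (\<Sum>l'\<in>S. if l' < i then ex w l' else 0)"
    using assms(1) Cons.prems by (simp add: sum.distrib x)
  finally show ?case using Cons by (simp add: x)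
qed (simp cong: if_cong)

lemma swaps_sum:
  assumes "finite S" "supp v \<subseteq> S" "supp w \<subseteq> S"
  shows "swaps v w = - (\<Sum>i\<in>S. \<Sum>l\<in>S. if l < i then ex v i * ex w l else 0)"
  using assms(2)
proof (induction v)
  case (Cons x v)
  obtain i b where x: "x = (i, b)" by fastforce
  have "(\<Sum>i'\<in>S. \<Sum>l\<in>S. if l < i' then ex (x # v) i' * ex w l else 0) =
      (\<Sum>i'\<in>S. (if i' = i then sg b * low i w else 0) + (\<Sum>l\<in>S. if l < i' then ex v i' * ex w l else 0))"
    unfolding low_sum[OF assms(1,3)]
    by (intro sum.cong refl) (auto simp: x sum_distrib_left distrib_right if_distrib cong: if_cong simp flip: sum.distrib intro!: sum.cong)
  also have "\<dots> = sg b * low i w + (\<Sum>i'\<in>S. \<Sum>l\<in>S. if l < i' then ex v i' * ex w l else 0)"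
    using assms(1) Cons.prems by (simp add: sum.distrib x)
  finally show ?case using Cons by (simp add: x)
qed (simp cong: if_cong)

text \<open>The functional whose value at the ordered monomial with exponents \<open>g\<close> is \<open>F g\<close>.\<close>

definition twisted :: "((int \<Rightarrow> int) \<Rightarrow> complex) \<Rightarrow> int free_star_algebra \<Rightarrow> complex" where
  "twisted F x = (\<Sum>w\<in>Poly_Mapping.keys x. Poly_Mapping.lookup x w * (ph (theta (letters w)) * F (ex (letters w))))"

lemma twisted_add: "twisted F (x + y) = twisted F x + twisted F y"
  unfolding twisted_def
  by (rule lin_ext_add[where F = "\<lambda>w c. c * (ph (theta (letters w)) * F (ex (letters w)))"]) (auto simp: distrib_right)

lemma twisted_single: "twisted F (Poly_Mapping.single w c) = c * (ph (theta (letters w)) * F (ex (letters w)))"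
  by (simp add: twisted_def)

lemma twisted_scale: "twisted F (free_scale c x) = c * twisted F x"
  by (induction x rule: free_induct) (simp_all add: scale_single twisted_single scale_add twisted_add distrib_left)

lemma twisted_P: "twisted F (P w) = ph (theta w) * F (ex w)"
  by (simp add: P_def twisted_single)

lemma twisted_sum: "twisted F (sum g I) = (\<Sum>i\<in>I. twisted F (g i))"
proof -
  have "twisted F 0 = 0" by (simp add: twisted_def)
  then show ?thesis by (induction I rule: infinite_finite_induct) (auto simp: twisted_add)
qed

lemma twisted_diff: "twisted F (x - y) = twisted F x - twisted F y"
  using twisted_add[of F x "free_scale (-1) y"] by (simp add: twisted_scale) (simp add: scale_neg_one)

text \<open>The relations are homogeneous in the exponents, and the phase \<open>theta\<close> is made to change
  under an exchange of neighbouring letters exactly as the relations demand.\<close>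

lemma twisted_kill: assumes "r \<in> torus_rels \<alpha>" shows "twisted F (x * r * y) = 0"
proof -
  have w: "twisted F (P v * r * P w) = 0" for v w
  proof -
    have gens: "free_star (free_gen l) * free_gen l = P [(l, True), (l, False)]"
      "free_gen l * free_star (free_gen l) = P [(l, False), (l, True)]"
      "free_gen l * free_gen k = P [(l, False), (k, False)]" for l k
      by (simp_all add: P_Cons U_1 U_m1)
    have "exp (\<i> * of_real \<alpha>) = ph 1" by (simp add: ph_def cis_conv_exp)
    then consider (1) l where "r = P [(l, True), (l, False)] - 1" | (2) l where "r = P [(l, False), (l, True)] - 1"
      | (3) l k where "l < k" "r = P [(l, False), (k, False)] - free_scale (ph 1) (P [(k, False), (l, False)])"
      using assms unfolding torus_rels_def gens by auto
    then show ?thesis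
    proof cases
      case 3
      have *: "ex (v @ [(l, False), (k, False)] @ w) = ex (v @ [(k, False), (l, False)] @ w)"
        by (rule ext) (simp add: ex_append)
      have "theta (v @ [(l, False), (k, False)] @ w) = theta (v @ [(k, False), (l, False)] @ w) + 1"
      proof -
        have "swaps v ([(l, False), (k, False)] @ w) = swaps v ([(k, False), (l, False)] @ w)"
          by (induction v "[(l, False), (k, False)] @ w" rule: swaps.induct) auto
        then show ?thesis using 3(1) by (simp add: theta_append)
      qed
      then have "twisted F (P (v @ [(l, False), (k, False)] @ w)) = ph 1 * twisted F (P (v @ [(k, False), (l, False)] @ w))"
        unfolding twisted_P * by (simp add: ph_add)
      moreover have "P v * r * P w = P (v @ [(l, False), (k, False)] @ w) - free_scale (ph 1) (P (v @ [(k, False), (l, False)] @ w))"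
        unfolding 3(2) P_append by (simp add: algebra_simps)
      ultimately show ?thesis by (simp add: twisted_diff twisted_scale)
    next
      case 1
      have *: "ex (v @ [(l, True), (l, False)] @ w) = ex (v @ w)" by (rule ext) (simp add: ex_append)
      have "swaps v ([(l, True), (l, False)] @ w) = swaps v w"
        by (induction v w rule: swaps.induct) auto
      then have "twisted F (P (v @ [(l, True), (l, False)] @ w)) = twisted F (P (v @ w))"
        unfolding twisted_P * by (simp add: theta_append)
      moreover have "P v * r * P w = P (v @ [(l, True), (l, False)] @ w) - P (v @ w)"
        unfolding 1 P_append by (simp add: algebra_simps)
      ultimately show ?thesis by (simp add: twisted_diff)
    next
      case 2
      have *: "ex (v @ [(l, False), (l, True)] @ w) = ex (v @ w)" by (rule ext) (simp add: ex_append)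
      have "swaps v ([(l, False), (l, True)] @ w) = swaps v w"
        by (induction v w rule: swaps.induct) auto
      then have "twisted F (P (v @ [(l, False), (l, True)] @ w)) = twisted F (P (v @ w))"
        unfolding twisted_P * by (simp add: theta_append)
      moreover have "P v * r * P w = P (v @ [(l, False), (l, True)] @ w) - P (v @ w)"
        unfolding 2 P_append by (simp add: algebra_simps)
      ultimately show ?thesis by (simp add: twisted_diff)
    qed
  qed
  have s: "Poly_Mapping.single v c = free_scale c (P (letters v))" for v c by (simp add: P_def scale_single)
  have "twisted F (P v * r * y) = 0" for v
    by (induction y rule: free_induct) (simp_all add: s distrib_left twisted_add twisted_scale w)
  then show ?thesis
    by (induction x rule: free_induct) (simp_all add: s distrib_right twisted_add twisted_scale)
qed

lemma twisted_square:
  "twisted F (free_star x * x) = (\<Sum>v\<in>Poly_Mapping.keys x. \<Sum>w\<in>Poly_Mapping.keys x.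
     cnj (Poly_Mapping.lookup x v) * Poly_Mapping.lookup x w *
     (ph (- theta (letters v) + swaps (letters v) (letters v) + theta (letters w) - swaps (letters v) (letters w))
      * F (\<lambda>j. ex (letters w) j - ex (letters v) j)))"
proof -
  have sP: "free_star (P v) = P (inv_word v)" for v
    by (simp add: P_def star_single star_word_def inv_word_def)
  have "free_star y * y = (\<Sum>v\<in>K. \<Sum>w\<in>K. free_scale (cnj (c v) * c w) (P (inv_word (letters v) @ letters w)))"
    if "y = (\<Sum>w\<in>K. free_scale (c w) (P (letters w)))" for y K c
    unfolding that
    by (simp only: star_sum sum_product star_scale sP scale_mult_left scale_mult_right scale_scale P_append mult.commute[of "c _" "cnj _"])
  note * = this[OF free_eq_sum_P]
  have "free_star x * x = (\<Sum>v\<in>Poly_Mapping.keys x. \<Sum>w\<in>Poly_Mapping.keys x.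
      free_scale (cnj (Poly_Mapping.lookup x v) * Poly_Mapping.lookup x w) (P (inv_word (letters v) @ letters w)))"
    by (rule *)
  moreover have "ex (inv_word v @ w) = (\<lambda>j. ex w j - ex v j)" for v w
    by (rule ext) (simp add: ex_append ex_inv)
  moreover have "theta (inv_word v @ w) = - theta v + swaps v v + theta w - swaps v w" for v w
    by (simp add: theta_append theta_inv swaps_inv_left)
  ultimately show ?thesis
    by (simp only: twisted_sum twisted_scale twisted_P)
qed

definition prod_weight :: "(int \<Rightarrow> complex) \<Rightarrow> (int \<Rightarrow> int) \<Rightarrow> complex" where
  "prod_weight m g = (if \<forall>j. g j \<in> Del then \<Prod>j | g j \<noteq> 0. m (g j) else 0)"

lemma prod_weight_superset:
  assumes "finite S" "\<And>j. j \<notin> S \<Longrightarrow> g j = 0" "m 0 = 1"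
  shows "prod_weight m g = (if \<forall>j. g j \<in> Del then \<Prod>j\<in>S. m (g j) else 0)"
proof -
  have "(\<Prod>j | g j \<noteq> 0. m (g j)) = (\<Prod>j\<in>S. m (g j))"
    using assms by (intro prod.mono_neutral_left) auto
  then show ?thesis by (simp add: prod_weight_def)
qed

lemma Del_diff: assumes "a \<in> Del" "b \<in> Del" shows "a - b \<in> Del"
proof -
  have "ph (a * a + b * b + (- (a * b) - a * b)) = 1"
    using assms Del_mult[OF assms] Del_mult[OF assms(1) Del_minus[OF assms(2)]]
    by (simp only: ph_add diff_conv_add_uminus Del_def mem_Collect_eq) (simp add: Del_def)
  then show ?thesis by (simp add: Del_def algebra_simps)
qed

lemma Del_add: assumes "a \<in> Del" "b \<in> Del" shows "a + b \<in> Del"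
  using Del_diff[OF assms(1) Del_minus[OF assms(2)]] by simp

lemma ph_sum_eq_1: "(\<And>i. i \<in> S \<Longrightarrow> ph (g i) = 1) \<Longrightarrow> ph (\<Sum>i\<in>S. g i) = 1"
  using ph_mult_sum[of S 1 g] by simp

lemma ph_uminus_eq_1: "ph n = 1 \<Longrightarrow> ph (- n) = 1"
  by (metis cnj_ph complex_cnj_one)

text \<open>Words are grouped by their exponents modulo \<open>\<Delta>\<^sub>\<alpha>\<close>, and \<open>u = r v\<close> represents the group of \<open>v\<close>
  and \<open>w\<close>. Phases with two exponents in \<open>\<Delta>\<^sub>\<alpha>\<close> are trivial, so \<open>swaps v v - swaps v w\<close> may be
  replaced by \<open>swaps u v - swaps u w\<close>, which separates the variables \<open>v\<close> and \<open>w\<close>. The matrix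
  entries thereby take the form \<open>cnj (y v) * y w\<close> within a group, and they are zero between
  different groups.\<close>

lemma twisted_char_nonneg:
  fixes \<zeta> :: "int \<Rightarrow> complex" and K :: "int star_word set"
  assumes \<zeta>: "\<And>j. cmod (\<zeta> j) = 1" and S: "finite S" "\<And>w. w \<in> K \<Longrightarrow> supp (letters w) \<subseteq> S" and K: "finite K"
  shows "(\<Sum>v\<in>K. \<Sum>w\<in>K. cnj (c v) * c w *
     (ph (- theta (letters v) + swaps (letters v) (letters v) + theta (letters w) - swaps (letters v) (letters w))
      * (if \<forall>j. ex (letters w) j - ex (letters v) j \<in> Del then \<Prod>j\<in>S. \<zeta> j powi (ex (letters w) j - ex (letters v) j) else 0))) \<in> \<real>\<^sub>\<ge>\<^sub>0"
proof -
  define rel where "rel v w \<longleftrightarrow> (\<forall>j. ex (letters w) j - ex (letters v) j \<in> Del)" for v w :: "int star_word"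
  have rel_refl: "rel v v" for v by (simp add: rel_def)
  have rel_sym: "rel w v" if "rel v w" for v w
  proof -
    have "ex (letters v) j - ex (letters w) j \<in> Del" for j
      using that Del_minus[of "ex (letters w) j - ex (letters v) j"] by (simp add: rel_def)
    then show ?thesis by (simp add: rel_def)
  qed
  have rel_trans: "rel u w" if "rel u v" "rel v w" for u v w
  proof -
    have "ex (letters w) j - ex (letters u) j \<in> Del" for j
      using that Del_add[of "ex (letters w) j - ex (letters v) j" "ex (letters v) j - ex (letters u) j"]
      by (simp add: rel_def)
    then show ?thesis by (simp add: rel_def)
  qed
  define r where "r w = (SOME v. v \<in> K \<and> rel v w)" for w
  have r: "r w \<in> K" "rel (r w) w" if "w \<in> K" for w
    using someI[of "\<lambda>v. v \<in> K \<and> rel v w" w] that rel_refl by (auto simp: r_def)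
  have r_iff: "r v = r w \<longleftrightarrow> rel v w" if "v \<in> K" "w \<in> K" for v w
  proof
    assume "r v = r w"
    then show "rel v w" using r[OF that(1)] r[OF that(2)] rel_trans rel_sym by metis
  next
    assume "rel v w"
    then have "rel u v \<longleftrightarrow> rel u w" for u using rel_trans rel_sym by blast
    then show "r v = r w" by (simp add: r_def)
  qed
  define y where "y w = c w * ph (theta (letters w) - swaps (letters (r w)) (letters w)) * (\<Prod>j\<in>S. \<zeta> j powi ex (letters w) j)" for w
  have \<zeta>0: "\<zeta> j \<noteq> 0" for j using \<zeta>[of j] by auto
  have "cnj (c v) * c w *
     (ph (- theta (letters v) + swaps (letters v) (letters v) + theta (letters w) - swaps (letters v) (letters w))
      * (if \<forall>j. ex (letters w) j - ex (letters v) j \<in> Del then \<Prod>j\<in>S. \<zeta> j powi (ex (letters w) j - ex (letters v) j) else 0))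
    = (if r v = r w then cnj (y v) * y w else 0)" if vw: "v \<in> K" "w \<in> K" for v w
  proof (cases "rel v w")
    case False
    then have "r v \<noteq> r w" "\<not> (\<forall>j. ex (letters w) j - ex (letters v) j \<in> Del)"
      using r_iff[OF vw] by (simp_all only: rel_def simp_thms)
    then show ?thesis by (simp only: if_False if_not_P mult_zero_right)
  next
    case True
    define u where "u = r v"
    have u: "u \<in> K" "rel u v" "r w = u" using r[OF vw(1)] r_iff[OF vw] True by (auto simp: u_def)
    let ?g = "\<lambda>v. ex (letters v)"
    have "ph ((swaps (letters v) (letters v) - swaps (letters v) (letters w)) - (swaps (letters u) (letters v) - swaps (letters u) (letters w))) = 1"
    proof -
      have "(swaps (letters v) (letters v) - swaps (letters v) (letters w)) - (swaps (letters u) (letters v) - swaps (letters u) (letters w))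
        = (\<Sum>i\<in>S. \<Sum>l\<in>S. if l < i then (?g v i - ?g u i) * (?g w l - ?g v l) else 0)"
        using S vw u by (simp add: swaps_sum[where S = S] algebra_simps flip: sum.distrib sum_subtractf sum_negf)
          (intro sum.cong refl, simp add: algebra_simps)
      moreover have "ph (if l < i then (?g v i - ?g u i) * (?g w l - ?g v l) else 0) = 1" for i l
        using True u(2) Del_mult by (simp add: rel_def)
      ultimately show ?thesis by (simp add: ph_sum_eq_1)
    qed
    then have p1: "ph (swaps (letters v) (letters v) - swaps (letters v) (letters w)) = ph (swaps (letters u) (letters v) - swaps (letters u) (letters w))"
      using ph_add[of "(swaps (letters v) (letters v) - swaps (letters v) (letters w)) - (swaps (letters u) (letters v) - swaps (letters u) (letters w))" "swaps (letters u) (letters v) - swaps (letters u) (letters w)"]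
      by simp
    have p2: "ph (- theta (letters v) + swaps (letters v) (letters v) + theta (letters w) - swaps (letters v) (letters w))
        = cnj (ph (theta (letters v) - swaps (letters u) (letters v))) * ph (theta (letters w) - swaps (letters u) (letters w))"
    proof -
      have "ph (- theta (letters v) + swaps (letters v) (letters v) + theta (letters w) - swaps (letters v) (letters w))
        = ph (theta (letters w) - theta (letters v)) * ph (swaps (letters v) (letters v) - swaps (letters v) (letters w))"
        unfolding ph_add[symmetric] by (simp add: algebra_simps)
      also have "\<dots> = ph (theta (letters w) - theta (letters v) + (swaps (letters u) (letters v) - swaps (letters u) (letters w)))"
        unfolding p1 ph_add ..
      also have "\<dots> = ph (- (theta (letters v) - swaps (letters u) (letters v)) + (theta (letters w) - swaps (letters u) (letters w)))"
        by (simp add: algebra_simps)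
      finally show ?thesis by (simp add: cnj_ph ph_add)
    qed
    have p3: "(\<Prod>j\<in>S. \<zeta> j powi (?g w j - ?g v j)) = cnj (\<Prod>j\<in>S. \<zeta> j powi ?g v j) * (\<Prod>j\<in>S. \<zeta> j powi ?g w j)"
    proof -
      have "\<zeta> j powi (?g w j - ?g v j) = cnj (\<zeta> j powi ?g v j) * \<zeta> j powi ?g w j" for j
      proof -
        have "\<zeta> j * cnj (\<zeta> j) = 1" using complex_norm_square[of "\<zeta> j"] \<zeta>[of j] by simp
        then have "cnj (\<zeta> j) = inverse (\<zeta> j)" by (rule inverse_unique[symmetric])
        then show ?thesis using \<zeta>0[of j] by (simp add: power_int_diff power_int_inverse divide_inverse)
      qed
      then show ?thesis by (simp flip: prod.distrib)
    qed
    show ?thesis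
      using True r_iff[OF vw] unfolding rel_def y_def u(3) u_def[symmetric] p2 p3 by (simp add: mult_ac)
  qed
  then have "(\<Sum>v\<in>K. \<Sum>w\<in>K. cnj (c v) * c w *
     (ph (- theta (letters v) + swaps (letters v) (letters v) + theta (letters w) - swaps (letters v) (letters w))
      * (if \<forall>j. ex (letters w) j - ex (letters v) j \<in> Del then \<Prod>j\<in>S. \<zeta> j powi (ex (letters w) j - ex (letters v) j) else 0)))
    = (\<Sum>v\<in>K. \<Sum>w\<in>K. if r v = r w then cnj (y v) * y w else 0)"
    by (intro sum.cong refl)
  then show ?thesis using psd_blocks[OF K, of r y] by simp
qed

end

lemma nonneg_Reals_sum: "(\<And>i. i \<in> I \<Longrightarrow> f i \<in> \<real>\<^sub>\<ge>\<^sub>0) \<Longrightarrow> sum f I \<in> (\<real>\<^sub>\<ge>\<^sub>0 :: complex set)"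
  by (induction I rule: infinite_finite_induct) (auto intro: nonneg_Reals_add_I)

context nc_torus
begin

context
  fixes m :: "int \<Rightarrow> complex" assumes m: "pos_def m" "m 0 = 1"
begin

definition approx_moment :: "nat \<Rightarrow> int \<Rightarrow> complex" where
  "approx_moment n k = (\<Sum>r<2*n. of_real (fejer_weight m n r) * node n r powi k)"

lemma approx_moment_0: "n > 0 \<Longrightarrow> approx_moment n 0 = 1"
  using fejer_total[OF m, of n] by (simp add: approx_moment_def flip: of_real_sum)

text \<open>Multiplying out the finite sums in the moments turns the functional into a nonnegative
  combination of functionals that have one character, the node \<open>\<rho> j\<close>, at each site \<open>j\<close>.\<close>

lemma twisted_approx_nonneg:
  assumes n: "n > 0"
  shows "twisted (prod_weight (approx_moment n)) (free_star x * x) \<in> \<real>\<^sub>\<ge>\<^sub>0"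
proof -
  define K where "K = Poly_Mapping.keys x"
  define S where "S = (\<Union>w\<in>K. supp (letters w))"
  have K: "finite K" by (simp add: K_def)
  have S: "finite S" "\<And>w. w \<in> K \<Longrightarrow> supp (letters w) \<subseteq> S" using K by (auto simp: S_def)
  let ?c = "Poly_Mapping.lookup x"
  define PS where "PS = PiE S (\<lambda>_. {..<2*n})"
  define W where "W \<rho> = (\<Prod>j\<in>S. fejer_weight m n (\<rho> j))" for \<rho> :: "int \<Rightarrow> nat"
  define C where "C \<rho> v w = (if \<forall>j. ex (letters w) j - ex (letters v) j \<in> Del
      then \<Prod>j\<in>S. node n (\<rho> j) powi (ex (letters w) j - ex (letters v) j) else 0)" for \<rho> :: "int \<Rightarrow> nat" and v w
  define T where "T v w = cnj (?c v) * ?c w" for v w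
  define H where "H v w = ph (- theta (letters v) + swaps (letters v) (letters v) + theta (letters w) - swaps (letters v) (letters w))" for v w
  have F: "prod_weight (approx_moment n) (\<lambda>j. ex (letters w) j - ex (letters v) j) = (\<Sum>\<rho>\<in>PS. of_real (W \<rho>) * C \<rho> v w)"
    if vw: "v \<in> K" "w \<in> K" for v w
  proof -
    let ?g = "\<lambda>j. ex (letters w) j - ex (letters v) j"
    have z: "?g j = 0" if "j \<notin> S" for j
    proof -
      have "j \<notin> supp (letters v)" "j \<notin> supp (letters w)" using that S(2)[OF vw(1)] S(2)[OF vw(2)] by blast+
      then have "ex (letters v) j = 0" "ex (letters w) j = 0" using ex_notin by blast+
      then show ?thesis by simp
    qed
    have "prod_weight (approx_moment n) ?g = (if \<forall>j. ?g j \<in> Del then \<Prod>j\<in>S. approx_moment n (?g j) else 0)"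
    proof (rule prod_weight_superset[OF S(1)])
      show "?g j = 0" if "j \<notin> S" for j using that by (rule z)
    qed (rule approx_moment_0[OF n])
    also have "(\<Prod>j\<in>S. approx_moment n (?g j)) = (\<Sum>\<rho>\<in>PS. \<Prod>j\<in>S. of_real (fejer_weight m n (\<rho> j)) * node n (\<rho> j) powi ?g j)"
      unfolding approx_moment_def PS_def by (rule prod_sum_PiE) (use S in auto)
    finally have e: "prod_weight (approx_moment n) ?g = (if \<forall>j. ?g j \<in> Del
      then \<Sum>\<rho>\<in>PS. \<Prod>j\<in>S. of_real (fejer_weight m n (\<rho> j)) * node n (\<rho> j) powi ?g j else 0)" .
    show ?thesis
    proof (cases "\<forall>j. ?g j \<in> Del")
      case True
      show ?thesis unfolding e C_def W_def if_P[OF True] by (simp add: prod.distrib)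
    next
      case False
      show ?thesis unfolding e C_def if_not_P[OF False] by simp
    qed
  qed
  have "twisted (prod_weight (approx_moment n)) (free_star x * x)
      = (\<Sum>v\<in>K. \<Sum>w\<in>K. T v w * (H v w * (\<Sum>\<rho>\<in>PS. of_real (W \<rho>) * C \<rho> v w)))"
    unfolding twisted_square K_def[symmetric] by (intro sum.cong refl) (simp add: F T_def H_def)
  also have "\<dots> = (\<Sum>v\<in>K. \<Sum>w\<in>K. \<Sum>\<rho>\<in>PS. of_real (W \<rho>) * (T v w * (H v w * C \<rho> v w)))"
    by (simp add: sum_distrib_left mult_ac)
  also have "\<dots> = (\<Sum>v\<in>K. \<Sum>\<rho>\<in>PS. \<Sum>w\<in>K. of_real (W \<rho>) * (T v w * (H v w * C \<rho> v w)))"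
    by (intro sum.cong refl sum.swap)
  also have "\<dots> = (\<Sum>\<rho>\<in>PS. \<Sum>v\<in>K. \<Sum>w\<in>K. of_real (W \<rho>) * (T v w * (H v w * C \<rho> v w)))"
    by (rule sum.swap)
  also have "\<dots> = (\<Sum>\<rho>\<in>PS. of_real (W \<rho>) * (\<Sum>v\<in>K. \<Sum>w\<in>K. T v w * (H v w * C \<rho> v w)))"
    by (simp add: sum_distrib_left)
  also have "\<dots> \<in> \<real>\<^sub>\<ge>\<^sub>0"
  proof (rule nonneg_Reals_sum, rule nonneg_Reals_mult_I)
    fix \<rho>
    show "of_real (W \<rho>) \<in> (\<real>\<^sub>\<ge>\<^sub>0 :: complex set)"
      unfolding nonneg_Reals_of_real_iff W_def by (intro prod_nonneg) (simp add: fejer_nonneg[OF m])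
    show "(\<Sum>v\<in>K. \<Sum>w\<in>K. T v w * (H v w * C \<rho> v w)) \<in> \<real>\<^sub>\<ge>\<^sub>0"
      unfolding T_def H_def C_def by (rule twisted_char_nonneg[OF _ S K]) simp
  qed
  finally show ?thesis .
qed

lemma twisted_nonneg: "twisted (prod_weight m) (free_star x * x) \<in> \<real>\<^sub>\<ge>\<^sub>0"
proof -
  have "(\<lambda>n. prod_weight (approx_moment n) g) \<longlonglongrightarrow> prod_weight m g" for g
  proof (cases "\<forall>j. g j \<in> Del")
    case True
    have "(\<lambda>n. \<Prod>j | g j \<noteq> 0. approx_moment n (g j)) \<longlonglongrightarrow> (\<Prod>j | g j \<noteq> 0. m (g j))"
      unfolding approx_moment_def by (intro tendsto_prod fejer_tendsto[OF m])
    then show ?thesis using True by (simp add: prod_weight_def)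
  next
    case False
    then have "prod_weight M g = 0" for M unfolding prod_weight_def by (rule if_not_P)
    then show ?thesis by simp
  qed
  then have lim: "(\<lambda>n. twisted (prod_weight (approx_moment n)) (free_star x * x)) \<longlonglongrightarrow> twisted (prod_weight m) (free_star x * x)"
    unfolding twisted_def by (intro tendsto_sum tendsto_mult tendsto_const)
  have ev: "\<forall>\<^sub>F n in sequentially. twisted (prod_weight (approx_moment n)) (free_star x * x) \<in> \<real>\<^sub>\<ge>\<^sub>0"
    using eventually_gt_at_top[of "0::nat"] by eventually_elim (rule twisted_approx_nonneg)
  show ?thesis by (rule Lim_in_closed_set[OF closed_nonneg_Reals_complex ev sequentially_bot lim])
qed

lemma low_zero: "supp w \<subseteq> {i} \<Longrightarrow> low i w = 0"
  by (induction i w rule: low.induct) auto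

lemma theta_zero: "supp w \<subseteq> {j} \<Longrightarrow> theta w = 0"
  by (induction w rule: theta.induct) (auto simp: low_zero)

lemma swaps_Del:
  assumes "\<And>i. ex v i \<in> Del" "\<And>i. ex w i \<in> Del" shows "ph (swaps v w) = 1"
proof -
  have "ph (if l < i then ex v i * ex w l else 0) = 1" for i l
    using Del_mult[OF assms] by simp
  then show ?thesis
    unfolding swaps_sum[of "supp v \<union> supp w" v w, simplified]
    by (intro ph_uminus_eq_1 ph_sum_eq_1)
qed

text \<open>Spreadability comes for free: relabelling leaves the moments of a product functional
  unchanged, and the moments determine it.\<close>

lemma product_functional_exists:
  "\<exists>f. spr f \<and> product_moments f (\<lambda>k. if k \<in> Del then m k else 0)"
proof (intro exI conjI)
  let ?f = "twisted (prod_weight m)"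
  have pf: "pos_functional ?f"
    by (simp add: pos_functional_def twisted_add twisted_scale twisted_nonneg)
  have one: "?f 1 = 1"
    using twisted_P[of "prod_weight m" "[]"] by (simp add: prod_weight_def)
  have le: "cmod (?f x) \<le> N x" for x
    using pos_functional_le_N[OF pf twisted_kill, of x] by (simp add: one)
  have bf: "bounded_fun ?f"
    using le unfolding bounded_fun_def by (auto simp: twisted_add twisted_scale intro!: exI[of _ 1])
  show pm: "product_moments ?f (\<lambda>k. if k \<in> Del then m k else 0)"
    unfolding product_moments_iff[OF bf]
  proof (intro conjI allI impI one)
    fix w j k assume j: "j \<notin> supp w"
    obtain v where v: "U j k = P v" "supp v \<subseteq> {j}" "\<And>i. ex v i = (if i = j then k else 0)"
      using U_word by metis
    have exj: "ex w j = 0" using j by (rule ex_notin)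
    have e: "ex (w @ v) = (\<lambda>i. if i = j then k else ex w i)"
      by (rule ext) (simp add: ex_append v(3) exj)
    have f: "?f (P w * U j k) = ph (theta w + swaps w v) * prod_weight m (ex (w @ v))"
      unfolding v(1) P_append[symmetric] twisted_P by (simp add: theta_append theta_zero[OF v(2)])
    show "?f (P w * U j k) = ?f (P w) * (if k \<in> Del then m k else 0)"
    proof (cases "k \<in> Del \<and> (\<forall>i. ex w i \<in> Del)")
      case False
      then have "\<exists>i. ex (w @ v) i \<notin> Del" unfolding e using exj by (metis Del_0)
      then have "prod_weight m (ex (w @ v)) = 0" by (auto simp: prod_weight_def)
      moreover have "(if k \<in> Del then m k else 0) = 0 \<or> prod_weight m (ex w) = 0"
        using False by (auto simp: prod_weight_def)
      ultimately show ?thesis unfolding f twisted_P by auto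
    next
      case True
      have "ph (swaps w v) = 1" using True by (intro swaps_Del) (auto simp: v(3))
      moreover have "prod_weight m (ex (w @ v)) = prod_weight m (ex w) * m k"
      proof -
        have "prod_weight m (ex (w @ v)) = (\<Prod>i\<in>insert j (supp w). m (ex (w @ v) i))"
          using True by (subst prod_weight_superset[of "insert j (supp w)"]) (auto simp: e m ex_notin)
        also have "\<dots> = m k * (\<Prod>i\<in>supp w. m (ex (w @ v) i))"
          using j by (subst prod.insert) (auto simp: e)
        also have "(\<Prod>i\<in>supp w. m (ex (w @ v) i)) = (\<Prod>i\<in>supp w. m (ex w i))"
          using j by (intro prod.cong) (auto simp: e)
        also have "\<dots> = prod_weight m (ex w)"
          using True by (subst prod_weight_superset[of "supp w"]) (auto simp: m ex_notin)
        finally show ?thesis by simp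
      qed
      ultimately show ?thesis using True by (simp add: f twisted_P ph_add)
    qed
  qed
  have "?f (shift h x) = ?f x" if h: "strict_mono h" for h x
  proof -
    have "(\<lambda>x. ?f (shift h x)) = ?f"
    proof (rule product_moments_unique[OF _ _ bf pm])
      show "bounded_fun (\<lambda>x. ?f (shift h x))"
        using order_trans[OF le N_shift_le[OF h]] unfolding bounded_fun_def
        by (auto simp: shift_add shift_scale twisted_add twisted_scale intro!: exI[of _ 1])
      have mono: "shift h (mono jks) = mono (map (\<lambda>(j, k). (h j, k)) jks)" for jks
        by (induction jks) (auto simp: shift_mult shift_U)
      have "distinct (map fst (map (\<lambda>(j, k). (h j, k)) jks))" if "distinct (map fst jks)" for jks :: "(int \<times> int) list"
      proof -
        have "map fst (map (\<lambda>(j, k). (h j, k)) jks) = map h (map fst jks)" by auto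
        then show ?thesis
          using that strict_mono_imp_inj_on[OF h] by (simp only: distinct_map)
      qed
      then show "product_moments (\<lambda>x. ?f (shift h x)) (\<lambda>k. if k \<in> Del then m k else 0)"
        using pm unfolding product_moments_def mono by (simp add: o_def case_prod_unfold cong: if_cong)
    qed
    then show ?thesis by (rule fun_cong)
  qed
  then show "spr ?f" using pf le one by (simp add: spr_def)
qed

end

text \<open>Normal forms make a product state unique, which resolves the definite descriptions.\<close>

lemma the_product_state:
  assumes \<phi>: "\<phi> \<in> states A" and pm: "product_moments (\<lambda>x. \<phi> (\<iota> x)) m"
  shows "(THE \<phi>. \<phi> \<in> states A \<and> (\<forall>jks. distinct (map fst jks) \<longrightarrow>
           \<phi> (\<iota> (mono jks)) = prod_list (map (\<lambda>(j, k). m k) jks))) = \<phi>"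
proof (rule the_equality)
  show "\<phi> \<in> states A \<and> (\<forall>jks. distinct (map fst jks) \<longrightarrow> \<phi> (\<iota> (mono jks)) = prod_list (map (\<lambda>(j, k). m k) jks))"
    using assms by (simp add: product_moments_def)
  fix \<psi> assume \<psi>: "\<psi> \<in> states A \<and> (\<forall>jks. distinct (map fst jks) \<longrightarrow> \<psi> (\<iota> (mono jks)) = prod_list (map (\<lambda>(j, k). m k) jks))"
  have bf: "bounded_fun (\<lambda>x. \<tau> (\<iota> x))" if "\<tau> \<in> states A" for \<tau>
    using state_pos_functional[OF that] unfolding bounded_fun_def pos_functional_def by (metis mult_1)
  have "(\<lambda>x. \<psi> (\<iota> x)) = (\<lambda>x. \<phi> (\<iota> x))"
    using \<psi> by (intro product_moments_unique[OF bf _ bf[OF \<phi>] pm]) (auto simp: product_moments_def)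
  then show "\<psi> = \<phi>" using \<psi> \<phi> by (intro states_eqI) (auto dest: fun_cong)
qed

lemma product_state_eq:
  assumes "\<phi> \<in> states A" "product_moments (\<lambda>x. \<phi> (\<iota> x)) m"
    and m: "\<And>k. \<omega> (circle_coord [^]\<^bsub>circle_algebra\<^esub> (k::int)) = m k"
  shows "product_state \<alpha> \<omega> = \<phi>"
  unfolding product_state_def torus_eq m torus_monomial_eq by (rule the_product_state[OF assms(1,2)])

end

section \<open>States on \<open>C(\<T>)\<close>\<close>

abbreviation circle :: "complex set" where "circle \<equiv> sphere 0 1"

definition zk :: "int \<Rightarrow> complex \<Rightarrow> complex" where
  "zk k = (\<lambda>w. if w \<in> circle then w powi k else 0)"

lemma circle_nonzero: "w \<in> circle \<Longrightarrow> w \<noteq> 0" by auto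

lemma zk_carrier: "zk k \<in> carrier circle_algebra"
proof -
  have "continuous_on circle (\<lambda>w. w powi k)"
    by (intro continuous_intros) auto
  then have "continuous_on circle (zk k)"
    by (rule continuous_on_eq) (simp add: zk_def)
  then show ?thesis by (simp add: circle_algebra_def zk_def)
qed

lemma circle_coord_pow: "circle_coord [^]\<^bsub>circle_algebra\<^esub> (k::int) = zk k"
proof -
  have p: "rec_nat \<one>\<^bsub>circle_algebra\<^esub> (\<lambda>u b. b \<otimes>\<^bsub>circle_algebra\<^esub> circle_coord) n = zk (int n)" for n
  proof (induction n)
    case (Suc n)
    have "zk (int n) \<otimes>\<^bsub>circle_algebra\<^esub> circle_coord = zk (int (Suc n))"
      by (rule ext) (auto simp: circle_algebra_def zk_def circle_coord_def power_int_def nat_add_distrib)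
    then show ?case using Suc by simp
  qed (rule ext, simp add: circle_algebra_def zk_def indicator_def)
  show ?thesis
  proof (cases "k < 0")
    case True
    have "inv\<^bsub>circle_algebra\<^esub> (zk (- k)) = zk k"
      unfolding m_inv_def
    proof (rule the_equality)
      have *: "w powi (- k) * w powi k = 1" if "w \<in> circle" for w
        using circle_nonzero[OF that] by (simp flip: power_int_add)
      have "zk (- k) \<otimes>\<^bsub>circle_algebra\<^esub> zk k = \<one>\<^bsub>circle_algebra\<^esub>"
        by (rule ext) (use * in \<open>simp add: circle_algebra_def zk_def indicator_def\<close>)
      moreover have "zk k \<otimes>\<^bsub>circle_algebra\<^esub> zk (- k) = \<one>\<^bsub>circle_algebra\<^esub>"
        by (rule ext) (use * in \<open>simp add: circle_algebra_def zk_def indicator_def mult.commute\<close>)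
      ultimately show "zk k \<in> carrier circle_algebra \<and> zk (- k) \<otimes>\<^bsub>circle_algebra\<^esub> zk k = \<one>\<^bsub>circle_algebra\<^esub>
          \<and> zk k \<otimes>\<^bsub>circle_algebra\<^esub> zk (- k) = \<one>\<^bsub>circle_algebra\<^esub>"
        by (simp add: zk_carrier)
      fix y assume y: "y \<in> carrier circle_algebra \<and> zk (- k) \<otimes>\<^bsub>circle_algebra\<^esub> y = \<one>\<^bsub>circle_algebra\<^esub>
          \<and> y \<otimes>\<^bsub>circle_algebra\<^esub> zk (- k) = \<one>\<^bsub>circle_algebra\<^esub>"
      show "y = zk k"
      proof
        fix w
        show "y w = zk k w"
        proof (cases "w \<in> circle")
          case True
          have "(\<lambda>w. zk (- k) w * y w) = indicator circle" using y by (simp add: circle_algebra_def)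
          from fun_cong[OF this, of w] have "zk (- k) w * y w = 1" using True by simp
          then have "w powi k * (w powi (- k) * y w) = w powi k" using True by (simp add: zk_def)
          then show ?thesis using *[OF True] True by (simp add: zk_def mult.assoc[symmetric] mult.commute[of "w powi k"])
        qed (use y in \<open>simp add: circle_algebra_def zk_def\<close>)
      qed
    qed
    then show ?thesis using True p[of "nat (- k)"] by (simp add: int_pow_def Let_def)
  qed (use p[of "nat k"] in \<open>simp add: int_pow_def Let_def\<close>)
qed

lemma circle_carrier:
  "f \<in> carrier circle_algebra \<longleftrightarrow> continuous_on circle f \<and> (\<forall>w. w \<notin> circle \<longrightarrow> f w = 0)"
  by (simp add: circle_algebra_def)

lemma circle_ops:
  "f \<oplus>\<^bsub>circle_algebra\<^esub> g = (\<lambda>w. f w + g w)" "f \<otimes>\<^bsub>circle_algebra\<^esub> g = (\<lambda>w. f w * g w)"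
  "c \<odot>\<^bsub>circle_algebra\<^esub> f = (\<lambda>w. c * f w)" "star circle_algebra f = (\<lambda>w. cnj (f w))"
  "\<one>\<^bsub>circle_algebra\<^esub> = zk 0"
  by (auto simp: circle_algebra_def zk_def indicator_def)

context
  fixes \<omega> assumes \<omega>: "\<omega> \<in> states circle_algebra"
begin

lemma cs_add: "f \<in> carrier circle_algebra \<Longrightarrow> g \<in> carrier circle_algebra \<Longrightarrow> \<omega> (\<lambda>w. f w + g w) = \<omega> f + \<omega> g"
  using \<omega> by (simp add: states_def circle_ops)

lemma cs_scale: "f \<in> carrier circle_algebra \<Longrightarrow> \<omega> (\<lambda>w. c * f w) = c * \<omega> f"
  using \<omega> by (simp add: states_def circle_ops)

lemma cs_sum:
  "finite I \<Longrightarrow> (\<lambda>w. \<Sum>i\<in>I. c i * zk (e i) w) \<in> carrier circle_algebra \<and>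
     \<omega> (\<lambda>w. \<Sum>i\<in>I. c i * zk (e i) w) = (\<Sum>i\<in>I. c i * \<omega> (zk (e i)))"
proof (induction I rule: finite_induct)
  case empty
  show ?case using cs_scale[OF zk_carrier[of 0], of 0] by (simp add: circle_carrier)
next
  case (insert i I)
  have "(\<lambda>w. c i * zk (e i) w) \<in> carrier circle_algebra"
    using zk_carrier[of "e i"] by (auto simp: circle_carrier intro: continuous_intros)
  with insert show ?case
    by (simp add: cs_add cs_scale[OF zk_carrier]) (auto simp: circle_carrier intro: continuous_intros)
qed

lemma circle_moments_pos_def: "pos_def (\<lambda>k. \<omega> (zk k))"
  unfolding pos_def_def
proof (intro allI)
  fix n :: nat and a :: "nat \<Rightarrow> complex"
  let ?p = "\<lambda>w. \<Sum>t<n. a t * zk (int t) w"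
  have p: "?p \<in> carrier circle_algebra" using cs_sum[of "{..<n}"] by simp
  have "\<omega> (star circle_algebra ?p \<otimes>\<^bsub>circle_algebra\<^esub> ?p) \<in> \<real>\<^sub>\<ge>\<^sub>0" using \<omega> p by (simp add: states_def)
  also have "star circle_algebra ?p \<otimes>\<^bsub>circle_algebra\<^esub> ?p =
      (\<lambda>w. \<Sum>(s, t)\<in>{..<n} \<times> {..<n}. (cnj (a s) * a t) * zk (int t - int s) w)"
  proof
    fix w
    have "cnj (zk (int s) w) * zk (int t) w = zk (int t - int s) w" for s t
    proof (cases "w \<in> circle")
      case True
      have "w * cnj w = 1" using complex_norm_square[of w] True by simp
      then have "cnj w = inverse w" by (rule inverse_unique[symmetric])
      then show ?thesis using True circle_nonzero[OF True]
        by (simp add: zk_def power_int_diff divide_inverse power_inverse mult.commute)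
    qed (simp add: zk_def)
    then show "(star circle_algebra ?p \<otimes>\<^bsub>circle_algebra\<^esub> ?p) w =
        (\<Sum>(s, t)\<in>{..<n} \<times> {..<n}. (cnj (a s) * a t) * zk (int t - int s) w)"
      unfolding circle_ops cnj_sum sum_product sum.cartesian_product
    proof (intro sum.cong refl, clarify)
      fix s t
      have "cnj (a s * zk (int s) w) * (a t * zk (int t) w) = cnj (a s) * a t * (cnj (zk (int s) w) * zk (int t) w)"
        by simp
      then show "cnj (a s * zk (int s) w) * (a t * zk (int t) w) = cnj (a s) * a t * zk (int t - int s) w"
        by (simp only: \<open>\<And>s t. cnj (zk (int s) w) * zk (int t) w = zk (int t - int s) w\<close>)
    qed
  qed
  also have "\<omega> \<dots> = (\<Sum>(s, t)\<in>{..<n} \<times> {..<n}. (cnj (a s) * a t) * \<omega> (zk (int t - int s)))"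
    using cs_sum[of "{..<n} \<times> {..<n}" "\<lambda>(s, t). cnj (a s) * a t" "\<lambda>(s, t). int t - int s"]
    by (simp add: case_prod_unfold)
  finally show "(\<Sum>s<n. \<Sum>t<n. cnj (a s) * a t * \<omega> (zk (int t - int s))) \<in> \<real>\<^sub>\<ge>\<^sub>0"
    by (simp add: sum.cartesian_product)
qed

end

lemma zk_rotate: assumes "cmod z = 1" shows "(\<lambda>w. zk k (z * w)) = (\<lambda>w. (z powi k) * zk k w)"
  using assms by (auto simp: zk_def norm_mult power_int_mult_distrib)

subsection \<open>Density of trigonometric polynomials\<close>

definition trig :: "(complex \<Rightarrow> complex) \<Rightarrow> bool" where
  "trig f \<longleftrightarrow> (\<exists>I :: (complex \<times> int) list. \<forall>w\<in>circle. f w = (\<Sum>(a, k)\<leftarrow>I. a * w powi k))"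

lemma trig_cong: "trig f \<Longrightarrow> (\<And>w. w \<in> circle \<Longrightarrow> f w = g w) \<Longrightarrow> trig g"
  unfolding trig_def by metis

lemma trig_monom: "trig (\<lambda>w. a * w powi k)"
  unfolding trig_def by (rule exI[of _ "[(a, k)]"]) simp

lemma trig_const: "trig (\<lambda>w. c)"
  using trig_monom[of c 0] by simp

lemma trig_add: assumes "trig f" "trig g" shows "trig (\<lambda>w. f w + g w)"
proof -
  obtain I J where "\<forall>w\<in>circle. f w = (\<Sum>(a, k)\<leftarrow>I. a * w powi k)" "\<forall>w\<in>circle. g w = (\<Sum>(a, k)\<leftarrow>J. a * w powi k)"
    using assms unfolding trig_def by blast
  then show ?thesis unfolding trig_def by (intro exI[of _ "I @ J"]) simp
qed

lemma trig_monom_mult: assumes "trig g" shows "trig (\<lambda>w. (a * w powi k) * g w)"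
proof -
  obtain J where J: "\<forall>w\<in>circle. g w = (\<Sum>(a, k)\<leftarrow>J. a * w powi k)"
    using assms unfolding trig_def by blast
  have "(a * w powi k) * (\<Sum>(a, k)\<leftarrow>J. a * w powi k) = (\<Sum>(b, l)\<leftarrow>map (\<lambda>(b, l). (a * b, k + l)) J. b * w powi l)"
    if "w \<in> circle" for w
    using circle_nonzero[OF that] by (induction J) (auto simp: algebra_simps power_int_add)
  then show ?thesis using J unfolding trig_def by (intro exI[of _ "map (\<lambda>(b, l). (a * b, k + l)) J"]) simp
qed

lemma trig_mult: assumes "trig f" "trig g" shows "trig (\<lambda>w. f w * g w)"
proof -
  obtain I where I: "\<forall>w\<in>circle. f w = (\<Sum>(a, k)\<leftarrow>I. a * w powi k)"
    using assms(1) unfolding trig_def by blast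
  have "trig (\<lambda>w. (\<Sum>(a, k)\<leftarrow>I. a * w powi k) * g w)"
  proof (induction I)
    case Nil
    show ?case using trig_const[of 0] by simp
  next
    case (Cons x I)
    obtain a k where x: "x = (a, k)" by fastforce
    from trig_add[OF trig_monom_mult[OF assms(2), of a k] Cons] show ?case by (simp add: x distrib_right)
  qed
  then show ?thesis by (rule trig_cong) (simp add: I)
qed

text \<open>On the circle \<open>Re w = (w + 1 / w) / 2\<close> and \<open>Im w = (w - 1 / w) / (2 \<i>)\<close>.\<close>

lemma trig_real_polynomial: "real_polynomial_function g \<Longrightarrow> trig (\<lambda>w. complex_of_real (g w))"
proof (induction rule: real_polynomial_function.induct)
  case (linear f)
  define p q where "p = f 1" and "q = f \<i>"
  have f: "f w = Re w * p + Im w * q" for w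
  proof -
    have "f w = f (Re w *\<^sub>R 1 + Im w *\<^sub>R \<i>)" by (metis complex_eq scaleR_conv_of_real mult.commute mult.right_neutral)
    also have "\<dots> = Re w * p + Im w * q"
      using linear by (simp only: bounded_linear.linear linear_add linear_scale p_def q_def real_scaleR_def)
    finally show ?thesis .
  qed
  have "trig (\<lambda>w. ((of_real p - \<i> * of_real q) / 2) * w powi 1 + ((of_real p + \<i> * of_real q) / 2) * w powi (-1))"
    by (intro trig_add trig_monom)
  then show ?case
  proof (rule trig_cong)
    fix w assume w: "w \<in> circle"
    have "w * cnj w = 1" using complex_norm_square[of w] w by simp
    then have "inverse w = cnj w" by (rule inverse_unique)
    then show "((of_real p - \<i> * of_real q) / 2) * w powi 1 + ((of_real p + \<i> * of_real q) / 2) * w powi (-1) = of_real (f w)"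
      by (simp add: f power_int_minus complex_eq_iff algebra_simps add_divide_distrib diff_divide_distrib)
  qed
next
  case (add f g) then show ?case using trig_add by fastforce
next
  case (mult f g) then show ?case using trig_mult by fastforce
qed (rule trig_const)

lemma trig_dense:
  assumes "continuous_on circle f" "e > 0"
  obtains t where "trig t" "\<And>w. w \<in> circle \<Longrightarrow> cmod (f w - t w) < e"
proof -
  have e: "e / 2 > 0" using assms by simp
  obtain g where g: "real_polynomial_function g" "\<And>w. w \<in> circle \<Longrightarrow> \<bar>Re (f w) - g w\<bar> < e / 2"
    using Stone_Weierstrass_real_polynomial_function[OF compact_sphere _ e, of 0 1 "\<lambda>w. Re (f w)"] assms(1)
    by (metis continuous_on_Re)
  obtain h where h: "real_polynomial_function h" "\<And>w. w \<in> circle \<Longrightarrow> \<bar>Im (f w) - h w\<bar> < e / 2"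
    using Stone_Weierstrass_real_polynomial_function[OF compact_sphere _ e, of 0 1 "\<lambda>w. Im (f w)"] assms(1)
    by (metis continuous_on_Im)
  show ?thesis
  proof (rule that)
    show "trig (\<lambda>w. of_real (g w) + \<i> * of_real (h w))"
      by (intro trig_add trig_mult trig_const trig_real_polynomial g h)
    fix w assume "w \<in> circle"
    then show "cmod (f w - (of_real (g w) + \<i> * of_real (h w))) < e"
      using cmod_le[of "f w - (of_real (g w) + \<i> * of_real (h w))"] g(2)[of w] h(2)[of w] by simp
  qed
qed

section \<open>States on \<open>C(\<T>)\<close> with prescribed moments\<close>

context
  fixes m :: "int \<Rightarrow> complex" assumes m: "pos_def m" "m 0 = 1"
begin

definition fejer_state :: "nat \<Rightarrow> (complex \<Rightarrow> complex) \<Rightarrow> complex" where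
  "fejer_state n f = (\<Sum>r<2*n. of_real (fejer_weight m n r) * f (node n r))"

lemma node_circle [simp]: "node n r \<in> circle" by simp

lemma fejer_state_diff_le:
  assumes "n > 0" "\<And>w. w \<in> circle \<Longrightarrow> cmod (f w - g w) \<le> e"
  shows "cmod (fejer_state n f - fejer_state n g) \<le> e"
proof -
  have "fejer_state n f - fejer_state n g = (\<Sum>r<2*n. of_real (fejer_weight m n r) * (f (node n r) - g (node n r)))"
    by (simp add: fejer_state_def right_diff_distrib sum_subtractf)
  also have "cmod \<dots> \<le> (\<Sum>r<2*n. fejer_weight m n r * e)"
    using assms(2)[OF node_circle] fejer_nonneg[OF m]
    by (intro order_trans[OF norm_sum] sum_mono) (simp add: norm_mult mult_left_mono)
  also have "\<dots> = e" using fejer_total[OF m assms(1)] by (simp flip: sum_distrib_right)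
  finally show ?thesis .
qed

lemma fejer_state_trig:
  assumes "\<forall>w\<in>circle. t w = (\<Sum>(a, k)\<leftarrow>I. a * w powi k)"
  shows "(\<lambda>n. fejer_state n t) \<longlonglongrightarrow> (\<Sum>(a, k)\<leftarrow>I. a * m k)"
proof -
  have "fejer_state n t = (\<Sum>(a, k)\<leftarrow>I. a * (\<Sum>r<2*n. of_real (fejer_weight m n r) * node n r powi k))" for n
  proof -
    have "fejer_state n t = (\<Sum>r<2*n. of_real (fejer_weight m n r) * (\<Sum>(a, k)\<leftarrow>I. a * node n r powi k))"
      using assms node_circle by (simp add: fejer_state_def)
    also have "\<dots> = (\<Sum>(a, k)\<leftarrow>I. a * (\<Sum>r<2*n. of_real (fejer_weight m n r) * node n r powi k))"
      by (induction I) (auto simp: distrib_left sum.distrib sum_distrib_left mult_ac)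
    finally show ?thesis .
  qed
  moreover have "(\<lambda>n. (\<Sum>(a, k)\<leftarrow>I. a * (\<Sum>r<2*n. of_real (fejer_weight m n r) * node n r powi k))) \<longlonglongrightarrow> (\<Sum>(a, k)\<leftarrow>I. a * m k)"
    by (induction I) (auto intro!: tendsto_add tendsto_mult fejer_tendsto[OF m])
  ultimately show ?thesis by simp
qed

lemma fejer_state_convergent: assumes f: "continuous_on circle f" shows "convergent (\<lambda>n. fejer_state n f)"
proof -
  have "Cauchy (\<lambda>n. fejer_state n f)"
    unfolding Cauchy_def
  proof (intro allI impI)
    fix e :: real assume e: "e > 0"
    then have "e / 4 > 0" by simp
    from trig_dense[OF f this] obtain t where t: "trig t" "\<And>w. w \<in> circle \<Longrightarrow> cmod (f w - t w) < e / 4" by blast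
    have "Cauchy (\<lambda>n. fejer_state n t)"
      using t(1) fejer_state_trig unfolding trig_def by (metis LIMSEQ_imp_Cauchy)
    then obtain M where M: "\<And>i j. i \<ge> M \<Longrightarrow> j \<ge> M \<Longrightarrow> dist (fejer_state i t) (fejer_state j t) < e / 4"
      using \<open>e / 4 > 0\<close> unfolding Cauchy_def by blast
    have d: "dist (fejer_state i f) (fejer_state i t) \<le> e / 4" if "i \<ge> Suc M" for i
      unfolding dist_norm by (rule fejer_state_diff_le) (use that t(2) in \<open>auto intro: less_imp_le\<close>)
    have "dist (fejer_state i f) (fejer_state j f) < e" if "i \<ge> Suc M" "j \<ge> Suc M" for i j
      using d[OF that(1)] d[OF that(2)] M[of i j] that e
        dist_triangle[of "fejer_state i f" "fejer_state j f" "fejer_state i t"]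
        dist_triangle[of "fejer_state i t" "fejer_state j f" "fejer_state j t"]
      by (simp add: dist_commute)
    then show "\<exists>M. \<forall>i\<ge>M. \<forall>j\<ge>M. dist (fejer_state i f) (fejer_state j f) < e" by blast
  qed
  then show ?thesis by (rule Cauchy_convergent)
qed

text \<open>The discrete measures \<open>fejer_state n\<close> converge on trigonometric polynomials because their
  moments do, and hence on \<open>C(\<T>)\<close> because they are uniformly contractive.\<close>

definition moment_state :: "(complex \<Rightarrow> complex) \<Rightarrow> complex" where
  "moment_state f = (if f \<in> carrier circle_algebra then lim (\<lambda>n. fejer_state n f) else 0)"

lemma moment_state_tendsto: "f \<in> carrier circle_algebra \<Longrightarrow> (\<lambda>n. fejer_state n f) \<longlonglongrightarrow> moment_state f"
  using fejer_state_convergent[of f] by (simp add: moment_state_def circle_carrier convergent_LIMSEQ_iff)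

lemma moment_state_zk: "moment_state (zk k) = m k"
proof (rule LIMSEQ_unique[OF moment_state_tendsto[OF zk_carrier]])
  show "(\<lambda>n. fejer_state n (zk k)) \<longlonglongrightarrow> m k"
    using fejer_state_trig[of "zk k" "[(1, k)]"] by (simp add: zk_def)
qed

lemma moment_state_state: "moment_state \<in> states circle_algebra"
  unfolding states_def mem_Collect_eq
proof (intro conjI allI ballI impI)
  fix f assume "f \<notin> carrier circle_algebra" then show "moment_state f = 0" by (simp add: moment_state_def)
next
  fix f g assume fg: "f \<in> carrier circle_algebra" "g \<in> carrier circle_algebra"
  then have "(\<lambda>w. f w + g w) \<in> carrier circle_algebra" by (auto simp: circle_carrier intro: continuous_intros)
  from moment_state_tendsto[OF this] have "(\<lambda>n. fejer_state n f + fejer_state n g) \<longlonglongrightarrow> moment_state (\<lambda>w. f w + g w)"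
    by (simp add: fejer_state_def distrib_left sum.distrib)
  then show "moment_state (f \<oplus>\<^bsub>circle_algebra\<^esub> g) = moment_state f + moment_state g"
    unfolding circle_ops using tendsto_add[OF moment_state_tendsto moment_state_tendsto] fg LIMSEQ_unique by blast
next
  fix c f assume f: "f \<in> carrier circle_algebra"
  then have "(\<lambda>w. c * f w) \<in> carrier circle_algebra" by (auto simp: circle_carrier intro: continuous_intros)
  from moment_state_tendsto[OF this] have "(\<lambda>n. c * fejer_state n f) \<longlonglongrightarrow> moment_state (\<lambda>w. c * f w)"
    by (simp add: fejer_state_def sum_distrib_left mult_ac)
  then show "moment_state (c \<odot>\<^bsub>circle_algebra\<^esub> f) = c * moment_state f"
    unfolding circle_ops using tendsto_mult[OF tendsto_const moment_state_tendsto[OF f]] LIMSEQ_unique by blast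
next
  fix f assume f: "f \<in> carrier circle_algebra"
  then have c: "(\<lambda>w. cnj (f w) * f w) \<in> carrier circle_algebra" by (auto simp: circle_carrier intro!: continuous_intros)
  have "fejer_state n (\<lambda>w. cnj (f w) * f w) \<in> \<real>\<^sub>\<ge>\<^sub>0" for n
  proof -
    have "cnj z * z \<in> \<real>\<^sub>\<ge>\<^sub>0" for z by (metis complex_norm_square mult.commute nonneg_Reals_of_real_iff zero_le_power2)
    then show ?thesis
      unfolding fejer_state_def
      by (intro nonneg_Reals_sum) (rule nonneg_Reals_mult_I, simp_all add: fejer_nonneg[OF m])
  qed
  then show "moment_state (star circle_algebra f \<otimes>\<^bsub>circle_algebra\<^esub> f) \<in> \<real>\<^sub>\<ge>\<^sub>0"
    unfolding circle_ops
    by (intro Lim_in_closed_set[OF closed_nonneg_Reals_complex _ sequentially_bot moment_state_tendsto[OF c]]) simp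
next
  show "moment_state \<one>\<^bsub>circle_algebra\<^esub> = 1" using moment_state_zk[of 0] m by (simp add: circle_ops)
qed

text \<open>A rotation multiplies the \<open>k\<close>-th moment by \<open>z powi k\<close>; equality on trigonometric polynomials
  extends by density.\<close>

lemma moment_state_invariant:
  assumes G: "\<And>z k. z \<in> G \<Longrightarrow> m k \<noteq> 0 \<Longrightarrow> z powi k = 1" "G \<subseteq> circle"
  shows "moment_state \<in> rotation_invariant_states G"
proof -
  have "moment_state (\<lambda>w. f (z * w)) = moment_state f" if f: "f \<in> carrier circle_algebra" and z: "z \<in> G" for f z
  proof -
    have zc: "cmod z = 1" using G(2) z by auto
    have rot: "z * w \<in> circle \<longleftrightarrow> w \<in> circle" for w using zc by (simp add: norm_mult)
    have f': "(\<lambda>w. f (z * w)) \<in> carrier circle_algebra"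
      using f rot unfolding circle_carrier
      by (auto intro!: continuous_on_compose2[of circle f circle "\<lambda>w. z * w"] continuous_intros simp: rot)
    have "cmod (moment_state (\<lambda>w. f (z * w)) - moment_state f) \<le> 0 + e" if "e > 0" for e
    proof -
      have "e / 2 > 0" using \<open>e > 0\<close> by simp
      from trig_dense[OF _ this] f obtain t where t: "trig t" "\<And>w. w \<in> circle \<Longrightarrow> cmod (f w - t w) < e / 2"
        unfolding circle_carrier by blast
      obtain I where I: "\<forall>w\<in>circle. t w = (\<Sum>(a, k)\<leftarrow>I. a * w powi k)" using t(1) unfolding trig_def by blast
      have "(\<Sum>(a, k)\<leftarrow>I. a * (z * w) powi k) = (\<Sum>(a, k)\<leftarrow>map (\<lambda>(a, k). (a * z powi k, k)) I. a * w powi k)" for w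
        by (induction I) (auto simp: power_int_mult_distrib)
      then have "\<forall>w\<in>circle. t (z * w) = (\<Sum>(a, k)\<leftarrow>map (\<lambda>(a, k). (a * z powi k, k)) I. a * w powi k)"
        using I rot by simp
      note l1 = fejer_state_trig[OF this] and l2 = fejer_state_trig[OF I]
      have "(\<Sum>(a, k)\<leftarrow>map (\<lambda>(a, k). (a * z powi k, k)) I. a * m k) = (\<Sum>(a, k)\<leftarrow>I. a * m k)"
      proof -
        have "z powi k * m k = m k" for k using G(1)[OF z, of k] by (cases "m k = 0") auto
        then show ?thesis by (induction I) (auto simp: mult.assoc)
      qed
      with l1 have l1': "(\<lambda>n. fejer_state n (\<lambda>w. t (z * w))) \<longlonglongrightarrow> (\<Sum>(a, k)\<leftarrow>I. a * m k)" by simp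
      have "(\<lambda>n. (fejer_state n (\<lambda>w. f (z * w)) - fejer_state n (\<lambda>w. t (z * w))) - (fejer_state n f - fejer_state n t))
          \<longlonglongrightarrow> (moment_state (\<lambda>w. f (z * w)) - (\<Sum>(a, k)\<leftarrow>I. a * m k)) - (moment_state f - (\<Sum>(a, k)\<leftarrow>I. a * m k))"
        by (intro tendsto_diff l1' l2 moment_state_tendsto f f')
      then have "(\<lambda>n. cmod ((fejer_state n (\<lambda>w. f (z * w)) - fejer_state n (\<lambda>w. t (z * w))) - (fejer_state n f - fejer_state n t)))
          \<longlonglongrightarrow> cmod (moment_state (\<lambda>w. f (z * w)) - moment_state f)"
        by (intro tendsto_norm) simp
      moreover have "cmod ((fejer_state n (\<lambda>w. f (z * w)) - fejer_state n (\<lambda>w. t (z * w))) - (fejer_state n f - fejer_state n t)) \<le> e"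
        if "n \<ge> 1" for n
      proof -
        have "cmod (fejer_state n (\<lambda>w. f (z * w)) - fejer_state n (\<lambda>w. t (z * w))) \<le> e / 2"
          using that t(2) rot by (intro fejer_state_diff_le) (auto intro: less_imp_le)
        moreover have "cmod (fejer_state n f - fejer_state n t) \<le> e / 2"
          using that t(2) by (intro fejer_state_diff_le) (auto intro: less_imp_le)
        ultimately show ?thesis
          using norm_triangle_ineq4[of "fejer_state n (\<lambda>w. f (z * w)) - fejer_state n (\<lambda>w. t (z * w))" "fejer_state n f - fejer_state n t"]
          by linarith
      qed
      ultimately have "cmod (moment_state (\<lambda>w. f (z * w)) - moment_state f) \<le> e"
        by (intro LIMSEQ_le_const2) blast+
      then show ?thesis by simp
    qed
    then have "cmod (moment_state (\<lambda>w. f (z * w)) - moment_state f) \<le> 0" by (rule field_le_epsilon)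
    then show ?thesis by simp
  qed
  then show ?thesis using moment_state_state by (simp add: rotation_invariant_states_def)
qed

end

section \<open>Extreme points of compact sets of functions\<close>

lemma continuous_on_eval: "continuous_on A (\<lambda>\<phi> :: 'a \<Rightarrow> complex. \<phi> x)"
  by (rule continuous_on_subset[OF continuous_on_product_coordinates]) simp

definition face_of_fun :: "('a \<Rightarrow> complex) set \<Rightarrow> ('a \<Rightarrow> complex) set \<Rightarrow> bool" where
  "face_of_fun K F \<longleftrightarrow> F \<subseteq> K \<and> closed F \<and> F \<noteq> {} \<and>
     (\<forall>a\<in>K. \<forall>b\<in>K. \<forall>t. 0 < t \<longrightarrow> t < 1 \<longrightarrow> (1 - t) *\<^sub>R a + t *\<^sub>R b \<in> F \<longrightarrow> a \<in> F \<and> b \<in> F)"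

text \<open>The points of a face where a continuous real functional is maximal form a smaller face.\<close>

lemma max_face:
  fixes K :: "('a \<Rightarrow> complex) set"
  assumes K: "compact K" and F: "face_of_fun K F"
  obtains G where "face_of_fun K G" "G \<subseteq> F" "\<And>\<phi> \<psi>. \<phi> \<in> G \<Longrightarrow> \<psi> \<in> F \<Longrightarrow> Re (c * \<psi> x) \<le> Re (c * \<phi> x)"
proof -
  let ?l = "\<lambda>\<phi>. Re (c * \<phi> x)"
  have cont: "continuous_on A ?l" for A by (intro continuous_intros continuous_on_eval)
  have F': "F \<subseteq> K" "closed F" "F \<noteq> {}" using F by (auto simp: face_of_fun_def)
  then have "compact F" using K by (metis compact_Int_closed inf.absorb_iff2)
  then obtain p where p: "p \<in> F" "\<And>\<psi>. \<psi> \<in> F \<Longrightarrow> ?l \<psi> \<le> ?l p"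
    using continuous_attains_sup[of F ?l] F'(3) cont by blast
  let ?G = "F \<inter> {\<phi>. ?l \<phi> = ?l p}"
  have "closed ?G"
    by (intro closed_Int F' closed_Collect_eq cont continuous_on_const)
  moreover have "a \<in> ?G \<and> b \<in> ?G"
    if ab: "a \<in> K" "b \<in> K" and t: "0 < t" "t < 1" and m: "(1 - t) *\<^sub>R a + t *\<^sub>R b \<in> ?G" for a b t
  proof -
    have f: "a \<in> F" "b \<in> F" using F ab t m unfolding face_of_fun_def by blast+
    have "?l p = (1 - t) * ?l a + t * ?l b"
      using m by (simp add: scaleR_fun_def algebra_simps)
    moreover have "?l a \<le> ?l p" "?l b \<le> ?l p" using p(2) f by auto
    moreover have "(1 - t) * ?l a \<le> (1 - t) * ?l p" "t * ?l b \<le> t * ?l p"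
      using calculation t by (intro mult_left_mono; simp)+
    moreover have "(1 - t) * ?l p + t * ?l p = ?l p" by (simp add: left_diff_distrib)
    ultimately have "(1 - t) * ?l a = (1 - t) * ?l p" "t * ?l b = t * ?l p" by linarith+
    then have "?l a = ?l p" "?l b = ?l p" using t by (simp_all only: mult_cancel_left) simp_all
    then show ?thesis using f by simp
  qed
  ultimately have "face_of_fun K ?G"
    unfolding face_of_fun_def using F' p(1) by blast
  then show ?thesis using p by (intro that[of ?G]) auto
qed

text \<open>Zorn's lemma produces maximal sets, so it is applied to the complements of faces; by
  compactness a chain of faces has a nonempty intersection.\<close>

lemma minimal_face:
  fixes K :: "('a \<Rightarrow> complex) set"
  assumes K: "compact K" and F: "face_of_fun K F"
  obtains G where "face_of_fun K G" "G \<subseteq> F" "\<And>H. face_of_fun K H \<Longrightarrow> H \<subseteq> G \<Longrightarrow> H = G"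
proof -
  define \<A> where "\<A> = uminus ` {G. face_of_fun K G \<and> G \<subseteq> F}"
  have "\<exists>M\<in>\<A>. \<forall>X\<in>\<A>. M \<subseteq> X \<longrightarrow> X = M"
  proof (rule subset_Zorn_nonempty)
    show "\<A> \<noteq> {}" using F by (auto simp: \<A>_def)
    fix \<C> assume ne: "\<C> \<noteq> {}" and ch: "subset.chain \<A> \<C>"
    define \<G> where "\<G> = uminus ` \<C>"
    have G: "face_of_fun K G" "G \<subseteq> F" if "G \<in> \<G>" for G
      using that ch by (auto simp: \<G>_def \<A>_def subset.chain_def)
    have tot: "G \<subseteq> H \<or> H \<subseteq> G" if "G \<in> \<G>" "H \<in> \<G>" for G H
      using that ch by (auto simp: \<G>_def subset.chain_def)
    have fin: "\<exists>G\<in>\<G>. G \<subseteq> \<Inter>\<B>" if "finite \<B>" "\<B> \<subseteq> \<G>" for \<B>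
      using that
    proof (induction \<B> rule: finite_induct)
      case empty
      then show ?case using ne by (auto simp: \<G>_def)
    next
      case (insert H \<B>)
      then obtain G where "G \<in> \<G>" "G \<subseteq> \<Inter>\<B>" by auto
      moreover have "G \<subseteq> H \<or> H \<subseteq> G" using tot insert.prems calculation(1) by blast
      ultimately show ?case using insert.prems by (metis Inter_insert inf_greatest insert_subset order.trans order_refl)
    qed
    have "K \<inter> \<Inter>\<G> \<noteq> {}"
    proof (rule compact_imp_fip[OF K])
      show "closed T" if "T \<in> \<G>" for T using G[OF that] by (simp add: face_of_fun_def)
      show "K \<inter> \<Inter>\<B> \<noteq> {}" if "finite \<B>" "\<B> \<subseteq> \<G>" for \<B>
      proof -
        obtain G0 where "G0 \<in> \<G>" "G0 \<subseteq> \<Inter>\<B>" using fin \<open>finite \<B>\<close> \<open>\<B> \<subseteq> \<G>\<close> by blast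
        then show ?thesis using G[of G0] unfolding face_of_fun_def by blast
      qed
    qed
    moreover obtain G0 where G0: "G0 \<in> \<G>" using ne by (auto simp: \<G>_def)
    ultimately have "face_of_fun K (\<Inter>\<G>)"
    proof -
      have "\<Inter>\<G> \<subseteq> K" using G0 G[of G0] unfolding face_of_fun_def by blast
      moreover have "closed (\<Inter>\<G>)" using G unfolding face_of_fun_def by (intro closed_Inter) blast
      moreover have "a \<in> \<Inter>\<G> \<and> b \<in> \<Inter>\<G>"
        if "a \<in> K" "b \<in> K" "0 < t" "t < 1" "(1 - t) *\<^sub>R a + t *\<^sub>R b \<in> \<Inter>\<G>" for a b t
      proof -
        have "a \<in> H \<and> b \<in> H" if "H \<in> \<G>" for H
          using G(1)[OF that] \<open>a \<in> K\<close> \<open>b \<in> K\<close> \<open>0 < t\<close> \<open>t < 1\<close> \<open>(1 - t) *\<^sub>R a + t *\<^sub>R b \<in> \<Inter>\<G>\<close> that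
          unfolding face_of_fun_def by blast
        then show ?thesis by blast
      qed
      ultimately show ?thesis unfolding face_of_fun_def using \<open>K \<inter> \<Inter>\<G> \<noteq> {}\<close> by blast
    qed
    moreover have "\<Inter>\<G> \<subseteq> F" using G0 G by blast
    moreover have "\<Union>\<C> = - \<Inter>\<G>" by (auto simp: \<G>_def)
    ultimately show "\<Union>\<C> \<in> \<A>" unfolding \<A>_def by blast
  qed
  then obtain G where G: "face_of_fun K G" "G \<subseteq> F" "\<forall>X\<in>\<A>. - G \<subseteq> X \<longrightarrow> X = - G"
    by (auto simp: \<A>_def)
  have "H = G" if "face_of_fun K H" "H \<subseteq> G" for H
  proof -
    have "- H \<in> \<A>" using that G(2) by (auto simp: \<A>_def)
    then have "- H = - G" using G(3) that(2) by blast
    then show ?thesis by simp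
  qed
  then show ?thesis using that G by blast
qed

text \<open>Bauer's maximum principle for the evaluation at \<open>x\<close>. Inside the face where the maximum is
  attained, a minimal face consists of a single point, since all evaluations are constant on it.\<close>

lemma extreme_point_maximizing:
  fixes K :: "('a \<Rightarrow> complex) set"
  assumes K: "compact K" "closed K" "K \<noteq> {}"
  obtains e where "e extreme_point_of K" "\<And>\<phi>. \<phi> \<in> K \<Longrightarrow> Re (\<phi> x) \<le> Re (e x)"
proof -
  have "face_of_fun K K" using K by (auto simp: face_of_fun_def)
  then obtain F where F0: "face_of_fun K F"
    "\<And>\<phi> \<psi>. \<phi> \<in> F \<Longrightarrow> \<psi> \<in> K \<Longrightarrow> Re (1 * \<psi> x) \<le> Re (1 * \<phi> x)"
    by (rule max_face[OF K(1), of K 1 x]) blast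
  note F = F0[unfolded mult_1]
  from minimal_face[OF K(1) F(1)] obtain G where G: "face_of_fun K G" "G \<subseteq> F"
    "\<And>H. face_of_fun K H \<Longrightarrow> H \<subseteq> G \<Longrightarrow> H = G" by blast
  have c: "Re (c * \<psi> y) \<le> Re (c * \<phi> y)" if "\<phi> \<in> G" "\<psi> \<in> G" for \<phi> \<psi> c y
    using max_face[OF K(1) G(1), of c y] G(3) that by metis
  have single: "\<phi> = \<psi>" if "\<phi> \<in> G" "\<psi> \<in> G" for \<phi> \<psi>
  proof
    fix y
    show "\<phi> y = \<psi> y"
      using c[OF that, of 1 y] c[OF that(2,1), of 1 y] c[OF that, of "- \<i>" y] c[OF that(2,1), of "- \<i>" y]
      by (simp add: complex_eq_iff)
  qed
  obtain e where e: "e \<in> G" using G(1) by (auto simp: face_of_fun_def)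
  have "e extreme_point_of K"
    unfolding extreme_point_of_def
  proof (intro conjI ballI notI)
    show "e \<in> K" using e G(1) by (auto simp: face_of_fun_def)
    fix a b assume ab: "a \<in> K" "b \<in> K" "e \<in> open_segment a b"
    then obtain t where t: "a \<noteq> b" "0 < t" "t < 1" "e = (1 - t) *\<^sub>R a + t *\<^sub>R b"
      by (auto simp: in_segment)
    then have "a \<in> G" "b \<in> G" using G(1) ab e unfolding face_of_fun_def by blast+
    then show False using single t(1) by blast
  qed
  then show ?thesis using that F(2) G(2) e by blast
qed

section \<open>Positive parts of functionals on spaces of continuous functions\<close>

definition linear_on :: "'a::topological_space set \<Rightarrow> (('a \<Rightarrow> real) \<Rightarrow> real) \<Rightarrow> bool" where
  "linear_on M L \<longleftrightarrow>
     (\<forall>g h. continuous_on M g \<longrightarrow> continuous_on M h \<longrightarrow> L (\<lambda>x. g x + h x) = L g + L h) \<and>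
     (\<forall>c g. continuous_on M g \<longrightarrow> L (\<lambda>x. c * g x) = c * L g)"

definition positive_on :: "'a::topological_space set \<Rightarrow> (('a \<Rightarrow> real) \<Rightarrow> real) \<Rightarrow> bool" where
  "positive_on M L \<longleftrightarrow> (\<forall>g. continuous_on M g \<longrightarrow> (\<forall>x\<in>M. 0 \<le> g x) \<longrightarrow> 0 \<le> L g)"

lemma linear_onD:
  assumes "linear_on M L" "continuous_on M g" "continuous_on M h"
  shows "L (\<lambda>x. g x + h x) = L g + L h" "L (\<lambda>x. c * g x) = c * L g" "L (\<lambda>x. g x - h x) = L g - L h"
    "L (\<lambda>x. - g x) = - L g"
proof -
  show add: "L (\<lambda>x. g x + h x) = L g + L h" and sc: "L (\<lambda>x. c * g x) = c * L g" for c
    using assms by (auto simp: linear_on_def)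
  have m: "L (\<lambda>x. (-1) * h x) = (-1) * L h"
    using assms unfolding linear_on_def by blast
  have "continuous_on M (\<lambda>x. (-1) * h x)" by (intro continuous_intros assms)
  then have "L (\<lambda>x. g x + (-1) * h x) = L g + L (\<lambda>x. (-1) * h x)"
    using assms unfolding linear_on_def by blast
  then show "L (\<lambda>x. g x - h x) = L g - L h" by (simp only: m) simp
  show "L (\<lambda>x. - g x) = - L g" using sc[of "-1"] by simp
qed

lemma positive_on_mono:
  assumes "linear_on M L" "positive_on M L" "continuous_on M g" "continuous_on M h" "\<And>x. x \<in> M \<Longrightarrow> g x \<le> h x"
  shows "L g \<le> L h"
proof -
  have "0 \<le> L (\<lambda>x. h x - g x)"
    using assms(2) unfolding positive_on_def
    by (elim allE[of _ "\<lambda>x. h x - g x"]) (auto intro: continuous_intros assms)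
  then show ?thesis using linear_onD(3)[OF assms(1,4,3)] by simp
qed

lemma positive_on_cong:
  assumes "linear_on M L" "positive_on M L" "continuous_on M g" "continuous_on M h" "\<And>x. x \<in> M \<Longrightarrow> g x = h x"
  shows "L g = L h"
  using positive_on_mono[OF assms(1,2,3,4)] positive_on_mono[OF assms(1,2,4,3)] assms(5) by (simp add: order_antisym)

lemma positive_on_bound:
  assumes "linear_on M L" "positive_on M L" "continuous_on M g" "continuous_on M h" "\<And>x. x \<in> M \<Longrightarrow> \<bar>g x - h x\<bar> \<le> e"
  shows "\<bar>L g - L h\<bar> \<le> e * L (\<lambda>x. 1)"
proof -
  have c: "continuous_on M (\<lambda>x. g x - h x)" "continuous_on M (\<lambda>x. e * 1)" "continuous_on M (\<lambda>x. - (e * 1))"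
    by (intro continuous_intros assms)+
  have "L (\<lambda>x. g x - h x) \<le> L (\<lambda>x. e * 1)"
    by (rule positive_on_mono[OF assms(1,2) c(1,2)]) (use assms(5) in \<open>simp add: abs_le_iff\<close>)
  moreover have "L (\<lambda>x. - (e * 1)) \<le> L (\<lambda>x. g x - h x)"
    by (rule positive_on_mono[OF assms(1,2) c(3,1)]) (use assms(5) in \<open>fastforce simp: abs_le_iff\<close>)
  moreover have "L (\<lambda>x. e * 1) = e * L (\<lambda>x. 1)" by (rule linear_onD(2)[OF assms(1) continuous_on_const continuous_on_const])
  moreover have "L (\<lambda>x. - (e * 1)) = - L (\<lambda>x. e * 1)" by (rule linear_onD(4)[OF assms(1) c(2) c(2)])
  ultimately show ?thesis by (simp add: linear_onD(3)[OF assms(1,3,4)] abs_le_iff)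
qed

context
  fixes M :: "'a::topological_space set" and L1 L2 :: "('a \<Rightarrow> real) \<Rightarrow> real"
  assumes L1: "linear_on M L1" "positive_on M L1" and L2: "linear_on M L2" "positive_on M L2"
begin

text \<open>Positive part of \<open>L1 - L2\<close>: \<open>pp\<close> is the Riesz--Kantorovich supremum, which is additive on
  nonnegative functions only, and \<open>ppart\<close> its linear extension to all continuous functions.\<close>

definition below :: "('a \<Rightarrow> real) \<Rightarrow> ('a \<Rightarrow> real) set" where
  "below g = {h. continuous_on M h \<and> (\<forall>x\<in>M. 0 \<le> h x \<and> h x \<le> g x)}"

definition pp :: "('a \<Rightarrow> real) \<Rightarrow> real" where
  "pp g = (SUP h\<in>below g. L1 h - L2 h)"

abbreviation nonneg :: "('a \<Rightarrow> real) \<Rightarrow> bool" where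
  "nonneg g \<equiv> continuous_on M g \<and> (\<forall>x\<in>M. 0 \<le> g x)"

lemma below_bdd: assumes "nonneg g" shows "bdd_above ((\<lambda>h. L1 h - L2 h) ` below g)"
proof (rule bdd_aboveI2)
  fix h assume h: "h \<in> below g"
  have "L1 h \<le> L1 g" using h assms by (intro positive_on_mono[OF L1]) (auto simp: below_def)
  moreover have "0 \<le> L2 h" using h L2(2) by (auto simp: below_def positive_on_def)
  ultimately show "L1 h - L2 h \<le> L1 g" by simp
qed

lemma below_zero: "nonneg g \<Longrightarrow> (\<lambda>x. 0) \<in> below g"
  by (auto simp: below_def)

lemma pp_upper: "nonneg g \<Longrightarrow> h \<in> below g \<Longrightarrow> L1 h - L2 h \<le> pp g"
  unfolding pp_def by (rule cSUP_upper[OF _ below_bdd])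

lemma pp_least: "nonneg g \<Longrightarrow> (\<And>h. h \<in> below g \<Longrightarrow> L1 h - L2 h \<le> c) \<Longrightarrow> pp g \<le> c"
  unfolding pp_def using below_zero by (intro cSUP_least) auto

lemma pp_ge: "nonneg g \<Longrightarrow> L1 g - L2 g \<le> pp g"
  by (rule pp_upper) (auto simp: below_def)

lemma pp_add:
  assumes g: "nonneg g" and h: "nonneg h" shows "pp (\<lambda>x. g x + h x) = pp g + pp h"
proof (rule antisym)
  have gh: "nonneg (\<lambda>x. g x + h x)" using g h by (auto intro: continuous_intros)
  show "pp (\<lambda>x. g x + h x) \<le> pp g + pp h"
  proof (rule pp_least[OF gh])
    fix u assume u: "u \<in> below (\<lambda>x. g x + h x)"
    \<comment> \<open>Riesz decomposition of a function below \<open>g + h\<close>.\<close>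
    define a where "a x = min (u x) (g x)" for x
    define b where "b x = u x - a x" for x
    have cu: "continuous_on M u" using u by (simp add: below_def)
    have ca: "continuous_on M a" unfolding a_def using cu g by (intro continuous_intros) auto
    have cb: "continuous_on M b" unfolding b_def by (intro continuous_intros cu ca)
    have ab: "a \<in> below g" "b \<in> below h"
      using u g h ca cb by (auto simp: below_def a_def b_def min_def)
    have ue: "u = (\<lambda>x. a x + b x)" by (auto simp: b_def)
    have "L1 u - L2 u = (L1 a - L2 a) + (L1 b - L2 b)"
      by (subst (1 2) ue) (simp add: linear_onD(1)[OF L1(1) ca cb] linear_onD(1)[OF L2(1) ca cb])
    then show "L1 u - L2 u \<le> pp g + pp h"
      using pp_upper[OF g ab(1)] pp_upper[OF h ab(2)] by simp
  qed
  have *: "L1 a - L2 a + (L1 b - L2 b) \<le> pp (\<lambda>x. g x + h x)" if a: "a \<in> below g" and b: "b \<in> below h" for a b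
  proof -
    have c: "continuous_on M a" "continuous_on M b" using a b by (auto simp: below_def)
    have "(\<lambda>x. a x + b x) \<in> below (\<lambda>x. g x + h x)"
      using a b by (auto simp: below_def intro: continuous_intros add_mono)
    from pp_upper[OF gh this] show ?thesis
      by (simp add: linear_onD(1)[OF L1(1) c] linear_onD(1)[OF L2(1) c])
  qed
  have "pp g \<le> pp (\<lambda>x. g x + h x) - (L1 b - L2 b)" if "b \<in> below h" for b
    using *[OF _ that] by (intro pp_least[OF g]) (simp add: le_diff_eq)
  then have "pp h \<le> pp (\<lambda>x. g x + h x) - pp g"
    by (intro pp_least[OF h]) (simp add: le_diff_eq add.commute)
  then show "pp g + pp h \<le> pp (\<lambda>x. g x + h x)" by simp
qed

lemma pp_scale_ge: assumes g: "nonneg g" and c: "c > 0" shows "c * pp g \<le> pp (\<lambda>x. c * g x)"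
proof -
  have cg: "nonneg (\<lambda>x. c * g x)" using g c by (auto intro: continuous_intros)
  have "pp g \<le> pp (\<lambda>x. c * g x) / c"
  proof (rule pp_least[OF g])
    fix h assume h: "h \<in> below g"
    then have ch: "continuous_on M h" by (simp add: below_def)
    have "(\<lambda>x. c * h x) \<in> below (\<lambda>x. c * g x)"
      using h c by (auto simp: below_def intro: continuous_intros)
    from pp_upper[OF cg this] have "c * (L1 h - L2 h) \<le> pp (\<lambda>x. c * g x)"
      by (simp add: linear_onD(2)[OF L1(1) ch ch] linear_onD(2)[OF L2(1) ch ch] right_diff_distrib)
    then show "L1 h - L2 h \<le> pp (\<lambda>x. c * g x) / c" using c by (simp add: field_simps)
  qed
  then show ?thesis using c by (simp add: field_simps)
qed

lemma pp_scale: assumes g: "nonneg g" and c: "c > 0" shows "pp (\<lambda>x. c * g x) = c * pp g"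
proof (rule antisym[OF _ pp_scale_ge[OF g c]])
  have cg: "nonneg (\<lambda>x. c * g x)" using g c by (auto intro: continuous_intros)
  have "inverse c * pp (\<lambda>x. c * g x) \<le> pp (\<lambda>x. inverse c * (c * g x))"
    using c by (intro pp_scale_ge[OF cg]) simp
  also have "(\<lambda>x. inverse c * (c * g x)) = g" using c by auto
  finally show "pp (\<lambda>x. c * g x) \<le> c * pp g" using c by (simp add: field_simps)
qed

definition ppart :: "('a \<Rightarrow> real) \<Rightarrow> real" where
  "ppart g = pp (\<lambda>x. max (g x) 0) - pp (\<lambda>x. max (- g x) 0)"

lemma nonneg_parts: "continuous_on M g \<Longrightarrow> nonneg (\<lambda>x. max (g x) 0)" "continuous_on M g \<Longrightarrow> nonneg (\<lambda>x. max (- g x) 0)"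
  by (auto intro!: continuous_intros)

lemma ppart_nonneg_eq: assumes "nonneg g" shows "ppart g = pp g"
proof -
  have "below (\<lambda>x. max (g x) 0) = below g" using assms by (auto simp: below_def max_def)
  then have 1: "pp (\<lambda>x. max (g x) 0) = pp g" by (simp add: pp_def)
  have z: "L1 h - L2 h = 0" if "h \<in> below (\<lambda>x. max (- g x) 0)" for h
  proof -
    have ch: "continuous_on M h" and e: "\<And>x. x \<in> M \<Longrightarrow> h x = 0 * h x"
    proof -
      show "continuous_on M h" using that by (simp add: below_def)
      have "h x = 0" if "x \<in> M" for x
        using \<open>h \<in> _\<close> assms that by (auto simp: below_def max_def split: if_splits intro: order_antisym)
      then show "x \<in> M \<Longrightarrow> h x = 0 * h x" for x by simp
    qed
    have ch0: "continuous_on M (\<lambda>x. 0 * h x)" by (intro continuous_intros ch)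
    have "L1 h = L1 (\<lambda>x. 0 * h x)" "L2 h = L2 (\<lambda>x. 0 * h x)"
      by (rule positive_on_cong[OF L1 ch ch0 e] positive_on_cong[OF L2 ch ch0 e]; assumption)+
    then show ?thesis using linear_onD(2)[OF L1(1) ch ch, of 0] linear_onD(2)[OF L2(1) ch ch, of 0] by simp
  qed
  have n: "nonneg (\<lambda>x. max (- g x) 0)" using assms by (intro nonneg_parts) simp
  have "pp (\<lambda>x. max (- g x) 0) = 0"
  proof (rule order_antisym)
    show "pp (\<lambda>x. max (- g x) 0) \<le> 0" by (rule pp_least[OF n]) (simp only: z order_refl)
    show "0 \<le> pp (\<lambda>x. max (- g x) 0)" using pp_upper[OF n below_zero[OF n]] by (simp only: z[OF below_zero[OF n]])
  qed
  then show ?thesis using 1 by (simp add: ppart_def)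
qed

lemma ppart_add:
  assumes g: "continuous_on M g" and h: "continuous_on M h"
  shows "ppart (\<lambda>x. g x + h x) = ppart g + ppart h"
proof -
  let ?p = "\<lambda>g x. max (g x) (0::real)" and ?n = "\<lambda>g x. max (- g x) (0::real)"
  let ?s = "\<lambda>x. g x + h x"
  have s: "continuous_on M ?s" by (intro continuous_intros g h)
  have nn: "nonneg (\<lambda>x. u x + v x)" if "nonneg u" "nonneg v" for u v
    using that by (auto intro: continuous_intros)
  have "(\<lambda>x. (?p ?s x + ?n g x) + ?n h x) = (\<lambda>x. (?n ?s x + ?p g x) + ?p h x)"
    by (rule ext) (auto simp: max_def)
  then have "pp (\<lambda>x. (?p ?s x + ?n g x) + ?n h x) = pp (\<lambda>x. (?n ?s x + ?p g x) + ?p h x)" by simp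
  then have "pp (?p ?s) + pp (?n g) + pp (?n h) = pp (?n ?s) + pp (?p g) + pp (?p h)"
    using nonneg_parts[OF s] nonneg_parts[OF g] nonneg_parts[OF h] by (simp add: pp_add nn del: minus_add_distrib)
  then show ?thesis unfolding ppart_def by linarith
qed

lemma ppart_scale: assumes g: "continuous_on M g" shows "ppart (\<lambda>x. c * g x) = c * ppart g"
proof -
  have pos: "ppart (\<lambda>x. c * g x) = c * ppart g" if c: "c > 0" and g: "continuous_on M g" for c g
  proof -
    have "(\<lambda>x. max (c * g x) 0) = (\<lambda>x. c * max (g x) 0)" "(\<lambda>x. max (- (c * g x)) 0) = (\<lambda>x. c * max (- g x) 0)"
      using c by (auto simp: max_def mult_le_0_iff zero_le_mult_iff)
    then show ?thesis
      using pp_scale[OF nonneg_parts(1)[OF g] c] pp_scale[OF nonneg_parts(2)[OF g] c]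
      by (simp add: ppart_def right_diff_distrib)
  qed
  have neg: "ppart (\<lambda>x. - g x) = - ppart g" for g by (simp add: ppart_def)
  consider "c > 0" | "c = 0" | "c < 0" by linarith
  then show ?thesis
  proof cases
    case 3
    have "ppart (\<lambda>x. - ((- c) * g x)) = - ((- c) * ppart g)"
      using neg[of "\<lambda>x. (- c) * g x"] pos[of "- c", OF _ g] 3 by simp
    then show ?thesis by simp
  qed (use pos g in \<open>auto simp: ppart_def\<close>)
qed

text \<open>The functional \<open>p\<close> is the least positive one above \<open>L1 - L2\<close>, so that \<open>L2 + p\<close> and \<open>L1 - p\<close>
  are the supremum and the infimum of \<open>L1\<close> and \<open>L2\<close>.\<close>

lemma riesz_positive_part:
  obtains p where "linear_on M p" "positive_on M p"
    "\<And>g. continuous_on M g \<Longrightarrow> (\<And>x. x \<in> M \<Longrightarrow> 0 \<le> g x) \<Longrightarrow> L1 g - L2 g \<le> p g"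
    "\<And>L g. positive_on M L \<Longrightarrow> linear_on M L \<Longrightarrow>
       (\<And>h. continuous_on M h \<Longrightarrow> (\<And>x. x \<in> M \<Longrightarrow> 0 \<le> h x) \<Longrightarrow> L1 h - L2 h \<le> L h) \<Longrightarrow>
       continuous_on M g \<Longrightarrow> (\<And>x. x \<in> M \<Longrightarrow> 0 \<le> g x) \<Longrightarrow> p g \<le> L g"
proof (rule that[of ppart])
  show "linear_on M ppart" by (simp add: linear_on_def ppart_add ppart_scale)
  show "L1 g - L2 g \<le> ppart g" if "continuous_on M g" "\<And>x. x \<in> M \<Longrightarrow> 0 \<le> g x" for g
    using that pp_ge by (simp add: ppart_nonneg_eq)
  have z: "L1 (\<lambda>x. 0) = 0" "L2 (\<lambda>x. 0) = 0"
    using linear_onD(2)[OF L1(1), of "\<lambda>x. 0" "\<lambda>x. 0" 0] linear_onD(2)[OF L2(1), of "\<lambda>x. 0" "\<lambda>x. 0" 0] by auto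
  show "positive_on M ppart"
    unfolding positive_on_def
  proof (intro allI impI)
    fix g :: "'a \<Rightarrow> real" assume "continuous_on M g" "\<forall>x\<in>M. 0 \<le> g x"
    then have g: "nonneg g" by simp
    from pp_upper[OF g below_zero[OF g]] show "0 \<le> ppart g" by (simp add: z ppart_nonneg_eq[OF g])
  qed
  fix L and g :: "'a \<Rightarrow> real" assume L: "positive_on M L" "linear_on M L"
    "\<And>h. continuous_on M h \<Longrightarrow> (\<And>x. x \<in> M \<Longrightarrow> 0 \<le> h x) \<Longrightarrow> L1 h - L2 h \<le> L h"
    and g: "continuous_on M g" "\<And>x. x \<in> M \<Longrightarrow> 0 \<le> g x"
  have "pp g \<le> L g"
  proof (rule pp_least)
    fix h assume h: "h \<in> below g"
    then have "L1 h - L2 h \<le> L h" by (intro L(3)) (auto simp: below_def)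
    also have "L h \<le> L g" using h g by (intro positive_on_mono[OF L(2,1)]) (auto simp: below_def)
    finally show "L1 h - L2 h \<le> L g" .
  qed (use g in auto)
  then show "ppart g \<le> L g" using g by (simp add: ppart_nonneg_eq)
qed

end

context nc_torus
begin

section \<open>The compact convex set of spreadable states\<close>

abbreviation K :: "(torus_elem \<Rightarrow> complex) set" where "K \<equiv> spreadable_states \<alpha>"

lemma K_states: "\<phi> \<in> K \<Longrightarrow> \<phi> \<in> states A"
  by (simp add: spreadable_iff)

lemma state_le_nrm: assumes "\<phi> \<in> states A" "S \<in> carrier A" shows "cmod (\<phi> S) \<le> nrm S"
proof -
  obtain X where X: "X \<in> CS" "S = cls X" using assms(2) by (rule carrierE)
  have "(\<lambda>n. cmod (\<phi> (\<iota> (X n)))) \<longlonglongrightarrow> cmod (\<phi> S)"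
    unfolding X(2) by (intro tendsto_norm st_tendsto[OF assms(1) X(1)])
  then show ?thesis
    unfolding X(2) by (rule LIMSEQ_le[OF _ nrm_tendsto[OF X(1)]]) (use state_pos_functional(2)[OF assms(1)] in auto)
qed

lemma closed_states: "closed (states A)"
proof -
  have ev: "continuous_on UNIV (\<lambda>\<phi> :: torus_elem \<Rightarrow> complex. \<phi> S)" for S by (rule continuous_on_eval)
  have "states A = (\<Inter>S\<in>- carrier A. {\<phi>. \<phi> S = 0})
      \<inter> (\<Inter>S\<in>carrier A. \<Inter>T\<in>carrier A. {\<phi>. \<phi> (S \<oplus>\<^bsub>A\<^esub> T) = \<phi> S + \<phi> T})
      \<inter> (\<Inter>c. \<Inter>S\<in>carrier A. {\<phi>. \<phi> (c \<odot>\<^bsub>A\<^esub> S) = c * \<phi> S})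
      \<inter> (\<Inter>S\<in>carrier A. (\<lambda>\<phi>. \<phi> (star A S \<otimes>\<^bsub>A\<^esub> S)) -` \<real>\<^sub>\<ge>\<^sub>0)
      \<inter> {\<phi>. \<phi> \<one>\<^bsub>A\<^esub> = 1}"
    unfolding states_def by (rule Set.set_eqI) (simp, blast)
  also have "closed \<dots>"
    by (intro closed_Int closed_INT ballI closed_Collect_eq continuous_intros ev closed_vimage closed_nonneg_Reals_complex)
  finally show ?thesis .
qed

lemma closed_K: "closed K"
proof -
  have ev: "continuous_on UNIV (\<lambda>\<phi> :: torus_elem \<Rightarrow> complex. \<phi> S)" for S by (rule continuous_on_eval)
  have "K = states A \<inter> (\<Inter>h\<in>{h. strict_mono h}. \<Inter>x. {\<phi>. \<phi> (\<iota> (shift h x)) = \<phi> (\<iota> x)})"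
    by (rule Set.set_eqI) (simp add: spreadable_iff)
  also have "closed \<dots>"
    by (intro closed_Int closed_INT ballI closed_Collect_eq ev closed_states)
  finally show ?thesis .
qed

text \<open>Since states are contractive, they lie in a product of discs, which is compact by
  Tychonoff's theorem.\<close>

lemma compact_K: "compact K"
proof -
  define B where "B S = cball (0::complex) (if S \<in> carrier A then nrm S else 0)" for S
  have "compactin (product_topology (\<lambda>_. euclidean) UNIV) (PiE UNIV B)"
    unfolding compactin_PiE by (simp add: B_def)
  then have c: "compact (PiE UNIV B)" by (simp add: euclidean_product_topology)
  have "K \<subseteq> PiE UNIV B"
  proof
    fix \<phi> assume "\<phi> \<in> K"
    then have \<phi>: "\<phi> \<in> states A" by (rule K_states)
    then have "\<phi> S = 0" if "S \<notin> carrier A" for S using that by (simp add: states_def)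
    then show "\<phi> \<in> PiE UNIV B" using state_le_nrm[OF \<phi>] by (auto simp: B_def)
  qed
  then have "K = PiE UNIV B \<inter> K" by blast
  then show ?thesis using compact_Int_closed[OF c closed_K] by simp
qed

lemma star_mult_carrier: "S \<in> carrier A \<Longrightarrow> star A S \<otimes>\<^bsub>A\<^esub> S \<in> carrier A"
  by (elim carrierE) (simp add: CS_star CS_mult)

lemma one_carrier: "\<one>\<^bsub>A\<^esub> \<in> carrier A" by (simp add: cls_one)

lemma smult_carrier: "S \<in> carrier A \<Longrightarrow> c \<odot>\<^bsub>A\<^esub> S \<in> carrier A"
  by (elim carrierE) (simp add: CS_scale)

lemma endo_carrier: "strict_mono h \<Longrightarrow> S \<in> carrier A \<Longrightarrow> torus_endo \<alpha> h S \<in> carrier A"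
  by (elim carrierE) (simp add: torus_endo_cls CS_shift_word)

lemma K_iff:
  "\<phi> \<in> K \<longleftrightarrow> \<phi> \<in> states A \<and> (\<forall>h. strict_mono h \<longrightarrow> (\<forall>S\<in>carrier A. \<phi> (torus_endo \<alpha> h S) = \<phi> S))"
  by (simp add: spreadable_states_def torus_eq)

lemma convex_K: "convex K"
proof (rule convexI)
  fix \<phi> \<psi> and u v :: real
  assume *: "\<phi> \<in> K" "\<psi> \<in> K" "0 \<le> u" "0 \<le> v" "u + v = 1"
  define \<tau> where "\<tau> = u *\<^sub>R \<phi> + v *\<^sub>R \<psi>"
  have e: "\<tau> S = of_real u * \<phi> S + of_real v * \<psi> S" for S
    by (simp add: \<tau>_def scaleR_fun_def scaleR_conv_of_real)
  have s: "\<phi> \<in> states A" "\<psi> \<in> states A" using * by (auto simp: K_iff)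
  have uv: "complex_of_real u + of_real v = 1" using *(5) by (simp flip: of_real_add)
  have "\<tau> (star A S \<otimes>\<^bsub>A\<^esub> S) \<in> \<real>\<^sub>\<ge>\<^sub>0" if "S \<in> carrier A" for S
    using s that *(3,4) unfolding e states_def by (auto intro!: nonneg_Reals_add_I nonneg_Reals_mult_I)
  then have "\<tau> \<in> states A"
    using s uv unfolding states_def by (auto simp: e algebra_simps)
  moreover have "\<tau> (torus_endo \<alpha> h S) = \<tau> S" if "strict_mono h" "S \<in> carrier A" for h S
    using *(1,2) that by (simp add: e K_iff)
  ultimately have "\<tau> \<in> K" by (simp add: K_iff)
  then show "u *\<^sub>R \<phi> + v *\<^sub>R \<psi> \<in> K" by (simp only: \<tau>_def)
qed

definition E :: "(torus_elem \<Rightarrow> complex) set" where "E = {\<phi>. \<phi> extreme_point_of K}"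

lemma restrict_inj: "\<phi> \<in> K \<Longrightarrow> \<psi> \<in> K \<Longrightarrow> (\<lambda>x. \<phi> (\<iota> x)) = (\<lambda>x. \<psi> (\<iota> x)) \<Longrightarrow> \<phi> = \<psi>"
  by (intro states_eqI K_states) (auto dest: fun_cong)

lemma extreme_iff:
  "\<phi> \<in> E \<longleftrightarrow> \<phi> \<in> K \<and> product_moments (\<lambda>x. \<phi> (\<iota> x)) (\<lambda>k. \<phi> (\<iota> (U 0 k)))"
proof
  assume "\<phi> \<in> E"
  then have \<phi>: "\<phi> \<in> K" and ext: "\<And>a b. a \<in> K \<Longrightarrow> b \<in> K \<Longrightarrow> \<phi> \<notin> open_segment a b"
    by (auto simp: E_def extreme_point_of_def)
  note spr = spr_of_state[OF \<phi>]
  have "extreme_spr (\<lambda>x. \<phi> (\<iota> x))"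
    unfolding extreme_spr_def
  proof (intro conjI[OF spr] allI impI)
    fix g h and t :: real
    assume g: "spr g" and h: "spr h" and t: "0 < t" "t < 1"
      and eq: "\<forall>x. \<phi> (\<iota> x) = of_real (1 - t) * g x + of_real t * h x"
    let ?a = "ext_fun g" and ?b = "ext_fun h"
    have ab: "?a \<in> K" "?b \<in> K" "\<And>x. ?a (\<iota> x) = g x" "\<And>x. ?b (\<iota> x) = h x"
      using state_of_spr[OF g] state_of_spr[OF h] by auto
    have "(1 - t) *\<^sub>R ?a + t *\<^sub>R ?b \<in> K"
      using convexD[OF convex_K ab(1,2), of "1 - t" t] t by simp
    then have p: "\<phi> = (1 - t) *\<^sub>R ?a + t *\<^sub>R ?b"
      by (intro restrict_inj[OF \<phi>]) (auto simp: eq ab scaleR_fun_def scaleR_conv_of_real)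
    have "?a = ?b" using ext[OF ab(1,2)] p t by (auto simp: in_segment)
    then have "\<phi> = ?a" unfolding p by (simp flip: scaleR_left_distrib)
    then show "g = (\<lambda>x. \<phi> (\<iota> x)) \<and> h = (\<lambda>x. \<phi> (\<iota> x))" using ab \<open>?a = ?b\<close> by (auto simp: fun_eq_iff)
  qed
  from extreme_product_moments[OF this] \<phi>
  show "\<phi> \<in> K \<and> product_moments (\<lambda>x. \<phi> (\<iota> x)) (\<lambda>k. \<phi> (\<iota> (U 0 k)))"
    unfolding mom_def[OF spr, abs_def] by simp
next
  assume *: "\<phi> \<in> K \<and> product_moments (\<lambda>x. \<phi> (\<iota> x)) (\<lambda>k. \<phi> (\<iota> (U 0 k)))"
  note spr = spr_of_state[OF conjunct1[OF *]]
  have ex: "extreme_spr (\<lambda>x. \<phi> (\<iota> x))"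
    using * spr by (intro product_moments_extreme) (simp_all add: mom_def[OF spr, abs_def])
  show "\<phi> \<in> E"
    unfolding E_def extreme_point_of_def mem_Collect_eq
  proof (intro conjI ballI notI)
    show "\<phi> \<in> K" using * by simp
    fix a b assume ab: "a \<in> K" "b \<in> K" "\<phi> \<in> open_segment a b"
    then obtain t where t: "a \<noteq> b" "0 < t" "t < 1" "\<phi> = (1 - t) *\<^sub>R a + t *\<^sub>R b"
      by (auto simp: in_segment)
    have "(\<lambda>x. a (\<iota> x)) = (\<lambda>x. \<phi> (\<iota> x)) \<and> (\<lambda>x. b (\<iota> x)) = (\<lambda>x. \<phi> (\<iota> x))"
      using ex[unfolded extreme_spr_def, THEN conjunct2, rule_format, OF spr_of_state[OF ab(1)] spr_of_state[OF ab(2)] t(2,3)]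
      by (simp add: t(4) scaleR_fun_def scaleR_conv_of_real)
    then show False using restrict_inj[OF ab(1,2)] t(1) by simp
  qed
qed

lemma E_K: "\<phi> \<in> E \<Longrightarrow> \<phi> \<in> K" by (simp add: extreme_iff)

lemma bounded_fun_K: "\<phi> \<in> K \<Longrightarrow> bounded_fun (\<lambda>x. \<phi> (\<iota> x))"
  by (intro spr_bounded spr_of_state)

text \<open>Multiplicativity over sites is a family of equations between evaluations.\<close>

lemma closed_E: "closed E"
proof -
  have ev: "continuous_on UNIV (\<lambda>\<phi> :: torus_elem \<Rightarrow> complex. \<phi> S)" for S by (rule continuous_on_eval)
  have "E = K \<inter> (\<Inter>(w, j, k)\<in>{(w, j, k). j \<notin> supp w}. {\<phi>. \<phi> (\<iota> (P w * U j k)) = \<phi> (\<iota> (P w)) * \<phi> (\<iota> (U 0 k))})"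
  proof (rule Set.set_eqI)
    fix \<phi>
    show "\<phi> \<in> E \<longleftrightarrow> \<phi> \<in> K \<inter> (\<Inter>(w, j, k)\<in>{(w, j, k). j \<notin> supp w}. {\<phi>. \<phi> (\<iota> (P w * U j k)) = \<phi> (\<iota> (P w)) * \<phi> (\<iota> (U 0 k))})"
    proof (cases "\<phi> \<in> K")
      case True
      have "\<phi> (\<iota> 1) = 1" using state_pos_functional(3)[OF K_states[OF True]] .
      then show ?thesis
        unfolding extreme_iff product_moments_iff[OF bounded_fun_K[OF True]] using True by auto
    qed (simp add: extreme_iff)
  qed
  also have "closed \<dots>"
    by (intro closed_Int closed_K closed_INT ballI, clarify)
      (intro closed_Collect_eq continuous_intros ev)
  finally show ?thesis .
qed

lemma K_le_of_E_le:
  assumes "\<phi> \<in> K" "\<And>e. e \<in> E \<Longrightarrow> Re (e S) \<le> c" shows "Re (\<phi> S) \<le> c"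
proof -
  obtain e where "e extreme_point_of K" "\<And>\<phi>. \<phi> \<in> K \<Longrightarrow> Re (\<phi> S) \<le> Re (e S)"
    using extreme_point_maximizing[OF compact_K closed_K, of S] assms(1) by blast
  then show ?thesis using assms by (metis E_def mem_Collect_eq order_trans)
qed

section \<open>The space of extreme points\<close>

text \<open>An extreme point is a product state and so is known from its one-site moments. The map
  \<open>moments\<close> is a continuous injection of a compact set into a metrizable space, hence a
  homeomorphism of the extreme points onto their image \<open>M\<close>. Elements of the algebra become
  functions on \<open>M\<close> through \<open>hat\<close>.\<close>

definition moments :: "(torus_elem \<Rightarrow> complex) \<Rightarrow> int \<Rightarrow> complex" where
  "moments \<phi> k = \<phi> (\<iota> (U 0 k))"

definition M :: "(int \<Rightarrow> complex) set" where "M = moments ` E"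

definition hat :: "torus_elem \<Rightarrow> (int \<Rightarrow> complex) \<Rightarrow> complex" where
  "hat S m = inv_into E moments m S"

lemma inj_moments: "inj_on moments E"
proof (rule inj_onI)
  fix \<phi> \<psi> assume *: "\<phi> \<in> E" "\<psi> \<in> E" "moments \<phi> = moments \<psi>"
  have "(\<lambda>k. \<phi> (\<iota> (U 0 k))) = (\<lambda>k. \<psi> (\<iota> (U 0 k)))"
    using *(3) by (simp add: fun_eq_iff moments_def)
  then show "\<phi> = \<psi>"
    using *(1,2) unfolding extreme_iff
    by (intro restrict_inj product_moments_unique[where m = "\<lambda>k. \<psi> (\<iota> (U 0 k))"]) (auto simp: bounded_fun_K)
qed

lemma hat_moments: "e \<in> E \<Longrightarrow> hat S (moments e) = e S"
  unfolding hat_def by (subst inv_into_f_f[OF inj_moments]) simp_all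

lemma continuous_moments: "continuous_on A' moments"
  by (rule continuous_on_coordinatewise_then_product) (simp add: moments_def continuous_on_eval)

lemma compact_E: "compact E"
proof -
  have "E = K \<inter> E" using E_K by blast
  then show ?thesis using compact_Int_closed[OF compact_K closed_E] by simp
qed

lemma compact_M: "compact M"
  unfolding M_def by (intro compact_continuous_image continuous_moments compact_E)

lemma continuous_hat: "continuous_on M (hat S)"
proof -
  have "continuous_on (moments ` E) (inv_into E moments)"
    by (rule continuous_on_inv[OF continuous_moments compact_E]) (simp add: inj_moments)
  from continuous_on_compose[OF this continuous_on_eval[of _ S]]
  show ?thesis by (simp add: M_def hat_def[abs_def] o_def)
qed

lemma continuous_Re_hat: "continuous_on M (\<lambda>m. Re (hat S m))" and continuous_Im_hat: "continuous_on M (\<lambda>m. Im (hat S m))"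
  using continuous_hat[of S] by (auto intro: continuous_intros)

lemma E_state: "e \<in> E \<Longrightarrow> e \<in> states A" using E_K K_states by blast

lemma M_cases: assumes "m \<in> M" obtains e where "e \<in> E" "m = moments e"
  using assms by (auto simp: M_def)

lemma E_mult:
  assumes e: "e \<in> E" and d: "\<And>w v. w \<in> X \<Longrightarrow> v \<in> Y \<Longrightarrow> supp w \<inter> supp v = {}"
    and w: "w \<in> X" "v \<in> Y"
  shows "e (\<iota> (P w * P v)) = e (\<iota> (P w)) * e (\<iota> (P v))"
proof -
  let ?f = "\<lambda>x. e (\<iota> x)"
  have pm: "product_moments ?f (\<lambda>k. e (\<iota> (U 0 k)))" and bf: "bounded_fun ?f"
    using e bounded_fun_K by (auto simp: extreme_iff)
  obtain n ds where n: "distinct ds" "set ds = supp w" "P w \<doteq> free_scale (ph n) (mono (map (\<lambda>j. (j, ex w j)) ds))"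
    using word_normal_form by blast
  obtain n' ds' where n': "distinct ds'" "set ds' = supp v" "P v \<doteq> free_scale (ph n') (mono (map (\<lambda>j. (j, ex v j)) ds'))"
    using word_normal_form by blast
  let ?a = "map (\<lambda>j. (j, ex w j)) ds" and ?b = "map (\<lambda>j. (j, ex v j)) ds'"
  have "P w * P v \<doteq> free_scale (ph n) (mono ?a) * free_scale (ph n') (mono ?b)"
    by (rule eqv_mult[OF n(3) n'(3)])
  also have "\<dots> = free_scale (ph n * ph n') (mono (?a @ ?b))"
    by (simp add: mono_append mult.commute)
  finally have "?f (P w * P v) = ph n * ph n' * ?f (mono (?a @ ?b))"
    using bf_eqv[OF bf] bf_scale[OF bf] by metis
  moreover have "?f (P w) = ph n * ?f (mono ?a)" "?f (P v) = ph n' * ?f (mono ?b)"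
    using bf_eqv[OF bf n(3)] bf_eqv[OF bf n'(3)] by (simp_all add: bf_scale[OF bf])
  moreover have "?f (mono (?a @ ?b)) = ?f (mono ?a) * ?f (mono ?b)"
  proof -
    note q = pm[unfolded product_moments_def, rule_format]
    have m: "map fst (map (\<lambda>j. (j, g j)) xs) = xs" for g :: "int \<Rightarrow> int" and xs
      by (induction xs) auto
    have d: "distinct (map fst (?a @ ?b))" "distinct (map fst ?a)" "distinct (map fst ?b)"
      unfolding map_append m using n(1,2) n'(1,2) d[OF w] by auto
    show ?thesis unfolding q[OF d(1)] q[OF d(2)] q[OF d(3)] by simp
  qed
  ultimately show ?thesis by simp
qed

text \<open>The two shifts make the supports of \<open>x\<close> and \<open>y\<close> disjoint without changing their values.\<close>

lemma E_shift_mult: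
  assumes e: "e \<in> E"
  shows "e (\<iota> (shift (\<lambda>j. 2 * j) x * shift (\<lambda>j. 2 * j + 1) y)) = e (\<iota> x) * e (\<iota> y)"
proof -
  let ?g = "\<lambda>j::int. 2 * j" and ?h = "\<lambda>j::int. 2 * j + 1" and ?f = "\<lambda>x. e (\<iota> x)"
  have bf: "bounded_fun ?f" using e bounded_fun_K by (auto simp: extreme_iff)
  have sh: "?f (shift h z) = ?f z" if "strict_mono h" for h z
    using e that by (simp add: extreme_iff spreadable_iff)
  have sm: "strict_mono ?g" "strict_mono ?h" by (auto simp: strict_mono_def)
  have add: "?f (u + v) = ?f u + ?f v" for u v using bf by (simp add: bounded_fun_def)
  have s: "Poly_Mapping.single v c = free_scale c (P (letters v))" for v c by (simp add: P_def scale_single)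
  have "?f (shift ?g (P w) * shift ?h (P v)) = ?f (P w) * ?f (P v)" for w v
  proof -
    have "?f (P (shl ?g w) * P (shl ?h v)) = ?f (P (shl ?g w)) * ?f (P (shl ?h v))"
    proof (rule E_mult[OF e, of "{shl ?g w}" "{shl ?h v}"])
      fix a b assume "a \<in> {shl ?g w}" "b \<in> {shl ?h v}"
      then show "supp a \<inter> supp b = {}" by (auto simp: supp_shl) presburger
    qed auto
    then show ?thesis unfolding shift_P[symmetric] by (simp only: sh[OF sm(1)] sh[OF sm(2)])
  qed
  then have "?f (shift ?g (P w) * shift ?h y) = ?f (P w) * ?f y" for w
    by (induction y rule: free_induct)
      (simp_all only: s shift_scale scale_mult_right bf_scale[OF bf] shift_add distrib_left add mult.left_commute)
  then show ?thesis
    by (induction x rule: free_induct)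
      (simp_all only: s shift_scale scale_mult_left bf_scale[OF bf] shift_add distrib_right add mult.assoc)
qed

text \<open>Stone--Weierstrass. The functions form a ring because a product of two of them is the
  function of a product with disjoint supports; the selfadjoint parts \<open>x'\<close> and \<open>y'\<close> are needed, as
  the real part of a product is not the product of the real parts.\<close>

lemma Re_hat_dense:
  assumes g: "continuous_on M g" and e: "e > 0"
  obtains x where "\<And>m. m \<in> M \<Longrightarrow> \<bar>g m - Re (hat (\<iota> x) m)\<bar> < e"
proof -
  define R where "R = {g. \<exists>x. \<forall>m\<in>M. g m = Re (hat (\<iota> x) m)}"
  note lin = pf_add[OF state_pos_functional(1)[OF E_state]] pf_scale[OF state_pos_functional(1)[OF E_state]]
    pf_star[OF state_pos_functional(1)[OF E_state]]
  interpret function_ring_on R M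
  proof
    show "compact M" by (rule compact_M)
    show "continuous_on M f" if f: "f \<in> R" for f
    proof -
      obtain x where "\<forall>m\<in>M. f m = Re (hat (\<iota> x) m)" using f by (auto simp: R_def)
      then show ?thesis using continuous_on_eq[OF continuous_Re_hat[of "\<iota> x"]] by simp
    qed
    show "(\<lambda>x. f x + g x) \<in> R" if fg: "f \<in> R" "g \<in> R" for f g
    proof -
      obtain x y where *: "\<forall>m\<in>M. f m = Re (hat (\<iota> x) m)" "\<forall>m\<in>M. g m = Re (hat (\<iota> y) m)"
        using fg by (auto simp: R_def)
      have "f m + g m = Re (hat (\<iota> (x + y)) m)" if "m \<in> M" for m
      proof -
        obtain e where "e \<in> E" "m = moments e" using \<open>m \<in> M\<close> by (rule M_cases)
        then show ?thesis using * that lin(1)[of e x y] by (simp add: hat_moments)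
      qed
      then show ?thesis unfolding R_def by blast
    qed
    show "(\<lambda>x. f x * g x) \<in> R" if fg: "f \<in> R" "g \<in> R" for f g
    proof -
      obtain x y where *: "\<forall>m\<in>M. f m = Re (hat (\<iota> x) m)" "\<forall>m\<in>M. g m = Re (hat (\<iota> y) m)"
        using fg by (auto simp: R_def)
      define x' where "x' = free_scale (1/2) (x + free_star x)"
      define y' where "y' = free_scale (1/2) (y + free_star y)"
      have "f m * g m = Re (hat (\<iota> (shift (\<lambda>j. 2 * j) x' * shift (\<lambda>j. 2 * j + 1) y')) m)" if "m \<in> M" for m
      proof -
        obtain e where e: "e \<in> E" "m = moments e" using \<open>m \<in> M\<close> by (rule M_cases)
        have "e (\<iota> x') = of_real (Re (e (\<iota> x)))" "e (\<iota> y') = of_real (Re (e (\<iota> y)))"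
          by (simp_all add: x'_def y'_def lin e(1) complex_add_cnj)
        then show ?thesis using * that E_shift_mult[OF e(1), of x' y'] e by (simp add: hat_moments)
      qed
      then show ?thesis unfolding R_def by blast
    qed
    show "(\<lambda>_. c) \<in> R" for c
    proof -
      have "c = Re (hat (\<iota> (free_scale (of_real c) 1)) m)" if "m \<in> M" for m
      proof -
        obtain e where e: "e \<in> E" "m = moments e" using \<open>m \<in> M\<close> by (rule M_cases)
        show ?thesis using e lin(2)[OF e(1), of "of_real c" 1] state_pos_functional(3)[OF E_state[OF e(1)]]
          by (simp add: hat_moments)
      qed
      then show ?thesis unfolding R_def by blast
    qed
    show "\<exists>f\<in>R. f a \<noteq> f b" if ab: "a \<in> M" "b \<in> M" "a \<noteq> b" for a b
    proof (rule ccontr)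
      assume n: "\<not> (\<exists>f\<in>R. f a \<noteq> f b)"
      obtain d where d: "d \<in> E" "a = moments d" using ab(1) by (rule M_cases)
      obtain e where e: "e \<in> E" "b = moments e" using ab(2) by (rule M_cases)
      have "(\<lambda>m. Re (hat (\<iota> x) m)) \<in> R" for x unfolding R_def by blast
      then have re: "Re (d (\<iota> x)) = Re (e (\<iota> x))" for x
        using n d e by (metis hat_moments)
      have "Im (d (\<iota> x)) = Im (e (\<iota> x))" for x
        using re[of "free_scale (- \<i>) x"] lin(2)[OF d(1), of "- \<i>" x] lin(2)[OF e(1), of "- \<i>" x] by simp
      then have "d = e" using re d(1) e(1) E_K by (intro restrict_inj) (auto simp: complex_eq_iff)
      then show False using ab(3) d(2) e(2) by simp
    qed
  qed
  from Stone_Weierstrass_basic[OF g e] obtain f where f: "f \<in> R" "\<forall>m\<in>M. \<bar>g m - f m\<bar> < e" by blast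
  then obtain x where x: "\<forall>m\<in>M. f m = Re (hat (\<iota> x) m)" by (auto simp: R_def)
  show ?thesis using f(2) x by (intro that[of x]) simp
qed

end

lemma small_imp_zero:
  fixes a c :: real assumes "\<And>e. e > 0 \<Longrightarrow> \<bar>a\<bar> \<le> c * e" shows "a = 0"
proof (rule ccontr)
  assume "a \<noteq> 0"
  then have "\<bar>a\<bar> > 0" by simp
  define d where "d = \<bar>c\<bar> + 1"
  have d: "d > 0" "c \<le> d" by (auto simp: d_def)
  define e where "e = \<bar>a\<bar> / (2 * d)"
  have e: "e > 0" using \<open>\<bar>a\<bar> > 0\<close> d by (simp add: e_def)
  have "\<bar>a\<bar> \<le> c * e" by (rule assms[OF e])
  also have "\<dots> \<le> d * e" using e d by (intro mult_right_mono) auto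
  also have "\<dots> = \<bar>a\<bar> / 2" using d(1) by (simp add: e_def)
  finally show False using \<open>\<bar>a\<bar> > 0\<close> by simp
qed

context nc_torus
begin

section \<open>Spreadable states as functionals on the space of extreme points\<close>

lemma state_add: "\<phi> \<in> states A \<Longrightarrow> S \<in> carrier A \<Longrightarrow> T \<in> carrier A \<Longrightarrow> \<phi> (S \<oplus>\<^bsub>A\<^esub> T) = \<phi> S + \<phi> T"
  and state_smult: "\<phi> \<in> states A \<Longrightarrow> S \<in> carrier A \<Longrightarrow> \<phi> (c \<odot>\<^bsub>A\<^esub> S) = c * \<phi> S"
  and state_square: "\<phi> \<in> states A \<Longrightarrow> S \<in> carrier A \<Longrightarrow> \<phi> (star A S \<otimes>\<^bsub>A\<^esub> S) \<in> \<real>\<^sub>\<ge>\<^sub>0"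
  and state_one: "\<phi> \<in> states A \<Longrightarrow> \<phi> \<one>\<^bsub>A\<^esub> = 1"
  by (auto simp: states_def)

lemma iota_carrier: "\<iota> x \<in> carrier A" by simp

lemma E_endo: "e \<in> E \<Longrightarrow> S \<in> carrier A \<Longrightarrow> strict_mono h \<Longrightarrow> e (torus_endo \<alpha> h S) = e S"
  using E_K by (auto simp: K_iff)

lemma hat_add: "m \<in> M \<Longrightarrow> S \<in> carrier A \<Longrightarrow> T \<in> carrier A \<Longrightarrow> hat (S \<oplus>\<^bsub>A\<^esub> T) m = hat S m + hat T m"
  and hat_smult: "m \<in> M \<Longrightarrow> S \<in> carrier A \<Longrightarrow> hat (c \<odot>\<^bsub>A\<^esub> S) m = c * hat S m"
  and hat_square: "m \<in> M \<Longrightarrow> S \<in> carrier A \<Longrightarrow> hat (star A S \<otimes>\<^bsub>A\<^esub> S) m \<in> \<real>\<^sub>\<ge>\<^sub>0"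
  and hat_one: "m \<in> M \<Longrightarrow> hat \<one>\<^bsub>A\<^esub> m = 1"
  and hat_endo: "m \<in> M \<Longrightarrow> S \<in> carrier A \<Longrightarrow> strict_mono h \<Longrightarrow> hat (torus_endo \<alpha> h S) m = hat S m"
  by (auto elim!: M_cases simp: hat_moments E_state state_add state_smult state_square state_one E_endo)

text \<open>By the maximum principle an inequality between two elements needs to be checked at extreme
  points only.\<close>

lemma K_mono:
  assumes \<phi>: "\<phi> \<in> K" and ST: "S \<in> carrier A" "T \<in> carrier A"
    and le: "\<And>m. m \<in> M \<Longrightarrow> Re (hat S m) \<le> Re (hat T m) + d"
  shows "Re (\<phi> S) \<le> Re (\<phi> T) + d"
proof -
  let ?D = "S \<oplus>\<^bsub>A\<^esub> (-1) \<odot>\<^bsub>A\<^esub> T"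
  have v: "\<psi> ?D = \<psi> S - \<psi> T" if "\<psi> \<in> states A" for \<psi>
    using that ST by (simp add: state_add state_smult smult_carrier)
  have "Re (\<phi> ?D) \<le> d"
  proof (rule K_le_of_E_le[OF \<phi>])
    fix e assume e: "e \<in> E"
    then have "moments e \<in> M" by (simp add: M_def)
    from le[OF this] show "Re (e ?D) \<le> d" using e by (simp add: v E_state hat_moments)
  qed
  then show ?thesis using v[OF K_states[OF \<phi>]] by simp
qed

text \<open>A spreadable state is monotone in the functions \<open>hat S\<close>, which are dense, so it extends to a
  positive functional on \<open>C(M)\<close>. The infimum over all approximations together with their errors
  defines the extension without a choice of sequences.\<close>

lemma extension_exists:
  assumes \<phi>: "\<phi> \<in> K"
  obtains L where "linear_on M L" "positive_on M L" "\<And>S. S \<in> carrier A \<Longrightarrow> L (\<lambda>m. Re (hat S m)) = Re (\<phi> S)"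
proof -
  define near where "near g S e \<longleftrightarrow> S \<in> carrier A \<and> (\<forall>m\<in>M. \<bar>Re (hat S m) - g m\<bar> \<le> e)" for g :: "(int \<Rightarrow> complex) \<Rightarrow> real" and S e
  define L where "L g = Inf {Re (\<phi> S) + e | S e. near g S e}" for g
  have cmp: "Re (\<phi> S) - e \<le> Re (\<phi> T) + d" if "near g S e" "near g T d" for g S T e d
  proof -
    have "Re (hat S m) \<le> Re (hat T m) + (e + d)" if "m \<in> M" for m
      using \<open>near g S e\<close> \<open>near g T d\<close> that unfolding near_def by (smt (verit))
    from K_mono[OF \<phi> _ _ this] show ?thesis using that by (simp add: near_def)
  qed
  have L: "\<bar>L g - Re (\<phi> S)\<bar> \<le> e" if n: "near g S e" for g S e
  proof -
    have "L g \<le> Re (\<phi> S) + e"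
      unfolding L_def
    proof (rule cInf_lower)
      show "bdd_below {Re (\<phi> S) + e | S e. near g S e}"
        using cmp[OF n] by (intro bdd_belowI[of _ "Re (\<phi> S) - e"]) auto
    qed (use n in blast)
    moreover have "Re (\<phi> S) - e \<le> L g"
      unfolding L_def by (rule cInf_greatest) (use n cmp[OF n] in auto)
    ultimately show ?thesis by linarith
  qed
  have ex: "\<exists>x. near g (\<iota> x) e" if "continuous_on M g" "e > 0" for g e
  proof -
    obtain x where "\<And>m. m \<in> M \<Longrightarrow> \<bar>g m - Re (hat (\<iota> x) m)\<bar> < e" using Re_hat_dense[OF \<open>continuous_on M g\<close> \<open>e > 0\<close>] by blast
    then have "near g (\<iota> x) e" unfolding near_def by (auto simp: abs_minus_commute less_imp_le)
    then show ?thesis by blast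
  qed
  show ?thesis
  proof (rule that[of L])
    show "linear_on M L"
      unfolding linear_on_def
    proof (intro conjI allI impI)
      fix g h :: "(int \<Rightarrow> complex) \<Rightarrow> real" assume g: "continuous_on M g" and h: "continuous_on M h"
      have "L (\<lambda>x. g x + h x) - (L g + L h) = 0"
      proof (rule small_imp_zero[where c = 4])
        fix e :: real assume e: "e > 0"
        obtain x y where x: "near g (\<iota> x) e" and y: "near h (\<iota> y) e" using ex[OF g e] ex[OF h e] by blast
        have "near (\<lambda>m. g m + h m) (\<iota> x \<oplus>\<^bsub>A\<^esub> \<iota> y) (2 * e)"
          unfolding near_def
        proof (intro conjI ballI)
          show "\<iota> x \<oplus>\<^bsub>A\<^esub> \<iota> y \<in> carrier A" by simp
          fix m assume m: "m \<in> M"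
          have "\<bar>Re (hat (\<iota> x) m) - g m\<bar> \<le> e" "\<bar>Re (hat (\<iota> y) m) - h m\<bar> \<le> e"
            using x y m by (auto simp: near_def)
          then show "\<bar>Re (hat (\<iota> x \<oplus>\<^bsub>A\<^esub> \<iota> y) m) - (g m + h m)\<bar> \<le> 2 * e"
            unfolding hat_add[OF m iota_carrier iota_carrier] plus_complex.sel by linarith
        qed
        from L[OF this] have "\<bar>L (\<lambda>m. g m + h m) - (Re (\<phi> (\<iota> x)) + Re (\<phi> (\<iota> y)))\<bar> \<le> 2 * e"
          unfolding state_add[OF K_states[OF \<phi>] iota_carrier iota_carrier] plus_complex.sel .
        then show "\<bar>L (\<lambda>x. g x + h x) - (L g + L h)\<bar> \<le> 4 * e"
          using L[OF x] L[OF y] by linarith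
      qed
      then show "L (\<lambda>x. g x + h x) = L g + L h" by simp
    next
      fix c and g :: "(int \<Rightarrow> complex) \<Rightarrow> real" assume g: "continuous_on M g"
      have "L (\<lambda>x. c * g x) - c * L g = 0"
      proof (rule small_imp_zero[where c = "2 * \<bar>c\<bar>"])
        fix e :: real assume e: "e > 0"
        obtain x where x: "near g (\<iota> x) e" using ex[OF g e] by blast
        have "near (\<lambda>m. c * g m) (of_real c \<odot>\<^bsub>A\<^esub> \<iota> x) (\<bar>c\<bar> * e)"
          unfolding near_def
        proof (intro conjI ballI)
          show "of_real c \<odot>\<^bsub>A\<^esub> \<iota> x \<in> carrier A" by (intro smult_carrier iota_carrier)
          fix m assume m: "m \<in> M"
          have "\<bar>c\<bar> * \<bar>Re (hat (\<iota> x) m) - g m\<bar> \<le> \<bar>c\<bar> * e"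
            using x m by (intro mult_left_mono) (auto simp: near_def)
          then show "\<bar>Re (hat (of_real c \<odot>\<^bsub>A\<^esub> \<iota> x) m) - c * g m\<bar> \<le> \<bar>c\<bar> * e"
            unfolding hat_smult[OF m iota_carrier] by (simp add: right_diff_distrib flip: abs_mult)
        qed
        from L[OF this] have 1: "\<bar>L (\<lambda>m. c * g m) - c * Re (\<phi> (\<iota> x))\<bar> \<le> \<bar>c\<bar> * e"
          unfolding state_smult[OF K_states[OF \<phi>] iota_carrier] by simp
        have "\<bar>c\<bar> * \<bar>L g - Re (\<phi> (\<iota> x))\<bar> \<le> \<bar>c\<bar> * e" by (intro mult_left_mono L[OF x]) simp
        then have "\<bar>c * L g - c * Re (\<phi> (\<iota> x))\<bar> \<le> \<bar>c\<bar> * e" by (simp add: right_diff_distrib flip: abs_mult)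
        with 1 show "\<bar>L (\<lambda>x. c * g x) - c * L g\<bar> \<le> 2 * \<bar>c\<bar> * e" by linarith
      qed
      then show "L (\<lambda>x. c * g x) = c * L g" by simp
    qed
    show "positive_on M L"
      unfolding positive_on_def
    proof (intro allI impI)
      fix g :: "(int \<Rightarrow> complex) \<Rightarrow> real" assume g: "continuous_on M g" "\<forall>x\<in>M. 0 \<le> g x"
      have "0 \<le> L g + e" if "e > 0" for e
      proof -
        have "e / 2 > 0" using that by simp
        then obtain x where x: "near g (\<iota> x) (e / 2)" using ex[OF g(1)] by blast
        have z: "hat (0 \<odot>\<^bsub>A\<^esub> \<iota> x) m = 0" if "m \<in> M" for m
          using hat_smult[OF that iota_carrier, of 0 x] by (simp only: mult_zero_left)
        have "Re (\<phi> (0 \<odot>\<^bsub>A\<^esub> \<iota> x)) \<le> Re (\<phi> (\<iota> x)) + e / 2"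
        proof (rule K_mono[OF \<phi> smult_carrier[OF iota_carrier] iota_carrier])
          fix m assume m: "m \<in> M"
          have "\<bar>Re (hat (\<iota> x) m) - g m\<bar> \<le> e / 2" "0 \<le> g m" using x g(2) m by (auto simp: near_def)
          then show "Re (hat (0 \<odot>\<^bsub>A\<^esub> \<iota> x) m) \<le> Re (hat (\<iota> x) m) + e / 2" unfolding z[OF m] zero_complex.sel by linarith
        qed
        then have "0 \<le> Re (\<phi> (\<iota> x)) + e / 2" unfolding state_smult[OF K_states[OF \<phi>] iota_carrier] by simp
        then show ?thesis using L[OF x] by linarith
      qed
      then show "0 \<le> L g" by (rule field_le_epsilon)
    qed
    fix S assume "S \<in> carrier A"
    then have "near (\<lambda>m. Re (hat S m)) S 0" by (simp add: near_def)
    from L[OF this] show "L (\<lambda>m. Re (hat S m)) = Re (\<phi> S)" by simp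
  qed
qed

text \<open>A functional on \<open>C(M)\<close> gives a functional on the algebra; together with its total mass it
  gives a point of the ambient space of the cone.\<close>

definition functional :: "(((int \<Rightarrow> complex) \<Rightarrow> real) \<Rightarrow> real) \<Rightarrow> torus_elem \<Rightarrow> complex" where
  "functional L S = (if S \<in> carrier A then Complex (L (\<lambda>m. Re (hat S m))) (L (\<lambda>m. Im (hat S m))) else 0)"

definition cone_point :: "(((int \<Rightarrow> complex) \<Rightarrow> real) \<Rightarrow> real) \<Rightarrow> (torus_elem \<Rightarrow> complex) \<times> real" where
  "cone_point L = (functional L, L (\<lambda>m. 1))"

abbreviation lin_pos where "lin_pos L \<equiv> linear_on M L \<and> positive_on M L"

abbreviation C :: "((torus_elem \<Rightarrow> complex) \<times> real) set" where "C \<equiv> cone hull (K \<times> {1})"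

lemma C_iff: "x \<in> C \<longleftrightarrow> (\<exists>c \<phi>. 0 \<le> c \<and> \<phi> \<in> K \<and> x = (c *\<^sub>R \<phi>, c))"
  unfolding cone_hull_expl by force

text \<open>The functions \<open>hat S\<close> inherit all linear properties of the extreme points, and \<open>L\<close> preserves
  them.\<close>

lemma functional_state:
  assumes L: "linear_on M L" "positive_on M L" and one: "L (\<lambda>m. 1) = 1"
  shows "functional L \<in> K"
proof -
  note cRe = continuous_Re_hat and cIm = continuous_Im_hat
  have cong: "L g = L h" if "continuous_on M g" "continuous_on M h" "\<And>m. m \<in> M \<Longrightarrow> g m = h m" for g h
    by (rule positive_on_cong[OF L that])
  have zero: "L (\<lambda>m. 0) = 0" using linear_onD(2)[of M L "\<lambda>_. 0" "\<lambda>_. 0" 0] L(1) by simp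
  have add: "functional L (S \<oplus>\<^bsub>A\<^esub> T) = functional L S + functional L T" if ST: "S \<in> carrier A" "T \<in> carrier A" for S T
  proof -
    have "L (\<lambda>m. Re (hat (S \<oplus>\<^bsub>A\<^esub> T) m)) = L (\<lambda>m. Re (hat S m) + Re (hat T m))"
      "L (\<lambda>m. Im (hat (S \<oplus>\<^bsub>A\<^esub> T) m)) = L (\<lambda>m. Im (hat S m) + Im (hat T m))"
      by (rule cong; (intro continuous_intros cRe cIm)?; simp add: hat_add ST)+
    then show ?thesis
      using ST by (simp add: functional_def carrier_add linear_onD(1)[OF L(1) cRe cRe] linear_onD(1)[OF L(1) cIm cIm] complex_eq_iff)
  qed
  have smult: "functional L (c \<odot>\<^bsub>A\<^esub> S) = c * functional L S" if S: "S \<in> carrier A" for c S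
  proof -
    have c1: "continuous_on M (\<lambda>m. a * Re (hat S m))" "continuous_on M (\<lambda>m. a * Im (hat S m))" for a
      by (intro continuous_intros cRe cIm)+
    have "L (\<lambda>m. Re (hat (c \<odot>\<^bsub>A\<^esub> S) m)) = L (\<lambda>m. Re c * Re (hat S m) - Im c * Im (hat S m))"
      "L (\<lambda>m. Im (hat (c \<odot>\<^bsub>A\<^esub> S) m)) = L (\<lambda>m. Re c * Im (hat S m) + Im c * Re (hat S m))"
      by (rule cong; (intro continuous_intros cRe cIm)?; simp add: hat_smult S)+
    then show ?thesis
      using S by (simp add: functional_def smult_carrier linear_onD(3)[OF L(1) c1(1) c1(2)] linear_onD(1)[OF L(1) c1(2) c1(1)]
          linear_onD(2)[OF L(1) cRe cRe] linear_onD(2)[OF L(1) cIm cIm] complex_eq_iff)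
  qed
  have pos: "functional L (star A S \<otimes>\<^bsub>A\<^esub> S) \<in> \<real>\<^sub>\<ge>\<^sub>0" if S: "S \<in> carrier A" for S
  proof -
    have "0 \<le> L (\<lambda>m. Re (hat (star A S \<otimes>\<^bsub>A\<^esub> S) m))"
      using L(2) cRe hat_square[OF _ S] unfolding positive_on_def by (metis complex_nonneg_Reals_iff)
    moreover have "L (\<lambda>m. Im (hat (star A S \<otimes>\<^bsub>A\<^esub> S) m)) = L (\<lambda>m. 0)"
      by (rule cong[OF cIm continuous_on_const]) (use hat_square[OF _ S] in \<open>simp add: complex_nonneg_Reals_iff\<close>)
    ultimately show ?thesis using star_mult_carrier[OF S] by (simp add: functional_def zero complex_nonneg_Reals_iff)
  qed
  have unit: "functional L \<one>\<^bsub>A\<^esub> = 1"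
  proof -
    have "L (\<lambda>m. Re (hat \<one>\<^bsub>A\<^esub> m)) = L (\<lambda>m. 1)" "L (\<lambda>m. Im (hat \<one>\<^bsub>A\<^esub> m)) = L (\<lambda>m. 0)"
      by (rule cong; (intro continuous_intros cRe cIm)?; simp add: hat_one)+
    then show ?thesis by (simp add: functional_def one_carrier one zero complex_eq_iff)
  qed
  have inv: "functional L (torus_endo \<alpha> h S) = functional L S" if h: "strict_mono h" and S: "S \<in> carrier A" for h S
  proof -
    have "L (\<lambda>m. Re (hat (torus_endo \<alpha> h S) m)) = L (\<lambda>m. Re (hat S m))" "L (\<lambda>m. Im (hat (torus_endo \<alpha> h S) m)) = L (\<lambda>m. Im (hat S m))"
      by (rule cong; (intro cRe cIm)?; simp add: hat_endo h S)+
    then show ?thesis using endo_carrier[OF h S] S by (simp add: functional_def)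
  qed
  have "functional L \<in> states A"
    unfolding states_def using add smult pos unit by (auto simp: functional_def)
  then show ?thesis using inv by (simp add: K_iff)
qed

lemma cone_point_in_C:
  assumes L: "lin_pos L" and ne: "K \<noteq> {}"
  shows "cone_point L \<in> C"
proof -
  define c where "c = L (\<lambda>m. 1)"
  have c: "c \<ge> 0" using L unfolding c_def positive_on_def by (auto intro: continuous_intros)
  show ?thesis
  proof (cases "c = 0")
    case True
    \<comment> \<open>A functional of total mass zero vanishes, as continuous functions on the compact space \<open>M\<close> are bounded.\<close>
    have "L g = 0" if g: "continuous_on M g" for g
    proof -
      have "compact ((\<lambda>x. \<bar>g x\<bar>) ` M)"
        by (intro compact_continuous_image compact_M continuous_intros g)
      then obtain B where B: "\<And>m. m \<in> M \<Longrightarrow> \<bar>g m\<bar> \<le> B"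
        by (meson bounded_imp_bdd_above compact_imp_bounded bdd_above_def imageI)
      have "L (\<lambda>m. 0) = 0"
        using L linear_onD(2)[of M L "\<lambda>m. 0" "\<lambda>m. 0" 0] by simp
      then show ?thesis
        using positive_on_bound[of M L g "\<lambda>m. 0" B] L g B True by (simp add: c_def)
    qed
    then have "cone_point L = (0, 0)"
      using True by (auto simp: cone_point_def functional_def continuous_Re_hat continuous_Im_hat c_def fun_eq_iff complex_eq_iff)
    moreover obtain \<phi> where \<phi>: "\<phi> \<in> K" using ne by blast
    ultimately have "cone_point L = (0 *\<^sub>R \<phi>, 0)" by simp
    then show ?thesis unfolding C_iff using \<phi> by (metis order_refl)
  next
    case False
    then have c: "c > 0" using c by simp
    let ?L = "\<lambda>g. inverse c * L g"
    have lp: "linear_on M ?L" "positive_on M ?L"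
      using L c by (auto simp: linear_on_def positive_on_def algebra_simps)
    have "functional ?L \<in> K" by (rule functional_state[OF lp]) (use c in \<open>simp add: c_def\<close>)
    moreover have "cone_point L = (c *\<^sub>R functional ?L, c)"
      using c by (auto simp: cone_point_def functional_def c_def[symmetric] scaleR_fun_def fun_eq_iff complex_eq_iff)
    ultimately show ?thesis unfolding C_iff using c by (metis less_imp_le)
  qed
qed

lemma C_cone_point: assumes "x \<in> C" obtains L where "lin_pos L" "x = cone_point L"
proof -
  obtain c \<phi> where x: "0 \<le> c" "\<phi> \<in> K" "x = (c *\<^sub>R \<phi>, c)" using assms C_iff by blast
  obtain L where L: "linear_on M L" "positive_on M L" "\<And>S. S \<in> carrier A \<Longrightarrow> L (\<lambda>m. Re (hat S m)) = Re (\<phi> S)"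
    using x(2) by (rule extension_exists) blast
  let ?L = "\<lambda>g. c * L g"
  have \<phi>: "\<phi> \<in> states A" using x(2) by (rule K_states)
  have Im: "L (\<lambda>m. Im (hat S m)) = Im (\<phi> S)" if S: "S \<in> carrier A" for S
  proof -
    have "L (\<lambda>m. Im (hat S m)) = L (\<lambda>m. Re (hat ((- \<i>) \<odot>\<^bsub>A\<^esub> S) m))"
      by (rule positive_on_cong[OF L(1,2) continuous_Im_hat continuous_Re_hat]) (simp add: hat_smult S)
    also have "\<dots> = Im (\<phi> S)" by (simp add: L(3) smult_carrier S state_smult[OF \<phi>])
    finally show ?thesis .
  qed
  have one: "L (\<lambda>m. 1) = 1"
  proof -
    have "L (\<lambda>m. 1) = L (\<lambda>m. Re (hat \<one>\<^bsub>A\<^esub> m))"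
      by (rule positive_on_cong[OF L(1,2) continuous_on_const continuous_Re_hat]) (simp add: hat_one)
    then show ?thesis by (simp add: L(3) one_carrier state_one[OF \<phi>])
  qed
  have "lin_pos ?L" using L(1,2) x(1) by (auto simp: linear_on_def positive_on_def algebra_simps)
  moreover have "x = cone_point ?L"
    using \<phi> by (auto simp: x(3) cone_point_def functional_def fun_eq_iff scaleR_fun_def complex_eq_iff L(3) Im one states_def)
  ultimately show ?thesis by (rule that)
qed

text \<open>By density a positive functional on \<open>C(M)\<close> is determined by its point of the cone.\<close>

lemma cone_point_eq:
  assumes L: "lin_pos L" and L': "lin_pos L'" and eq: "cone_point L = cone_point L'" and g: "continuous_on M g"
  shows "L g = L' g"
proof -
  have one: "L (\<lambda>m. 1) = L' (\<lambda>m. 1)" using eq by (simp add: cone_point_def)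
  have re: "L (\<lambda>m. Re (hat (\<iota> x) m)) = L' (\<lambda>m. Re (hat (\<iota> x) m))" for x
    using eq by (auto simp: cone_point_def functional_def fun_eq_iff dest: spec[of _ "\<iota> x"])
  have "L g - L' g = 0"
  proof (rule small_imp_zero[where c = "2 * L (\<lambda>m. 1)"])
    fix e :: real assume e: "e > 0"
    obtain x where x: "\<And>m. m \<in> M \<Longrightarrow> \<bar>g m - Re (hat (\<iota> x) m)\<bar> < e" using Re_hat_dense[OF g e] by blast
    have "\<bar>L g - L (\<lambda>m. Re (hat (\<iota> x) m))\<bar> \<le> e * L (\<lambda>m. 1)"
      by (rule positive_on_bound[of M L g "\<lambda>m. Re (hat (\<iota> x) m)" e]) (use L x g in \<open>auto intro: continuous_Re_hat less_imp_le\<close>)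
    moreover have "\<bar>L' g - L' (\<lambda>m. Re (hat (\<iota> x) m))\<bar> \<le> e * L' (\<lambda>m. 1)"
      by (rule positive_on_bound[of M L' g "\<lambda>m. Re (hat (\<iota> x) m)" e]) (use L' x g in \<open>auto intro: continuous_Re_hat less_imp_le\<close>)
    ultimately show "\<bar>L g - L' g\<bar> \<le> 2 * L (\<lambda>m. 1) * e" unfolding re one by (simp add: algebra_simps)
  qed
  then show ?thesis by simp
qed

section \<open>The lattice cone over the spreadable states\<close>

lemma lin_pos_add: "lin_pos L \<Longrightarrow> lin_pos L' \<Longrightarrow> lin_pos (\<lambda>g. L g + L' g)"
  by (auto simp: linear_on_def positive_on_def algebra_simps)

lemma cone_point_add: "cone_point (\<lambda>g. L g + L' g) = cone_point L + cone_point L'"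
  by (auto simp: cone_point_def functional_def fun_eq_iff complex_eq_iff)

text \<open>The order of the cone is the order of functionals on \<open>C(M)\<close>.\<close>

lemma cone_point_diff_iff:
  assumes L: "lin_pos L" and L': "lin_pos L'" and ne: "K \<noteq> {}"
  shows "cone_point L' - cone_point L \<in> C \<longleftrightarrow> (\<forall>g. continuous_on M g \<longrightarrow> (\<forall>m\<in>M. 0 \<le> g m) \<longrightarrow> L g \<le> L' g)"
proof
  assume "cone_point L' - cone_point L \<in> C"
  then obtain L'' where L'': "lin_pos L''" "cone_point L' - cone_point L = cone_point L''" by (rule C_cone_point)
  then have e: "cone_point L' = cone_point (\<lambda>g. L g + L'' g)"
    unfolding cone_point_add by (metis add.commute diff_add_cancel)
  have "L' g = L g + L'' g" if "continuous_on M g" for g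
    by (rule cone_point_eq[OF L' lin_pos_add[OF L L''(1)] e that])
  then show "\<forall>g. continuous_on M g \<longrightarrow> (\<forall>m\<in>M. 0 \<le> g m) \<longrightarrow> L g \<le> L' g"
    using L''(1) by (simp add: positive_on_def)
next
  assume le: "\<forall>g. continuous_on M g \<longrightarrow> (\<forall>m\<in>M. 0 \<le> g m) \<longrightarrow> L g \<le> L' g"
  have "lin_pos (\<lambda>g. L' g - L g)"
    using L L' le by (auto simp: linear_on_def positive_on_def algebra_simps)
  moreover have "cone_point (\<lambda>g. L' g - L g) = cone_point L' - cone_point L"
    by (auto simp: cone_point_def functional_def fun_eq_iff complex_eq_iff)
  ultimately show "cone_point L' - cone_point L \<in> C" using cone_point_in_C[OF _ ne] by metis
qed

lemma C_add: assumes "x \<in> C" "y \<in> C" and ne: "K \<noteq> {}" shows "x + y \<in> C"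
proof -
  obtain L where L: "lin_pos L" "x = cone_point L" using assms(1) by (rule C_cone_point)
  obtain L' where L': "lin_pos L'" "y = cone_point L'" using assms(2) by (rule C_cone_point)
  show ?thesis
    unfolding L(2) L'(2) cone_point_add[symmetric] by (rule cone_point_in_C[OF lin_pos_add[OF L(1) L'(1)] ne])
qed

lemma C_antisym: assumes "z \<in> C" "- z \<in> C" shows "z = 0"
proof -
  obtain c \<phi> d \<psi> where *: "0 \<le> c" "z = (c *\<^sub>R \<phi>, c)" "0 \<le> d" "- z = (d *\<^sub>R \<psi>, d)"
    using assms C_iff by metis
  then have "c = 0" by simp
  then show ?thesis using * by (simp add: zero_prod_def)
qed

abbreviation cone_order where
  "cone_order \<equiv> \<lparr>carrier = C, eq = (=), le = (\<lambda>x y. y - x \<in> C)\<rparr>"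

lemma cone_lattice: assumes ne: "K \<noteq> {}" shows "Lattice.lattice cone_order"
proof -
  obtain \<phi> where \<phi>: "\<phi> \<in> K" using ne by blast
  have "0 = (0 *\<^sub>R \<phi>, 0 :: real)" by (simp add: zero_prod_def)
  then have zero: "0 \<in> C" unfolding C_iff using \<phi> by (metis order_refl)
  have tr: "z - x \<in> C" if "y - x \<in> C" "z - y \<in> C" for x y z
    using C_add[OF that ne] by (simp add: algebra_simps)
  have anti: "x = y" if "y - x \<in> C" "x - y \<in> C" for x y
    using C_antisym[of "y - x"] that by simp
  note le_iff = cone_point_diff_iff[OF _ _ ne]
  have sup_inf: "(\<exists>s. least cone_order s (Upper cone_order {x, y})) \<and> (\<exists>i. greatest cone_order i (Lower cone_order {x, y}))"
    if xy: "x \<in> C" "y \<in> C" for x y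
  proof -
    obtain L1 where L1: "lin_pos L1" "x = cone_point L1" using xy(1) by (rule C_cone_point)
    obtain L2 where L2: "lin_pos L2" "y = cone_point L2" using xy(2) by (rule C_cone_point)
    obtain p where p: "linear_on M p" "positive_on M p"
      "\<And>g. continuous_on M g \<Longrightarrow> (\<And>x. x \<in> M \<Longrightarrow> 0 \<le> g x) \<Longrightarrow> L1 g - L2 g \<le> p g"
      "\<And>L g. positive_on M L \<Longrightarrow> linear_on M L \<Longrightarrow>
         (\<And>h. continuous_on M h \<Longrightarrow> (\<And>x. x \<in> M \<Longrightarrow> 0 \<le> h x) \<Longrightarrow> L1 h - L2 h \<le> L h) \<Longrightarrow>
         continuous_on M g \<Longrightarrow> (\<And>x. x \<in> M \<Longrightarrow> 0 \<le> g x) \<Longrightarrow> p g \<le> L g"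
      using riesz_positive_part[of M L1 L2] L1(1) L2(1) by blast
    have p0: "0 \<le> p g" if "continuous_on M g" "\<And>m. m \<in> M \<Longrightarrow> 0 \<le> g m" for g
      using p(2) that by (simp add: positive_on_def)
    have pL1: "p g \<le> L1 g" if "continuous_on M g" "\<And>m. m \<in> M \<Longrightarrow> 0 \<le> g m" for g
    proof (rule p(4)[OF _ _ _ that])
      show "L1 h - L2 h \<le> L1 h" if "continuous_on M h" "\<And>x. x \<in> M \<Longrightarrow> 0 \<le> h x" for h
        using L2(1) that by (simp add: positive_on_def)
    qed (use L1(1) in auto)
    have S: "lin_pos (\<lambda>g. L2 g + p g)" using lin_pos_add[OF L2(1)] p(1,2) by blast
    have I: "lin_pos (\<lambda>g. L1 g - p g)"
      using L1(1) p(1) pL1 by (auto simp: linear_on_def positive_on_def algebra_simps)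
    let ?s = "cone_point (\<lambda>g. L2 g + p g)" and ?i = "cone_point (\<lambda>g. L1 g - p g)"
    have up: "Upper cone_order {x, y} = {u \<in> C. u - x \<in> C \<and> u - y \<in> C}"
      and low: "Lower cone_order {x, y} = {l \<in> C. x - l \<in> C \<and> y - l \<in> C}"
      using xy by (auto simp: Upper_def Lower_def simp del: split_paired_All)
    have "?s - x \<in> C" unfolding L1(2) le_iff[OF L1(1) S] using p(3) by (smt (verit))
    moreover have "?s - y \<in> C" unfolding L2(2) le_iff[OF L2(1) S] using p0 by simp
    moreover have "u - ?s \<in> C" if u: "u \<in> C" "u - x \<in> C" "u - y \<in> C" for u
    proof -
      obtain L where L: "lin_pos L" "u = cone_point L" using u(1) by (rule C_cone_point)
      have b: "L1 g \<le> L g" "L2 g \<le> L g" if "continuous_on M g" "\<And>m. m \<in> M \<Longrightarrow> 0 \<le> g m" for g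
        using u(2,3) that unfolding L(2) L1(2) L2(2) le_iff[OF L1(1) L(1)] le_iff[OF L2(1) L(1)] by auto
      have D: "linear_on M (\<lambda>g. L g - L2 g)" "positive_on M (\<lambda>g. L g - L2 g)"
        using L(1) L2(1) b(2) by (auto simp: linear_on_def positive_on_def algebra_simps)
      have "p g \<le> L g - L2 g" if "continuous_on M g" "\<And>m. m \<in> M \<Longrightarrow> 0 \<le> g m" for g
        by (rule p(4)[OF D(2,1) _ that]) (simp add: b(1))
      then show ?thesis unfolding L(2) le_iff[OF S L(1)] by (simp add: algebra_simps)
    qed
    ultimately have "least cone_order ?s (Upper cone_order {x, y})"
      unfolding least_def up using cone_point_in_C[OF S ne]
      by (simp only: gorder.simps partial_object.simps eq_object.simps mem_Collect_eq) blast
    moreover have "x - ?i \<in> C" unfolding L1(2) le_iff[OF I L1(1)] using p0 by simp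
    moreover have "y - ?i \<in> C" unfolding L2(2) le_iff[OF I L2(1)] using p(3) by (smt (verit))
    moreover have "?i - u \<in> C" if u: "u \<in> C" "x - u \<in> C" "y - u \<in> C" for u
    proof -
      obtain L where L: "lin_pos L" "u = cone_point L" using u(1) by (rule C_cone_point)
      have b: "L g \<le> L1 g" "L g \<le> L2 g" if "continuous_on M g" "\<And>m. m \<in> M \<Longrightarrow> 0 \<le> g m" for g
        using u(2,3) that unfolding L(2) L1(2) L2(2) le_iff[OF L(1) L1(1)] le_iff[OF L(1) L2(1)] by auto
      have D: "linear_on M (\<lambda>g. L1 g - L g)" "positive_on M (\<lambda>g. L1 g - L g)"
        using L(1) L1(1) b(1) by (auto simp: linear_on_def positive_on_def algebra_simps)
      have "p g \<le> L1 g - L g" if "continuous_on M g" "\<And>m. m \<in> M \<Longrightarrow> 0 \<le> g m" for g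
        by (rule p(4)[OF D(2,1) _ that]) (simp add: b(2))
      then show ?thesis unfolding L(2) le_iff[OF L(1) I] by (simp add: algebra_simps)
    qed
    ultimately have "greatest cone_order ?i (Lower cone_order {x, y})"
      unfolding greatest_def low using cone_point_in_C[OF I ne]
      by (simp only: gorder.simps partial_object.simps eq_object.simps mem_Collect_eq) blast
    with \<open>least cone_order ?s (Upper cone_order {x, y})\<close> show ?thesis by blast
  qed
  show ?thesis
  proof (unfold_locales, simp_all only: gorder.simps partial_object.simps eq_object.simps diff_self)
    show "\<exists>s. least cone_order s (Upper cone_order {x, y})" if "x \<in> C" "y \<in> C" for x y
      using sup_inf[OF that] by blast
    show "\<exists>i. greatest cone_order i (Lower cone_order {x, y})" if "x \<in> C" "y \<in> C" for x y
      using sup_inf[OF that] by blast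
    show "z - x \<in> C" if "y - x \<in> C" "z - y \<in> C" for x y z using that by (rule tr)
    show "x = y" if "y - x \<in> C" "x - y \<in> C" for x y using that by (rule anti)
    show "0 \<in> C" by (rule zero)
  qed
qed

lemma spreadable_states_bauer: assumes "K \<noteq> {}" shows "bauer_simplex K"
  using compact_K convex_K closed_E cone_lattice[OF assms]
  by (simp add: bauer_simplex_def choquet_simplex_def E_def)

end

text \<open>These are the moments of Haar measure.\<close>

lemma delta_pos_def: "pos_def (\<lambda>k. if k = 0 then 1 else 0)"
  unfolding pos_def_def
proof (intro allI)
  fix n :: nat and a :: "nat \<Rightarrow> complex"
  have "(\<Sum>s<n. \<Sum>t<n. cnj (a s) * a t * (if int t - int s = 0 then 1 else 0)) =
      (\<Sum>s<n. \<Sum>t<n. if t = s then of_real ((cmod (a s))\<^sup>2) else 0)"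
    by (intro sum.cong refl) (auto simp: complex_norm_square mult.commute simp flip: of_real_power)
  also have "\<dots> = (\<Sum>s<n. of_real ((cmod (a s))\<^sup>2))" by simp
  also have "\<dots> \<in> \<real>\<^sub>\<ge>\<^sub>0"
    by (rule nonneg_Reals_sum) (simp only: nonneg_Reals_of_real_iff zero_le_power2)
  finally show "(\<Sum>s<n. \<Sum>t<n. cnj (a s) * a t * (if int t - int s = 0 then 1 else 0)) \<in> \<real>\<^sub>\<ge>\<^sub>0" .
qed

context nc_torus
begin

section \<open>Extreme points and product states\<close>

text \<open>The group \<open>\<Delta>\<^sub>\<alpha>\<close> is zero or generated by its least positive element \<open>d\<close>; a root of unity of
  order \<open>2 \<bar>k\<bar>\<close> or \<open>d\<close>, respectively, separates \<open>k\<close> from it.\<close>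

lemma perp_separates:
  assumes k: "k \<notin> Del" obtains z where "z \<in> Delta_perp \<alpha>" "z powi k \<noteq> 1"
proof (cases "Del = {0}")
  case True
  have k0: "k \<noteq> 0" using k by auto
  define z where "z = cis (pi / of_int k)"
  have "z powi k = cis pi" using k0 unfolding z_def by (simp add: cis_power_int)
  then have "z powi k \<noteq> 1" by (simp add: cis_pi)
  moreover have "z \<in> Delta_perp \<alpha>" using True by (simp add: Delta_perp_def Delta_eq z_def)
  ultimately show ?thesis using that by blast
next
  case False
  then obtain a where "a \<in> Del" "a \<noteq> 0" using Del_0 by blast
  then have ex: "\<exists>n. 0 < n \<and> int n \<in> Del"
    using Del_minus[of a] by (intro exI[of _ "nat \<bar>a\<bar>"]) (auto simp: abs_if)
  define d where "d = (LEAST n. 0 < n \<and> int n \<in> Del)"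
  have d: "0 < d" "int d \<in> Del" using LeastI_ex[OF ex] by (auto simp: d_def)
  have dmin: "d \<le> n" if "0 < n" "int n \<in> Del" for n unfolding d_def using that by (intro Least_le) simp
  have mult: "int d * q \<in> Del" for q
  proof -
    have "ph (int d * q * (int d * q)) = 1"
      using ph_mult_sum[of "{..<nat (q * q)}" "int d" "\<lambda>_. int d"] d(2)
      by (simp add: Del_def mult_ac)
    then show ?thesis by (simp add: Del_def)
  qed
  have dvd: "int d dvd l" if l: "l \<in> Del" for l
  proof -
    have "l - int d * (l div int d) \<in> Del" by (rule Del_diff[OF l mult])
    then have r: "l mod int d \<in> Del" by (simp add: minus_mult_div_eq_mod)
    have "l mod int d = 0"
    proof (rule ccontr)
      assume "l mod int d \<noteq> 0"
      then have "0 < l mod int d" "l mod int d < int d" using pos_mod_bound[of "int d" l] pos_mod_sign[of "int d" l] d(1) by linarith+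
      then show False using dmin[of "nat (l mod int d)"] r by simp
    qed
    then show ?thesis by auto
  qed
  define z where "z = cis (2 * pi / real d)"
  have pw: "z powi l = 1 \<longleftrightarrow> int d dvd l" for l
  proof -
    have "z powi l = cis (2 * pi * of_int l / real d)" unfolding z_def by (simp add: cis_power_int mult_ac)
    also have "\<dots> = 1 \<longleftrightarrow> (\<exists>n::int. 2 * pi * of_int l / real d = of_int (2 * n) * pi)"
      unfolding cis_conv_exp exp_eq_1 by simp
    also have "\<dots> \<longleftrightarrow> (\<exists>n::int. real_of_int l = of_int (int d * n))"
    proof (rule ex_cong1)
      fix n :: int
      have "2 * pi * of_int l / real d = of_int (2 * n) * pi \<longleftrightarrow>
          2 * pi * of_int l = 2 * pi * (of_int n * real d)"
        using d(1) by (simp add: divide_eq_eq mult_ac)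
      also have "\<dots> \<longleftrightarrow> real_of_int l = of_int (int d * n)" by (simp add: mult.commute)
      finally show "2 * pi * of_int l / real d = of_int (2 * n) * pi \<longleftrightarrow> real_of_int l = of_int (int d * n)" .
    qed
    also have "\<dots> \<longleftrightarrow> int d dvd l" unfolding of_int_eq_iff by (auto simp: dvd_def)
    finally show ?thesis .
  qed
  have "z \<in> Delta_perp \<alpha>" using pw dvd by (simp add: Delta_perp_def Delta_eq) (simp add: z_def)
  moreover have "\<not> int d dvd k" using mult k by (auto elim!: dvdE)
  then have "z powi k \<noteq> 1" using pw by simp
  ultimately show ?thesis using that by blast
qed

lemma extreme_point_with_moments:
  assumes m: "pos_def m" "m 0 = 1" and off: "\<And>k. k \<notin> Del \<Longrightarrow> m k = 0"
  obtains \<phi> where "\<phi> \<in> E" "product_moments (\<lambda>x. \<phi> (\<iota> x)) m"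
proof -
  obtain f where f: "spr f" "product_moments f (\<lambda>k. if k \<in> Del then m k else 0)"
    using product_functional_exists[OF m] by blast
  have "(\<lambda>k. if k \<in> Del then m k else 0) = m" using off by auto
  then have pm: "product_moments f m" using f(2) by simp
  let ?\<phi> = "ext_fun f"
  have \<phi>: "?\<phi> \<in> K" "(\<lambda>x. ?\<phi> (\<iota> x)) = f" using state_of_spr[OF f(1)] by auto
  have "f (U 0 k) = m k" for k
    using pm[unfolded product_moments_def, rule_format, of "[(0, k)]"] by simp
  then have "(\<lambda>k. ?\<phi> (\<iota> (U 0 k))) = m" using \<phi>(2) by (auto simp: fun_eq_iff)
  then have "?\<phi> \<in> E" unfolding extreme_iff using \<phi> pm by simp
  then show ?thesis using that \<phi>(2) pm by simp
qed

text \<open>Positive definiteness of the moments is positivity of \<open>e\<close> on polynomials in a single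
  generator.\<close>

lemma E_moments:
  assumes e: "e \<in> E" and m: "m = (\<lambda>k. e (\<iota> (U 0 k)))"
  shows "pos_def m" "m 0 = 1" "\<And>k. k \<notin> Del \<Longrightarrow> m k = 0" "product_moments (\<lambda>x. e (\<iota> x)) m"
proof -
  have eK: "e \<in> K" and pm: "product_moments (\<lambda>x. e (\<iota> x)) (\<lambda>k. e (\<iota> (U 0 k)))" using e by (auto simp: extreme_iff)
  note spr = spr_of_state[OF eK]
  let ?f = "\<lambda>x. e (\<iota> x)"
  show "product_moments ?f m" using pm by (simp add: m)
  show "m 0 = 1" using state_pos_functional(3)[OF K_states[OF eK]] by (simp add: m)
  show "m k = 0" if "k \<notin> Del" for k
  proof -
    obtain v where "U 0 k = P v" "\<And>i. ex v i = (if i = 0 then k else 0)" using U_word by metis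
    then show ?thesis using f_word_zero[OF spr, of v 0] that by (simp add: m)
  qed
  show "pos_def m"
    unfolding pos_def_def
  proof (intro allI)
    fix n :: nat and a :: "nat \<Rightarrow> complex"
    let ?y = "\<Sum>t<n. free_scale (a t) (U 0 (int t))"
    have "free_star ?y * ?y = (\<Sum>s<n. \<Sum>t<n. free_scale (cnj (a s) * a t) (U 0 (- int s) * U 0 (int t)))"
      by (simp only: star_sum star_scale star_U sum_product scale_mult_left scale_mult_right scale_scale mult.commute[of "a _" "cnj _"])
    then have "?f (free_star ?y * ?y) = (\<Sum>s<n. \<Sum>t<n. cnj (a s) * a t * ?f (U 0 (- int s) * U 0 (int t)))"
      by (simp only: f_rules[OF spr])
    also have "\<dots> = (\<Sum>s<n. \<Sum>t<n. cnj (a s) * a t * m (int t - int s))"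
      using f_eqv[OF spr U_add[of 0 "- int _" "int _"]] by (simp add: m)
    finally show "(\<Sum>s<n. \<Sum>t<n. cnj (a s) * a t * m (int t - int s)) \<in> \<real>\<^sub>\<ge>\<^sub>0"
      using pf_pos[OF f_pf[OF spr], of ?y] by simp
  qed
qed

text \<open>Both sides are parametrized by positive definite moments that vanish off \<open>\<Delta>\<^sub>\<alpha>\<close>: for states
  on \<open>C(\<T>)\<close> the vanishing is equivalent to invariance under \<open>Delta_perp \<alpha>\<close>.\<close>

lemma extreme_points_eq: "E = product_state \<alpha> ` rotation_invariant_states (Delta_perp \<alpha>)"
proof (intro equalityI subsetI)
  fix e assume e: "e \<in> E"
  define m where "m = (\<lambda>k. e (\<iota> (U 0 k)))"
  note m = E_moments[OF e m_def]
  have "moment_state m \<in> rotation_invariant_states (Delta_perp \<alpha>)"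
  proof (rule moment_state_invariant[OF m(1,2)])
    fix z k assume "z \<in> Delta_perp \<alpha>" "m k \<noteq> 0"
    then show "z powi k = 1" using m(3)[of k] by (auto simp: Delta_perp_def Delta_eq)
  qed (auto simp: Delta_perp_def)
  moreover have "product_state \<alpha> (moment_state m) = e"
    by (rule product_state_eq[OF E_state[OF e] m(4)]) (simp add: circle_coord_pow moment_state_zk[OF m(1,2)])
  ultimately show "e \<in> product_state \<alpha> ` rotation_invariant_states (Delta_perp \<alpha>)" by force
next
  fix e assume "e \<in> product_state \<alpha> ` rotation_invariant_states (Delta_perp \<alpha>)"
  then obtain \<omega> where \<omega>: "\<omega> \<in> rotation_invariant_states (Delta_perp \<alpha>)" "e = product_state \<alpha> \<omega>" by blast
  have st: "\<omega> \<in> states circle_algebra" using \<omega>(1) by (simp add: rotation_invariant_states_def)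
  define m where "m k = \<omega> (zk k)" for k
  have "pos_def m" using circle_moments_pos_def[OF st] by (simp add: m_def[abs_def])
  moreover have "m 0 = 1" using st by (simp add: m_def states_def circle_ops)
  moreover have "m k = 0" if k: "k \<notin> Del" for k
  proof -
    obtain z where z: "z \<in> Delta_perp \<alpha>" "z powi k \<noteq> 1" using perp_separates[OF k] .
    have "\<omega> (\<lambda>w. zk k (z * w)) = \<omega> (zk k)"
      using \<omega>(1) z(1) zk_carrier by (simp add: rotation_invariant_states_def)
    moreover have "\<omega> (\<lambda>w. zk k (z * w)) = z powi k * m k"
      using z(1) by (simp add: zk_rotate Delta_perp_def cs_scale[OF st zk_carrier] m_def)
    ultimately have "(z powi k - 1) * m k = 0" by (simp add: m_def left_diff_distrib)
    then show ?thesis using z(2) by simp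
  qed
  ultimately obtain \<phi> where \<phi>: "\<phi> \<in> E" "product_moments (\<lambda>x. \<phi> (\<iota> x)) m" using extreme_point_with_moments by blast
  have "product_state \<alpha> \<omega> = \<phi>"
    by (rule product_state_eq[OF E_state[OF \<phi>(1)] \<phi>(2)]) (simp add: circle_coord_pow m_def)
  then show "e \<in> E" using \<phi>(1) \<omega>(2) by simp
qed

lemma trace_extreme:
  obtains \<phi> where "\<phi> \<in> E" "product_moments (\<lambda>x. \<phi> (\<iota> x)) (\<lambda>k. if k = 0 then 1 else 0)"
proof (rule extreme_point_with_moments[OF delta_pos_def])
  show "(if k = 0 then 1 else 0) = (0::complex)" if "k \<notin> Del" for k using that by auto
qed simp_all

lemma K_nonempty: "K \<noteq> {}"
  using trace_extreme E_K by blast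

text \<open>Here \<open>\<Delta>\<^sub>\<alpha> = {0}\<close>, so the trace is the only extreme point, and the maximum principle applied
  to all elements leaves no room for another state.\<close>

lemma spreadable_states_irrational:
  assumes "\<alpha> / (2 * pi) \<notin> \<rat>" shows "K = {canonical_trace \<alpha>}"
proof -
  have Del: "k = 0" if k: "k \<in> Del" for k
  proof (rule ccontr)
    assume k0: "k \<noteq> 0"
    obtain q :: int where "\<alpha> * of_int (k * k) = 2 * pi * of_int q" using k by (auto simp: Del_def ph_eq_1_iff)
    then have "\<alpha> / (2 * pi) = of_int q / of_int (k * k)" using k0 by (simp add: field_simps)
    then show False using assms by simp
  qed
  let ?m = "\<lambda>k::int. if k = 0 then 1 else (0::complex)"
  obtain \<phi> where \<phi>: "\<phi> \<in> E" "product_moments (\<lambda>x. \<phi> (\<iota> x)) ?m" using trace_extreme .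
  have "canonical_trace \<alpha> = \<phi>"
    unfolding canonical_trace_def torus_eq torus_monomial_eq
    by (rule the_product_state[OF E_state[OF \<phi>(1)] \<phi>(2)])
  have "e = \<phi>" if e: "e \<in> E" for e
  proof -
    note m = E_moments[OF e refl]
    have "(\<lambda>k. e (\<iota> (U 0 k))) = ?m" using m(2,3) Del by (auto simp: fun_eq_iff)
    then have "product_moments (\<lambda>x. e (\<iota> x)) ?m" using m(4) by simp
    then show ?thesis
      by (rule restrict_inj[OF E_K[OF e] E_K[OF \<phi>(1)]
            product_moments_unique[OF bounded_fun_K[OF E_K[OF e]] _ bounded_fun_K[OF E_K[OF \<phi>(1)]] \<phi>(2)]])
  qed
  then have E: "E = {\<phi>}" using \<phi>(1) by blast
  have "\<psi> = \<phi>" if \<psi>: "\<psi> \<in> K" for \<psi>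
  proof (rule restrict_inj[OF \<psi> E_K[OF \<phi>(1)]], rule ext)
    fix x
    have le: "Re (\<psi> (\<iota> y)) \<le> Re (\<phi> (\<iota> y))" for y
      by (rule K_le_of_E_le[OF \<psi>]) (simp add: E)
    note sc = pf_scale[OF state_pos_functional(1)[OF K_states[OF \<psi>]]] pf_scale[OF state_pos_functional(1)[OF E_state[OF \<phi>(1)]]]
    show "\<psi> (\<iota> x) = \<phi> (\<iota> x)"
      using le[of x] le[of "free_scale (-1) x"] le[of "free_scale \<i> x"] le[of "free_scale (-\<i>) x"]
      by (simp add: sc complex_eq_iff)
  qed
  then have "K = {\<phi>}" using E_K[OF \<phi>(1)] by blast
  then show ?thesis by (simp only: \<open>canonical_trace \<alpha> = \<phi>\<close>)
qed

end

section \<open>The rational case\<close>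

lemma prime_power_dvd_square_iff:
  fixes p n :: nat assumes p: "prime p"
  shows "p ^ m dvd n\<^sup>2 \<longleftrightarrow> p ^ half_up m dvd n"
proof (cases "n = 0")
  case False
  have unit: "\<not> is_unit p" using p not_prime_unit[of p] by blast
  have "p ^ m dvd n\<^sup>2 \<longleftrightarrow> m \<le> multiplicity p (n\<^sup>2)"
    using False unit by (intro power_dvd_iff_le_multiplicity) auto
  also have "multiplicity p (n\<^sup>2) = 2 * multiplicity p n"
    using p False by (intro prime_elem_multiplicity_power_distrib) auto
  also have "m \<le> 2 * multiplicity p n \<longleftrightarrow> half_up m \<le> multiplicity p n"
    unfolding half_up_def by presburger
  also have "\<dots> \<longleftrightarrow> p ^ half_up m dvd n"
    using False unit by (intro power_dvd_iff_le_multiplicity[symmetric]) auto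
  finally show ?thesis .
qed simp

lemma prod_prime_powers_dvd_iff:
  fixes n :: nat
  assumes "finite P" "\<forall>p\<in>P. prime p"
  shows "(\<Prod>p\<in>P. p ^ m p) dvd n \<longleftrightarrow> (\<forall>p\<in>P. p ^ m p dvd n)"
  using assms
proof (induction P rule: finite_induct)
  case (insert p P)
  have "coprime (p ^ m p) (\<Prod>q\<in>P. q ^ m q)"
    using insert by (intro prod_coprime_right) (auto intro!: primes_coprime coprime_power_left_iff[THEN iffD2] coprime_power_right_iff[THEN iffD2])
  then have "p ^ m p * (\<Prod>q\<in>P. q ^ m q) dvd n \<longleftrightarrow> p ^ m p dvd n \<and> (\<Prod>q\<in>P. q ^ m q) dvd n"
    by (metis divides_mult dvd_mult_left dvd_mult_right)
  then show ?case using insert by simp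
qed simp

text \<open>The numerator is prime to the denominator, so \<open>k\<close> lies in \<open>\<Delta>\<^sub>\<alpha>\<close> iff the denominator divides
  \<open>k\<^sup>2\<close>, which is decided prime by prime.\<close>

lemma Delta_perp_rational:
  fixes P Q :: "nat set"
  assumes fin: "finite Q" "finite P" and pr: "\<forall>q\<in>Q. prime q" "\<forall>p\<in>P. prime p" and disj: "Q \<inter> P = {}"
    and \<alpha>: "\<alpha> / (2 * pi) = real (\<Prod>q\<in>Q. q ^ n q) / real (\<Prod>p\<in>P. p ^ m p)"
  shows "Delta_perp \<alpha> = {z. z ^ (\<Prod>p\<in>P. p ^ half_up (m p)) = 1}"
proof -
  define a where "a = (\<Prod>q\<in>Q. q ^ n q)"
  define b where "b = (\<Prod>p\<in>P. p ^ m p)"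
  define c where "c = (\<Prod>p\<in>P. p ^ half_up (m p))"
  have b: "b > 0" unfolding b_def using pr(2) by (intro prod_pos) (simp add: prime_gt_0_nat)
  have c: "c > 0" unfolding c_def using pr(2) by (intro prod_pos) (simp add: prime_gt_0_nat)
  have cop: "coprime a b"
    unfolding a_def b_def using pr disj
    by (intro prod_coprime_left prod_coprime_right) (auto intro!: primes_coprime)
  have sq: "b dvd k\<^sup>2 \<longleftrightarrow> c dvd k" for k :: nat
    unfolding b_def c_def using fin pr by (simp add: prod_prime_powers_dvd_iff prime_power_dvd_square_iff)
  have \<alpha>': "\<alpha> = 2 * pi * real a / real b" using \<alpha> by (simp add: a_def b_def field_simps)
  have D: "k \<in> Delta \<alpha> \<longleftrightarrow> int c dvd k" for k
  proof -
    have "k \<in> Delta \<alpha> \<longleftrightarrow> (\<exists>q::int. \<alpha> * of_int (k * k) = 2 * pi * of_int q)"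
      unfolding nc_torus.Delta_eq nc_torus.Del_def mem_Collect_eq nc_torus.ph_eq_1_iff ..
    also have "\<dots> \<longleftrightarrow> (\<exists>q::int. real_of_int (int a * (k * k)) = of_int (int b * q))"
    proof (rule ex_cong1)
      fix q :: int
      have "\<alpha> * of_int (k * k) = 2 * pi * of_int q \<longleftrightarrow>
          2 * pi * (real a * of_int (k * k)) = 2 * pi * (real b * of_int q)"
        unfolding \<alpha>' using b by (simp add: divide_eq_eq mult_ac)
      also have "\<dots> \<longleftrightarrow> real_of_int (int a * (k * k)) = of_int (int b * q)"
        by (simp only: mult_cancel_left) simp
      finally show "\<alpha> * of_int (k * k) = 2 * pi * of_int q \<longleftrightarrow>
          real_of_int (int a * (k * k)) = of_int (int b * q)" .
    qed
    also have "\<dots> \<longleftrightarrow> int b dvd int a * k\<^sup>2"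
      unfolding of_int_eq_iff power2_eq_square by (auto simp: dvd_def)
    also have "\<dots> \<longleftrightarrow> int b dvd k\<^sup>2"
      using cop by (intro coprime_dvd_mult_right_iff) (simp add: coprime_commute)
    also have "\<dots> \<longleftrightarrow> int b dvd int ((nat \<bar>k\<bar>)\<^sup>2)" by simp
    also have "\<dots> \<longleftrightarrow> c dvd nat \<bar>k\<bar>" unfolding int_dvd_int_iff by (rule sq)
    also have "\<dots> \<longleftrightarrow> int c dvd k" by (metis abs_dvd_iff dvd_abs_iff int_dvd_int_iff int_nat_eq abs_ge_zero)
    finally show ?thesis .
  qed
  have "z \<in> Delta_perp \<alpha> \<longleftrightarrow> z ^ c = 1" for z
  proof
    assume z: "z \<in> Delta_perp \<alpha>"
    have "int c \<in> Delta \<alpha>" using D[of "int c"] by simp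
    then have "z powi int c = 1" using z unfolding Delta_perp_def by blast
    then show "z ^ c = 1" by simp
  next
    assume z: "z ^ c = 1"
    have "cmod z ^ c = 1" using z by (metis norm_one norm_power)
    then have "cmod z = 1" using c by (metis norm_ge_zero power_eq_1_iff abs_norm_cancel gr0_implies_Suc power_inject_base power_one zero_le_one)
    moreover have "z powi l = 1" if l: "l \<in> Delta \<alpha>" for l
    proof -
      obtain t where "l = int c * t" using l D by (auto elim: dvdE)
      then have "z powi l = (z powi int c) powi t" by (simp add: power_int_mult)
      then show ?thesis using z by simp
    qed
    ultimately show "z \<in> Delta_perp \<alpha>" by (simp add: Delta_perp_def)
  qed
  then show ?thesis unfolding c_def by blast
qed

theorem theorem3p8:
  fixes \<alpha> :: real
  shows
    "bauer_simplex (spreadable_states \<alpha>) \<and>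
     {\<phi>. \<phi> extreme_point_of spreadable_states \<alpha>} =
       product_state \<alpha> ` rotation_invariant_states (Delta_perp \<alpha>) \<and>
     (\<alpha> / (2 * pi) \<notin> \<rat> \<longrightarrow> spreadable_states \<alpha> = {canonical_trace \<alpha>}) \<and>
     (\<forall>(Q::nat set) (P::nat set) (n::nat \<Rightarrow> nat) (m::nat \<Rightarrow> nat).
        finite Q \<and> finite P \<and> (\<forall>q\<in>Q. prime q) \<and> (\<forall>p\<in>P. prime p) \<and> Q \<inter> P = {} \<and>
        \<alpha> / (2 * pi) = real (\<Prod>q\<in>Q. q ^ n q) / real (\<Prod>p\<in>P. p ^ m p) \<longrightarrow>
        {\<phi>. \<phi> extreme_point_of spreadable_states \<alpha>} =
          product_state \<alpha> `
            rotation_invariant_states {z. z ^ (\<Prod>p\<in>P. p ^ half_up (m p)) = 1})"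
proof -
  have ext: "{\<phi>. \<phi> extreme_point_of spreadable_states \<alpha>} = product_state \<alpha> ` rotation_invariant_states (Delta_perp \<alpha>)"
    using nc_torus.extreme_points_eq[of \<alpha>] by (simp add: nc_torus.E_def)
  show ?thesis
    using nc_torus.spreadable_states_bauer[OF nc_torus.K_nonempty, of \<alpha>] nc_torus.spreadable_states_irrational[of \<alpha>] ext Delta_perp_rational[of _ _ \<alpha>]
    by auto
qed

end
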